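(* Let $F$ be a non-archimedean local field, $E$ a finite-dimensional reduced $F$-algebra and $R\subset E$ an order, with notation as in the context. Then: (1) $\tilde J_R(s)=q^{\delta s}P_R(q^{-s})$ for some polynomial $P_R(t)\in 1+t\mathbb{Z}[t]$ of degree $2\delta$. (2) $\tilde J_R(0)=\tilde J_R(1)=\#(\Lambda\backslash X_R)$; equivalently $P_R(1)=q^{\delta}P_R(q^{-1})=\#(\Lambda\backslash X_R)$. (3) $\tilde J_R(s)=\tilde J_R(1-s)$; equivalently $P_R(t)=(qt^2)^{\delta}P_R(q^{-1}t^{-1})$.
   Context: $F$ has ring of integers $\mathcal{O}_F$, uniformizer $\pi$, residue field $k=\mathbb{F}_q$, absolute value $|\cdot|$ with $|\pi|=q^{-1}$, extended to $E^\times$ by $|x|=|N_{E/F}(x)|$. Write $E=\prod_{i\in B}E_i$ (fields), $\tilde k_i$ the residue field of $E_i$, $n_i=[\tilde k_i:k]$, $\mathcal{O}_E=\prod\mathcal{O}_{E_i}$. An order is a finitely generated $\mathcal{O}_F$-subalgebra $R\subset E$ with $R\otimes_{\mathcal{O}_F}F=E$; a fractional $R$-ideal is a finitely generated $R$-submodule $M\subset E$ with $M\otimes_{\mathcal{O}_F}F=E$. $X_R$ is the set of fractional $R$-ideals, with $E^\times$ acting by multiplication. $\Lambda\subset E^\times$ is a free abelian subgroup with $E^\times=\Lambda\times\mathcal{O}_E^\times$ (e.g. $\prod_i\pi_i^{\mathbb{Z}}$ for uniformizers $\pi_i$ of $E_i$); it acts freely on $X_R$ with finitely many orbits. For fractional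 ideals, $[M_1:M_2]=\mathrm{length}_{\mathcal{O}_F}(M_1/M_1\cap M_2)-\mathrm{length}_{\mathcal{O}_F}(M_2/M_1\cap M_2)$, and $\delta=[\mathcal{O}_E:R]$. Let $c\in\mathcal{O}_E$ generate the different $\mathfrak{d}_{E/F}$, define $(x,y)=\mathrm{Tr}_{E/F}(c^{-1}xy)$ and $M^\vee=\{x\in E:(x,M)\subset\mathcal{O}_F\}$. $\mathrm{Quot}^j_{R^\vee}$ is the set of fractional $R$-ideals $M\subset R^\vee$ with $[R^\vee:M]=j$. Define $J_R(s)=\sum_{j\ge0}\#\mathrm{Quot}^j_{R^\vee}\,q^{-js}$ (convergent for $\mathrm{Re}(s)$ large, then meromorphically continued), $V_R(s)=q^{\delta s}\prod_{i\in B}(1-q^{-n_is})$, $\tilde J_R(s)=V_R(s)J_R(s)$. *)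

theory Defs
  imports
    "HOL-Complex_Analysis.Complex_Analysis"
    "HOL-Algebra.Free_Abelian_Groups"
begin

section \<open>Non-archimedean local fields\<close>

definition val_ring :: "('f::field \<Rightarrow> real) \<Rightarrow> 'f set" where
  "val_ring av = {x. av x \<le> 1}"

definition val_ideal :: "('f::field \<Rightarrow> real) \<Rightarrow> 'f set" where
  "val_ideal av = {x. av x < 1}"

definition residue_field :: "('f::field \<Rightarrow> real) \<Rightarrow> 'f set set" where
  "residue_field av =
     val_ring av // {(x, y). x \<in> val_ring av \<and> y \<in> val_ring av \<and> x - y \<in> val_ideal av}"

definition residue_card :: "('f::field \<Rightarrow> real) \<Rightarrow> nat" where
  "residue_card av = card (residue_field av)"

text \<open>A field complete for a nontrivial discrete absolute value with finite residue field; the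
  absolute value is normalised by \<open>av \<pi> = 1 / q\<close> for a uniformizer \<open>\<pi>\<close>, i.e. a nonzero generator
  of the maximal ideal.\<close>

locale nonarch_local_field =
  fixes av :: "'f::field \<Rightarrow> real"
  assumes av_nonneg: "0 \<le> av x"
    and av_eq_0_iff: "av x = 0 \<longleftrightarrow> x = 0"
    and av_mult: "av (x * y) = av x * av y"
    and av_ultrametric: "av (x + y) \<le> max (av x) (av y)"
    and av_complete: "\<And>X :: nat \<Rightarrow> 'f. (\<forall>e>0. \<exists>N. \<forall>m\<ge>N. \<forall>n\<ge>N. av (X m - X n) < e)
                        \<Longrightarrow> \<exists>l. (\<lambda>n. av (X n - l)) \<longlonglongrightarrow> 0"
    and finite_residue_field: "finite (residue_field av)"
    and uniformizer: "\<exists>\<pi>. \<pi> \<noteq> 0 \<and> val_ideal av = (\<lambda>x. \<pi> * x) ` val_ring av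
                        \<and> av \<pi> = 1 / real (residue_card av)"

section \<open>Finite-dimensional reduced algebras\<close>

text \<open>The field \<open>F\<close> is the type \<open>'f\<close>, the algebra \<open>E\<close> is the type \<open>'e\<close>, and \<open>sc\<close> is the scalar
  multiplication.\<close>

locale reduced_local_algebra =
  nonarch_local_field av + vector_space sc
  for av :: "'f::field \<Rightarrow> real" and sc :: "'f \<Rightarrow> 'e::comm_ring_1 \<Rightarrow> 'e" +
  assumes sc_mult_left: "sc a x * y = sc a (x * y)"
    and finite_dimensional: "\<exists>B. finite B \<and> module.span sc B = (UNIV :: 'e set)"
    and reduced: "x ^ n = 0 \<Longrightarrow> x = (0::'e)"

text \<open>The trace of multiplication by \<open>x\<close>, computed in an arbitrary \<open>F\<close>-basis of \<open>E\<close>.\<close>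

definition alg_trace :: "('f::field \<Rightarrow> 'e::comm_ring_1 \<Rightarrow> 'e) \<Rightarrow> 'e \<Rightarrow> 'f" where
  "alg_trace sc x =
     (let B = (SOME B. \<not> module.dependent sc B \<and> module.span sc B = UNIV)
      in \<Sum>b\<in>B. module.representation sc B (x * b) b)"

text \<open>The decomposition \<open>E = \<Prod>\<^sub>i E\<^sub>i\<close> is indexed by the primitive idempotents \<open>e\<close> of \<open>E\<close>: the factor
  belonging to \<open>e\<close> is \<open>{x. e * x = x}\<close>, a field with unit element \<open>e\<close>.\<close>

definition prim_idem :: "'e::comm_ring_1 set" where
  "prim_idem = {e. e * e = e \<and> e \<noteq> 0 \<and> (\<forall>f. f * f = f \<longrightarrow> e * f = f \<longrightarrow> f = 0 \<or> f = e)}"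

definition factor :: "'e::comm_ring_1 \<Rightarrow> 'e set" where
  "factor e = {x. e * x = x}"

text \<open>The integral closure of the valuation ring in the factor of \<open>e\<close>. In that ring the power with
  exponent 0 is \<open>e\<close>, whence the terms \<open>e * x ^ i\<close>.\<close>

definition factor_integers ::
    "('f::field \<Rightarrow> real) \<Rightarrow> ('f \<Rightarrow> 'e::comm_ring_1 \<Rightarrow> 'e) \<Rightarrow> 'e \<Rightarrow> 'e set" where
  "factor_integers av sc e =
     {x \<in> factor e. \<exists>p :: 'f poly. lead_coeff p = 1 \<and> (\<forall>i. coeff p i \<in> val_ring av)
                      \<and> (\<Sum>i\<le>degree p. sc (coeff p i) (e * x ^ i)) = 0}"

text \<open>The maximal ideal (the non-units) of the integers of a factor, and the degree over \<open>k\<close> of the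
  residue field; a \<open>k\<close>-basis of the latter is given by a set of representatives.\<close>

definition factor_max_ideal ::
    "('f::field \<Rightarrow> real) \<Rightarrow> ('f \<Rightarrow> 'e::comm_ring_1 \<Rightarrow> 'e) \<Rightarrow> 'e \<Rightarrow> 'e set" where
  "factor_max_ideal av sc e =
     {x \<in> factor_integers av sc e. \<not> (\<exists>y \<in> factor_integers av sc e. x * y = e)}"

definition residue_basis ::
    "('f::field \<Rightarrow> real) \<Rightarrow> ('f \<Rightarrow> 'e::comm_ring_1 \<Rightarrow> 'e) \<Rightarrow> 'e \<Rightarrow> 'e set \<Rightarrow> bool" where
  "residue_basis av sc e S \<longleftrightarrow>
     finite S \<and> S \<subseteq> factor_integers av sc e \<and>
     (\<forall>u \<in> S \<rightarrow> val_ring av.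
        (\<Sum>b\<in>S. sc (u b) b) \<in> factor_max_ideal av sc e \<longrightarrow> (\<forall>b\<in>S. u b \<in> val_ideal av)) \<and>
     (\<forall>x \<in> factor_integers av sc e. \<exists>u \<in> S \<rightarrow> val_ring av.
        x - (\<Sum>b\<in>S. sc (u b) b) \<in> factor_max_ideal av sc e)"

definition residue_degree ::
    "('f::field \<Rightarrow> real) \<Rightarrow> ('f \<Rightarrow> 'e::comm_ring_1 \<Rightarrow> 'e) \<Rightarrow> 'e \<Rightarrow> nat" where
  "residue_degree av sc e = card (SOME S. residue_basis av sc e S)"

text \<open>\<open>\<O>\<^sub>E = \<Prod>\<^sub>i \<O>\<^bsub>E\<^sub>i\<^esub>\<close>\<close>

definition alg_integers ::
    "('f::field \<Rightarrow> real) \<Rightarrow> ('f \<Rightarrow> 'e::comm_ring_1 \<Rightarrow> 'e) \<Rightarrow> 'e set" where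
  "alg_integers av sc = {x. \<forall>e \<in> prim_idem. e * x \<in> factor_integers av sc e}"

section \<open>Orders, fractional ideals and their relative length\<close>

text \<open>Submodules over the valuation ring \<open>\<O>\<^sub>F\<close>, and over a subring \<open>R\<close> of \<open>E\<close>.\<close>

definition OF_submodule ::
    "('f::field \<Rightarrow> real) \<Rightarrow> ('f \<Rightarrow> 'e::comm_ring_1 \<Rightarrow> 'e) \<Rightarrow> 'e set \<Rightarrow> bool" where
  "OF_submodule av sc M \<longleftrightarrow>
     0 \<in> M \<and> (\<forall>x\<in>M. \<forall>y\<in>M. x + y \<in> M) \<and> (\<forall>a\<in>val_ring av. \<forall>x\<in>M. sc a x \<in> M)"

definition ring_submodule :: "'e::comm_ring_1 set \<Rightarrow> 'e set \<Rightarrow> bool" where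
  "ring_submodule R M \<longleftrightarrow>
     0 \<in> M \<and> (\<forall>x\<in>M. \<forall>y\<in>M. x + y \<in> M) \<and> (\<forall>r\<in>R. \<forall>x\<in>M. r * x \<in> M)"

text \<open>For an \<open>\<O>\<^sub>F\<close>-submodule \<open>M\<close> of \<open>E\<close> the map from the tensor product of \<open>M\<close> and \<open>F\<close> to \<open>E\<close> is
  injective, so that \<open>M \<otimes> F = E\<close> says that \<open>M\<close> spans \<open>E\<close> over \<open>F\<close>. As usual for orders, finite
  generation is meant as an \<open>\<O>\<^sub>F\<close>-module.\<close>

definition is_order ::
    "('f::field \<Rightarrow> real) \<Rightarrow> ('f \<Rightarrow> 'e::comm_ring_1 \<Rightarrow> 'e) \<Rightarrow> 'e set \<Rightarrow> bool" where
  "is_order av sc R \<longleftrightarrow>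
     OF_submodule av sc R \<and> 1 \<in> R \<and> (\<forall>x\<in>R. \<forall>y\<in>R. x * y \<in> R) \<and>
     (\<exists>S. finite S \<and> R = OF_submodule av sc hull S) \<and>
     module.span sc R = UNIV"

definition frac_ideals ::
    "('f::field \<Rightarrow> 'e::comm_ring_1 \<Rightarrow> 'e) \<Rightarrow> 'e set \<Rightarrow> 'e set set" where
  "frac_ideals sc R =
     {M. ring_submodule R M \<and> (\<exists>S. finite S \<and> M = ring_submodule R hull S) \<and>
         module.span sc M = UNIV}"

text \<open>The length of the \<open>\<O>\<^sub>F\<close>-module \<open>M / N\<close>, for \<open>N \<subseteq> M\<close>; submodules of the quotient are identified
  with the submodules between \<open>N\<close> and \<open>M\<close>.\<close>

definition quot_length ::
    "('f::field \<Rightarrow> real) \<Rightarrow> ('f \<Rightarrow> 'e::comm_ring_1 \<Rightarrow> 'e) \<Rightarrow> 'e set \<Rightarrow> 'e set \<Rightarrow> enat" where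
  "quot_length av sc M N =
     (SUP n \<in> {n. \<exists>C :: nat \<Rightarrow> 'e set. C 0 = N \<and> C n = M \<and>
                    (\<forall>i\<le>n. OF_submodule av sc (C i)) \<and> (\<forall>i<n. C i \<subset> C (Suc i))}. enat n)"

definition rel_index ::
    "('f::field \<Rightarrow> real) \<Rightarrow> ('f \<Rightarrow> 'e::comm_ring_1 \<Rightarrow> 'e) \<Rightarrow> 'e set \<Rightarrow> 'e set \<Rightarrow> int" where
  "rel_index av sc M1 M2 =
     int (the_enat (quot_length av sc M1 (M1 \<inter> M2))) -
     int (the_enat (quot_length av sc M2 (M1 \<inter> M2)))"

definition delta ::
    "('f::field \<Rightarrow> real) \<Rightarrow> ('f \<Rightarrow> 'e::comm_ring_1 \<Rightarrow> 'e) \<Rightarrow> 'e set \<Rightarrow> int" where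
  "delta av sc R = rel_index av sc (alg_integers av sc) R"

section \<open>The lattice of units and its orbits\<close>

definition unit_group :: "'e::comm_ring_1 monoid" where
  "unit_group = units_of \<lparr>carrier = UNIV, monoid.mult = (*), one = 1\<rparr>"

definition integer_units ::
    "('f::field \<Rightarrow> real) \<Rightarrow> ('f \<Rightarrow> 'e::comm_ring_1 \<Rightarrow> 'e) \<Rightarrow> 'e set" where
  "integer_units av sc = {x \<in> alg_integers av sc. \<exists>y \<in> alg_integers av sc. x * y = 1}"

definition is_unit_lattice ::
    "('f::field \<Rightarrow> real) \<Rightarrow> ('f \<Rightarrow> 'e::comm_ring_1 \<Rightarrow> 'e) \<Rightarrow> 'e set \<Rightarrow> bool" where
  "is_unit_lattice av sc L \<longleftrightarrow>
     subgroup L unit_group \<and>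
     (\<exists>S :: 'e set. unit_group \<lparr>carrier := L\<rparr> \<cong> free_Abelian_group S) \<and>
     bij_betw (\<lambda>(l, u). l * u) (L \<times> integer_units av sc) (carrier unit_group)"

definition orbits ::
    "('f::field \<Rightarrow> 'e::comm_ring_1 \<Rightarrow> 'e) \<Rightarrow> 'e set \<Rightarrow> 'e set \<Rightarrow> 'e set set set" where
  "orbits sc R L = (\<lambda>M. (\<lambda>l. (\<lambda>x. l * x) ` M) ` L) ` frac_ideals sc R"

section \<open>Duality\<close>

definition codifferent ::
    "('f::field \<Rightarrow> real) \<Rightarrow> ('f \<Rightarrow> 'e::comm_ring_1 \<Rightarrow> 'e) \<Rightarrow> 'e set" where
  "codifferent av sc = {x. \<forall>y \<in> alg_integers av sc. alg_trace sc (x * y) \<in> val_ring av}"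

definition different ::
    "('f::field \<Rightarrow> real) \<Rightarrow> ('f \<Rightarrow> 'e::comm_ring_1 \<Rightarrow> 'e) \<Rightarrow> 'e set" where
  "different av sc = {x. \<forall>y \<in> codifferent av sc. x * y \<in> alg_integers av sc}"

text \<open>The generator has to be invertible in \<open>E\<close>, since its inverse enters the pairing; such a generator
  exists precisely when the trace form is nondegenerate, i.e. when \<open>E\<close> is separable over \<open>F\<close>.\<close>

definition generates_different ::
    "('f::field \<Rightarrow> real) \<Rightarrow> ('f \<Rightarrow> 'e::comm_ring_1 \<Rightarrow> 'e) \<Rightarrow> 'e \<Rightarrow> bool" where
  "generates_different av sc c \<longleftrightarrow>
     c \<in> alg_integers av sc \<and> c \<in> carrier unit_group \<and>
     different av sc = (\<lambda>x. c * x) ` alg_integers av sc"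

definition pairing :: "('f::field \<Rightarrow> 'e::comm_ring_1 \<Rightarrow> 'e) \<Rightarrow> 'e \<Rightarrow> 'e \<Rightarrow> 'e \<Rightarrow> 'f" where
  "pairing sc c x y = alg_trace sc (inv\<^bsub>unit_group\<^esub> c * x * y)"

definition dual ::
    "('f::field \<Rightarrow> real) \<Rightarrow> ('f \<Rightarrow> 'e::comm_ring_1 \<Rightarrow> 'e) \<Rightarrow> 'e \<Rightarrow> 'e set \<Rightarrow> 'e set" where
  "dual av sc c M = {x. \<forall>y\<in>M. pairing sc c x y \<in> val_ring av}"

section \<open>The zeta function\<close>

definition Quot_dual ::
    "('f::field \<Rightarrow> real) \<Rightarrow> ('f \<Rightarrow> 'e::comm_ring_1 \<Rightarrow> 'e) \<Rightarrow> 'e \<Rightarrow> 'e set \<Rightarrow> nat \<Rightarrow> 'e set set" where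
  "Quot_dual av sc c R j =
     {M \<in> frac_ideals sc R. M \<subseteq> dual av sc c R \<and> rel_index av sc (dual av sc c R) M = int j}"

text \<open>The predicate says that \<open>J\<close> is meromorphic on the whole plane and that the Dirichlet series
  converges to \<open>J\<close> on some right half-plane. Such a \<open>J\<close> is unique, because \<open>nicely_meromorphic_on\<close>
  prescribes the value 0 at poles and requires continuity elsewhere.\<close>

definition continues_zeta ::
    "('f::field \<Rightarrow> real) \<Rightarrow> ('f \<Rightarrow> 'e::comm_ring_1 \<Rightarrow> 'e) \<Rightarrow> 'e \<Rightarrow> 'e set \<Rightarrow> (complex \<Rightarrow> complex) \<Rightarrow> bool"
  where
  "continues_zeta av sc c R J \<longleftrightarrow>
     J nicely_meromorphic_on UNIV \<and>
     (\<exists>\<sigma>::real. \<forall>s. Re s > \<sigma> \<longrightarrow>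
        (\<lambda>j. of_nat (card (Quot_dual av sc c R j)) *
              of_nat (residue_card av) powr (- of_nat j * s)) sums J s)"

definition zeta_J ::
    "('f::field \<Rightarrow> real) \<Rightarrow> ('f \<Rightarrow> 'e::comm_ring_1 \<Rightarrow> 'e) \<Rightarrow> 'e \<Rightarrow> 'e set \<Rightarrow> complex \<Rightarrow> complex" where
  "zeta_J av sc c R = (SOME J. continues_zeta av sc c R J)"

definition factor_V ::
    "('f::field \<Rightarrow> real) \<Rightarrow> ('f \<Rightarrow> 'e::comm_ring_1 \<Rightarrow> 'e) \<Rightarrow> 'e set \<Rightarrow> complex \<Rightarrow> complex" where
  "factor_V av sc R s =
     of_nat (residue_card av) powr (of_int (delta av sc R) * s) *
     (\<Prod>e\<in>prim_idem. 1 - of_nat (residue_card av) powr (- of_nat (residue_degree av sc e) * s))"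

text \<open>The product of the two meromorphic functions: the pointwise product has to be corrected at the
  poles of \<open>J\<close> that are cancelled by zeros of \<open>V\<close>, for example at \<open>0\<close>.\<close>

definition zeta_J_tilde ::
    "('f::field \<Rightarrow> real) \<Rightarrow> ('f \<Rightarrow> 'e::comm_ring_1 \<Rightarrow> 'e) \<Rightarrow> 'e \<Rightarrow> 'e set \<Rightarrow> complex \<Rightarrow> complex" where
  "zeta_J_tilde av sc c R = remove_sings (\<lambda>s. factor_V av sc R s * zeta_J av sc c R s)"

end

theory Submission
  imports Defs
begin

text \<open>
  Multiplying the zeta series by \<open>\<Prod>\<^sub>i (1 - t\<^bsup>n\<^sub>i\<^esup>)\<close> turns it into \<open>\<Sum>\<^sub>M w(M) t\<^bsup>[R\<^sup>\<or> : M]\<^esup>\<close>, where \<open>M\<close> runs over all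
  fractional \<open>R\<close>-ideals and \<open>w(M)\<close> is an alternating sum over the sets \<open>I\<close> of factors of the truth values of
  \<open>P\<^sub>I\<inverse> \<in> M\<^sup>\<or>\<close>, \<open>P\<^sub>I\<close> being the product of the uniformizers of the factors in \<open>I\<close>. Only finitely many \<open>w(M)\<close> are
  nonzero, which gives the polynomial. Its value at 1 is the number of \<open>M\<close> with \<open>M \<O>\<^sub>E = \<O>\<^sub>E\<close>, and these
  represent the orbits.

  For the functional equation, average \<open>w(u M)\<close> over units \<open>u\<close> of \<open>\<O>\<^sub>E\<close> modulo a conductor. The average is a
  combination, over pairs \<open>I, J\<close>, of indices of the lattices \<open>M\<^sup>\<or> \<inter> P\<^sub>J P\<^sub>I\<inverse> \<O>\<^sub>E\<close>. Since \<open>\<O>\<^sub>E\<close> is self-dual,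
  duality exchanges \<open>N \<inter> x \<O>\<^sub>E\<close> with \<open>N\<^sup>\<or> + x\<inverse> \<O>\<^sub>E\<close>, hence the roles of \<open>I\<close> and \<open>J\<close>, and the averages at \<open>M\<close> and
  \<open>M\<^sup>\<or>\<close> differ by the factor \<open>q\<^bsup>[\<O>\<^sub>E : M]\<^esup>\<close>.
\<close>

section \<open>Indices of additive subgroups\<close>

text \<open>Duality does not visibly relate \<open>wt M\<close> to \<open>wt (D M)\<close>, since
  \<open>wt\<close> tests finitely many single vectors. Averaging over units replaces the vector
  P_I^-1 by all generators of P_I^-1 O_E, and being a generator is in turn an alternating sum over
  sets J of factors; this second sum puts I and J on the same footing. Working modulo
  \<open>p ^ cond_exp\<close> suffices: that multiple of O_E lies in R, so 1 plus it consists of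
  units that leave every fractional ideal unchanged, and all volumes become finite indices.

  The definitions give O_E only as an integral closure. That it is a lattice comes from the trace
  form, which is nondegenerate because c is invertible; that its factors are discrete valuation
  rings comes from completeness, by lifting idempotents from O_E modulo the uniformizer of F. No
  extension of absolute values is constructed.

  The degree 2 delta is not read off from lattices: the functional equation together with the
  constant term 1 forces it. The same equation carries the orbit count from t = 1 to t =
  1/q.\<close>

definition add_subgroup :: "'a::ab_group_add set \<Rightarrow> bool" where
  "add_subgroup W \<longleftrightarrow> 0 \<in> W \<and> (\<forall>x\<in>W. \<forall>y\<in>W. x - y \<in> W)"

definition coset :: "'a::ab_group_add set \<Rightarrow> 'a \<Rightarrow> 'a set" where
  "coset W x = {y. y - x \<in> W}"

text \<open>\<open>M\<close> is an arbitrary set, as in \<open>idx\<close>, because the units of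
  \<open>A\<close> and the generators of a principal ideal are counted modulo a lattice as
  well.\<close>

definition coset_reps :: "'a::ab_group_add set \<Rightarrow> 'a set \<Rightarrow> 'a set \<Rightarrow> bool" where
  "coset_reps D M W \<longleftrightarrow> D \<subseteq> M \<and> (\<forall>x\<in>M. \<exists>!d. d \<in> D \<and> x - d \<in> W)"

definition idx :: "'a::ab_group_add set \<Rightarrow> 'a set \<Rightarrow> nat" where
  "idx M W = card (coset W ` M)"

definition fin_idx :: "'a::ab_group_add set \<Rightarrow> 'a set \<Rightarrow> bool" where
  "fin_idx M W \<longleftrightarrow> finite (coset W ` M)"

definition sumset :: "'a::ab_group_add set \<Rightarrow> 'a set \<Rightarrow> 'a set" where
  "sumset A B = (\<lambda>(a, b). a + b) ` (A \<times> B)"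

lemma add_subgroup_zero: "add_subgroup W \<Longrightarrow> 0 \<in> W"
  and add_subgroup_diff: "add_subgroup W \<Longrightarrow> x \<in> W \<Longrightarrow> y \<in> W \<Longrightarrow> x - y \<in> W"
  by (auto simp: add_subgroup_def)

lemma add_subgroup_minus: "add_subgroup W \<Longrightarrow> x \<in> W \<Longrightarrow> - x \<in> W"
  using add_subgroup_diff[of W 0 x] add_subgroup_zero by auto

lemma add_subgroup_minus_commute: "add_subgroup W \<Longrightarrow> x - y \<in> W \<Longrightarrow> y - x \<in> W"
  using add_subgroup_minus[of W "x - y"] by auto

lemma add_subgroup_add: "add_subgroup W \<Longrightarrow> x \<in> W \<Longrightarrow> y \<in> W \<Longrightarrow> x + y \<in> W"
  using add_subgroup_diff[of W x "- y"] add_subgroup_minus[of W y] by auto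

lemma add_subgroup_trans: "add_subgroup W \<Longrightarrow> x - y \<in> W \<Longrightarrow> y - z \<in> W \<Longrightarrow> x - z \<in> W"
  using add_subgroup_add[of W "x - y" "y - z"] by auto

lemma add_subgroup_Int: "add_subgroup V \<Longrightarrow> add_subgroup W \<Longrightarrow> add_subgroup (V \<inter> W)"
  by (auto simp: add_subgroup_def)

lemma add_subgroup_sumset:
  assumes "add_subgroup V" "add_subgroup W" shows "add_subgroup (sumset V W)"
  unfolding add_subgroup_def sumset_def
proof (intro conjI ballI)
  show "0 \<in> (\<lambda>(a, b). a + b) ` (V \<times> W)"
    using assms by (force simp: add_subgroup_def)
next
  fix x y assume "x \<in> (\<lambda>(a, b). a + b) ` (V \<times> W)" "y \<in> (\<lambda>(a, b). a + b) ` (V \<times> W)"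
  then obtain a b a' b' where *: "a \<in> V" "b \<in> W" "a' \<in> V" "b' \<in> W" "x = a + b" "y = a' + b'"
    by auto
  then have "x - y = (a - a') + (b - b')" by simp
  then show "x - y \<in> (\<lambda>(a, b). a + b) ` (V \<times> W)"
    using * assms by (intro image_eqI[of _ _ "(a - a', b - b')"]) (auto simp: add_subgroup_def)
qed

lemma sumset_upper1: "add_subgroup W \<Longrightarrow> V \<subseteq> sumset V W"
  and sumset_upper2: "add_subgroup V \<Longrightarrow> W \<subseteq> sumset V W"
  unfolding sumset_def by (force simp: add_subgroup_def)+

lemma sumset_least: "add_subgroup M \<Longrightarrow> V \<subseteq> M \<Longrightarrow> W \<subseteq> M \<Longrightarrow> sumset V W \<subseteq> M"
  unfolding sumset_def by (auto intro: add_subgroup_add)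

lemma coset_eq_iff:
  assumes "add_subgroup W" shows "coset W x = coset W y \<longleftrightarrow> x - y \<in> W"
proof
  assume "coset W x = coset W y"
  then have "x \<in> coset W y" using assms by (auto simp: coset_def add_subgroup_def)
  then show "x - y \<in> W" by (simp add: coset_def)
next
  assume "x - y \<in> W"
  then show "coset W x = coset W y"
    using assms add_subgroup_trans add_subgroup_minus_commute unfolding coset_def by blast
qed

lemma coset_reps_exist:
  assumes W: "add_subgroup W" shows "\<exists>D. coset_reps D M W"
proof -
  let ?D = "inv_into M (coset W) ` (coset W ` M)"
  have inj: "d = d'" if "d \<in> ?D" "d' \<in> ?D" "d - d' \<in> W" for d d'
  proof -
    have "coset W d = coset W d'" using that W by (simp add: coset_eq_iff)
    then show ?thesis using that(1,2) by (auto simp: f_inv_into_f)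
  qed
  have "\<exists>!d. d \<in> ?D \<and> x - d \<in> W" if "x \<in> M" for x
  proof (rule ex1I[of _ "inv_into M (coset W) (coset W x)"])
    have "coset W x = coset W (inv_into M (coset W) (coset W x))"
      using that by (simp add: f_inv_into_f)
    then show *: "inv_into M (coset W) (coset W x) \<in> ?D \<and> x - inv_into M (coset W) (coset W x) \<in> W"
      using that W by (intro conjI imageI) (simp_all add: coset_eq_iff)
    fix d assume d: "d \<in> ?D \<and> x - d \<in> W"
    show "d = inv_into M (coset W) (coset W x)"
      by (rule inj) (use * d add_subgroup_trans[OF W add_subgroup_minus_commute[OF W]] in blast)+
  qed
  moreover have "?D \<subseteq> M" by (auto intro: inv_into_into)
  ultimately have "coset_reps ?D M W" unfolding coset_reps_def by (intro conjI ballI)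
  then show ?thesis ..
qed

lemma coset_reps_bij:
  assumes W: "add_subgroup W" and D: "coset_reps D M W"
  shows "bij_betw (coset W) D (coset W ` M)"
proof (rule bij_betw_imageI)
  show "inj_on (coset W) D"
  proof (rule inj_onI)
    fix x y assume *: "x \<in> D" "y \<in> D" "coset W x = coset W y"
    then have "x - y \<in> W" "x \<in> M" using W D by (auto simp: coset_eq_iff coset_reps_def)
    moreover have "x - x \<in> W" using W by (simp add: add_subgroup_zero)
    ultimately show "x = y" using D *(1,2) unfolding coset_reps_def by blast
  qed
  show "coset W ` D = coset W ` M"
    using D W coset_eq_iff unfolding coset_reps_def by (safe; blast)
qed

lemma idx_eq_card:
  assumes "add_subgroup W" "coset_reps D M W" shows "idx M W = card D"
  using bij_betw_same_card[OF coset_reps_bij[OF assms]] by (simp add: idx_def)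

lemma fin_idx_iff_finite:
  assumes "add_subgroup W" "coset_reps D M W" shows "fin_idx M W \<longleftrightarrow> finite D"
  using bij_betw_finite[OF coset_reps_bij[OF assms]] by (simp add: fin_idx_def)

lemma coset_reps_unique:
  "coset_reps D M W \<Longrightarrow> x \<in> M \<Longrightarrow> d \<in> D \<Longrightarrow> d' \<in> D \<Longrightarrow> x - d \<in> W \<Longrightarrow> x - d' \<in> W \<Longrightarrow> d = d'"
  unfolding coset_reps_def by blast

text \<open>Representatives of the two levels are added. It is enough that \<open>M\<close> absorbs
  \<open>M'\<close>: \<open>unit_count\<close> applies the tower law to a set of generators, which
  is not a group in general.\<close>

lemma coset_reps_trans:
  assumes W: "add_subgroup W" and M': "add_subgroup M'"
    and M: "\<And>x y. x \<in> M \<Longrightarrow> y \<in> M' \<Longrightarrow> x + y \<in> M" and sub: "W \<subseteq> M'"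
    and D: "coset_reps D M M'" and D': "coset_reps D' M' W"
  shows "inj_on (\<lambda>(d, d'). d + d') (D \<times> D')"
    and "coset_reps ((\<lambda>(d, d'). d + d') ` (D \<times> D')) M W"
proof -
  have DM: "D \<subseteq> M" "D' \<subseteq> M'" using D D' by (auto simp: coset_reps_def)
  have eq: "d = e \<and> d' = e'"
    if *: "d \<in> D" "e \<in> D" "d' \<in> D'" "e' \<in> D'" "(d + d') - (e + e') \<in> W" for d e d' e'
  proof -
    have "(d + d') - (e + e') \<in> M'" using that sub by auto
    moreover have "e' - d' \<in> M'" using * DM M' by (auto intro: add_subgroup_diff)
    ultimately have "((d + d') - (e + e')) + (e' - d') \<in> M'" using M' by (blast intro: add_subgroup_add)
    then have "d - e \<in> M'" by (simp add: algebra_simps)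
    moreover have "d - d \<in> M'" using M' by (simp add: add_subgroup_zero)
    ultimately have 1: "d = e" using coset_reps_unique[OF D, of d d e] * DM by auto
    then have "d' - e' \<in> W" using * by simp
    moreover have "d' - d' \<in> W" using W by (simp add: add_subgroup_zero)
    ultimately have "d' = e'" using coset_reps_unique[OF D', of d' d' e'] * DM by auto
    with 1 show ?thesis by simp
  qed
  then show "inj_on (\<lambda>(d, d'). d + d') (D \<times> D')"
    using W by (intro inj_onI) (auto simp: add_subgroup_zero)
  show "coset_reps ((\<lambda>(d, d'). d + d') ` (D \<times> D')) M W"
    unfolding coset_reps_def
  proof (intro conjI ballI)
    show "(\<lambda>(d, d'). d + d') ` (D \<times> D') \<subseteq> M"
      using DM M by auto
  next
    fix x assume x: "x \<in> M"
    obtain d where d: "d \<in> D" "x - d \<in> M'" using D x unfolding coset_reps_def by blast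
    obtain d' where d': "d' \<in> D'" "x - d - d' \<in> W" using D' d unfolding coset_reps_def by blast
    show "\<exists>!s. s \<in> (\<lambda>(d, d'). d + d') ` (D \<times> D') \<and> x - s \<in> W"
    proof (rule ex1I[of _ "d + d'"])
      show *: "d + d' \<in> (\<lambda>(d, d'). d + d') ` (D \<times> D') \<and> x - (d + d') \<in> W"
        using d d' by (auto simp: diff_diff_eq)
      fix s assume "s \<in> (\<lambda>(d, d'). d + d') ` (D \<times> D') \<and> x - s \<in> W"
      then obtain e e' where e: "e \<in> D" "e' \<in> D'" "s = e + e'" "x - s \<in> W" by auto
      have "(d + d') - (e + e') \<in> W"
        using add_subgroup_trans[OF W add_subgroup_minus_commute[OF W], of x "d + d'" s] * e by auto
      then show "s = d + d'" using eq e d d' by blast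
    qed
  qed
qed

lemma idx_trans_closed:
  assumes "add_subgroup W" "add_subgroup M'" "\<And>x y. x \<in> M \<Longrightarrow> y \<in> M' \<Longrightarrow> x + y \<in> M" "W \<subseteq> M'"
  shows "idx M W = idx M M' * idx M' W"
    and "fin_idx M M' \<Longrightarrow> fin_idx M' W \<Longrightarrow> fin_idx M W"
proof -
  obtain D D' where D: "coset_reps D M M'" "coset_reps D' M' W"
    using coset_reps_exist assms by metis
  note * = coset_reps_trans[OF assms D]
  show "idx M W = idx M M' * idx M' W"
    using idx_eq_card[OF assms(1) *(2)] idx_eq_card[OF _ D(1)] idx_eq_card[OF _ D(2)] assms
      card_image[OF *(1)] card_cartesian_product by metis
  show "fin_idx M W" if "fin_idx M M'" "fin_idx M' W"
    using that fin_idx_iff_finite[OF assms(1) *(2)] fin_idx_iff_finite[OF _ D(1)]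
      fin_idx_iff_finite[OF _ D(2)] assms by auto
qed

lemma idx_trans:
  assumes "add_subgroup W" "add_subgroup M'" "add_subgroup M" "W \<subseteq> M'" "M' \<subseteq> M"
  shows "idx M W = idx M M' * idx M' W"
    and "fin_idx M M' \<Longrightarrow> fin_idx M' W \<Longrightarrow> fin_idx M W"
proof -
  have closed: "x + y \<in> M" if "x \<in> M" "y \<in> M'" for x y
    using assms(3,5) that by (intro add_subgroup_add) auto
  show "idx M W = idx M M' * idx M' W"
    by (rule idx_trans_closed(1)[OF assms(1,2) closed assms(4)])
  show "fin_idx M M' \<Longrightarrow> fin_idx M' W \<Longrightarrow> fin_idx M W"
    by (rule idx_trans_closed(2)[OF assms(1,2) closed assms(4)])
qed

lemma fin_idx_mono:
  assumes "add_subgroup W" "add_subgroup W'" "fin_idx M W" "W \<subseteq> W'" "M' \<subseteq> M"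
  shows "fin_idx M' W'"
proof -
  have "fin_idx M W'"
  proof -
    \<comment> \<open>Each \<open>W\<close>-coset goes to the \<open>W'\<close>-coset of any of its
      elements. The chosen element may lie outside \<open>M\<close>, which does no harm because
      \<open>W\<close> is contained in \<open>W'\<close>.\<close>
    have "coset W' ` M \<subseteq> (\<lambda>C. coset W' (SOME x. x \<in> C)) ` (coset W ` M)"
    proof safe
      fix x assume x: "x \<in> M"
      have "x \<in> coset W x" using assms by (simp add: coset_def add_subgroup_zero)
      then have "(SOME y. y \<in> coset W x) \<in> coset W x" by (rule someI)
      then have "coset W' (SOME y. y \<in> coset W x) = coset W' x"
        using assms(4) by (subst coset_eq_iff[OF assms(2)]) (auto simp: coset_def)
      then show "coset W' x \<in> (\<lambda>C. coset W' (SOME x. x \<in> C)) ` (coset W ` M)"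
        using x by (metis imageI)
    qed
    then show ?thesis using assms(3) unfolding fin_idx_def by (meson finite_imageI finite_subset)
  qed
  then show ?thesis using assms(5) unfolding fin_idx_def by (meson finite_subset image_mono)
qed

text \<open>Second isomorphism theorem: representatives of \<open>B\<close> modulo the intersection
  serve unchanged for the sum modulo \<open>A\<close>.\<close>

lemma coset_reps_sumset:
  assumes A: "add_subgroup A" and B: "add_subgroup B" and D: "coset_reps D B (A \<inter> B)"
  shows "coset_reps D (sumset A B) A"
  unfolding coset_reps_def
proof (intro conjI ballI)
  show "D \<subseteq> sumset A B" using D sumset_upper2[OF A] unfolding coset_reps_def by blast
  fix x assume "x \<in> sumset A B"
  then obtain a b where ab: "a \<in> A" "b \<in> B" "x = a + b" by (auto simp: sumset_def)
  obtain d where d: "d \<in> D" "b - d \<in> A \<inter> B" using D ab unfolding coset_reps_def by blast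
  show "\<exists>!d. d \<in> D \<and> x - d \<in> A"
  proof (rule ex1I[of _ d])
    have "x - d = a + (b - d)" using ab by simp
    then show *: "d \<in> D \<and> x - d \<in> A" using d ab A add_subgroup_add by (metis IntD1)
    fix e assume e: "e \<in> D \<and> x - e \<in> A"
    have "e \<in> B" "d \<in> B" using e d D by (auto simp: coset_reps_def)
    then have "b - e \<in> B" using ab B by (auto intro: add_subgroup_diff)
    moreover have "b - e = (x - e) - a" using ab by simp
    ultimately have "b - e \<in> A \<inter> B" using A e ab add_subgroup_diff by (metis IntI)
    then show "e = d" using coset_reps_unique[OF D ab(2)] e d by blast
  qed
qed

lemma idx_sumset:
  assumes "add_subgroup A" "add_subgroup B" shows "idx (sumset A B) A = idx B (A \<inter> B)"
proof -
  obtain D where D: "coset_reps D B (A \<inter> B)"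
    using coset_reps_exist[OF add_subgroup_Int[OF assms]] by blast
  show ?thesis
    using idx_eq_card[OF assms(1) coset_reps_sumset[OF assms D]]
      idx_eq_card[OF add_subgroup_Int[OF assms] D] by simp
qed

lemma idx_pos:
  assumes "fin_idx M W" "M \<noteq> {}" shows "idx M W > 0"
  using assms by (simp add: fin_idx_def idx_def card_gt_0_iff)

lemma idx_self: "add_subgroup M \<Longrightarrow> idx M M = 1"
proof -
  assume M: "add_subgroup M"
  then have "coset M x = coset M 0" if "x \<in> M" for x using that coset_eq_iff[of M x 0] by simp
  then have "coset M ` M = {coset M 0}" using add_subgroup_zero[OF M] by blast
  then show ?thesis by (simp add: idx_def)
qed

lemma fin_idx_self: "add_subgroup M \<Longrightarrow> fin_idx M M"
  using idx_self[of M] by (auto simp: fin_idx_def idx_def intro: card_ge_0_finite)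

lemma idx_eq_1_imp:
  assumes "add_subgroup W" "add_subgroup M" "idx M W = 1" shows "M \<subseteq> W"
proof
  fix x assume "x \<in> M"
  obtain C where "coset W ` M = {C}" using assms(3) by (auto simp: idx_def card_1_singleton_iff)
  then have "coset W x = coset W 0" using \<open>x \<in> M\<close> add_subgroup_zero[OF assms(2)] by blast
  then show "x \<in> W" using assms(1) by (simp add: coset_eq_iff)
qed

text \<open>An intermediate group is a union of cosets, hence determined by a subset of a finite
  set. The finiteness of all sets of fractional ideals below rests on this.\<close>

lemma finite_intermediate:
  assumes W: "add_subgroup W" and fin: "fin_idx M W"
  shows "finite {N. add_subgroup N \<and> W \<subseteq> N \<and> N \<subseteq> M}"
proof (rule inj_on_finite[where f = "\<lambda>N. coset W ` N"])
  have *: "N = M \<inter> \<Union>(coset W ` N)" if "add_subgroup N" "W \<subseteq> N" "N \<subseteq> M" for N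
  proof (intro equalityI subsetI)
    fix x assume "x \<in> N" then show "x \<in> M \<inter> \<Union>(coset W ` N)"
      using that add_subgroup_zero[OF W] by (auto simp: coset_def intro!: bexI[of _ x])
  next
    fix x assume "x \<in> M \<inter> \<Union>(coset W ` N)"
    then obtain y where y: "y \<in> N" "x - y \<in> W" by (auto simp: coset_def)
    then have "(x - y) + y \<in> N" using that by (blast intro: add_subgroup_add)
    then show "x \<in> N" by simp
  qed
  show "inj_on (\<lambda>N. coset W ` N) {N. add_subgroup N \<and> W \<subseteq> N \<and> N \<subseteq> M}"
    by (rule inj_onI) (metis (mono_tags, lifting) "*" mem_Collect_eq)
  show "(\<lambda>N. coset W ` N) ` {N. add_subgroup N \<and> W \<subseteq> N \<and> N \<subseteq> M} \<subseteq> Pow (coset W ` M)"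
    by auto
  show "finite (Pow (coset W ` M))" using fin by (simp add: fin_idx_def)
qed

section \<open>Multiplication by a unit\<close>

context
  fixes u v :: "'a::comm_ring_1" assumes uv: "u * v = 1"
begin

lemma inj_mult_unit: "inj ((*) u)"
proof (rule injI)
  fix x y assume "u * x = u * y"
  then have "v * (u * x) = v * (u * y)" by simp
  then show "x = y" using uv by (metis mult.commute mult.left_commute mult.right_neutral)
qed

lemma mult_unit_mem_iff: "u * x \<in> (*) u ` M \<longleftrightarrow> x \<in> M"
  using inj_mult_unit by (simp add: inj_image_mem_iff)

lemma mem_mult_unit_iff: "x \<in> (*) u ` M \<longleftrightarrow> v * x \<in> M"
proof -
  have "u * (v * x) = x" using uv by (simp add: mult.assoc[symmetric])
  then show ?thesis using mult_unit_mem_iff[of "v * x" M] by simp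
qed

lemma add_subgroup_scale: "add_subgroup M \<Longrightarrow> add_subgroup ((*) u ` M)"
  unfolding add_subgroup_def by (simp add: mem_mult_unit_iff right_diff_distrib)

lemma coset_reps_scale:
  assumes "coset_reps D M W" shows "coset_reps ((*) u ` D) ((*) u ` M) ((*) u ` W)"
  unfolding coset_reps_def
proof (intro conjI ballI)
  show "(*) u ` D \<subseteq> (*) u ` M" using assms by (auto simp: coset_reps_def)
  fix x assume "x \<in> (*) u ` M"
  then obtain m where m: "x = u * m" "m \<in> M" by auto
  then obtain d where d: "d \<in> D" "m - d \<in> W" using assms unfolding coset_reps_def by blast
  have mem: "x - u * e \<in> (*) u ` W \<longleftrightarrow> m - e \<in> W" for e
    using mult_unit_mem_iff[of "m - e" W] m by (simp add: right_diff_distrib)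
  show "\<exists>!d. d \<in> (*) u ` D \<and> x - d \<in> (*) u ` W"
  proof (rule ex1I[of _ "u * d"])
    show "u * d \<in> (*) u ` D \<and> x - u * d \<in> (*) u ` W" using d mem by blast
    fix e assume "e \<in> (*) u ` D \<and> x - e \<in> (*) u ` W"
    then show "e = u * d" using mem coset_reps_unique[OF assms m(2)] d by blast
  qed
qed

lemma idx_scale:
  assumes "add_subgroup W"
  shows "idx ((*) u ` M) ((*) u ` W) = idx M W"
    and "fin_idx ((*) u ` M) ((*) u ` W) \<longleftrightarrow> fin_idx M W"
proof -
  obtain D where D: "coset_reps D M W" using coset_reps_exist[OF assms] by blast
  have inj: "inj_on ((*) u) D" using inj_mult_unit by (rule inj_on_subset) simp
  show "idx ((*) u ` M) ((*) u ` W) = idx M W"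
    using idx_eq_card[OF add_subgroup_scale[OF assms] coset_reps_scale[OF D]]
      idx_eq_card[OF assms D] card_image[OF inj] by simp
  show "fin_idx ((*) u ` M) ((*) u ` W) \<longleftrightarrow> fin_idx M W"
    using fin_idx_iff_finite[OF add_subgroup_scale[OF assms] coset_reps_scale[OF D]]
      fin_idx_iff_finite[OF assms D] finite_image_iff[OF inj] by simp
qed

end

section \<open>The valuation ring\<close>

context nonarch_local_field
begin

abbreviation "q \<equiv> residue_card av"

definition unif :: 'f where
  "unif = (SOME \<pi>. \<pi> \<noteq> 0 \<and> val_ideal av = (\<lambda>x. \<pi> * x) ` val_ring av \<and> av \<pi> = 1 / real q)"

lemma unif_nz: "unif \<noteq> 0"
  and val_ideal_eq: "val_ideal av = (*) unif ` val_ring av"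
  and av_unif: "av unif = 1 / real q"
  using someI_ex[OF uniformizer] unfolding unif_def by auto

lemma av_1: "av 1 = 1"
  using av_mult[of 1 1] av_eq_0_iff[of 1] by simp

lemma av_minus: "av (- x) = av x"
proof -
  have "av (- 1) * av (- 1) = 1" using av_mult[of "- 1" "- 1"] av_1 by simp
  then have "av (- 1) = 1"
    using av_nonneg[of "- 1"] by (metis abs_of_nonneg abs_mult_self_eq abs_one real_sqrt_abs2 real_sqrt_one)
  then show ?thesis using av_mult[of "- 1" x] by simp
qed

lemma av_power: "av (x ^ n) = av x ^ n"
  by (induction n) (simp_all add: av_1 av_mult)

lemma av_inverse: "av (inverse x) = inverse (av x)"
proof (cases "x = 0")
  case True then show ?thesis using av_eq_0_iff[of 0] by simp
next
  case False
  then have "av x * av (inverse x) = 1" using av_mult[of x "inverse x"] av_1 by simp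
  then show ?thesis by (metis inverse_unique)
qed

lemma val_ring_0: "0 \<in> val_ring av" and val_ring_1: "1 \<in> val_ring av"
  using av_eq_0_iff[of 0] av_1 by (auto simp: val_ring_def)

lemma val_ring_add: "x \<in> val_ring av \<Longrightarrow> y \<in> val_ring av \<Longrightarrow> x + y \<in> val_ring av"
  using av_ultrametric[of x y] by (auto simp: val_ring_def)

lemma val_ring_minus: "x \<in> val_ring av \<Longrightarrow> - x \<in> val_ring av"
  by (simp add: val_ring_def av_minus)

lemma val_ring_diff: "x \<in> val_ring av \<Longrightarrow> y \<in> val_ring av \<Longrightarrow> x - y \<in> val_ring av"
  using val_ring_add[of x "- y"] val_ring_minus[of y] by simp

lemma val_ring_mult: "x \<in> val_ring av \<Longrightarrow> y \<in> val_ring av \<Longrightarrow> x * y \<in> val_ring av"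
  using av_nonneg[of x] av_nonneg[of y] by (auto simp: val_ring_def av_mult mult_le_one)

lemma val_ring_power: "x \<in> val_ring av \<Longrightarrow> x ^ n \<in> val_ring av"
  by (induction n) (auto intro: val_ring_1 val_ring_mult)

lemma val_ring_sum: "(\<And>i. i \<in> I \<Longrightarrow> f i \<in> val_ring av) \<Longrightarrow> sum f I \<in> val_ring av"
  by (induction I rule: infinite_finite_induct) (auto intro: val_ring_0 val_ring_add)

lemma add_subgroup_val_ring: "add_subgroup (val_ring av)"
  using val_ring_0 val_ring_diff by (auto simp: add_subgroup_def)

lemma add_subgroup_val_ideal: "add_subgroup (val_ideal av)"
  unfolding val_ideal_eq
  by (rule add_subgroup_scale[of unif "inverse unif"]) (auto simp: unif_nz add_subgroup_val_ring)

lemma val_ideal_subset: "val_ideal av \<subseteq> val_ring av"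
  by (auto simp: val_ideal_def val_ring_def)

lemma residue_field_eq: "residue_field av = coset (val_ideal av) ` val_ring av"
proof -
  have "{(x, y). x \<in> val_ring av \<and> y \<in> val_ring av \<and> x - y \<in> val_ideal av} `` {x} = coset (val_ideal av) x"
    if x: "x \<in> val_ring av" for x
  proof -
    have "y \<in> val_ring av" if "y - x \<in> val_ideal av" for y
      using val_ring_add[of "y - x" x] that x val_ideal_subset by auto
    then show ?thesis
      using x add_subgroup_minus_commute[OF add_subgroup_val_ideal] by (auto simp: coset_def)
  qed
  then show ?thesis unfolding residue_field_def quotient_def by auto
qed

lemma q_eq_idx: "q = idx (val_ring av) (val_ideal av)"
  and fin_idx_val_ideal: "fin_idx (val_ring av) (val_ideal av)"
  using finite_residue_field by (simp_all add: residue_card_def residue_field_eq idx_def fin_idx_def)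

lemma q_ge_2: "q \<ge> 2"
proof -
  have "coset (val_ideal av) 0 \<noteq> coset (val_ideal av) 1"
    using coset_eq_iff[OF add_subgroup_val_ideal, of 1 0] av_1 by (auto simp: val_ideal_def)
  then have "card {coset (val_ideal av) 0, coset (val_ideal av) 1} = 2" by simp
  moreover have "{coset (val_ideal av) 0, coset (val_ideal av) 1} \<subseteq> residue_field av"
    using val_ring_0 val_ring_1 by (auto simp: residue_field_eq)
  ultimately show ?thesis
    using card_mono[OF finite_residue_field] by (metis residue_card_def)
qed

lemma unif_in: "unif \<in> val_ring av"
  using q_ge_2 by (simp add: val_ring_def av_unif divide_le_eq_1)

lemma unit_inverse: "av x = 1 \<Longrightarrow> inverse x \<in> val_ring av"
  by (simp add: val_ring_def av_inverse)

lemma val_ring_cases: "x \<in> val_ring av \<Longrightarrow> x \<in> val_ideal av \<or> av x = 1"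
  by (auto simp: val_ring_def val_ideal_def)

lemma unif_power_clears: "\<exists>k. unif ^ k * x \<in> val_ring av"
proof -
  obtain k where k: "av x < real 2 ^ k" using real_arch_pow[of 2 "av x"] by auto
  have "av (unif ^ k * x) = av x / real q ^ k"
    by (simp add: av_mult av_power av_unif power_divide)
  also have "\<dots> \<le> 1"
  proof -
    have "(2::real) ^ k \<le> real q ^ k" using q_ge_2 by (intro power_mono) auto
    then have "av x \<le> real q ^ k" using k by simp
    moreover have "real q ^ k > 0" using q_ge_2 by simp
    ultimately show ?thesis by simp
  qed
  finally show ?thesis by (auto simp: val_ring_def)
qed

text \<open>Induction on an exponent \<open>k\<close> with \<open>unif ^ k / x\<close> integral: a
  nonunit \<open>x\<close> is divisible by \<open>unif\<close>, and the quotient satisfies the bound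
  \<open>k - 1\<close>.\<close>

lemma unif_decomp:
  assumes "x \<in> val_ring av" "x \<noteq> 0" shows "\<exists>k u. av u = 1 \<and> x = unif ^ k * u"
proof -
  obtain k where k: "unif ^ k * inverse x \<in> val_ring av" using unif_power_clears by blast
  have "\<exists>k u. av u = 1 \<and> x = unif ^ k * u"
    if "x \<in> val_ring av" "x \<noteq> 0" "unif ^ k * inverse x \<in> val_ring av" for k x
    using that
  proof (induction k arbitrary: x)
    case 0
    then have "inverse (av x) \<le> 1" "av x \<le> 1" "av x \<noteq> 0"
      using av_eq_0_iff[of x] by (auto simp: val_ring_def av_inverse)
    then have "av x = 1" using av_nonneg[of x]
      by (metis antisym inverse_le_1_iff less_eq_real_def not_less)
    then show ?case by (intro exI[of _ 0] exI[of _ x]) auto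
  next
    case (Suc k)
    show ?case
    proof (cases "av x = 1")
      case True then show ?thesis by (intro exI[of _ 0] exI[of _ x]) auto
    next
      case False
      then obtain y where y: "x = unif * y" "y \<in> val_ring av"
        using val_ring_cases[OF Suc.prems(1)] by (auto simp: val_ideal_eq)
      have "unif ^ Suc k * inverse x = unif ^ k * inverse y" using y unif_nz by (simp add: field_simps)
      with Suc.prems(3) have "unif ^ k * inverse y \<in> val_ring av" by metis
      then obtain j u where "av u = 1" "y = unif ^ j * u"
        using Suc.IH[of y] y Suc.prems(2) by auto
      then show ?thesis using y by (intro exI[of _ "Suc j"] exI[of _ u]) auto
    qed
  qed
  then show ?thesis using assms k by blast
qed

lemma unif_power_mono: "unif ^ k * x \<in> val_ring av \<Longrightarrow> k \<le> j \<Longrightarrow> unif ^ j * x \<in> val_ring av"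
  using val_ring_mult[OF val_ring_power[OF unif_in, of "j - k"], of "unif ^ k * x"]
  by (simp add: mult.assoc[symmetric] power_add[symmetric])

end

section \<open>Lengths and indices of modules over the valuation ring\<close>

context reduced_local_algebra
begin

abbreviation "osub \<equiv> OF_submodule av sc"

text \<open>The uniformizer of \<open>F\<close> as an element of \<open>E\<close>: scaling a lattice
  by it is then a ring multiplication, covered by the lemmas on multiplication by units.\<close>

definition p :: 'e where "p = sc unif 1"
definition p_inv :: 'e where "p_inv = sc (inverse unif) 1"

lemma sc_eq_mult: "sc a x = sc a 1 * x"
  by (simp add: sc_mult_left)

lemma sc_mult_right: "x * sc a y = sc a (x * y)"
  using sc_mult_left[of a y x] by (simp add: mult.commute)

lemma p_p_inv: "p * p_inv = 1"
  by (simp add: p_def p_inv_def sc_mult_left unif_nz)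

lemma sc_unif_power: "sc (unif ^ k) x = p ^ k * x"
proof (induction k)
  case (Suc k)
  have "sc (unif ^ Suc k) x = sc unif (sc (unif ^ k) x)" by simp
  also have "\<dots> = p * (p ^ k * x)"
    using Suc by (subst sc_eq_mult) (simp add: p_def)
  finally show ?case by (simp add: mult.assoc)
qed simp

lemma p_power_inv: "p ^ k * p_inv ^ k = 1"
  by (metis p_p_inv power_mult_distrib power_one)

lemma p_inv_power: "p_inv ^ k * p ^ k = 1"
  by (metis p_power_inv mult.commute)

lemma osub_0: "osub M \<Longrightarrow> 0 \<in> M"
  and osub_add: "osub M \<Longrightarrow> x \<in> M \<Longrightarrow> y \<in> M \<Longrightarrow> x + y \<in> M"
  and osub_sc: "osub M \<Longrightarrow> a \<in> val_ring av \<Longrightarrow> x \<in> M \<Longrightarrow> sc a x \<in> M"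
  by (auto simp: OF_submodule_def)

lemma osub_minus: "osub M \<Longrightarrow> x \<in> M \<Longrightarrow> - x \<in> M"
  using osub_sc[of M "- 1" x] val_ring_minus[OF val_ring_1] by simp

lemma osub_diff: "osub M \<Longrightarrow> x \<in> M \<Longrightarrow> y \<in> M \<Longrightarrow> x - y \<in> M"
  using osub_add[of M x "- y"] osub_minus[of M y] by simp

lemma osub_sum: "osub M \<Longrightarrow> (\<And>i. i \<in> I \<Longrightarrow> f i \<in> M) \<Longrightarrow> sum f I \<in> M"
  by (induction I rule: infinite_finite_induct) (auto intro: osub_0 osub_add)

lemma osub_add_subgroup: "osub M \<Longrightarrow> add_subgroup M"
  by (auto simp: add_subgroup_def osub_0 osub_diff)

lemma osub_p: "osub M \<Longrightarrow> x \<in> M \<Longrightarrow> p * x \<in> M"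
  using osub_sc[of M unif x] unif_in sc_unif_power[of 1 x] by simp

lemma osub_p_power: "osub M \<Longrightarrow> x \<in> M \<Longrightarrow> p ^ k * x \<in> M"
  using osub_sc[of M "unif ^ k" x] val_ring_power[OF unif_in] by (simp add: sc_unif_power)

lemma osub_p_power_mono: "osub M \<Longrightarrow> p ^ k * x \<in> M \<Longrightarrow> k \<le> j \<Longrightarrow> p ^ j * x \<in> M"
  using osub_p_power[of M "p ^ k * x" "j - k"]
  by (simp add: mult.assoc[symmetric] power_add[symmetric])

lemma osub_image_mult: "osub M \<Longrightarrow> osub ((*) u ` M)"
proof -
  assume M: "osub M"
  have "u * x + u * y \<in> (*) u ` M" if "x \<in> M" "y \<in> M" for x y
    using osub_add[OF M that] by (metis imageI distrib_left)
  moreover have "sc a (u * x) \<in> (*) u ` M" if "a \<in> val_ring av" "x \<in> M" for a x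
    using osub_sc[OF M that] sc_mult_right by (metis imageI)
  moreover have "0 \<in> (*) u ` M" using osub_0[OF M] by force
  ultimately show ?thesis by (auto simp: OF_submodule_def)
qed

lemma osub_vimage_mult: "osub M \<Longrightarrow> osub {x. u * x \<in> M}"
  unfolding OF_submodule_def by (auto simp: distrib_left sc_mult_right)

lemma osub_Int: "osub M \<Longrightarrow> osub N \<Longrightarrow> osub (M \<inter> N)"
  by (auto simp: OF_submodule_def)

lemma osub_sumset: "osub M \<Longrightarrow> osub N \<Longrightarrow> osub (sumset M N)"
proof -
  assume MN: "osub M" "osub N"
  then have "add_subgroup (sumset M N)" by (simp add: osub_add_subgroup add_subgroup_sumset)
  moreover have "sc a x \<in> sumset M N" if "a \<in> val_ring av" "x \<in> sumset M N" for a x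
  proof -
    obtain m n where "m \<in> M" "n \<in> N" "x = m + n" using \<open>x \<in> sumset M N\<close> by (auto simp: sumset_def)
    then have "sc a m \<in> M" "sc a n \<in> N" "sc a x = sc a m + sc a n"
      using MN that by (auto simp: osub_sc scale_right_distrib)
    then show ?thesis by (force simp: sumset_def)
  qed
  ultimately show ?thesis
    by (auto simp: OF_submodule_def add_subgroup_zero add_subgroup_add)
qed

lemma osub_line: "osub ((\<lambda>a. sc a y) ` val_ring av)"
proof -
  have "0 \<in> (\<lambda>a. sc a y) ` val_ring av" using val_ring_0 by force
  moreover have "sc a y + sc b y \<in> (\<lambda>a. sc a y) ` val_ring av"
    if "a \<in> val_ring av" "b \<in> val_ring av" for a b
    using val_ring_add[OF that] by (metis imageI scale_left_distrib)
  moreover have "sc a (sc b y) \<in> (\<lambda>a. sc a y) ` val_ring av"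
    if "a \<in> val_ring av" "b \<in> val_ring av" for a b
    using val_ring_mult[OF that] by (intro image_eqI[of _ _ "a * b"]) auto
  ultimately show ?thesis by (auto simp: OF_submodule_def)
qed

text \<open>The annihilator of \<open>y\<close> modulo \<open>N\<close> is exactly the maximal
  ideal, as a coefficient of absolute value 1 could be inverted. The quotient is thus a copy of the
  residue field.\<close>

lemma idx_simple_step:
  assumes N: "osub N" and y: "y \<notin> N" "p * y \<in> N"
  shows "idx (sumset N ((\<lambda>a. sc a y) ` val_ring av)) N = q"
proof -
  let ?Y = "(\<lambda>a. sc a y) ` val_ring av"
  have mem: "sc a y \<in> N \<longleftrightarrow> a \<in> val_ideal av" if "a \<in> val_ring av" for a
  proof
    assume "sc a y \<in> N"
    show "a \<in> val_ideal av"
    proof (rule ccontr)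
      assume "a \<notin> val_ideal av"
      then have "av a = 1" using val_ring_cases that by blast
      then have "a \<noteq> 0" "inverse a \<in> val_ring av" using unit_inverse av_eq_0_iff[of a] by auto
      then have "sc (inverse a) (sc a y) \<in> N" using N \<open>sc a y \<in> N\<close> by (blast intro: osub_sc)
      then show False using y \<open>a \<noteq> 0\<close> by simp
    qed
  next
    assume "a \<in> val_ideal av"
    then obtain b where b: "a = unif * b" "b \<in> val_ring av" by (auto simp: val_ideal_eq)
    have "sc a y = sc b (sc unif y)" by (simp add: b mult.commute[of unif])
    also have "sc unif y = p * y" using sc_unif_power[of 1 y] by simp
    finally have "sc a y = sc b (p * y)" .
    then show "sc a y \<in> N" using osub_sc[OF N b(2) y(2)] by simp
  qed
  obtain D where D: "coset_reps D (val_ring av) (val_ideal av)"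
    using coset_reps_exist[OF add_subgroup_val_ideal] by blast
  have DO: "D \<subseteq> val_ring av" using D by (simp add: coset_reps_def)
  have diff: "sc a y - sc b y \<in> N \<inter> ?Y \<longleftrightarrow> a - b \<in> val_ideal av"
    if "a \<in> val_ring av" "b \<in> val_ring av" for a b
    using mem[OF val_ring_diff[OF that]] val_ring_diff[OF that]
    by (auto simp: scale_left_diff_distrib[symmetric])
  have inj: "inj_on (\<lambda>a. sc a y) D"
    using y osub_0[OF N] by (auto intro!: inj_onI)
  have "coset_reps ((\<lambda>a. sc a y) ` D) ?Y (N \<inter> ?Y)"
    unfolding coset_reps_def
  proof (intro conjI ballI)
    show "(\<lambda>a. sc a y) ` D \<subseteq> ?Y" using DO by blast
    fix x assume "x \<in> ?Y"
    then obtain a where a: "x = sc a y" "a \<in> val_ring av" by auto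
    then obtain d where d: "d \<in> D" "a - d \<in> val_ideal av" using D unfolding coset_reps_def by blast
    show "\<exists>!d. d \<in> (\<lambda>a. sc a y) ` D \<and> x - d \<in> N \<inter> ?Y"
    proof (rule ex1I[of _ "sc d y"])
      show "sc d y \<in> (\<lambda>a. sc a y) ` D \<and> x - sc d y \<in> N \<inter> ?Y" using a d diff[of a d] DO by blast
      fix e assume "e \<in> (\<lambda>a. sc a y) ` D \<and> x - e \<in> N \<inter> ?Y"
      then obtain b where "b \<in> D" "e = sc b y" "a - b \<in> val_ideal av" using a diff[of a] DO by blast
      then show "e = sc d y" using coset_reps_unique[OF D a(2)] d by blast
    qed
  qed
  then have "idx ?Y (N \<inter> ?Y) = card ((\<lambda>a. sc a y) ` D)"
    by (intro idx_eq_card osub_add_subgroup osub_Int N osub_line)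
  also have "\<dots> = card D" using inj by (rule card_image)
  also have "\<dots> = q" using idx_eq_card[OF add_subgroup_val_ideal D] q_eq_idx by simp
  finally show ?thesis by (subst idx_sumset) (auto intro: osub_add_subgroup N osub_line)
qed

text \<open>Produces a simple submodule of \<open>M / N\<close>. Finite index makes two multiples
  \<open>p ^ i * x\<close> and \<open>p ^ j * x\<close> agree modulo \<open>N\<close>, which forces
  a power of \<open>p\<close> to kill \<open>x\<close>; the last multiple outside \<open>N\<close>
  generates the simple submodule.\<close>

lemma osub_step:
  assumes N: "osub N" and M: "osub M" and "N \<subset> M" and fin: "fin_idx M N"
  shows "\<exists>N'. osub N' \<and> N \<subset> N' \<and> N' \<subseteq> M \<and> idx N' N = q \<and> (\<forall>x\<in>N'. p * x \<in> N)"
proof -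
  obtain x where x: "x \<in> M" "x \<notin> N" using \<open>N \<subset> M\<close> by blast
  have "\<not> inj (\<lambda>i::nat. coset N (p ^ i * x))"
  proof
    assume "inj (\<lambda>i::nat. coset N (p ^ i * x))"
    then have "infinite (range (\<lambda>i::nat. coset N (p ^ i * x)))" by (simp add: finite_image_iff)
    moreover have "range (\<lambda>i::nat. coset N (p ^ i * x)) \<subseteq> coset N ` M"
      using osub_p_power[OF M x(1)] by auto
    ultimately show False using fin unfolding fin_idx_def by (meson finite_subset)
  qed
  then obtain i j where ij: "i < j" "coset N (p ^ i * x) = coset N (p ^ j * x)"
    unfolding inj_def by (metis linorder_neqE_nat)
  \<comment> \<open>The congruence says that \<open>u\<close> times \<open>p ^ i * x\<close> lies in
    \<open>N\<close>, and \<open>u\<close> is a unit, being 1 minus a multiple of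
    \<open>unif\<close>.\<close>
  define u where "u = 1 - unif ^ (j - i)"
  have "av u = 1"
  proof (rule ccontr)
    assume "av u \<noteq> 1"
    moreover have "u \<in> val_ring av"
      unfolding u_def by (intro val_ring_diff val_ring_1 val_ring_power unif_in)
    ultimately have "u \<in> val_ideal av" using val_ring_cases by blast
    moreover have "unif ^ (j - i) \<in> val_ideal av"
    proof -
      have "j - i = Suc (j - i - 1)" using ij by simp
      then have "unif ^ (j - i) = unif * unif ^ (j - i - 1)" by (metis power_Suc)
      then show ?thesis unfolding val_ideal_eq using val_ring_power[OF unif_in] by blast
    qed
    ultimately have "u + unif ^ (j - i) \<in> val_ideal av"
      using add_subgroup_add[OF add_subgroup_val_ideal] by blast
    then show False using av_1 by (simp add: u_def val_ideal_def)
  qed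
  have "p ^ i * x - p ^ j * x \<in> N" using ij coset_eq_iff[OF osub_add_subgroup[OF N]] by blast
  moreover have "p ^ i * x - p ^ j * x = sc u (p ^ i * x)"
  proof -
    have "p ^ j * x = sc (unif ^ (j - i)) (p ^ i * x)"
      using ij by (simp add: sc_unif_power mult.assoc[symmetric] power_add[symmetric])
    then show ?thesis by (simp add: u_def scale_left_diff_distrib)
  qed
  ultimately have "sc (inverse u) (sc u (p ^ i * x)) \<in> N"
    using osub_sc[OF N unit_inverse[OF \<open>av u = 1\<close>]] by metis
  moreover have "u \<noteq> 0" using \<open>av u = 1\<close> av_eq_0_iff[of u] by auto
  ultimately have ex: "p ^ i * x \<in> N" by simp
  define k where "k = (LEAST k. p ^ k * x \<in> N)"
  have k: "p ^ k * x \<in> N" unfolding k_def using ex by (rule LeastI)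
  have "k \<noteq> 0" using k x by (cases k) auto
  then obtain k' where k': "k = Suc k'" by (cases k) auto
  define y where "y = p ^ k' * x"
  have y: "y \<notin> N" unfolding y_def using not_less_Least[of k' "\<lambda>k. p ^ k * x \<in> N"] k' k_def by auto
  have py: "p * y \<in> N" using k by (simp add: k' y_def mult.assoc)
  have yM: "y \<in> M" unfolding y_def by (rule osub_p_power[OF M x(1)])
  let ?Y = "(\<lambda>a. sc a y) ` val_ring av"
  have YM: "?Y \<subseteq> M" using osub_sc[OF M _ yM] by blast
  have "y \<in> ?Y" using val_ring_1 by (intro image_eqI[of _ _ 1]) auto
  then have "y \<in> sumset N ?Y" by (rule subsetD[OF sumset_upper2[OF osub_add_subgroup[OF N]]])
  moreover have "N \<subseteq> sumset N ?Y" by (rule sumset_upper1[OF osub_add_subgroup[OF osub_line]])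
  ultimately have "N \<subset> sumset N ?Y" using y by auto
  moreover have "sumset N ?Y \<subseteq> M"
    using YM \<open>N \<subset> M\<close> osub_add_subgroup[OF M] by (intro sumset_least) auto
  moreover have "p * z \<in> N" if "z \<in> sumset N ?Y" for z
  proof -
    obtain n a where z: "n \<in> N" "a \<in> val_ring av" "z = n + sc a y"
      using \<open>z \<in> sumset N ?Y\<close> by (auto simp: sumset_def)
    have "p * z = p * n + sc a (p * y)" by (simp add: z(3) distrib_left sc_mult_right)
    then show ?thesis using osub_add[OF N osub_p[OF N z(1)] osub_sc[OF N z(2) py]] by simp
  qed
  ultimately show ?thesis using idx_simple_step[OF N y py] osub_sumset[OF N osub_line] by blast
qed

lemma osub_chain_exists:
  assumes "osub N" "osub M" "N \<subseteq> M" "fin_idx M N"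
  shows "\<exists>l C. idx M N = q ^ l \<and> C 0 = N \<and> C l = M \<and> (\<forall>i\<le>l. osub (C i)) \<and> (\<forall>i<l. C i \<subset> C (Suc i))"
  using assms
proof (induction "idx M N" arbitrary: N rule: less_induct)
  case less
  show ?case
  proof (cases "N = M")
    case True
    then show ?thesis using less.prems idx_self[OF osub_add_subgroup[OF less.prems(1)]]
      by (intro exI[of _ 0] exI[of _ "\<lambda>_. M"]) auto
  next
    case False
    then obtain N' where N': "osub N'" "N \<subset> N'" "N' \<subseteq> M" "idx N' N = q"
      using osub_step[OF less.prems(1,2) _ less.prems(4)] less.prems(3) by blast
    have idx: "idx M N = idx M N' * q"
      using idx_trans(1)[of N N' M] N' less.prems osub_add_subgroup by (metis psubset_imp_subset)
    have fin': "fin_idx M N'"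
      using fin_idx_mono[OF _ _ less.prems(4), of N' M] N' less.prems osub_add_subgroup by blast
    have "idx M N' > 0" using idx_pos[OF fin'] osub_0[OF less.prems(2)] by blast
    then have "idx M N' < idx M N" using idx q_ge_2 by simp
    from less.hyps[OF this N'(1) less.prems(2) N'(3) fin']
    obtain l C where C: "idx M N' = q ^ l" "C 0 = N'" "C l = M" "\<forall>i\<le>l. osub (C i)"
      "\<forall>i<l. C i \<subset> C (Suc i)" by blast
    define C' where "C' = case_nat N C"
    have "\<forall>i\<le>Suc l. osub (C' i)" using C(4) less.prems(1) by (auto simp: C'_def split: nat.split)
    moreover have "\<forall>i<Suc l. C' i \<subset> C' (Suc i)"
      using C(5) C(2) N'(2) by (auto simp: C'_def split: nat.split)
    moreover have "C' 0 = N" "C' (Suc l) = M" using C by (auto simp: C'_def)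
    moreover have "idx M N = q ^ Suc l" using idx C(1) by simp
    ultimately show ?thesis by blast
  qed
qed

text \<open>Each strict inclusion contributes an index that is a power of \<open>q\<close> other
  than 1, hence at least \<open>q\<close>. This bounds every chain, while
  \<open>osub_chain_exists\<close> provides one that attains the bound.\<close>

lemma osub_chain_bound:
  assumes "\<forall>i\<le>n. osub (C i)" "\<forall>i<n. C i \<subset> C (Suc i)" "fin_idx (C n) (C 0)"
  shows "C 0 \<subseteq> C n \<and> q ^ n \<le> idx (C n) (C 0)"
  using assms
proof (induction n)
  case 0
  then show ?case using idx_self[OF osub_add_subgroup[of "C 0"]] by simp
next
  case (Suc n)
  have sub: "osub (C 0)" "osub (C n)" "osub (C (Suc n))" using Suc.prems by auto
  have "C n \<subset> C (Suc n)" using Suc.prems by blast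
  then have "fin_idx (C n) (C 0)"
    using fin_idx_mono[OF _ _ Suc.prems(3), of "C 0" "C n"] sub osub_add_subgroup by blast
  then have IH: "C 0 \<subseteq> C n" "q ^ n \<le> idx (C n) (C 0)" using Suc by auto
  have fin: "fin_idx (C (Suc n)) (C n)"
    using fin_idx_mono[OF _ _ Suc.prems(3), of "C n" "C (Suc n)"] sub IH osub_add_subgroup by blast
  obtain l where l: "idx (C (Suc n)) (C n) = q ^ l"
    using osub_chain_exists[OF sub(2,3) _ fin] \<open>C n \<subset> C (Suc n)\<close> by blast
  have "l \<noteq> 0"
    using idx_eq_1_imp[of "C n" "C (Suc n)"] l \<open>C n \<subset> C (Suc n)\<close> sub osub_add_subgroup
    by (metis power_0 psubsetE)
  then have "q ^ 1 \<le> q ^ l" using q_ge_2 by (intro power_increasing) auto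
  then have "q ^ Suc n \<le> idx (C (Suc n)) (C n) * idx (C n) (C 0)"
    using IH(2) l by (simp add: mult_le_mono)
  also have "\<dots> = idx (C (Suc n)) (C 0)"
    using idx_trans(1)[of "C 0" "C n" "C (Suc n)"] sub IH \<open>C n \<subset> C (Suc n)\<close> osub_add_subgroup by auto
  finally show ?case using IH \<open>C n \<subset> C (Suc n)\<close> by auto
qed

definition len :: "'e set \<Rightarrow> 'e set \<Rightarrow> nat" where
  "len M N = the_enat (quot_length av sc M N)"

lemma idx_len:
  assumes "osub N" "osub M" "N \<subseteq> M" "fin_idx M N"
  shows "idx M N = q ^ len M N"
proof -
  obtain l C where C: "idx M N = q ^ l" "C 0 = N" "C l = M" "\<forall>i\<le>l. osub (C i)"
    "\<forall>i<l. C i \<subset> C (Suc i)" using osub_chain_exists[OF assms] by blast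
  let ?S = "{n. \<exists>C. C 0 = N \<and> C n = M \<and> (\<forall>i\<le>n. osub (C i)) \<and> (\<forall>i<n. C i \<subset> C (Suc i))}"
  have "quot_length av sc M N = enat l"
    unfolding quot_length_def
  proof (rule antisym)
    show "(SUP n\<in>?S. enat n) \<le> enat l"
    proof (rule SUP_least)
      fix n assume "n \<in> ?S"
      then obtain C' where C': "C' 0 = N" "C' n = M" "\<forall>i\<le>n. osub (C' i)" "\<forall>i<n. C' i \<subset> C' (Suc i)"
        by auto
      have "q ^ n \<le> q ^ l"
        using osub_chain_bound[OF C'(3,4)] assms(4) C(1) C'(1,2) by simp
      then show "enat n \<le> enat l" using q_ge_2 by (simp add: power_increasing_iff)
    qed
    have "l \<in> ?S" using C by blast
    then show "enat l \<le> (SUP n\<in>?S. enat n)" by (rule SUP_upper)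
  qed
  then show ?thesis using C(1) by (simp add: len_def)
qed

lemma q_power_inject: "q ^ m = q ^ n \<longleftrightarrow> m = n"
  using q_ge_2 by (intro power_inject_exp) auto

lemma rel_index_len:
  "rel_index av sc M1 M2 = int (len M1 (M1 \<inter> M2)) - int (len M2 (M1 \<inter> M2))"
  by (simp add: rel_index_def len_def)

end

section \<open>Lattices and fractional ideals\<close>

locale local_order = reduced_local_algebra av sc
  for av :: "'f::field \<Rightarrow> real" and sc :: "'f \<Rightarrow> 'e::comm_ring_1 \<Rightarrow> 'e" +
  fixes R :: "'e set"
  assumes order: "is_order av sc R"
begin

text \<open>Commensurability with \<open>R\<close> by powers of \<open>p\<close> stands for finite
  generation and full rank, which both follow (\<open>lat_fg\<close>, \<open>lat_clears\<close>). It
  passes to sums, intersections and scalings by comparing exponents.\<close>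

definition lat :: "'e set \<Rightarrow> bool" where
  "lat M \<longleftrightarrow> osub M \<and> (\<exists>k. \<forall>x\<in>R. p ^ k * x \<in> M) \<and> (\<exists>k. \<forall>x\<in>M. p ^ k * x \<in> R)"

lemma osub_R: "osub R"
  and one_R: "1 \<in> R"
  and mult_R: "x \<in> R \<Longrightarrow> y \<in> R \<Longrightarrow> x * y \<in> R"
  and span_R: "span R = UNIV"
  using order by (auto simp: is_order_def)

lemma lat_osub: "lat M \<Longrightarrow> osub M" by (simp add: lat_def)

lemma lat_add_subgroup: "lat M \<Longrightarrow> add_subgroup M"
  by (simp add: lat_osub osub_add_subgroup)

lemma power_R: "x \<in> R \<Longrightarrow> x ^ n \<in> R"
  by (induction n) (auto intro: one_R mult_R)

lemma lat_R: "lat R"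
  unfolding lat_def using osub_R by (auto intro!: exI[of _ 0])

lemma p_power_R: "p ^ k \<in> R"
  using osub_p_power[OF osub_R one_R, of k] by simp

lemma span_clears:
  assumes M: "osub M" and span: "span M = UNIV" shows "\<exists>k. p ^ k * x \<in> M"
proof -
  have "x \<in> span M" using span by simp
  then show ?thesis
  proof (induction rule: span_induct_alt)
    case base
    then show ?case using osub_0[OF M] by auto
  next
    case (step c x y)
    obtain k where k: "p ^ k * y \<in> M" using step.IH by blast
    obtain j where j: "unif ^ j * c \<in> val_ring av" using unif_power_clears by blast
    have "p ^ max j k * sc c x = sc (unif ^ max j k * c) x"
      by (simp add: sc_unif_power[symmetric])
    also have "\<dots> \<in> M" using unif_power_mono[OF j, of "max j k"] step.hyps osub_sc[OF M] by simp
    finally have "p ^ max j k * (sc c x + y) \<in> M"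
      using osub_p_power_mono[OF M k, of "max j k"] osub_add[OF M] by (simp add: distrib_left)
    then show ?case by blast
  qed
qed

lemma clears_R: "\<exists>k. p ^ k * x \<in> R"
  using span_clears[OF osub_R span_R] .

lemma lat_clears: assumes "lat M" shows "\<exists>k. p ^ k * x \<in> M"
proof -
  obtain j where j: "\<forall>x\<in>R. p ^ j * x \<in> M" using assms by (auto simp: lat_def)
  obtain k where "p ^ k * x \<in> R" using clears_R by blast
  then have "p ^ (j + k) * x \<in> M" using j by (simp add: power_add mult.assoc)
  then show ?thesis by blast
qed

lemma osub_clears_span:
  assumes "\<And>x. \<exists>k. p ^ k * x \<in> M" shows "span M = UNIV"
proof -
  have "x \<in> span M" for x
  proof -
    obtain k where "p ^ k * x \<in> M" using assms by blast
    then have "sc (inverse unif ^ k) (p ^ k * x) \<in> span M" by (intro span_scale span_base)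
    also have "sc (inverse unif ^ k) (p ^ k * x) = x"
      by (simp add: sc_unif_power[symmetric] power_mult_distrib[symmetric] unif_nz)
    finally show ?thesis .
  qed
  then show ?thesis by blast
qed

lemma lat_sandwich:
  assumes "osub N" "lat W" "lat M"
    and "\<And>x. x \<in> W \<Longrightarrow> p ^ i * x \<in> N" "\<And>x. x \<in> N \<Longrightarrow> p ^ j * x \<in> M"
  shows "lat N"
proof -
  obtain k where k: "\<forall>x\<in>R. p ^ k * x \<in> W" using assms by (auto simp: lat_def)
  obtain l where l: "\<forall>x\<in>M. p ^ l * x \<in> R" using assms by (auto simp: lat_def)
  have "\<forall>x\<in>R. p ^ (i + k) * x \<in> N" using k assms(4) by (simp add: power_add mult.assoc)
  moreover have "\<forall>x\<in>N. p ^ (l + j) * x \<in> R" using l assms(5) by (simp add: power_add mult.assoc)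
  ultimately show ?thesis using assms(1) by (auto simp: lat_def)
qed

lemma lat_between: "osub N \<Longrightarrow> lat W \<Longrightarrow> lat M \<Longrightarrow> W \<subseteq> N \<Longrightarrow> N \<subseteq> M \<Longrightarrow> lat N"
  by (rule lat_sandwich[of N W M 0 0]) auto

lemma lat_commensurable:
  assumes "lat M" "lat N" shows "\<exists>k. \<forall>x\<in>M. p ^ k * x \<in> N"
proof -
  obtain k where k: "\<forall>x\<in>M. p ^ k * x \<in> R" using assms by (auto simp: lat_def)
  obtain l where l: "\<forall>x\<in>R. p ^ l * x \<in> N" using assms by (auto simp: lat_def)
  have "\<forall>x\<in>M. p ^ (l + k) * x \<in> N" using k l by (simp add: power_add mult.assoc)
  then show ?thesis ..
qed

lemma lat_Int: assumes "lat M" "lat N" shows "lat (M \<inter> N)"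
proof -
  obtain k where k: "\<forall>x\<in>M. p ^ k * x \<in> N" using lat_commensurable assms by blast
  show ?thesis
    by (rule lat_sandwich[of _ M M k 0]) (use assms k in \<open>auto intro: osub_Int lat_osub osub_p_power\<close>)
qed

lemma lat_sumset: assumes "lat M" "lat N" shows "lat (sumset M N)"
proof -
  obtain k where k: "\<forall>x\<in>N. p ^ k * x \<in> M" using lat_commensurable assms by blast
  show ?thesis
  proof (rule lat_sandwich[of _ M M 0 k])
    show "osub (sumset M N)" using assms by (simp add: osub_sumset lat_osub)
    show "p ^ 0 * x \<in> sumset M N" if "x \<in> M" for x
      using that sumset_upper1[OF lat_add_subgroup[OF assms(2)], of M] by auto
    fix x assume "x \<in> sumset M N"
    then obtain m n where "x = m + n" "m \<in> M" "n \<in> N" by (auto simp: sumset_def)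
    then show "p ^ k * x \<in> M"
      using k osub_p_power[of M m k] assms by (auto simp: distrib_left lat_osub intro!: osub_add)
  qed (use assms in auto)
qed

lemma lat_bound_mult:
  assumes "lat M" "lat N" shows "\<exists>k. \<forall>x\<in>M. p ^ k * (u * x) \<in> N"
proof -
  obtain k where k: "\<forall>x\<in>M. p ^ k * x \<in> R" using assms by (auto simp: lat_def)
  obtain l where l: "\<forall>x\<in>R. p ^ l * x \<in> N" using assms by (auto simp: lat_def)
  obtain j where j: "p ^ j * u \<in> R" using clears_R by blast
  have "p ^ (l + j + k) * (u * x) \<in> N" if "x \<in> M" for x
  proof -
    have "(p ^ j * u) * (p ^ k * x) \<in> R" using mult_R[OF j] k that by blast
    then have "p ^ l * ((p ^ j * u) * (p ^ k * x)) \<in> N" using l by blast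
    then show ?thesis by (simp add: power_add ac_simps)
  qed
  then show ?thesis by blast
qed

lemma lat_scale: assumes "lat M" and uv: "u * v = 1" shows "lat ((*) u ` M)"
proof -
  obtain k where k: "\<forall>x\<in>M. p ^ k * (u * x) \<in> M" using lat_bound_mult assms by blast
  obtain j where j: "\<forall>x\<in>M. p ^ j * (v * x) \<in> M" using lat_bound_mult assms by blast
  show ?thesis
  proof (rule lat_sandwich[of _ M M j k])
    show "osub ((*) u ` M)" using assms by (simp add: osub_image_mult lat_osub)
    show "p ^ j * x \<in> (*) u ` M" if "x \<in> M" for x
      unfolding mem_mult_unit_iff[OF uv] using j that by (simp add: mult.left_commute[of v])
  qed (use assms k in auto)
qed

lemma lat_p_power: "lat M \<Longrightarrow> lat ((*) (p ^ k) ` M)"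
  by (rule lat_scale[OF _ p_power_inv])

lemma lat_p_inv_power: "lat M \<Longrightarrow> lat ((*) (p_inv ^ k) ` M)"
  by (rule lat_scale[OF _ p_inv_power])

lemma OF_submodule_hull: "osub (osub hull S)"
  by (rule hull_in) (auto simp: OF_submodule_def)

text \<open>The generators form an indexed family because powers of an element, which may repeat,
  serve as generators later.\<close>

lemma OF_hull_family:
  assumes "finite I"
  shows "osub hull (f ` I) = {\<Sum>i\<in>I. sc (a i) (f i) |a. a \<in> I \<rightarrow> val_ring av}" (is "_ = ?T")
proof (rule hull_unique)
  show "f ` I \<subseteq> ?T"
  proof
    fix s assume "s \<in> f ` I"
    then obtain i where "s = f i" "i \<in> I" by auto
    moreover from this have "(\<Sum>j\<in>I. sc (if j = i then 1 else 0) (f j)) = f i" using assms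
      by (simp add: if_distrib[of "\<lambda>a. sc a _"] sum.delta cong: if_cong)
    ultimately show "s \<in> ?T" using val_ring_0 val_ring_1
      by (auto intro!: exI[of _ "\<lambda>j. if j = i then 1 else 0"])
  qed
  show "osub ?T"
    unfolding OF_submodule_def
  proof (intro conjI ballI)
    show "0 \<in> ?T" using val_ring_0 by (auto intro!: exI[of _ "\<lambda>_. 0"])
    fix x y assume "x \<in> ?T" "y \<in> ?T"
    then obtain a b where "x = (\<Sum>i\<in>I. sc (a i) (f i))" "y = (\<Sum>i\<in>I. sc (b i) (f i))"
      "a \<in> I \<rightarrow> val_ring av" "b \<in> I \<rightarrow> val_ring av" by auto
    then show "x + y \<in> ?T"
      by (auto intro!: exI[of _ "\<lambda>s. a s + b s"] val_ring_add
          simp: scale_left_distrib sum.distrib Pi_iff)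
  next
    fix c x assume "c \<in> val_ring av" "x \<in> ?T"
    then obtain a where "x = (\<Sum>i\<in>I. sc (a i) (f i))" "a \<in> I \<rightarrow> val_ring av" by auto
    then show "sc c x \<in> ?T" using \<open>c \<in> val_ring av\<close>
      by (auto intro!: exI[of _ "\<lambda>s. c * a s"] val_ring_mult simp: scale_sum_right Pi_iff)
  qed
  fix T assume "f ` I \<subseteq> T" "osub T"
  then show "?T \<subseteq> T" by (auto intro!: osub_sum osub_sc)
qed

lemma OF_hull_finite:
  assumes "finite S" shows "osub hull S = {\<Sum>s\<in>S. sc (a s) s |a. a \<in> S \<rightarrow> val_ring av}"
  using OF_hull_family[OF assms, of "\<lambda>s. s"] by simp

text \<open>In a combination of the finitely many generators the coefficients matter only modulo
  \<open>unif\<close>, so combinations with coefficients in a finite set \<open>D\<close> of digits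
  represent \<open>R\<close> modulo \<open>p R\<close>.\<close>

lemma fin_idx_R_p: "fin_idx R ((*) p ` R)"
proof -
  obtain S where S: "finite S" "R = osub hull S" using order by (auto simp: is_order_def)
  obtain D where D: "coset_reps D (val_ring av) (val_ideal av)"
    using coset_reps_exist[OF add_subgroup_val_ideal] by blast
  have finD: "finite D"
    using fin_idx_iff_finite[OF add_subgroup_val_ideal D] fin_idx_val_ideal by simp
  have SR: "S \<subseteq> R" unfolding S(2) by (rule hull_subset)
  have ag: "add_subgroup ((*) p ` R)" by (intro osub_add_subgroup osub_image_mult osub_R)
  have "coset ((*) p ` R) ` R \<subseteq> coset ((*) p ` R) ` ((\<lambda>f. \<Sum>s\<in>S. sc (f s) s) ` (S \<rightarrow>\<^sub>E D))"
  proof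
    fix C assume "C \<in> coset ((*) p ` R) ` R"
    then obtain x where x: "x \<in> R" "C = coset ((*) p ` R) x" by auto
    then obtain a where a: "x = (\<Sum>s\<in>S. sc (a s) s)" "a \<in> S \<rightarrow> val_ring av"
      using OF_hull_finite[OF S(1)] S(2) by auto
    have "\<forall>s\<in>S. \<exists>d\<in>D. \<exists>b\<in>val_ring av. a s - d = unif * b"
    proof
      fix s assume "s \<in> S"
      then obtain d where "d \<in> D" "a s - d \<in> val_ideal av"
        using D a(2) unfolding coset_reps_def by blast
      then show "\<exists>d\<in>D. \<exists>b\<in>val_ring av. a s - d = unif * b" unfolding val_ideal_eq by blast
    qed
    then obtain d b where d: "\<forall>s\<in>S. d s \<in> D \<and> b s \<in> val_ring av \<and> a s - d s = unif * b s"
      by metis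
    have "x - (\<Sum>s\<in>S. sc (d s) s) = (\<Sum>s\<in>S. sc (unif * b s) s)"
      using d by (simp add: a(1) sum_subtractf[symmetric] scale_left_diff_distrib[symmetric])
    also have "\<dots> = p * (\<Sum>s\<in>S. sc (b s) s)"
    proof -
      have "sc (unif * b s) s = p * sc (b s) s" for s
        using sc_unif_power[of 1 "sc (b s) s"] by simp
      then show ?thesis by (simp add: sum_distrib_left)
    qed
    also have "\<dots> \<in> (*) p ` R" using d SR by (intro imageI osub_sum osub_sc osub_R) auto
    finally have "C = coset ((*) p ` R) (\<Sum>s\<in>S. sc (restrict d S s) s)"
      using x(2) coset_eq_iff[OF ag] by simp
    moreover have "restrict d S \<in> S \<rightarrow>\<^sub>E D" using d by auto
    ultimately show "C \<in> coset ((*) p ` R) ` ((\<lambda>f. \<Sum>s\<in>S. sc (f s) s) ` (S \<rightarrow>\<^sub>E D))" by blast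
  qed
  moreover have "finite (S \<rightarrow>\<^sub>E D)" using S finD by (intro finite_PiE) auto
  ultimately show ?thesis unfolding fin_idx_def by (meson finite_imageI finite_subset)
qed

lemma fin_idx_R_p_power: "fin_idx R ((*) (p ^ k) ` R)"
proof (induction k)
  case 0
  show ?case using fin_idx_self[OF osub_add_subgroup[OF osub_R]] by simp
next
  case (Suc k)
  have eq: "(*) (p ^ Suc k) ` R = (*) (p ^ k) ` ((*) p ` R)"
    by (simp add: image_image ac_simps)
  have "fin_idx ((*) (p ^ k) ` R) ((*) (p ^ Suc k) ` R)"
    unfolding eq using fin_idx_R_p
    by (subst idx_scale(2)[OF p_power_inv]) (auto intro: osub_add_subgroup osub_image_mult osub_R)
  moreover have "(*) (p ^ Suc k) ` R \<subseteq> (*) (p ^ k) ` R"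
    unfolding eq using osub_p[OF osub_R] by (intro image_mono) auto
  moreover have "(*) (p ^ k) ` R \<subseteq> R" using osub_p_power[OF osub_R] by auto
  ultimately show ?case
    by (intro idx_trans(2)[OF _ _ _ _ _ Suc.IH] osub_add_subgroup osub_image_mult osub_R)
qed

lemma lat_fin_idx: assumes "lat M" "lat N" shows "fin_idx M N"
proof -
  obtain k where k: "\<forall>x\<in>M. p ^ k * x \<in> R" using assms by (auto simp: lat_def)
  obtain l where l: "\<forall>x\<in>R. p ^ l * x \<in> N" using assms by (auto simp: lat_def)
  have eq: "(*) (p_inv ^ k) ` (*) (p ^ (k + l)) ` R = (*) (p ^ l) ` R"
    by (simp add: image_image power_add mult.assoc[symmetric] p_inv_power)
  have "fin_idx ((*) (p_inv ^ k) ` R) ((*) (p ^ l) ` R)"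
    unfolding eq[symmetric]
    by (subst idx_scale(2)[OF p_inv_power]) (auto intro: osub_add_subgroup osub_image_mult osub_R fin_idx_R_p_power)
  then show ?thesis
  proof (rule fin_idx_mono[rotated 2])
    show "(*) (p ^ l) ` R \<subseteq> N" using l by auto
    show "M \<subseteq> (*) (p_inv ^ k) ` R" using k by (auto simp: mem_mult_unit_iff[OF p_inv_power])
  qed (use assms in \<open>auto intro: osub_add_subgroup osub_image_mult osub_R lat_osub\<close>)
qed

lemma lat_finite_intermediate:
  assumes "lat M" "lat W" shows "finite {N. osub N \<and> W \<subseteq> N \<and> N \<subseteq> M}"
  using finite_intermediate[OF lat_add_subgroup[OF assms(2)] lat_fin_idx[OF assms]]
  by (rule finite_subset[rotated]) (auto intro: osub_add_subgroup)

section \<open>The relative index of lattices\<close>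

abbreviation "ri \<equiv> rel_index av sc"

lemma lat_idx_len: "lat N \<Longrightarrow> lat M \<Longrightarrow> N \<subseteq> M \<Longrightarrow> idx M N = q ^ len M N"
  by (intro idx_len lat_osub lat_fin_idx)

lemma lat_idx_pos: "lat N \<Longrightarrow> lat M \<Longrightarrow> idx M N > 0"
  using idx_pos[OF lat_fin_idx] osub_0[OF lat_osub] by blast

lemma len_trans:
  assumes "lat W" "lat N" "lat M" "W \<subseteq> N" "N \<subseteq> M"
  shows "len M W = len M N + len N W"
proof -
  have "q ^ len M W = idx M W" using assms lat_idx_len by (metis subset_trans)
  also have "\<dots> = idx M N * idx N W"
    using assms by (intro idx_trans) (auto intro: lat_add_subgroup)
  also have "\<dots> = q ^ (len M N + len N W)" using assms by (simp add: lat_idx_len power_add)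
  finally show ?thesis using q_power_inject by blast
qed

lemma len_self: "lat M \<Longrightarrow> len M M = 0"
  using len_trans[of M M M] by simp

text \<open>Any common sublattice may replace the intersection. Transitivity then follows by passing
  to the intersection of three lattices.\<close>

lemma ri_eq_len:
  assumes "lat W" "lat M" "lat N" "W \<subseteq> M" "W \<subseteq> N"
  shows "ri M N = int (len M W) - int (len N W)"
  using len_trans[of W "M \<inter> N" M] len_trans[of W "M \<inter> N" N] assms lat_Int[of M N]
  by (simp add: rel_index_len)

lemma ri_sub: "lat N \<Longrightarrow> lat M \<Longrightarrow> N \<subseteq> M \<Longrightarrow> ri M N = int (len M N)"
  using ri_eq_len[of N M N] len_self[of N] by simp

lemma ri_trans: assumes "lat A" "lat B" "lat C" shows "ri A C = ri A B + ri B C"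
proof -
  let ?W = "A \<inter> B \<inter> C"
  have "lat ?W" using assms lat_Int by blast
  moreover have "?W \<subseteq> A" "?W \<subseteq> B" "?W \<subseteq> C" by auto
  ultimately show ?thesis
    using ri_eq_len[of ?W A C] ri_eq_len[of ?W A B] ri_eq_len[of ?W B C] assms by simp
qed

lemma ri_self: "lat A \<Longrightarrow> ri A A = 0"
  using ri_trans[of A A A] by simp

lemma ri_sym: "lat A \<Longrightarrow> lat B \<Longrightarrow> ri B A = - ri A B"
  using ri_trans[of A B A] ri_self[of A] by simp

lemma len_0_imp: assumes "lat N" "lat M" "N \<subseteq> M" "len M N = 0" shows "N = M"
proof -
  have "idx M N = 1" using assms lat_idx_len[of N M] by simp
  then show ?thesis using idx_eq_1_imp[of N M] assms lat_add_subgroup by blast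
qed

lemma len_scale:
  assumes uv: "u * v = 1" and "lat M" "lat N" "N \<subseteq> M"
  shows "len ((*) u ` M) ((*) u ` N) = len M N"
proof -
  have "q ^ len ((*) u ` M) ((*) u ` N) = idx ((*) u ` M) ((*) u ` N)"
    using assms by (subst lat_idx_len) (auto intro: lat_scale)
  also have "\<dots> = q ^ len M N"
    using assms by (subst idx_scale(1)[OF uv]) (auto intro: lat_add_subgroup simp: lat_idx_len)
  finally show ?thesis using q_power_inject by blast
qed

lemma ri_scale:
  assumes uv: "u * v = 1" and "lat M" "lat N" shows "ri ((*) u ` M) ((*) u ` N) = ri M N"
proof -
  let ?W = "M \<inter> N"
  have W: "lat ?W" using assms lat_Int by blast
  have "ri ((*) u ` M) ((*) u ` N) =
     int (len ((*) u ` M) ((*) u ` ?W)) - int (len ((*) u ` N) ((*) u ` ?W))"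
    using W assms by (intro ri_eq_len) (auto intro: lat_scale)
  also have "\<dots> = ri M N"
    using W assms by (simp add: len_scale[OF uv] ri_eq_len[of ?W M N])
  finally show ?thesis .
qed

text \<open>Both sides are the valuation of the determinant of multiplication by \<open>u\<close>.
  The proof inserts \<open>N\<close> and \<open>u N\<close> and cancels
  \<open>[u N : u M] = [N : M]\<close> against \<open>[M : N]\<close>.\<close>

lemma ri_unit_indep:
  assumes uv: "u * v = 1" and "lat M" "lat N" shows "ri M ((*) u ` M) = ri N ((*) u ` N)"
proof -
  note sc = lat_scale[OF assms(2) uv] lat_scale[OF assms(3) uv]
  have "ri M ((*) u ` M) = ri M N + ri N ((*) u ` N) + ri ((*) u ` N) ((*) u ` M)"
    using ri_trans[of M N "(*) u ` M"] ri_trans[of N "(*) u ` N" "(*) u ` M"] assms sc by simp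
  also have "ri ((*) u ` N) ((*) u ` M) = ri N M" using assms by (intro ri_scale) auto
  finally show ?thesis using ri_sym[of M N] assms by simp
qed

lemma ri_sumset: assumes "lat A" "lat B" shows "ri (sumset A B) A = ri B (A \<inter> B)"
proof -
  have *: "A \<subseteq> sumset A B" "lat (sumset A B)" "lat (A \<inter> B)"
    using assms by (simp_all add: lat_sumset lat_Int sumset_upper1 lat_add_subgroup)
  have "q ^ len (sumset A B) A = q ^ len B (A \<inter> B)"
    using idx_sumset[of A B] assms * by (simp add: lat_idx_len lat_add_subgroup)
  then show ?thesis using q_power_inject assms * by (simp add: ri_sub)
qed

text \<open>Finitely many generators have a common denominator; conversely an
  \<open>R\<close>-stable lattice is generated by \<open>p ^ k\<close> and representatives modulo
  \<open>p ^ k R\<close>. From here on fractional ideals are treated as \<open>R\<close>-stable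
  lattices.\<close>

lemma frac_ideals_iff: "M \<in> frac_ideals sc R \<longleftrightarrow> ring_submodule R M \<and> lat M"
proof -
  have osub: "osub M" if "ring_submodule R M"
    unfolding OF_submodule_def
  proof (intro conjI ballI)
    show "0 \<in> M" using that by (simp add: ring_submodule_def)
    show "x + y \<in> M" if "x \<in> M" "y \<in> M" for x y
      using that \<open>ring_submodule R M\<close> by (simp add: ring_submodule_def)
    fix a x assume "a \<in> val_ring av" "x \<in> M"
    then have "sc a 1 * x \<in> M"
      using that osub_sc[OF osub_R _ one_R] by (simp add: ring_submodule_def)
    then show "sc a x \<in> M" using sc_eq_mult by metis
  qed
  show ?thesis
  proof
    assume "M \<in> frac_ideals sc R"
    then obtain S where M: "ring_submodule R M" "finite S" "M = ring_submodule R hull S" "span M = UNIV"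
      by (auto simp: frac_ideals_def)
    note oM = osub[OF M(1)]
    have "\<exists>k. \<forall>s\<in>S. p ^ k * s \<in> R"
    proof -
      obtain f where f: "p ^ f s * s \<in> R" for s using clears_R by metis
      have "p ^ (\<Sum>s\<in>S. f s) * s \<in> R" if "s \<in> S" for s
        using osub_p_power_mono[OF osub_R f member_le_sum[OF that]] M(2) by simp
      then show ?thesis by blast
    qed
    then obtain k where k: "\<forall>s\<in>S. p ^ k * s \<in> R" by blast
    have "ring_submodule R {x. p ^ k * x \<in> R}"
      using osub_0[OF osub_R] osub_add[OF osub_R] mult_R
      by (auto simp: ring_submodule_def distrib_left mult.left_commute)
    then have "M \<subseteq> {x. p ^ k * x \<in> R}"
      unfolding M(3) using k by (intro hull_minimal) auto
    moreover obtain j where j: "p ^ j * 1 \<in> M" using span_clears[OF oM M(4)] by blast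
    have "\<forall>x\<in>R. p ^ j * x \<in> M"
    proof
      fix x assume "x \<in> R"
      then have "x * (p ^ j * 1) \<in> M" using M(1) j by (simp add: ring_submodule_def)
      then show "p ^ j * x \<in> M" by (simp add: mult.commute)
    qed
    ultimately show "ring_submodule R M \<and> lat M" using oM M(1) by (auto simp: lat_def)
  next
    assume M: "ring_submodule R M \<and> lat M"
    then obtain k where k: "\<forall>x\<in>R. p ^ k * x \<in> M" by (auto simp: lat_def)
    have pk: "lat ((*) (p ^ k) ` R)" by (rule lat_p_power[OF lat_R])
    obtain D where D: "coset_reps D M ((*) (p ^ k) ` R)"
      using coset_reps_exist[OF lat_add_subgroup[OF pk]] by blast
    have "finite D" using fin_idx_iff_finite[OF lat_add_subgroup[OF pk] D] lat_fin_idx pk M by blast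
    let ?H = "ring_submodule R hull (insert (p ^ k) D)"
    have H: "ring_submodule R ?H" by (rule hull_in) (auto simp: ring_submodule_def)
    have HS: "insert (p ^ k) D \<subseteq> ?H" by (rule hull_subset)
    have "p ^ k \<in> M" using k one_R by force
    then have "?H \<subseteq> M" using M D by (intro hull_minimal) (auto simp: coset_reps_def)
    moreover have "M \<subseteq> ?H"
    proof
      fix x assume "x \<in> M"
      then obtain d r where d: "d \<in> D" "r \<in> R" "x - d = p ^ k * r"
        using D unfolding coset_reps_def by blast
      have "d \<in> ?H" "r * p ^ k \<in> ?H" using d HS H unfolding ring_submodule_def by blast+
      moreover have "x = d + r * p ^ k" using d by (simp add: algebra_simps)
      ultimately show "x \<in> ?H" using H unfolding ring_submodule_def by blast
    qed
    ultimately have "M = ?H" by blast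
    moreover have "span M = UNIV" using lat_clears M by (intro osub_clears_span) blast
    ultimately show "M \<in> frac_ideals sc R"
      using M \<open>finite D\<close> unfolding frac_ideals_def by blast
  qed
qed

end

section \<open>Decomposition into fields\<close>

context reduced_local_algebra
begin

definition basis :: "'e set \<Rightarrow> bool" where
  "basis B \<longleftrightarrow> finite B \<and> independent B \<and> span B = UNIV"

lemma basisD: "basis B \<Longrightarrow> finite B" "basis B \<Longrightarrow> independent B" "basis B \<Longrightarrow> x \<in> span B"
  by (auto simp: basis_def)

lemma independent_imp_finite: "independent B \<Longrightarrow> finite B"
  using finite_dimensional independent_span_bound by (metis subset_UNIV)

lemma basis_exists': "\<exists>B. basis B"
proof -
  obtain B where "B \<subseteq> UNIV" "independent B" "UNIV \<subseteq> span B" by (rule maximal_independent_subset)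
  then have "basis B" using independent_imp_finite by (auto simp: basis_def)
  then show ?thesis ..
qed

lemma basis_finite_dim: "basis B \<Longrightarrow> finite_dimensional_vector_space sc B"
  by unfold_locales (auto simp: basis_def)

lemma subspace_range_mult: "subspace (range ((*) g))"
  unfolding subspace_def
proof (intro conjI ballI allI)
  show "0 \<in> range ((*) g)" by (metis mult_zero_right rangeI)
  show "a + b \<in> range ((*) g)" if "a \<in> range ((*) g)" "b \<in> range ((*) g)" for a b
    using that by (auto simp: distrib_left[symmetric])
  show "sc c a \<in> range ((*) g)" if "a \<in> range ((*) g)" for c a
    using that by (auto simp: sc_mult_right[symmetric])
qed

text \<open>Von Neumann regularity. The ideals \<open>x ^ n E\<close> stabilise by dimension, giving
  \<open>x ^ n = x ^ Suc n * y\<close>; then \<open>x * (1 - x * y)\<close> is nilpotent, hence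
  zero. Later arguments use the idempotent \<open>x * y\<close>.\<close>

lemma regular: "\<exists>y. x * x * y = (x :: 'e)"
proof -
  obtain B where B: "basis B" using basis_exists' by blast
  interpret fd: finite_dimensional_vector_space sc B by (rule basis_finite_dim[OF B])
  let ?I = "\<lambda>n. range ((*) (x ^ n))"
  note sub = subspace_range_mult
  have dec: "?I (Suc n) \<subseteq> ?I n" for n by (auto simp: mult.assoc mult.left_commute[of x])
  have "\<exists>n. dim (?I n) \<le> dim (?I (Suc n))"
  proof (rule ccontr)
    assume "\<not> ?thesis"
    then have lt: "dim (?I (Suc n)) < dim (?I n)" for n by (simp add: not_le)
    have "dim (?I n) + n \<le> dim (?I 0)" for n
    proof (induction n)
      case (Suc n) then show ?case using lt[of n] by simp
    qed simp
    from this[of "Suc (dim (?I 0))"] show False by simp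
  qed
  then obtain n where "dim (?I n) \<le> dim (?I (Suc n))" by blast
  then have "?I (Suc n) = ?I n" using fd.subspace_dim_equal[OF sub sub dec] by blast
  then have "x ^ n * 1 \<in> ?I (Suc n)" by (metis rangeI)
  then obtain y where y: "x ^ n = x ^ Suc n * y" by auto
  have "(x * (1 - x * y)) ^ Suc n = (x ^ n * (1 - x * y)) * (x * (1 - x * y) ^ n)"
    by (simp only: power_mult_distrib power_Suc ac_simps)
  also have "x ^ n * (1 - x * y) = 0"
    using y by (simp add: algebra_simps)
  finally have "x * (1 - x * y) = 0" using reduced[of "x * (1 - x * y)" "Suc n"] by simp
  then show ?thesis by (intro exI[of _ y]) (simp add: algebra_simps)
qed

section \<open>Primitive idempotents\<close>

lemma prim_idemD:
  "e \<in> prim_idem \<Longrightarrow> e * e = e" "e \<in> prim_idem \<Longrightarrow> e \<noteq> 0"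
  "e \<in> prim_idem \<Longrightarrow> f * f = f \<Longrightarrow> e * f = f \<Longrightarrow> f = 0 \<or> f = e"
  by (auto simp: prim_idem_def)

lemma prim_idem_orth:
  assumes "e \<in> prim_idem" "f \<in> prim_idem" "e \<noteq> f" shows "e * f = 0"
proof -
  have e: "e * e = e" and f: "f * f = f" using assms prim_idemD by auto
  have 2: "e * (e * f) = e * f" "f * (e * f) = e * f"
    using e f by (simp_all add: mult.assoc[symmetric]) (simp add: mult.assoc mult.left_commute[of f])
  have 1: "(e * f) * (e * f) = e * f" using 2 by (simp add: mult.assoc)
  show ?thesis using prim_idemD(3)[OF assms(1) 1 2(1)] prim_idemD(3)[OF assms(2) 1 2(2)] assms(3) by auto
qed

text \<open>Passing to a smaller idempotent \<open>g\<close> strictly shrinks the ideal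
  \<open>f E\<close>, so the descent stops by dimension.\<close>

lemma prim_idem_below:
  assumes "f * f = f" "f \<noteq> (0 :: 'e)" shows "\<exists>e\<in>prim_idem. f * e = e"
proof -
  obtain B where B: "basis B" using basis_exists' by blast
  interpret fd: finite_dimensional_vector_space sc B by (rule basis_finite_dim[OF B])
  show ?thesis
    using assms
  proof (induction "dim (range ((*) f))" arbitrary: f rule: less_induct)
    case less
    show ?case
    proof (cases "f \<in> prim_idem")
      case True
      then show ?thesis using less.prems by blast
    next
      case False
      then obtain g where g: "g * g = g" "f * g = g" "g \<noteq> 0" "g \<noteq> f"
        using less.prems unfolding prim_idem_def by blast
      have "g * x = f * (g * x)" for x using g(2) by (simp add: mult.assoc[symmetric])
      then have "range ((*) g) \<subseteq> range ((*) f)" by blast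
      moreover have "f \<notin> range ((*) g)"
      proof
        assume "f \<in> range ((*) g)"
        then obtain h where "f = g * h" by blast
        then have "g * f = f" using g(1) by (simp add: mult.assoc[symmetric])
        then show False using g by (simp add: mult.commute)
      qed
      moreover have "f \<in> range ((*) f)" using less.prems by (metis rangeI)
      ultimately have "range ((*) g) \<subset> range ((*) f)" by blast
      moreover have "span (range ((*) h)) = range ((*) h)" for h
        using subspace_range_mult span_eq_iff by blast
      ultimately have "dim (range ((*) g)) < dim (range ((*) f))"
        by (intro fd.dim_psubset) (simp only:)
      then obtain e where e: "e \<in> prim_idem" "g * e = e" using less.hyps g by blast
      have "f * (g * e) = g * e" using g(2) by (simp add: mult.assoc[symmetric])
      then have "f * e = e" using e by simp
      then show ?thesis using e by blast
    qed
  qed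
qed

lemma finite_prim_idem: "finite (prim_idem :: 'e set)"
proof (rule independent_imp_finite)
  show "independent (prim_idem :: 'e set)"
    unfolding independent_explicit_module
  proof (intro allI impI)
    fix t and u :: "'e \<Rightarrow> 'f" and v
    assume t: "finite t" "t \<subseteq> prim_idem" "(\<Sum>e\<in>t. sc (u e) e) = 0" "v \<in> t"
    have "0 = v * (\<Sum>e\<in>t. sc (u e) e)" using t by simp
    also have "\<dots> = (\<Sum>e\<in>t. if e = v then sc (u v) v else 0)"
      unfolding sum_distrib_left
    proof (rule sum.cong)
      fix e assume "e \<in> t"
      then show "v * sc (u e) e = (if e = v then sc (u v) v else 0)"
        using t prim_idem_orth[of v e] prim_idemD(1)[of v] by (auto simp: sc_mult_right)
    qed simp
    also have "\<dots> = sc (u v) v" using t by simp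
    finally show "u v = 0" using prim_idemD(2)[of v] t by auto
  qed
qed

lemma sum_prim_idem_mult:
  assumes "e \<in> prim_idem" "S \<subseteq> (prim_idem :: 'e set)" shows "e * \<Sum>S = (if e \<in> S then e else 0)"
proof -
  have fin: "finite S" by (rule finite_subset[OF assms(2) finite_prim_idem])
  have "e * \<Sum>S = (\<Sum>f\<in>S. if f = e then e else 0)"
    unfolding sum_distrib_left
  proof (rule sum.cong)
    fix f assume "f \<in> S"
    then have "f \<in> prim_idem" using assms(2) by blast
    then show "e * f = (if f = e then e else 0)"
      using prim_idem_orth[OF assms(1)] prim_idemD(1)[OF assms(1)] by auto
  qed simp
  then show ?thesis using fin by simp
qed

text \<open>Were \<open>1 - ?s\<close> nonzero, this idempotent would lie above a primitive one, yet
  it is orthogonal to all of them.\<close>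

lemma sum_prim_idem: "\<Sum>prim_idem = (1 :: 'e)"
proof (rule ccontr)
  let ?s = "\<Sum>prim_idem :: 'e"
  assume "?s \<noteq> 1"
  have s: "e * ?s = e" if "e \<in> prim_idem" for e
    using sum_prim_idem_mult[OF that subset_refl] that by simp
  have "?s * ?s = (\<Sum>e\<in>prim_idem. e * ?s)" by (rule sum_distrib_right)
  also have "\<dots> = ?s" using s by simp
  finally have ss: "?s * ?s = ?s" .
  then obtain e where e: "e \<in> prim_idem" "(1 - ?s) * e = e"
    using prim_idem_below[of "1 - ?s"] \<open>?s \<noteq> 1\<close> by (auto simp: algebra_simps)
  then have "e = 0" using s[OF e(1)] by (simp add: algebra_simps)
  then show False using e prim_idemD(2) by blast
qed

lemma sum_components: "(\<Sum>e\<in>prim_idem. e * x) = (x :: 'e)"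
  by (simp add: sum_distrib_right[symmetric] sum_prim_idem)

lemma components_eqI: assumes "\<And>e. e \<in> prim_idem \<Longrightarrow> e * x = e * y" shows "x = (y :: 'e)"
proof -
  have "(\<Sum>e\<in>prim_idem. e * x) = (\<Sum>e\<in>prim_idem. e * y)" using assms by (intro sum.cong) auto
  then show ?thesis by (simp only: sum_components)
qed

text \<open>The idempotent \<open>x * y\<close> from \<open>regular\<close> lies below
  \<open>e\<close> and is nonzero, so primitivity makes it equal to \<open>e\<close>.\<close>

lemma factor_field:
  assumes e: "e \<in> prim_idem" and x: "x \<in> factor e" "x \<noteq> (0 :: 'e)"
  shows "\<exists>y\<in>factor e. x * y = e"
proof -
  obtain y where y: "x * x * y = x" using regular by blast
  have "(x * y) * (x * y) = (x * x * y) * y" by (simp add: ac_simps)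
  then have "(x * y) * (x * y) = x * y" using y by simp
  moreover have "e * (x * y) = x * y" using x by (simp add: factor_def mult.assoc[symmetric])
  moreover have "x * y \<noteq> 0" using y x by (metis mult.assoc mult_zero_right)
  ultimately have "x * y = e" using prim_idemD(3)[OF e] by blast
  moreover have "x * (e * y) = x * y"
    using x by (simp add: factor_def mult.left_commute[of x] mult.assoc[symmetric]) (simp add: mult.commute[of x e])
  moreover have "e * y \<in> factor e" using prim_idemD(1)[OF e] by (simp add: factor_def mult.assoc[symmetric])
  ultimately show ?thesis by metis
qed

section \<open>The trace\<close>

lemma representation_sum_basis:
  assumes B: "basis B" and b: "b \<in> B" shows "representation B (\<Sum>b\<in>B. sc (a b) b) b = a b"
proof -
  note * = basisD[OF B]
  have "representation B (\<Sum>b\<in>B. sc (a b) b) b = (\<Sum>c\<in>B. a c * representation B c b)"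
    using * by (subst representation_sum) (auto simp: representation_scale)
  also have "\<dots> = (\<Sum>c\<in>B. if c = b then a b else 0)"
    using * by (intro sum.cong) (auto simp: representation_basis)
  finally show ?thesis using *(1) b by simp
qed

lemma basis_expansion: "basis B \<Longrightarrow> (\<Sum>b\<in>B. sc (representation B x b) b) = x"
  using sum_representation_eq[of B x B] by (auto simp: basis_def)

text \<open>The identity tr(ST) = tr(TS) for a change of coordinates. The trace is defined by a
  basis picked by choice, while its integrality is seen in a basis adapted to a lattice.\<close>

lemma trace_basis_indep:
  assumes B: "basis B" and C: "basis C"
  shows "(\<Sum>b\<in>B. representation B (x * b) b) = (\<Sum>c\<in>C. representation C (x * c) c)"
proof -
  note 1 = basisD[OF B] and 2 = basisD[OF C]
  have "(\<Sum>b\<in>B. representation B (x * b) b)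
      = (\<Sum>b\<in>B. \<Sum>c\<in>C. representation C (x * b) c * representation B c b)"
  proof (rule sum.cong)
    fix b assume "b \<in> B"
    have "representation B (x * b) = representation B (\<Sum>c\<in>C. sc (representation C (x * b) c) c)"
      using basis_expansion[OF C, of "x * b"] by simp
    also have "\<dots> = (\<lambda>b'. \<Sum>c\<in>C. representation C (x * b) c * representation B c b')"
      using 1 by (subst representation_sum) (auto simp: representation_scale)
    finally show "representation B (x * b) b = (\<Sum>c\<in>C. representation C (x * b) c * representation B c b)"
      by simp
  qed simp
  also have "\<dots> = (\<Sum>c\<in>C. \<Sum>b\<in>B. representation B c b * representation C (x * b) c)"
    by (subst sum.swap) (simp add: mult.commute)
  also have "\<dots> = (\<Sum>c\<in>C. representation C (x * c) c)"
  proof (rule sum.cong)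
    fix c assume "c \<in> C"
    have "x * c = (\<Sum>b\<in>B. sc (representation B c b) (x * b))"
      using arg_cong[OF basis_expansion[OF B, of c], of "\<lambda>y. x * y"]
      by (simp add: sum_distrib_left sc_mult_right)
    then have "representation C (x * c) = (\<lambda>c'. \<Sum>b\<in>B. representation B c b * representation C (x * b) c')"
      using 2 by (simp add: representation_sum representation_scale)
    then show "(\<Sum>b\<in>B. representation B c b * representation C (x * b) c) = representation C (x * c) c"
      by simp
  qed simp
  finally show ?thesis .
qed

abbreviation "tr \<equiv> alg_trace sc"

lemma tr_eq: assumes "basis B" shows "tr x = (\<Sum>b\<in>B. representation B (x * b) b)"
proof -
  let ?B = "SOME B. independent B \<and> span B = UNIV"
  have "\<exists>B. independent B \<and> span B = UNIV" using basis_exists' unfolding basis_def by blast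
  then have "independent ?B \<and> span ?B = UNIV" by (rule someI_ex)
  then have "basis ?B" using independent_imp_finite by (auto simp: basis_def)
  then show ?thesis using trace_basis_indep[OF _ assms] by (simp add: alg_trace_def Let_def)
qed

lemma tr_add: "tr (x + y) = tr x + tr y"
proof -
  obtain B where B: "basis B" using basis_exists' by blast
  show ?thesis using basisD[OF B]
    by (simp add: tr_eq[OF B] distrib_right representation_add sum.distrib)
qed

lemma tr_sc: "tr (sc a x) = a * tr x"
proof -
  obtain B where B: "basis B" using basis_exists' by blast
  show ?thesis using basisD[OF B]
    by (simp add: tr_eq[OF B] sc_mult_left representation_scale sum_distrib_left)
qed

lemma tr_0: "tr 0 = 0" using tr_sc[of 0 0] by simp

lemma tr_sum: "tr (sum f I) = (\<Sum>i\<in>I. tr (f i))"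
  by (induction I rule: infinite_finite_induct) (auto simp: tr_0 tr_add)

end

section \<open>Bases of lattices and integral elements\<close>

context local_order
begin

lemma lat_fg: assumes "lat M" shows "\<exists>S. finite S \<and> M = osub hull S"
proof -
  obtain S where S: "finite S" "R = osub hull S" using order by (auto simp: is_order_def)
  obtain k where k: "\<forall>x\<in>R. p ^ k * x \<in> M" using assms by (auto simp: lat_def)
  have pk: "lat ((*) (p ^ k) ` R)" by (rule lat_p_power[OF lat_R])
  obtain D where D: "coset_reps D M ((*) (p ^ k) ` R)"
    using coset_reps_exist[OF lat_add_subgroup[OF pk]] by blast
  have "finite D"
    using fin_idx_iff_finite[OF lat_add_subgroup[OF pk] D] lat_fin_idx[OF assms pk] by simp
  let ?G = "D \<union> (*) (p ^ k) ` S"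
  have SR: "S \<subseteq> R" unfolding S(2) by (rule hull_subset)
  have "?G \<subseteq> M" using D k SR by (auto simp: coset_reps_def)
  then have "osub hull ?G \<subseteq> M" using lat_osub[OF assms] by (rule hull_minimal)
  moreover have "M \<subseteq> osub hull ?G"
  proof
    fix x assume "x \<in> M"
    then obtain d r where d: "d \<in> D" "r \<in> R" "x - d = p ^ k * r"
      using D unfolding coset_reps_def by blast
    have H: "?G \<subseteq> osub hull ?G" by (rule hull_subset)
    have "S \<subseteq> {y. p ^ k * y \<in> osub hull ?G}" using H by auto
    then have "R \<subseteq> {y. p ^ k * y \<in> osub hull ?G}"
      unfolding S(2) by (rule hull_minimal) (intro osub_vimage_mult OF_submodule_hull)
    then have "d + p ^ k * r \<in> osub hull ?G" using d H by (intro osub_add OF_submodule_hull) auto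
    then show "x \<in> osub hull ?G" by (simp add: d(3)[symmetric])
  qed
  ultimately show ?thesis using S \<open>finite D\<close> by (intro exI[of _ ?G]) auto
qed

text \<open>A generating set of least size is independent: in a nontrivial relation, dividing by the
  coefficient of largest absolute value expresses one generator integrally by the others.\<close>

lemma lat_basis:
  assumes M: "lat M"
  shows "\<exists>B. basis B \<and> B \<subseteq> M \<and> (\<forall>x. x \<in> M \<longleftrightarrow> (\<forall>b\<in>B. representation B x b \<in> val_ring av))"
proof -
  obtain S where S: "finite S" "M = osub hull S"
    and min: "\<And>T. finite T \<Longrightarrow> M = osub hull T \<Longrightarrow> card S \<le> card T"
    using ex_has_least_nat[of "\<lambda>S. finite S \<and> M = osub hull S" _ card] lat_fg[OF M] by metis
  have SM: "S \<subseteq> M" unfolding S(2) by (rule hull_subset)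
  have "independent S"
  proof
    assume "dependent S"
    then obtain u where u: "\<exists>v\<in>S. u v \<noteq> 0" "(\<Sum>v\<in>S. sc (u v) v) = 0"
      using dependent_finite[OF S(1)] by blast
    have "Max ((\<lambda>v. av (u v)) ` S) \<in> (\<lambda>v. av (u v)) ` S" using S u by (intro Max_in) auto
    then obtain w where w: "w \<in> S" "av (u w) = Max ((\<lambda>v. av (u v)) ` S)" by auto
    have le: "av (u v) \<le> av (u w)" if "v \<in> S" for v using that S w by simp
    have "u w \<noteq> 0"
    proof
      assume "u w = 0"
      then have "av (u v) \<le> 0" if "v \<in> S" for v using le[OF that] av_eq_0_iff[of "u w"] by simp
      then show False using u av_nonneg av_eq_0_iff by (metis antisym)
    qed
    have "w = (\<Sum>v\<in>S - {w}. sc (- u v / u w) v)"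
    proof -
      have "sc (u w) w + (\<Sum>v\<in>S - {w}. sc (u v) v) = 0"
        using u(2) sum.remove[OF S(1) w(1), of "\<lambda>v. sc (u v) v"] by simp
      then have "sc (inverse (u w)) (sc (u w) w + (\<Sum>v\<in>S - {w}. sc (u v) v)) = 0" by simp
      then have "w + (\<Sum>v\<in>S - {w}. sc (u v / u w) v) = 0"
        using \<open>u w \<noteq> 0\<close> by (simp add: scale_right_distrib scale_sum_right field_simps)
      then have "w = - (\<Sum>v\<in>S - {w}. sc (u v / u w) v)" by (simp add: eq_neg_iff_add_eq_0)
      then show ?thesis by (simp add: sum_negf)
    qed
    also have "\<dots> \<in> osub hull (S - {w})"
    proof (intro osub_sum osub_sc OF_submodule_hull)
      fix v assume v: "v \<in> S - {w}"
      have "av (u w) > 0" using \<open>u w \<noteq> 0\<close> av_nonneg[of "u w"] av_eq_0_iff[of "u w"] by simp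
      then have "av (u v) * inverse (av (u w)) \<le> 1" using le[of v] v by (simp add: field_simps)
      then show "- u v / u w \<in> val_ring av"
        by (simp add: val_ring_def divide_inverse av_minus av_mult av_inverse)
      show "v \<in> osub hull (S - {w})" using v by (rule hull_inc)
    qed
    finally have "w \<in> osub hull (S - {w})" .
    then have "S \<subseteq> osub hull (S - {w})" using hull_subset[of "S - {w}" osub] by blast
    then have "osub hull S \<subseteq> osub hull (S - {w})" by (intro hull_minimal OF_submodule_hull)
    moreover have "osub hull (S - {w}) \<subseteq> osub hull S" by (rule hull_mono) auto
    ultimately have "M = osub hull (S - {w})" using S(2) by blast
    then have "card S \<le> card (S - {w})" using S(1) by (intro min) auto
    then show False using w S(1) by (metis card_Diff1_less not_less)
  qed
  moreover have "span S = UNIV"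
  proof -
    have "osub (span S)"
      unfolding OF_submodule_def by (auto intro: span_zero span_add span_scale)
    with span_superset have "M \<subseteq> span S" unfolding S(2) by (rule hull_minimal)
    moreover have "span M = UNIV" using lat_clears[OF M] by (rule osub_clears_span)
    ultimately show ?thesis by (metis span_mono span_span top.extremum_uniqueI)
  qed
  ultimately have B: "basis S" using S(1) by (simp add: basis_def)
  have "x \<in> M \<longleftrightarrow> (\<forall>b\<in>S. representation S x b \<in> val_ring av)" for x
  proof
    assume "x \<in> M"
    then obtain a where a: "x = (\<Sum>s\<in>S. sc (a s) s)" "a \<in> S \<rightarrow> val_ring av"
      using OF_hull_finite[OF S(1)] S(2) by auto
    then show "\<forall>b\<in>S. representation S x b \<in> val_ring av"
      using representation_sum_basis[OF B] by auto
  next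
    assume "\<forall>b\<in>S. representation S x b \<in> val_ring av"
    then have "(\<Sum>b\<in>S. sc (representation S x b) b) \<in> M"
      using SM by (intro osub_sum osub_sc lat_osub[OF M]) auto
    then show "x \<in> M" by (simp add: basis_expansion[OF B])
  qed
  then show ?thesis using B SM by blast
qed

text \<open>A coordinate divisible by all powers of \<open>unif\<close> is zero. Several elements
  below are proved to vanish by showing that division by powers of \<open>p\<close> never leaves a
  lattice.\<close>

lemma lat_no_line:
  assumes M: "lat M" and y: "\<And>m. p_inv ^ m * y \<in> M" shows "y = 0"
proof -
  obtain B where B: "basis B" "\<And>x. x \<in> M \<longleftrightarrow> (\<forall>b\<in>B. representation B x b \<in> val_ring av)"
    using lat_basis[OF M] by blast
  have "representation B y b = 0" if b: "b \<in> B" for b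
  proof (rule ccontr)
    assume nz: "representation B y b \<noteq> 0"
    let ?a = "representation B y b"
    obtain k where k: "unif ^ k * inverse ?a \<in> val_ring av" using unif_power_clears by blast
    let ?z = "p_inv ^ Suc k * y"
    have "y = sc (unif ^ Suc k) ?z"
      by (simp only: sc_unif_power mult.assoc[symmetric] p_power_inv mult_1)
    then have "?a = representation B (sc (unif ^ Suc k) ?z) b" by simp
    also have "\<dots> = unif ^ Suc k * representation B ?z b"
      using representation_scale[OF basisD(2,3)[OF B(1)]] by simp
    finally have eq: "?a = unif ^ Suc k * representation B ?z b" .
    have "representation B ?z b \<in> val_ring av" using y[of "Suc k"] B(2) b by blast
    with eq obtain c where c: "?a = unif ^ Suc k * c" "c \<in> val_ring av" by blast
    then have "(unif ^ k * inverse ?a) * c \<in> val_ring av" using val_ring_mult[OF k] by blast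
    moreover have "(unif ^ k * inverse ?a) * c = inverse unif"
    proof -
      have "c \<noteq> 0" using nz c(1) by auto
      then show ?thesis unfolding c(1) using unif_nz by (simp add: field_simps)
    qed
    ultimately have "av (inverse unif) \<le> 1" by (simp add: val_ring_def)
    then show False using q_ge_2 by (simp add: av_inverse av_unif)
  qed
  then show ?thesis using basis_expansion[OF B(1), of y] by simp
qed

text \<open>The power-bounded elements, which turn out to be \<open>\<O>\<^sub>E\<close> (\<open>alg_integers_eq\<close>). Unlike for
  integrality in terms of monic polynomials, closure under sums and products is immediate.\<close>

definition A :: "'e set" where
  "A = {x. \<exists>k. \<forall>n. p ^ k * x ^ n \<in> R}"

lemma of_nat_R: "of_nat n \<in> R"
  by (induction n) (auto intro: osub_0 osub_add osub_R one_R)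

lemma R_subset_A: "R \<subseteq> A"
  unfolding A_def using power_R by (auto intro!: exI[of _ 0])

lemma A_add: assumes "x \<in> A" "y \<in> A" shows "x + y \<in> A"
proof -
  obtain k l where k: "\<And>n. p ^ k * x ^ n \<in> R" and l: "\<And>n. p ^ l * y ^ n \<in> R"
    using assms by (auto simp: A_def)
  have "p ^ (k + l) * (x + y) ^ n \<in> R" for n
  proof -
    have "p ^ (k + l) * (x + y) ^ n
        = (\<Sum>i\<le>n. of_nat (n choose i) * ((p ^ k * x ^ i) * (p ^ l * y ^ (n - i))))"
      by (simp add: binomial_ring sum_distrib_left power_add ac_simps)
    also have "\<dots> \<in> R" by (intro osub_sum[OF osub_R] mult_R[OF of_nat_R] mult_R[OF k l])
    finally show ?thesis .
  qed
  then show ?thesis by (auto simp: A_def)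
qed

lemma A_mult: assumes "x \<in> A" "y \<in> A" shows "x * y \<in> A"
proof -
  obtain k l where k: "\<And>n. p ^ k * x ^ n \<in> R" and l: "\<And>n. p ^ l * y ^ n \<in> R"
    using assms by (auto simp: A_def)
  have "p ^ (k + l) * (x * y) ^ n \<in> R" for n
  proof -
    have "p ^ (k + l) * (x * y) ^ n = (p ^ k * x ^ n) * (p ^ l * y ^ n)"
      by (simp add: power_add power_mult_distrib ac_simps)
    then show ?thesis using mult_R[OF k l, of n n] by simp
  qed
  then show ?thesis by (auto simp: A_def)
qed

lemma one_A: "1 \<in> A" using one_R R_subset_A by blast

lemma osub_A: "osub A"
  unfolding OF_submodule_def
proof (intro conjI ballI)
  show "0 \<in> A" using osub_0[OF osub_R] R_subset_A by blast
  show "x + y \<in> A" if "x \<in> A" "y \<in> A" for x y using A_add that .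
  fix a x assume "a \<in> val_ring av" "x \<in> A"
  then have "sc a 1 * x \<in> A" using osub_sc[OF osub_R _ one_R] R_subset_A by (intro A_mult) auto
  then show "sc a x \<in> A" using sc_eq_mult by metis
qed

lemma A_power: "x \<in> A \<Longrightarrow> x ^ n \<in> A"
  by (induction n) (auto intro: one_A A_mult)

text \<open>\<open>M\<close> contains some \<open>p ^ j\<close>, hence all
  \<open>x ^ n * p ^ j\<close>, and elements of \<open>M\<close> have bounded denominators.\<close>

lemma stable_imp_A:
  assumes M: "lat M" and x: "\<And>m. m \<in> M \<Longrightarrow> x * m \<in> M" shows "x \<in> A"
proof -
  obtain j where j: "p ^ j * 1 \<in> M" using lat_clears[OF M] by blast
  obtain k where k: "\<forall>m\<in>M. p ^ k * m \<in> R" using M by (auto simp: lat_def)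
  have "x ^ n * p ^ j \<in> M" for n
  proof (induction n)
    case 0 then show ?case using j by simp
  next
    case (Suc n) then show ?case using x by (simp add: mult.assoc)
  qed
  then have "p ^ k * (x ^ n * p ^ j) \<in> R" for n using k by blast
  then have "p ^ (k + j) * x ^ n \<in> R" for n by (simp add: power_add ac_simps)
  then show ?thesis by (auto simp: A_def)
qed

text \<open>The set \<open>?M\<close> is the largest part of \<open>R\<close> stable under
  \<open>x\<close>. Power-boundedness is what makes it contain a multiple of
  \<open>R\<close>.\<close>

lemma A_stable_lattice:
  assumes "x \<in> A" shows "\<exists>M. lat M \<and> (\<forall>m\<in>M. x * m \<in> M)"
proof -
  obtain k where k: "\<And>n. p ^ k * x ^ n \<in> R" using assms by (auto simp: A_def)
  let ?M = "{y. \<forall>n. x ^ n * y \<in> R}"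
  have 1: "osub ?M"
    using osub_R unfolding OF_submodule_def by (auto simp: distrib_left sc_mult_right)
  have 2: "p ^ k * y \<in> ?M" if "y \<in> R" for y
  proof (safe)
    fix n
    have "(p ^ k * x ^ n) * y \<in> R" using mult_R[OF k that] .
    then show "x ^ n * (p ^ k * y) \<in> R" by (simp add: ac_simps)
  qed
  have 3: "p ^ 0 * y \<in> R" if "y \<in> ?M" for y
  proof -
    have "x ^ 0 * y \<in> R" using that by blast
    then show ?thesis by simp
  qed
  have "lat ?M" by (rule lat_sandwich[OF 1 lat_R lat_R 2 3])
  moreover have "\<forall>m\<in>?M. x * m \<in> ?M"
  proof safe
    fix m n assume "\<forall>n. x ^ n * m \<in> R"
    then have "x ^ Suc n * m \<in> R" by blast
    then show "x ^ n * (x * m) \<in> R" by (simp add: ac_simps)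
  qed
  ultimately show ?thesis by blast
qed

text \<open>In a basis of a lattice stable under \<open>x\<close> the matrix of multiplication by
  \<open>x\<close> has integral entries.\<close>

lemma tr_A: assumes "x \<in> A" shows "tr x \<in> val_ring av"
proof -
  obtain M where M: "lat M" "\<forall>m\<in>M. x * m \<in> M" using A_stable_lattice[OF assms] by blast
  obtain B where B: "basis B" "B \<subseteq> M" "\<And>x. x \<in> M \<longleftrightarrow> (\<forall>b\<in>B. representation B x b \<in> val_ring av)"
    using lat_basis[OF M(1)] by blast
  show ?thesis
    unfolding tr_eq[OF B(1)] using B M by (intro val_ring_sum) blast
qed

lemma idem_A: assumes "e * e = e" shows "e \<in> A"
proof -
  obtain k where k: "p ^ k * e \<in> R" using clears_R by blast
  have "e ^ Suc n = e" for n using assms by (induction n) auto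
  then have "p ^ k * e ^ n \<in> R" for n using k p_power_R by (cases n) auto
  then show ?thesis by (auto simp: A_def)
qed

text \<open>\<open>A\<close> is not yet known to be a lattice, so \<open>lat_no_line\<close> is
  applied to \<open>R\<close> with a denominator: power-boundedness of the single element
  \<open>p_inv * e\<close> bounds all \<open>p_inv ^ m * e\<close>.\<close>

lemma no_line_A:
  assumes idem: "e * e = e" and line: "\<And>m. p_inv ^ m * e \<in> A" shows "e = 0"
proof -
  have "p_inv * e \<in> A" using line[of 1] by simp
  then obtain k where k: "\<And>n. p ^ k * (p_inv * e) ^ n \<in> R" by (auto simp: A_def)
  have e: "e ^ Suc n = e" for n using idem by (induction n) auto
  have "p_inv ^ m * (p_inv * e) \<in> (*) (p_inv ^ k) ` R" for m
  proof -
    have "(p_inv * e) ^ Suc m = p_inv ^ Suc m * e" by (simp only: power_mult_distrib e)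
    also have "\<dots> = p_inv ^ m * (p_inv * e)" by (simp add: ac_simps)
    finally show ?thesis unfolding mem_mult_unit_iff[OF p_inv_power] using k[of "Suc m"] by simp
  qed
  then have "p_inv * e = 0" by (rule lat_no_line[OF lat_p_inv_power[OF lat_R]])
  then have "(p * p_inv) * e = 0" by (simp only: mult.assoc mult_zero_right)
  then show ?thesis by (simp add: p_p_inv)
qed

text \<open>Induction on the generators of the ambient module. The coefficients of the new generator
  \<open>s\<close> that occur in \<open>N\<close> are governed by the least power of
  \<open>unif\<close> among them; an element of \<open>N\<close> realising it, together with
  generators of the part of \<open>N\<close> without \<open>s\<close>, generates
  \<open>N\<close>.\<close>

lemma OF_hull_noetherian:
  assumes "finite S" "osub N" "N \<subseteq> osub hull S"
  shows "\<exists>T. finite T \<and> N = osub hull T"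
  using assms
proof (induction S arbitrary: N rule: finite_induct)
  case empty
  have "osub {0}" by (auto simp: OF_submodule_def)
  then have "osub hull {} \<subseteq> {0}" by (intro hull_minimal) auto
  then have "N = {0}" using empty osub_0 by blast
  moreover have "osub hull {} = {0}"
    using \<open>osub hull {} \<subseteq> {0}\<close> osub_0[OF OF_submodule_hull] by blast
  ultimately show ?case by (intro exI[of _ "{}"]) auto
next
  case (insert s S)
  let ?H = "osub hull S"
  have "osub (N \<inter> ?H)" by (intro osub_Int insert.prems OF_submodule_hull)
  then obtain T where T: "finite T" "N \<inter> ?H = osub hull T"
    using insert.IH[of "N \<inter> ?H"] by blast
  have split: "\<exists>a m. a \<in> val_ring av \<and> m \<in> ?H \<and> x = sc a s + m" if "x \<in> N" for x
  proof -
    obtain a where a: "x = (\<Sum>t\<in>insert s S. sc (a t) t)" "a \<in> insert s S \<rightarrow> val_ring av"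
    proof -
      have "x \<in> osub hull (insert s S)" using \<open>x \<in> N\<close> insert.prems(2) by (rule rev_subsetD)
      moreover have "finite (insert s S)" using insert.hyps by simp
      ultimately show ?thesis using that OF_hull_finite[of "insert s S"] by blast
    qed
    then have "x = sc (a s) s + (\<Sum>t\<in>S. sc (a t) t)" using insert.hyps by simp
    moreover have "(\<Sum>t\<in>S. sc (a t) t) \<in> ?H" using a by (auto simp: OF_hull_finite[OF insert.hyps(1)])
    ultimately show ?thesis using a by blast
  qed
  show ?case
  proof (cases "\<exists>a m. a \<noteq> 0 \<and> a \<in> val_ring av \<and> m \<in> ?H \<and> sc a s + m \<in> N")
    case False
    have "N \<subseteq> ?H"
    proof
      fix x assume "x \<in> N"
      then obtain a m where am: "a \<in> val_ring av" "m \<in> ?H" "x = sc a s + m" using split by blast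
      then have "a = 0" using False \<open>x \<in> N\<close> by blast
      then show "x \<in> ?H" using am by simp
    qed
    then show ?thesis using T by (metis inf.absorb1)
  next
    case True
    define good where "good k \<longleftrightarrow> (\<exists>m\<in>?H. sc (unif ^ k) s + m \<in> N)" for k
    have to_good: "\<exists>k u. av u = 1 \<and> a = unif ^ k * u \<and> good k"
      if a: "a \<noteq> 0" "a \<in> val_ring av" "m \<in> ?H" "sc a s + m \<in> N" for a m
    proof -
      obtain k u where ku: "av u = 1" "a = unif ^ k * u" using unif_decomp a by blast
      have "u \<noteq> 0" using ku av_eq_0_iff[of u] by auto
      have iu: "inverse u \<in> val_ring av" by (rule unit_inverse[OF ku(1)])
      have "sc (inverse u) (sc a s + m) \<in> N" by (rule osub_sc[OF insert.prems(1) iu a(4)])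
      moreover have "sc (inverse u) (sc a s + m) = sc (unif ^ k) s + sc (inverse u) m"
        using \<open>u \<noteq> 0\<close> by (simp add: ku scale_right_distrib)
      ultimately have "sc (unif ^ k) s + sc (inverse u) m \<in> N" by simp
      moreover have "sc (inverse u) m \<in> ?H" by (rule osub_sc[OF OF_submodule_hull iu a(3)])
      ultimately have "good k" unfolding good_def by blast
      then show ?thesis using ku by blast
    qed
    define k where "k = (LEAST k. good k)"
    obtain k' where "good k'" using True to_good by blast
    then have "good k" unfolding k_def by (rule LeastI)
    then obtain m0 where m0: "m0 \<in> ?H" "sc (unif ^ k) s + m0 \<in> N" unfolding good_def by blast
    let ?n = "sc (unif ^ k) s + m0"
    have "N \<subseteq> osub hull (insert ?n T)"
    proof
      fix x assume x: "x \<in> N"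
      then obtain a m where am: "a \<in> val_ring av" "m \<in> ?H" "x = sc a s + m" using split by blast
      have "\<exists>c\<in>val_ring av. a = c * unif ^ k"
      proof (cases "a = 0")
        case True then show ?thesis using val_ring_0 by force
      next
        case False
        then obtain j u where ju: "av u = 1" "a = unif ^ j * u" "good j" using to_good am x by blast
        then have "k \<le> j" unfolding k_def by (simp add: Least_le)
        then have "unif ^ j = unif ^ (j - k) * unif ^ k" by (simp add: power_add[symmetric])
        then have "a = (unif ^ (j - k) * u) * unif ^ k" using ju by (simp add: ac_simps)
        moreover have "unif ^ (j - k) * u \<in> val_ring av"
          using ju by (intro val_ring_mult val_ring_power unif_in) (simp add: val_ring_def)
        ultimately show ?thesis by blast
      qed
      then obtain c where c: "c \<in> val_ring av" "a = c * unif ^ k" by blast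
      have "x - sc c ?n = m - sc c m0" by (simp add: am c scale_right_distrib)
      moreover have "m - sc c m0 \<in> ?H" using am m0 c by (intro osub_diff osub_sc OF_submodule_hull)
      moreover have "x - sc c ?n \<in> N" using x m0 c insert.prems by (intro osub_diff osub_sc)
      ultimately have "x - sc c ?n \<in> osub hull T" using T(2) by auto
      moreover have "osub hull T \<subseteq> osub hull (insert ?n T)" by (rule hull_mono) auto
      moreover have "sc c ?n \<in> osub hull (insert ?n T)"
        using c by (intro osub_sc OF_submodule_hull hull_inc) auto
      ultimately have "(x - sc c ?n) + sc c ?n \<in> osub hull (insert ?n T)"
        by (intro osub_add[OF OF_submodule_hull]) auto
      then show "x \<in> osub hull (insert ?n T)" by simp
    qed
    moreover have "osub hull (insert ?n T) \<subseteq> N"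
      using m0 T(2) hull_subset[of T osub] insert.prems by (intro hull_minimal) auto
    ultimately show ?thesis using T by (intro exI[of _ "insert ?n T"]) auto
  qed
qed

section \<open>Integral elements are the power-bounded ones\<close>

lemma factor_integers_subset_A:
  assumes "x \<in> factor_integers av sc e" shows "x \<in> A"
proof -
  obtain P :: "'f poly" where P: "lead_coeff P = 1" "\<forall>i. coeff P i \<in> val_ring av"
    "(\<Sum>i\<le>degree P. sc (coeff P i) (e * x ^ i)) = 0" and xe: "x \<in> factor e"
    using assms by (auto simp: factor_integers_def)
  define d where "d = degree P"
  let ?H = "osub hull ((\<lambda>i. e * x ^ i) ` {..<d})"
  have inH: "e * x ^ i \<in> ?H" if "i < d" for i using that by (intro hull_inc) auto
  have *: "{..d} = insert d {..<d}" by auto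
  have rel: "e * x ^ d = - (\<Sum>i<d. sc (coeff P i) (e * x ^ i))"
    using P(1,3) unfolding d_def[symmetric] * by (simp add: eq_neg_iff_add_eq_0)
  \<comment> \<open>The monic relation pushes every power into the span of the first
    \<open>d\<close>, whose denominators are bounded.\<close>
  have all: "e * x ^ n \<in> ?H" for n
  proof (induction n rule: less_induct)
    case (less n)
    show ?case
    proof (cases "n < d")
      case False
      then have n: "x ^ n = x ^ (n - d) * x ^ d" by (simp add: power_add[symmetric])
      then have "e * x ^ n = x ^ (n - d) * (e * x ^ d)" by (simp add: ac_simps)
      also have "\<dots> = - (\<Sum>i<d. sc (coeff P i) (e * x ^ (n - d + i)))"
        by (simp add: rel sum_distrib_left sc_mult_right power_add ac_simps)
      also have "\<dots> \<in> ?H"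
        using P(2) False less.IH
        by (intro osub_minus osub_sum osub_sc OF_submodule_hull) auto
      finally show ?thesis .
    qed (use inH in auto)
  qed
  have "\<exists>k. \<forall>i<d. p ^ k * (e * x ^ i) \<in> R"
  proof -
    have "\<forall>i. \<exists>k. p ^ k * (e * x ^ i) \<in> R" using clears_R by blast
    then obtain f where f: "p ^ f i * (e * x ^ i) \<in> R" for i by metis
    have "p ^ (\<Sum>i<d. f i) * (e * x ^ i) \<in> R" if "i < d" for i
      using that by (intro osub_p_power_mono[OF osub_R f] member_le_sum) auto
    then show ?thesis by blast
  qed
  then obtain k where k: "\<forall>i<d. p ^ k * (e * x ^ i) \<in> R" by blast
  then have "?H \<subseteq> {y. p ^ k * y \<in> R}"
    by (intro hull_minimal osub_vimage_mult osub_R) auto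
  then have kn: "p ^ k * (e * x ^ n) \<in> R" for n using all by blast
  have "p ^ k * x ^ n \<in> R" for n
  proof (cases n)
    \<comment> \<open>\<open>e * x ^ 0\<close> is \<open>e\<close> and not 1, so the zeroth power is
      treated apart.\<close>
    case 0 then show ?thesis using p_power_R by simp
  next
    case (Suc m)
    then have "e * x ^ n = x ^ n" using xe by (simp add: factor_def mult.assoc[symmetric])
    then show ?thesis using kn[of n] by simp
  qed
  then show "x \<in> A" by (auto simp: A_def)
qed

text \<open>The elements \<open>e * x ^ i\<close> span a submodule of a lattice, hence a finitely
  generated one. Finitely many of them already span it, and the next power is an integral
  combination of these.\<close>

lemma A_integral_relation:
  assumes "x \<in> A"
  shows "\<exists>d a. a \<in> {..<d} \<rightarrow> val_ring av \<and> e * x ^ d = (\<Sum>i<d. sc (a i) (e * x ^ i))"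
proof -
  obtain k where k: "\<And>n. p ^ k * x ^ n \<in> R" using assms by (auto simp: A_def)
  obtain j where j: "p ^ j * e \<in> R" using clears_R by blast
  let ?f = "\<lambda>i. e * x ^ i"
  let ?K = "(*) (p_inv ^ (k + j)) ` R"
  have latK: "lat ?K" by (rule lat_p_inv_power[OF lat_R])
  have fK: "?f i \<in> ?K" for i
    unfolding mem_mult_unit_iff[OF p_inv_power]
    using mult_R[OF j k[of i]] by (simp add: power_add ac_simps)
  let ?N = "osub hull (range ?f)"
  have NK: "?N \<subseteq> ?K" using fK by (intro hull_minimal lat_osub[OF latK]) auto
  obtain S where S: "finite S" "?K = osub hull S" using lat_fg[OF latK] by blast
  obtain T where T: "finite T" "?N = osub hull T"
    using OF_hull_noetherian[OF S(1) OF_submodule_hull] NK S(2) by metis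
  let ?U = "\<lambda>d. osub hull (?f ` {..<d})"
  have Umono: "?U a \<subseteq> ?U b" if "a \<le> b" for a b
    using that by (intro hull_mono image_mono) auto
  have "?N \<subseteq> (\<Union>d. ?U d)"
  proof (rule hull_minimal)
    show "range ?f \<subseteq> (\<Union>d. ?U d)"
    proof
      fix y assume "y \<in> range ?f"
      then obtain i where "y = ?f i" by auto
      then have "y \<in> ?U (Suc i)" by (intro hull_inc) auto
      then show "y \<in> (\<Union>d. ?U d)" by blast
    qed
    show "osub (\<Union>d. ?U d)"
    proof (rule OF_submodule_def[THEN iffD2], intro conjI ballI)
      show "0 \<in> (\<Union>d. ?U d)" using osub_0[OF OF_submodule_hull] by blast
      fix y z assume "y \<in> (\<Union>d. ?U d)" "z \<in> (\<Union>d. ?U d)"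
      then obtain a b where ab: "y \<in> ?U a" "z \<in> ?U b" by blast
      have "y \<in> ?U (max a b)" using ab(1) Umono[of a "max a b"] by auto
      moreover have "z \<in> ?U (max a b)" using ab(2) Umono[of b "max a b"] by auto
      ultimately have "y + z \<in> ?U (max a b)" by (intro osub_add[OF OF_submodule_hull])
      then show "y + z \<in> (\<Union>d. ?U d)" by blast
    next
      fix a y assume "a \<in> val_ring av" "y \<in> (\<Union>d. ?U d)"
      then obtain d where "y \<in> ?U d" by blast
      then have "sc a y \<in> ?U d" using \<open>a \<in> val_ring av\<close> by (intro osub_sc[OF OF_submodule_hull])
      then show "sc a y \<in> (\<Union>d. ?U d)" by blast
    qed
  qed
  moreover have "T \<subseteq> ?N" unfolding T(2) by (rule hull_subset)
  ultimately have "\<forall>t\<in>T. \<exists>d. t \<in> ?U d" by blast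
  then obtain g where g: "\<forall>t\<in>T. t \<in> ?U (g t)" by metis
  define d where "d = (\<Sum>t\<in>T. g t)"
  have "T \<subseteq> ?U d"
  proof
    fix t assume t: "t \<in> T"
    have "g t \<le> d" unfolding d_def using t T(1) by (intro member_le_sum) auto
    then show "t \<in> ?U d" using g t Umono[of "g t" d] by auto
  qed
  then have "osub hull T \<subseteq> ?U d" by (rule hull_minimal) (rule OF_submodule_hull)
  moreover have "?f d \<in> ?N" by (intro hull_inc) auto
  ultimately have "?f d \<in> ?U d" using T(2) by blast
  then show ?thesis using OF_hull_family[of "{..<d}" ?f] by auto
qed

lemma factor_integers_eq: "factor_integers av sc e = A \<inter> factor e"
proof (intro equalityI subsetI)
  fix x assume "x \<in> factor_integers av sc e"
  then show "x \<in> A \<inter> factor e"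
    using factor_integers_subset_A by (auto simp: factor_integers_def)
next
  fix x assume "x \<in> A \<inter> factor e"
  then have x: "x \<in> A" "x \<in> factor e" by auto
  obtain d a where a: "e * x ^ d = (\<Sum>i<d. sc (a i) (e * x ^ i))" "a \<in> {..<d} \<rightarrow> val_ring av"
    using A_integral_relation[OF x(1)] by blast
  define P :: "'f poly" where "P = Abs_poly (\<lambda>n. if n = d then 1 else if n < d then - a n else 0)"
  have cP: "coeff P = (\<lambda>n. if n = d then 1 else if n < d then - a n else 0)"
    unfolding P_def by (rule coeff_Abs_poly[of d]) auto
  have degP: "degree P = d"
    by (intro antisym degree_le le_degree) (auto simp: cP)
  have *: "{..d} = insert d {..<d}" by auto
  have "(\<Sum>i\<le>degree P. sc (coeff P i) (e * x ^ i)) = 0"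
    unfolding degP * using a(1) by (simp add: cP sum_negf)
  moreover have "\<forall>i. coeff P i \<in> val_ring av"
    using a(2) val_ring_0 val_ring_1 val_ring_minus by (auto simp: cP)
  moreover have "lead_coeff P = 1" unfolding degP by (simp add: cP)
  ultimately show "x \<in> factor_integers av sc e" using x(2) by (auto simp: factor_integers_def)
qed

lemma alg_integers_eq: "alg_integers av sc = A"
proof (intro equalityI subsetI)
  fix x assume "x \<in> alg_integers av sc"
  then have "e * x \<in> A" if "e \<in> prim_idem" for e
    using that factor_integers_eq by (auto simp: alg_integers_def)
  then have "(\<Sum>e\<in>prim_idem. e * x) \<in> A" by (intro osub_sum osub_A)
  then show "x \<in> A" by (simp add: sum_components)
next
  fix x assume x: "x \<in> A"
  show "x \<in> alg_integers av sc"
    unfolding alg_integers_def factor_integers_eq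
  proof (safe)
    fix e :: 'e assume e: "e \<in> prim_idem"
    show "e * x \<in> A" by (rule A_mult[OF idem_A[OF prim_idemD(1)[OF e]] x])
    show "e * x \<in> factor e" using prim_idemD(1)[OF e] by (simp add: factor_def mult.assoc[symmetric])
  qed
qed

end

section \<open>Duality of lattices\<close>

lemma carrier_unit_group: "carrier unit_group = {x :: 'a::comm_ring_1. \<exists>y. x * y = 1}"
  by (auto simp: unit_group_def units_of_def Units_def mult.commute)

lemma group_unit_group: "Group.group (unit_group :: 'a::comm_ring_1 monoid)"
  unfolding unit_group_def
  by (rule monoid.units_group, unfold_locales) (auto simp: mult.assoc)

lemma unit_group_simps [simp]: "x \<otimes>\<^bsub>unit_group\<^esub> y = x * y" "\<one>\<^bsub>unit_group\<^esub> = 1"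
  by (simp_all add: unit_group_def units_of_def)

lemma unit_group_inv: "x \<in> carrier unit_group \<Longrightarrow> x * inv\<^bsub>unit_group\<^esub> x = 1"
  using group.r_inv[OF group_unit_group, of x] by simp

locale local_duality = local_order av sc R
  for av :: "'f::field \<Rightarrow> real" and sc :: "'f \<Rightarrow> 'e::comm_ring_1 \<Rightarrow> 'e" and R :: "'e set" +
  fixes c :: 'e
  assumes different_gen: "generates_different av sc c"
begin

definition c_inv :: 'e where "c_inv = inv\<^bsub>unit_group\<^esub> c"

lemma c_c_inv: "c * c_inv = 1"
  using unit_group_inv different_gen by (auto simp: c_inv_def generates_different_def)

lemma different_eq: "different av sc = (*) c ` A"
  using different_gen by (simp add: generates_different_def alg_integers_eq)

lemma c_mult_codifferent: "x \<in> codifferent av sc \<Longrightarrow> c * x \<in> A"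
proof -
  assume x: "x \<in> codifferent av sc"
  have "c * 1 \<in> different av sc" unfolding different_eq using one_A by (rule imageI)
  then show ?thesis using x by (simp add: different_def alg_integers_eq)
qed

text \<open>The radical is an ideal, so if nonzero it contains a nonzero idempotent
  \<open>e\<close>, and the codifferent contains \<open>c_inv\<close> times every
  \<open>p_inv ^ m * e\<close>. The generator \<open>c\<close> maps the codifferent into
  \<open>A\<close>, so \<open>A\<close> would contain a line.\<close>

lemma tr_nondegenerate:
  assumes "\<And>y. tr (x * y) = 0" shows "x = 0"
proof -
  obtain y where y: "x * x * y = x" using regular by blast
  define e where "e = x * y"
  have ex: "x * e = x" using y by (simp add: e_def mult.assoc)
  have ee: "e * e = e"
  proof -
    have "e * e = (x * e) * y" unfolding e_def by (simp add: ac_simps)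
    also have "\<dots> = e" by (simp only: ex) (simp only: e_def)
    finally show ?thesis .
  qed
  have "p_inv ^ m * e \<in> A" for m
  proof -
    have "tr ((c_inv * (p_inv ^ m * e)) * z) = 0" for z
    proof -
      have "(c_inv * (p_inv ^ m * e)) * z = x * (y * c_inv * p_inv ^ m * z)"
        by (simp add: e_def ac_simps)
      then show ?thesis using assms by simp
    qed
    then have "c_inv * (p_inv ^ m * e) \<in> codifferent av sc"
      using val_ring_0 by (simp add: codifferent_def)
    then have "c * (c_inv * (p_inv ^ m * e)) \<in> A" by (rule c_mult_codifferent)
    then show ?thesis by (simp add: mult.assoc[symmetric] c_c_inv)
  qed
  then have "e = 0" using no_line_A ee by blast
  then show ?thesis using ex by simp
qed

text \<open>The factor \<open>d\<close> stays a parameter: \<open>c_inv\<close> gives the duality of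
  the statement, and 1 gives the plain trace form, for which the dual of \<open>A\<close> is the
  codifferent.\<close>

definition dl :: "'e \<Rightarrow> 'e set \<Rightarrow> 'e set" where
  "dl d M = {x. \<forall>y\<in>M. tr (d * x * y) \<in> val_ring av}"

lemma dl_antimono: "M \<subseteq> N \<Longrightarrow> dl d N \<subseteq> dl d M"
  by (auto simp: dl_def)

lemma dl_dl_upper: "M \<subseteq> dl d (dl d M)"
  by (auto simp: dl_def mult.assoc mult.left_commute mult.commute)

lemma osub_dl: "osub (dl d M)"
proof (rule OF_submodule_def[THEN iffD2], intro conjI ballI)
  show "0 \<in> dl d M" using val_ring_0 by (simp add: dl_def tr_0)
  fix x y assume "x \<in> dl d M" "y \<in> dl d M"
  then show "x + y \<in> dl d M"
    by (simp add: dl_def distrib_left distrib_right tr_add val_ring_add)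
next
  fix a x assume "a \<in> val_ring av" "x \<in> dl d M"
  then show "sc a x \<in> dl d M"
    by (simp add: dl_def sc_mult_right sc_mult_left tr_sc val_ring_mult)
qed

text \<open>Pairing with the basis is an injective linear map by nondegeneracy, hence bijective by
  dimension; \<open>s b\<close> is the preimage of \<open>b\<close>.\<close>

lemma dual_basis:
  assumes d: "d * d' = 1" and B: "basis B"
  shows "\<exists>s. (\<forall>b\<in>B. \<forall>b'\<in>B. tr (d * s b * b') = (if b = b' then 1 else 0)) \<and>
             (\<forall>x. x = (\<Sum>b\<in>B. sc (tr (d * x * b)) (s b)))"
proof -
  interpret fd: finite_dimensional_vector_space sc B by (rule basis_finite_dim[OF B])
  define \<phi> where "\<phi> x = (\<Sum>b\<in>B. sc (tr (d * x * b)) b)" for x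
  have add: "\<phi> (x + y) = \<phi> x + \<phi> y" for x y
    by (simp add: \<phi>_def distrib_left distrib_right tr_add scale_left_distrib sum.distrib)
  have scale: "\<phi> (sc a x) = sc a (\<phi> x)" for a x
    by (simp add: \<phi>_def sc_mult_right sc_mult_left tr_sc scale_sum_right)
  have rep: "representation B (\<phi> x) b = tr (d * x * b)" if "b \<in> B" for x b
    unfolding \<phi>_def by (rule representation_sum_basis[OF B that])
  have lin: "Vector_Spaces.linear sc sc \<phi>"
    by unfold_locales (auto simp: add scale scale_right_distrib scale_left_distrib)
  have inj: "inj \<phi>"
  proof (rule injI)
    fix x y assume "\<phi> x = \<phi> y"
    then have "tr (d * x * b) = tr (d * y * b)" if "b \<in> B" for b using rep that by metis
    then have *: "tr (d * (x - y) * b) = 0" if "b \<in> B" for b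
    proof -
      have "tr (d * (x - y) * b) + tr (d * y * b) = tr (d * x * b)"
        by (simp add: tr_add[symmetric] algebra_simps)
      then show ?thesis using \<open>\<And>b. b \<in> B \<Longrightarrow> tr (d * x * b) = tr (d * y * b)\<close>[OF that] by simp
    qed
    have "tr (d * (x - y) * z) = 0" for z
    proof -
      have "d * (x - y) * z = (\<Sum>b\<in>B. sc (representation B z b) (d * (x - y) * b))"
        using arg_cong[OF basis_expansion[OF B, of z], of "\<lambda>z. d * (x - y) * z"]
        by (simp add: sum_distrib_left sc_mult_right)
      then show ?thesis using * by (simp add: tr_sum tr_sc)
    qed
    then have "d * (x - y) = 0" by (rule tr_nondegenerate)
    then have "d' * (d * (x - y)) = 0" by simp
    then have "(d * d') * (x - y) = 0" by (simp only: ac_simps)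
    then show "x = y" using d by simp
  qed
  have "surj \<phi>" by (rule fd.linear_inj_imp_surj[OF lin inj])
  then have "\<forall>b. \<exists>x. \<phi> x = b" by (metis surjD)
  then obtain s where s: "\<And>b. \<phi> (s b) = b" by metis
  have 1: "tr (d * s b * b') = (if b = b' then 1 else 0)" if "b \<in> B" "b' \<in> B" for b b'
  proof -
    have "tr (d * s b * b') = representation B b b'" using rep[OF that(2), of "s b"] s by simp
    then show ?thesis using representation_basis[OF basisD(2)[OF B] that(1)] by auto
  qed
  have sum: "\<phi> (\<Sum>b\<in>I. f b) = (\<Sum>b\<in>I. \<phi> (f b))" for f and I :: "'e set"
  proof (induction I rule: infinite_finite_induct)
    case (infinite I) then show ?case using scale[of 0 0] by simp
  next
    case empty then show ?case using scale[of 0 0] by simp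
  qed (simp add: add)
  have 2: "x = (\<Sum>b\<in>B. sc (tr (d * x * b)) (s b))" for x
  proof (rule injD[OF inj])
    show "\<phi> x = \<phi> (\<Sum>b\<in>B. sc (tr (d * x * b)) (s b))"
      by (simp add: sum scale s) (simp add: \<phi>_def)
  qed
  show ?thesis using 1 2 by blast
qed

text \<open>In a lattice basis, the coordinates of \<open>y\<close> are its pairings with the dual
  basis, which lies in the dual lattice; this gives the bidual. The coordinates of \<open>x\<close>
  in the dual basis are its pairings with \<open>B\<close>, which bounds the dual.\<close>

lemma
  assumes d: "d * d' = 1" and M: "lat M"
  shows lat_dl: "lat (dl d M)" and dl_dl: "dl d (dl d M) = M"
proof -
  obtain B where B: "basis B" "B \<subseteq> M" "\<And>x. x \<in> M \<longleftrightarrow> (\<forall>b\<in>B. representation B x b \<in> val_ring av)"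
    using lat_basis[OF M] by blast
  obtain s where s: "\<And>b b'. b \<in> B \<Longrightarrow> b' \<in> B \<Longrightarrow> tr (d * s b * b') = (if b = b' then 1 else 0)"
    "\<And>x. x = (\<Sum>b\<in>B. sc (tr (d * x * b)) (s b))"
    using dual_basis[OF d B(1)] by metis
  have finB: "finite B" using B(1) by (rule basisD)
  have expand: "tr (d * x * y) = (\<Sum>b\<in>B. representation B y b * tr (d * x * b))" for x y
  proof -
    have "d * x * y = (\<Sum>b\<in>B. sc (representation B y b) (d * x * b))"
      using arg_cong[OF basis_expansion[OF B(1), of y], of "\<lambda>z. d * x * z"]
      by (simp add: sum_distrib_left sc_mult_right)
    then show ?thesis by (simp add: tr_sum tr_sc)
  qed
  have s_dl: "s b \<in> dl d M" if "b \<in> B" for b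
    unfolding dl_def
  proof safe
    fix y assume "y \<in> M"
    then show "tr (d * s b * y) \<in> val_ring av"
      unfolding expand[of "s b" y] using B(3) s(1)[OF that] val_ring_0
      by (intro val_ring_sum) auto
  qed
  have "dl d (dl d M) \<subseteq> M"
  proof
    fix y assume y: "y \<in> dl d (dl d M)"
    have "representation B y b \<in> val_ring av" if b: "b \<in> B" for b
    proof -
      have "tr (d * s b * y) = (\<Sum>b'\<in>B. if b' = b then representation B y b else 0)"
        unfolding expand[of "s b" y] using s(1)[OF b] by (intro sum.cong) auto
      then have "representation B y b = tr (d * y * s b)" using finB b by (simp add: ac_simps)
      then show ?thesis using y s_dl[OF b] by (auto simp: dl_def)
    qed
    then show "y \<in> M" using B(3) by blast
  qed
  then show "dl d (dl d M) = M" using dl_dl_upper by blast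
  have clear: "\<exists>k. \<forall>b\<in>B. p ^ k * g b \<in> R" for g
  proof -
    have "\<forall>i. \<exists>k. p ^ k * g i \<in> R" using clears_R by blast
    then obtain f where f: "p ^ f i * g i \<in> R" for i by metis
    have "p ^ (\<Sum>i\<in>B. f i) * g i \<in> R" if "i \<in> B" for i
      using that finB by (intro osub_p_power_mono[OF osub_R f] member_le_sum) auto
    then show ?thesis by blast
  qed
  obtain k where k: "\<forall>b\<in>B. p ^ k * s b \<in> R" using clear by blast
  obtain l where l: "\<forall>b\<in>B. p ^ l * (d * b) \<in> R" using clear[of "\<lambda>b. d * b"] by blast
  have 1: "p ^ k * x \<in> R" if "x \<in> dl d M" for x
  proof -
    have "p ^ k * x = (\<Sum>b\<in>B. sc (tr (d * x * b)) (p ^ k * s b))"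
      using arg_cong[OF s(2)[of x], of "\<lambda>z. p ^ k * z"] by (simp add: sum_distrib_left sc_mult_right)
    also have "\<dots> \<in> R" using that k B(2) by (intro osub_sum osub_sc osub_R) (auto simp: dl_def)
    finally show ?thesis .
  qed
  have 2: "p ^ l * r \<in> dl d M" if "r \<in> R" for r
    unfolding dl_def
  proof safe
    fix y assume "y \<in> M"
    have "tr (d * (p ^ l * r) * b) \<in> val_ring av" if "b \<in> B" for b
    proof (rule tr_A)
      have "r * (p ^ l * (d * b)) \<in> R" using mult_R \<open>r \<in> R\<close> l that by blast
      moreover have "r * (p ^ l * (d * b)) = d * (p ^ l * r) * b" by (simp add: ac_simps)
      ultimately show "d * (p ^ l * r) * b \<in> A" using R_subset_A by auto
    qed
    then show "tr (d * (p ^ l * r) * y) \<in> val_ring av"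
      unfolding expand[of "p ^ l * r" y] using B(3) \<open>y \<in> M\<close> by (intro val_ring_sum val_ring_mult) auto
  qed
  show "lat (dl d M)" by (rule lat_sandwich[OF osub_dl lat_R lat_R 2 1])
qed

text \<open>Finiteness of the integral closure: traces of power-bounded elements are integral, so
  \<open>A\<close> lies between \<open>R\<close> and the trace dual of \<open>R\<close>.\<close>

lemma lat_A: "lat A"
proof (rule lat_between[OF osub_A lat_R lat_dl[of 1 1, OF _ lat_R]])
  show "A \<subseteq> dl 1 R" using R_subset_A by (auto simp: dl_def intro!: tr_A A_mult)
qed (auto simp: R_subset_A)

text \<open>Duality reverses chains of lattices, so it preserves lengths.\<close>

lemma len_dl:
  assumes d: "d * d' = 1" and "lat M" "lat N" "N \<subseteq> M"
  shows "len (dl d N) (dl d M) = len M N"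
proof -
  \<comment> \<open>One inequality suffices: applied again to the dual lattices it gives the other
    one by biduality.\<close>
  have le: "len M N \<le> len (dl d N) (dl d M)" if M: "lat M" and N: "lat N" and NM: "N \<subseteq> M" for M N
  proof -
    obtain l C where C: "idx M N = q ^ l" "C 0 = N" "C l = M" "\<forall>i\<le>l. osub (C i)"
      "\<forall>i<l. C i \<subset> C (Suc i)"
      using osub_chain_exists[OF lat_osub[OF N] lat_osub[OF M] NM lat_fin_idx[OF M N]] by blast
    have l: "l = len M N" using C(1) lat_idx_len[OF N M NM] q_power_inject by metis
    have sub: "N \<subseteq> C i" if "i \<le> l" for i
      using that
    proof (induction i)
      case (Suc i) then show ?case using C(5) by (metis Suc_le_lessD less_imp_le_nat psubsetE subset_trans)
    qed (simp add: C)
    have sup: "C (l - i) \<subseteq> M" if "i \<le> l" for i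
      using that
    proof (induction i)
      case (Suc i)
      then have "C (l - Suc i) \<subset> C (Suc (l - Suc i))" using C(5) by simp
      moreover have "Suc (l - Suc i) = l - i" using Suc by simp
      ultimately show ?case using Suc by auto
    qed (simp add: C)
    have lat: "lat (C i)" if "i \<le> l" for i
      using C(4) sub[OF that] sup[of "l - i"] that by (intro lat_between[OF _ N M]) auto
    define D where "D i = dl d (C (l - i))" for i
    have 1: "\<forall>i\<le>l. osub (D i)" by (simp add: D_def osub_dl)
    have 2: "\<forall>i<l. D i \<subset> D (Suc i)"
    proof safe
      fix i assume i: "i < l"
      have "C (l - Suc i) \<subset> C (Suc (l - Suc i))" using i C(5) by simp
      moreover have "Suc (l - Suc i) = l - i" using i by simp
      ultimately have CC: "C (l - Suc i) \<subset> C (l - i)" by simp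
      show "x \<in> D (Suc i)" if "x \<in> D i" for x
        using that CC dl_antimono[of "C (l - Suc i)" "C (l - i)" d] by (auto simp: D_def)
      assume "D i = D (Suc i)"
      then have "dl d (dl d (C (l - i))) = dl d (dl d (C (l - Suc i)))" by (simp add: D_def)
      then show False using CC dl_dl[OF d lat] i by auto
    qed
    have "lat (D 0)" "lat (D l)" using lat_dl[OF d lat] by (simp_all add: D_def)
    then have "q ^ l \<le> idx (D l) (D 0)" "D 0 \<subseteq> D l"
      using osub_chain_bound[OF 1 2] lat_fin_idx by blast+
    then have "q ^ l \<le> q ^ len (D l) (D 0)" using lat_idx_len \<open>lat (D 0)\<close> \<open>lat (D l)\<close> by simp
    then have "l \<le> len (D l) (D 0)" using q_ge_2 by (simp add: power_increasing_iff)
    then show ?thesis using l C by (simp add: D_def)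
  qed
  have "len M N \<le> len (dl d N) (dl d M)" by (rule le) fact+
  moreover have "len (dl d N) (dl d M) \<le> len (dl d (dl d M)) (dl d (dl d N))"
    using assms by (intro le lat_dl[OF d] dl_antimono)
  ultimately show ?thesis using dl_dl[OF d] assms by simp
qed

lemma ri_dl:
  assumes d: "d * d' = 1" and "lat M" "lat N" shows "ri (dl d N) (dl d M) = ri M N"
proof -
  let ?W = "M \<inter> N"
  have W: "lat ?W" using assms lat_Int by blast
  have "ri M N = ri M ?W + ri ?W N" using assms W by (intro ri_trans)
  also have "ri M ?W = ri (dl d ?W) (dl d M)"
    using assms W lat_dl[OF d] by (simp add: ri_sub dl_antimono len_dl[OF d])
  also have "ri ?W N = - ri N ?W" using ri_sym assms W by blast
  also have "ri N ?W = ri (dl d ?W) (dl d N)"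
    using assms W lat_dl[OF d] by (simp add: ri_sub dl_antimono len_dl[OF d])
  also have "- ri (dl d ?W) (dl d N) = ri (dl d N) (dl d ?W)"
    using ri_sym[OF lat_dl[OF d W] lat_dl[OF d \<open>lat N\<close>]] by simp
  finally have "ri M N = ri (dl d ?W) (dl d M) + ri (dl d N) (dl d ?W)" .
  then show ?thesis using ri_trans[of "dl d N" "dl d ?W" "dl d M"] lat_dl[OF d] assms W by simp
qed

abbreviation "dual_lat \<equiv> dual av sc c"

lemma dual_eq_dl: "dual_lat M = dl c_inv M"
  by (simp add: dual_def dl_def pairing_def c_inv_def)

section \<open>The factors are discretely valued\<close>

text \<open>The coordinates in a lattice basis are Cauchy sequences in the complete field
  \<open>F\<close>.\<close>

lemma lat_complete:
  assumes M: "lat M" and X: "\<And>n. X (Suc n) - X n \<in> (*) (p ^ n) ` M"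
  shows "\<exists>x. \<forall>n. x - X n \<in> (*) (p ^ n) ` M"
proof -
  obtain B where B: "basis B" "B \<subseteq> M" "\<And>x. x \<in> M \<longleftrightarrow> (\<forall>b\<in>B. representation B x b \<in> val_ring av)"
    using lat_basis[OF M] by blast
  note Bd = basisD[OF B(1)]
  have pM: "x \<in> (*) (p ^ n) ` M \<longleftrightarrow> (\<forall>b\<in>B. av (representation B x b) \<le> (1 / real q) ^ n)" for x n
  proof -
    have "representation B x b = unif ^ n * representation B (p_inv ^ n * x) b" for b
    proof -
      have "x = sc (unif ^ n) (p_inv ^ n * x)"
        by (simp only: sc_unif_power mult.assoc[symmetric] p_power_inv mult_1)
      then have "representation B x b = representation B (sc (unif ^ n) (p_inv ^ n * x)) b" by simp
      then show ?thesis using representation_scale[OF Bd(2,3)] by simp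
    qed
    then have "av (representation B x b) = (1 / real q) ^ n * av (representation B (p_inv ^ n * x) b)" for b
      by (metis av_mult av_power av_unif)
    moreover have "(1 / real q) ^ n > 0" using q_ge_2 by simp
    ultimately have "av (representation B x b) \<le> (1 / real q) ^ n \<longleftrightarrow>
        representation B (p_inv ^ n * x) b \<in> val_ring av" for b
      by (simp add: val_ring_def mult_le_cancel_left1)
    then show ?thesis by (simp add: mem_mult_unit_iff[OF p_power_inv] B(3))
  qed
  let ?a = "\<lambda>b n. representation B (X n) b"
  let ?r = "1 / real q"
  have r: "0 < ?r" "?r < 1" using q_ge_2 by auto
  have diff: "av (?a b m - ?a b n) \<le> ?r ^ n" if b: "b \<in> B" and "n \<le> m" for b m n
    using \<open>n \<le> m\<close>
  proof (induction m rule: dec_induct)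
    case base then show ?case using r av_eq_0_iff[of 0] by simp
  next
    case (step m)
    have "av (?a b (Suc m) - ?a b m) \<le> ?r ^ m"
      using X[of m] b representation_diff[OF Bd(2,3,3)] by (simp add: pM)
    also have "\<dots> \<le> ?r ^ n" using step r by (intro power_decreasing) auto
    finally have "av ((?a b (Suc m) - ?a b m) + (?a b m - ?a b n)) \<le> ?r ^ n"
      using av_ultrametric[of "?a b (Suc m) - ?a b m" "?a b m - ?a b n"] step.IH by linarith
    then show ?case by simp
  qed
  have "\<forall>b\<in>B. \<exists>l. (\<lambda>n. av (?a b n - l)) \<longlonglongrightarrow> 0"
  proof
    fix b assume b: "b \<in> B"
    show "\<exists>l. (\<lambda>n. av (?a b n - l)) \<longlonglongrightarrow> 0"
    proof (rule av_complete, intro allI impI)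
      fix \<epsilon> :: real assume "\<epsilon> > 0"
      then obtain N where N: "?r ^ N < \<epsilon>" using real_arch_pow_inv[OF _ r(2)] by blast
      have "av (?a b m - ?a b n) < \<epsilon>" if "m \<ge> N" "n \<ge> N" for m n
      proof -
        have "av (?a b n - ?a b N) \<le> ?r ^ N" "av (?a b m - ?a b N) \<le> ?r ^ N"
          using diff[OF b] that by auto
        then have "av ((?a b m - ?a b N) + - (?a b n - ?a b N)) \<le> ?r ^ N"
          using av_ultrametric[of "?a b m - ?a b N" "- (?a b n - ?a b N)"]
            av_minus[of "?a b n - ?a b N"] by linarith
        moreover have "(?a b m - ?a b N) + - (?a b n - ?a b N) = ?a b m - ?a b n" by simp
        ultimately have "av (?a b m - ?a b n) \<le> ?r ^ N" by (simp only:)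
        then show ?thesis using N by simp
      qed
      then show "\<exists>N. \<forall>m\<ge>N. \<forall>n\<ge>N. av (?a b m - ?a b n) < \<epsilon>" by blast
    qed
  qed
  then obtain l where l: "\<And>b. b \<in> B \<Longrightarrow> (\<lambda>n. av (?a b n - l b)) \<longlonglongrightarrow> 0" by metis
  let ?x = "\<Sum>b\<in>B. sc (l b) b"
  have "?x - X n \<in> (*) (p ^ n) ` M" for n
    unfolding pM
  proof
    fix b assume b: "b \<in> B"
    have "eventually (\<lambda>m. av (?a b m - l b) < ?r ^ n) sequentially"
      using order_tendstoD(2)[OF l[OF b]] r by simp
    then obtain N where N: "\<forall>m\<ge>N. av (?a b m - l b) < ?r ^ n" by (auto simp: eventually_sequentially)
    define m where "m = max N n"
    have "av (?a b m - l b) < ?r ^ n" using N by (simp add: m_def)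
    then have 1: "av (- (?a b m - l b)) \<le> ?r ^ n" using av_minus[of "?a b m - l b"] by linarith
    have 2: "av (?a b m - ?a b n) \<le> ?r ^ n" using diff[OF b] by (simp add: m_def)
    have "av (- (?a b m - l b) + (?a b m - ?a b n)) \<le> ?r ^ n"
      using av_ultrametric[of "- (?a b m - l b)" "?a b m - ?a b n"] 1 2 by linarith
    moreover have "representation B (?x - X n) b = - (?a b m - l b) + (?a b m - ?a b n)"
      using representation_diff[OF Bd(2,3,3)] representation_sum_basis[OF B(1) b] by simp
    ultimately show "av (representation B (?x - X n) b) \<le> ?r ^ n" by simp
  qed
  then show ?thesis by blast
qed

lemma p_A: "x \<in> A \<Longrightarrow> p * x \<in> A"
  by (rule osub_p[OF osub_A])

lemma A_diff: "x \<in> A \<Longrightarrow> y \<in> A \<Longrightarrow> x - y \<in> A"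
  by (rule osub_diff[OF osub_A])

lemma of_nat_A: "of_nat n \<in> A"
  using of_nat_R R_subset_A by blast

lemma numeral_A: "numeral n \<in> A"
  using of_nat_A[of "numeral n"] by simp

lemma A_no_line: "(\<And>m. p_inv ^ m * y \<in> A) \<Longrightarrow> y = 0"
  by (rule lat_no_line[OF lat_A])

text \<open>Newton iteration for \<open>X\<^sup>2 - X\<close>. This is where completeness enters; it makes each factor local.\<close>

lemma idempotent_lift:
  assumes f: "f \<in> A" and ff: "p_inv * (f * f - f) \<in> A"
  shows "\<exists>g\<in>A. g * g = g \<and> p_inv * (g - f) \<in> A"
proof -
  \<comment> \<open>As \<open>(2 * h - 1)^2 = 1 + 4 * (h * h - h)\<close>, the derivative
    \<open>2 * h - 1\<close> is its own inverse up to the error, and the Newton step becomes the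
    polynomial \<open>h - (h * h - h) * (2 * h - 1)\<close>.\<close>
  define X where "X = rec_nat f (\<lambda>_ h. 3 * h * h - 2 * h * h * h)"
  have X0: "X 0 = f" and XS: "X (Suc n) = 3 * X n * X n - 2 * X n * X n * X n" for n
    by (simp_all add: X_def)
  have XA: "X n \<in> A" for n
    by (induction n) (auto simp: X0 XS f intro!: A_diff A_mult numeral_A)
  have idem: "p_inv ^ Suc n * (X n * X n - X n) \<in> A" for n
  proof (induction n)
    case 0 then show ?case using ff by (simp add: X0)
  next
    case (Suc n)
    let ?h = "X n" and ?d = "p_inv ^ Suc n * (X n * X n - X n)"
    have "X (Suc n) * X (Suc n) - X (Suc n)
        = (?h * ?h - ?h) * (?h * ?h - ?h) * (4 * ?h * ?h - 4 * ?h - 3)"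
      unfolding XS by (simp add: algebra_simps)
    then have "p_inv ^ Suc (Suc n) * (X (Suc n) * X (Suc n) - X (Suc n))
        = p_inv ^ Suc (Suc n) * ((?h * ?h - ?h) * (?h * ?h - ?h) * (4 * ?h * ?h - 4 * ?h - 3))" by simp
    also have "\<dots> = p ^ n * p_inv ^ n * \<dots>" by (simp add: p_power_inv)
    also have "\<dots> = p ^ n * (?d * ?d * (4 * ?h * ?h - 4 * ?h - 3))"
      by (simp add: power_add ac_simps)
    also have "\<dots> \<in> A"
      by (intro osub_p_power[OF osub_A] A_mult A_diff numeral_A XA Suc.IH)
    finally show ?case .
  qed
  have step: "X (Suc n) - X n \<in> (*) (p ^ n) ` (*) p ` A" for n
  proof -
    have "X (Suc n) - X n = (X n * X n - X n) * (1 - 2 * X n)" unfolding XS by (simp add: algebra_simps)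
    then have "p_inv ^ Suc n * (X (Suc n) - X n) = (p_inv ^ Suc n * (X n * X n - X n)) * (1 - 2 * X n)"
      by (simp add: ac_simps)
    also have "\<dots> \<in> A" by (intro A_mult idem A_diff one_A numeral_A XA)
    finally have "p_inv * (p_inv ^ n * (X (Suc n) - X n)) \<in> A" by (simp add: ac_simps)
    then show ?thesis unfolding mem_mult_unit_iff[OF p_power_inv] mem_mult_unit_iff[OF p_p_inv] .
  qed
  have "lat ((*) p ` A)" by (rule lat_scale[OF lat_A p_p_inv])
  from lat_complete[OF this step] obtain g where "\<forall>n. g - X n \<in> (*) (p ^ n) ` (*) p ` A" by blast
  then have g: "p_inv * (p_inv ^ n * (g - X n)) \<in> A" for n
    unfolding mem_mult_unit_iff[OF p_power_inv] mem_mult_unit_iff[OF p_p_inv] by blast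
  have gf: "p_inv * (g - f) \<in> A" using g[of 0] by (simp add: X0)
  have gA: "g \<in> A"
  proof -
    have "p * (p_inv * (g - f)) \<in> A" by (rule p_A[OF gf])
    then have "g - f \<in> A" by (simp add: mult.assoc[symmetric] p_p_inv)
    then show ?thesis using A_add[OF _ f] by force
  qed
  have "g * g - g = 0"
  proof (rule A_no_line)
    fix m
    have 1: "p_inv ^ m * (g - X m) \<in> A" using p_A[OF g[of m]] by (simp add: mult.assoc[symmetric] p_p_inv)
    have 2: "p_inv ^ m * (X m * X m - X m) \<in> A"
      using p_A[OF idem[of m]] by (simp add: mult.assoc[symmetric] p_p_inv)
    have "p_inv ^ m * (g * g - g) = (p_inv ^ m * (g - X m)) * (g + X m - 1) + p_inv ^ m * (X m * X m - X m)"
      by (simp add: algebra_simps)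
    also have "\<dots> \<in> A" by (intro A_add[OF _ 2] A_mult[OF 1] A_diff A_add gA XA one_A)
    finally show "p_inv ^ m * (g * g - g) \<in> A" .
  qed
  then show ?thesis using gA gf by auto
qed

text \<open>Regularity gives a quasi-inverse \<open>t\<close> and an idempotent \<open>h\<close>
  killed by \<open>1 + p * y\<close>. On \<open>h\<close>, division by \<open>p\<close> is
  multiplication by \<open>- y\<close>, so \<open>h\<close> stays integral under all such divisions
  and vanishes; hence \<open>t\<close> is an inverse.\<close>

lemma one_plus_p_unit:
  assumes y: "y \<in> A" shows "\<exists>v\<in>A. (1 + p * y) * v = 1"
proof -
  let ?u = "1 + p * y"
  obtain t where t: "?u * ?u * t = ?u" using regular by blast
  define h where "h = 1 - ?u * t"
  have uh: "?u * h = 0" using t by (simp add: h_def algebra_simps)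
  have hh: "h * h = h"
  proof -
    have "h * h = h - (?u * h) * t" unfolding h_def by (simp add: algebra_simps)
    then show ?thesis using uh by simp
  qed
  have hA: "h \<in> A" by (rule idem_A[OF hh])
  have ph: "p_inv * h = - y * h"
  proof -
    have "h = - (p * y * h)" using uh by (simp add: distrib_right eq_neg_iff_add_eq_0)
    then have "p_inv * h = - ((p * p_inv) * (y * h))"
      by (metis mult.assoc mult.commute mult_minus_right)
    then show ?thesis by (simp add: p_p_inv)
  qed
  have "p_inv ^ m * h = (- y) ^ m * h" for m
  proof (induction m)
    case (Suc m)
    have "p_inv ^ Suc m * h = p_inv ^ m * (p_inv * h)" by (simp add: ac_simps)
    also have "\<dots> = (- y) * (p_inv ^ m * h)" unfolding ph by (simp add: ac_simps)
    also have "\<dots> = (- y) ^ Suc m * h" unfolding Suc by (simp only: power_Suc mult.assoc)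
    finally show ?case .
  qed simp
  moreover have "(- y) ^ m * h \<in> A" for m
    by (intro A_mult A_power hA osub_minus[OF osub_A] y)
  ultimately have "h = 0" by (intro A_no_line) simp
  then have ut: "?u * t = 1" by (simp add: h_def)
  \<comment> \<open>Rewriting \<open>(1 + p * y) * t = 1\<close> removes one power of
    \<open>p\<close> at a time from the denominator of \<open>t\<close>.\<close>
  have down: "p ^ j * t \<in> A" if "p ^ Suc j * t \<in> A" for j
  proof -
    have "p ^ j * (?u * t) = p ^ j" by (simp only: ut mult_1_right)
    then have "p ^ j * t = p ^ j - y * (p ^ Suc j * t)" by (simp add: algebra_simps)
    also have "\<dots> \<in> A" using that y p_power_R R_subset_A by (intro A_diff A_mult[of y]) auto
    finally show ?thesis .
  qed
  obtain k where "p ^ k * t \<in> A" using lat_clears[OF lat_A] by blast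
  then have "p ^ 0 * t \<in> A"
  proof (induction k)
    case (Suc k) then show ?case using down by blast
  qed
  then show ?thesis using ut by auto
qed

section \<open>The ring of integers of each factor is local\<close>

abbreviation "integ e \<equiv> A \<inter> factor e"

definition unit_in :: "'e \<Rightarrow> 'e \<Rightarrow> bool" where
  "unit_in e x \<longleftrightarrow> x \<in> integ e \<and> (\<exists>y\<in>integ e. x * y = e)"

definition nonunits :: "'e \<Rightarrow> 'e set" where
  "nonunits e = {x \<in> integ e. \<not> unit_in e x}"

lemma factor_max_ideal_eq: "factor_max_ideal av sc e = nonunits e"
  by (auto simp: factor_max_ideal_def nonunits_def unit_in_def factor_integers_eq)

lemma factor_mult1: "x \<in> factor e \<Longrightarrow> x * y \<in> factor e"
  by (simp add: factor_def mult.assoc[symmetric])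

lemma factor_mult2: "y \<in> factor e \<Longrightarrow> x * y \<in> factor e"
  using factor_mult1[of y e x] by (simp add: mult.commute)

lemma factor_add: "x \<in> factor e \<Longrightarrow> y \<in> factor e \<Longrightarrow> x + y \<in> factor e"
  and factor_diff: "x \<in> factor e \<Longrightarrow> y \<in> factor e \<Longrightarrow> x - y \<in> factor e"
  by (simp_all add: factor_def distrib_left right_diff_distrib)

lemma prim_in_factor: "e \<in> prim_idem \<Longrightarrow> e \<in> factor e"
  by (simp add: factor_def prim_idemD)

lemma prim_A: "e \<in> prim_idem \<Longrightarrow> e \<in> A"
  by (simp add: idem_A prim_idemD)

lemma prim_integ: "e \<in> prim_idem \<Longrightarrow> e \<in> integ e"
  by (simp add: prim_in_factor prim_A)

lemma integ_mult: "x \<in> integ e \<Longrightarrow> y \<in> integ e \<Longrightarrow> x * y \<in> integ e"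
  by (auto intro: A_mult factor_mult1)

lemma unit_in_factor_right: "unit_in e (x * y) \<Longrightarrow> x \<in> integ e \<Longrightarrow> y \<in> integ e \<Longrightarrow> unit_in e x"
  unfolding unit_in_def using integ_mult by (metis mult.assoc)

lemma unit_in_p_inv:
  assumes e: "e \<in> prim_idem" and x: "x \<in> integ e" and px: "p_inv * x \<in> A" shows "x \<in> nonunits e"
proof -
  have "\<not> unit_in e x"
  proof
    assume "unit_in e x"
    then obtain y where y: "y \<in> integ e" "x * y = e" by (auto simp: unit_in_def)
    have "p_inv * e \<in> A" using A_mult[OF px, of y] y by (simp add: mult.assoc)
    then have "(p_inv * e) ^ Suc m \<in> A" for m by (rule A_power)
    moreover have "e ^ Suc m = e" for m using prim_idemD(1)[OF e] by (induction m) auto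
    ultimately have *: "p_inv ^ Suc m * e \<in> A" for m by (simp only: power_mult_distrib)
    have "p_inv ^ m * e \<in> A" for m using *[of "m - 1"] prim_A[OF e] by (cases m) auto
    then show False using A_no_line prim_idemD(2)[OF e] by blast
  qed
  then show ?thesis using x by (simp add: nonunits_def)
qed

lemma p_inv_prim_notin: "e \<in> prim_idem \<Longrightarrow> p_inv * e \<notin> A"
  using unit_in_p_inv[of e e] prim_integ[of e] prim_idemD(1)[of e] by (auto simp: nonunits_def unit_in_def)

text \<open>Powers of \<open>x\<close> repeat modulo \<open>p A\<close>, so some power is idempotent
  there and lifts to an idempotent \<open>g\<close>. Primitivity leaves \<open>e * g = 0\<close>,
  which makes \<open>x\<close> nilpotent modulo \<open>p\<close>, or \<open>e * g = e\<close>, which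
  makes that power a unit.\<close>

lemma unit_or_nilpotent:
  assumes e: "e \<in> prim_idem" and x: "x \<in> integ e"
  shows "unit_in e x \<or> (\<exists>n. p_inv * x ^ Suc n \<in> A)"
proof -
  have xA: "x \<in> A" and xe: "e * x = x" using x by (auto simp: factor_def)
  have latpA: "lat ((*) p ` A)" by (rule lat_scale[OF lat_A p_p_inv])
  have "\<not> inj (\<lambda>i::nat. coset ((*) p ` A) (x ^ i))"
  proof
    assume "inj (\<lambda>i::nat. coset ((*) p ` A) (x ^ i))"
    then have "infinite (range (\<lambda>i::nat. coset ((*) p ` A) (x ^ i)))" by (simp add: finite_image_iff)
    moreover have "range (\<lambda>i::nat. coset ((*) p ` A) (x ^ i)) \<subseteq> coset ((*) p ` A) ` A"
      using A_power[OF xA] by auto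
    ultimately show False using lat_fin_idx[OF lat_A latpA] unfolding fin_idx_def by (meson finite_subset)
  qed
  then obtain a b where ab: "a < b" "coset ((*) p ` A) (x ^ a) = coset ((*) p ` A) (x ^ b)"
    unfolding inj_def by (metis linorder_neqE_nat)
  define d where "d = b - a"
  have "p_inv * (x ^ a - x ^ b) \<in> A"
    using ab coset_eq_iff[OF lat_add_subgroup[OF latpA]] mem_mult_unit_iff[OF p_p_inv] by blast
  then have base: "p_inv * (x ^ (a + d) - x ^ a) \<in> A"
    using osub_minus[OF osub_A, of "p_inv * (x ^ a - x ^ b)"] ab by (simp add: d_def algebra_simps)
  have per1: "p_inv * (x ^ (j + d) - x ^ j) \<in> A" if "j \<ge> a" for j
  proof -
    have "x ^ (j - a) * (p_inv * (x ^ (a + d) - x ^ a)) \<in> A" by (intro A_mult A_power xA base)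
    moreover have "x ^ (j - a) * (p_inv * (x ^ (a + d) - x ^ a)) = p_inv * (x ^ (j - a + (a + d)) - x ^ (j - a + a))"
      by (simp add: power_add right_diff_distrib ac_simps)
    ultimately show ?thesis using that by simp
  qed
  have per: "p_inv * (x ^ (j + m * d) - x ^ j) \<in> A" if "j \<ge> a" for j m
  proof (induction m)
    case 0 then show ?case using osub_0[OF osub_A] by simp
  next
    case (Suc m)
    have "p_inv * (x ^ (j + m * d + d) - x ^ (j + m * d)) \<in> A" using that by (intro per1) auto
    then have "p_inv * (x ^ (j + m * d + d) - x ^ (j + m * d)) + p_inv * (x ^ (j + m * d) - x ^ j) \<in> A"
      by (rule A_add[OF _ Suc.IH])
    then show ?case by (simp add: algebra_simps)
  qed
  \<comment> \<open>A multiple of the period \<open>d\<close> beyond the preperiod \<open>a\<close>,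
    so that \<open>x ^ (2 * n)\<close> and \<open>x ^ n\<close> agree modulo
    \<open>p\<close>.\<close>
  define n where "n = Suc a * d"
  have d: "d \<ge> 1" using ab by (simp add: d_def)
  then have "Suc a * 1 \<le> n" unfolding n_def by (intro mult_le_mono2)
  then have na: "n \<ge> a" "n \<ge> 1" by auto
  define f where "f = x ^ n"
  have n': "n = Suc (n - 1)" using na by simp
  have fA: "f \<in> A" unfolding f_def by (rule A_power[OF xA])
  have ef: "e * f = f" unfolding f_def using xe by (subst (1 2) n') (simp add: mult.assoc[symmetric])
  have "p_inv * (f * f - f) \<in> A"
    using per[OF na(1), of "Suc a"] unfolding f_def n_def[symmetric] by (simp add: power_add)
  then obtain g where g: "g \<in> A" "g * g = g" "p_inv * (g - f) \<in> A" using idempotent_lift[OF fA] by blast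
  have eg: "(e * g) * (e * g) = e * g" "e * (e * g) = e * g"
    using g(2) prim_idemD(1)[OF e] by (metis mult.assoc mult.commute)+
  have "p_inv * (e * g - f) = e * (p_inv * (g - f))"
    using ef by (simp add: right_diff_distrib mult.left_commute[of e])
  also have "\<dots> \<in> A" by (intro A_mult prim_A e g)
  finally have egf: "p_inv * (e * g - f) \<in> A" .
  consider "e * g = 0" | "e * g = e" using prim_idemD(3)[OF e eg] by blast
  then show ?thesis
  proof cases
    case 1
    then have "p_inv * f \<in> A" using osub_minus[OF osub_A egf] by simp
    then show ?thesis unfolding f_def using n' by metis
  next
    case 2
    define y where "y = p_inv * (f - e)"
    have yA: "y \<in> A" using osub_minus[OF osub_A egf] by (simp add: 2 y_def algebra_simps)
    have "1 + p * y = 1 + (f - e)" by (simp add: y_def mult.assoc[symmetric] p_p_inv)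
    then obtain v where v: "v \<in> A" "(1 + (f - e)) * v = 1" using one_plus_p_unit[OF yA] by metis
    have "e * (1 + (f - e)) = f" using ef prim_idemD(1)[OF e] by (simp add: algebra_simps)
    then have "f * (e * v) = e * e * ((1 + (f - e)) * v)" by (metis mult.assoc mult.left_commute mult.commute)
    then have fv: "f * (e * v) = e" using v prim_idemD(1)[OF e] by simp
    have "x * (x ^ (n - 1) * (e * v)) = f * (e * v)"
      unfolding f_def by (subst (2) n') (simp add: mult.assoc)
    then have "x * (x ^ (n - 1) * (e * v)) = e" using fv by simp
    moreover have "x ^ (n - 1) * (e * v) \<in> integ e"
      using v(1) prim_A[OF e] prim_in_factor[OF e]
      by (intro IntI A_mult A_power xA factor_mult2 factor_mult1) auto
    ultimately show ?thesis using x by (auto simp: unit_in_def)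
  qed
qed

section \<open>Uniformizers and principal ideals\<close>

lemma nonunits_A: "x \<in> nonunits e \<Longrightarrow> x \<in> A"
  and nonunits_factor: "x \<in> nonunits e \<Longrightarrow> e * x = x"
  and nonunits_integ: "x \<in> nonunits e \<Longrightarrow> x \<in> integ e"
  by (auto simp: nonunits_def factor_def)

lemma nonunits_nilpotent:
  "e \<in> prim_idem \<Longrightarrow> x \<in> nonunits e \<Longrightarrow> \<exists>n. p_inv * x ^ Suc n \<in> A"
  using unit_or_nilpotent by (auto simp: nonunits_def)

lemma nonunits_mult:
  assumes "x \<in> nonunits e" "y \<in> integ e" shows "x * y \<in> nonunits e"
proof -
  have "x * y \<in> integ e" using integ_mult nonunits_integ assms by blast
  moreover have "\<not> unit_in e (x * y)"
    using unit_in_factor_right nonunits_integ[OF assms(1)] assms by (auto simp: nonunits_def)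
  ultimately show ?thesis by (simp add: nonunits_def)
qed

lemma nonunits_mult_A:
  assumes "x \<in> nonunits e" "y \<in> A" and e: "e \<in> prim_idem" shows "x * y \<in> nonunits e"
proof -
  have "x * y = x * (e * y)"
    using nonunits_factor[OF assms(1)] by (metis mult.assoc mult.commute)
  moreover have "e * y \<in> integ e" using assms e by (auto intro: A_mult prim_A factor_mult1 prim_in_factor)
  ultimately show ?thesis using nonunits_mult[OF assms(1)] by metis
qed

text \<open>Since \<open>s\<close> is nilpotent modulo \<open>p\<close>, a finite geometric series
  times \<open>1 - s\<close> lies in \<open>1 + p A\<close>, which consists of units.\<close>

lemma one_minus_nonunit:
  assumes e: "e \<in> prim_idem" and s: "s \<in> nonunits e" shows "unit_in e (e - s)"
proof -
  obtain n where n: "p_inv * s ^ Suc n \<in> A" using nonunits_nilpotent[OF e s] by blast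
  have sA: "s \<in> A" and es: "e * s = s" using s nonunits_A nonunits_factor by auto
  define y where "y = - (p_inv * s ^ Suc n)"
  have yA: "y \<in> A" unfolding y_def by (rule osub_minus[OF osub_A n])
  have "1 + p * y = 1 - s ^ Suc n" by (simp add: y_def mult.assoc[symmetric] p_p_inv)
  also have "\<dots> = (1 - s) * (\<Sum>i<Suc n. s ^ i)" by (rule one_diff_power_eq)
  finally have geo: "1 + p * y = (1 - s) * (\<Sum>i<Suc n. s ^ i)" .
  obtain v where v: "v \<in> A" "(1 + p * y) * v = 1" using one_plus_p_unit[OF yA] by blast
  define w where "w = (\<Sum>i<Suc n. s ^ i) * v"
  have wA: "w \<in> A" unfolding w_def using v by (intro A_mult osub_sum osub_A A_power sA)
  have "(1 - s) * w = 1" using v by (simp only: geo w_def mult.assoc)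
  then have "e * ((1 - s) * w) = e" by simp
  moreover have "(e - s) * (e * w) = e * ((1 - s) * w)"
    using es prim_idemD(1)[OF e] by (simp add: left_diff_distrib mult.assoc[symmetric] mult.commute[of s e] right_diff_distrib)
  ultimately have "(e - s) * (e * w) = e" by simp
  moreover have "e * w \<in> integ e" using wA by (auto intro: A_mult prim_A[OF e] factor_mult1 prim_in_factor[OF e])
  moreover have "e - s \<in> integ e"
    using prim_integ[OF e] nonunits_integ[OF s] by (auto intro: A_diff factor_diff)
  ultimately show ?thesis unfolding unit_in_def by blast
qed

lemma nonunits_add:
  assumes e: "e \<in> prim_idem" and x: "x \<in> nonunits e" and y: "y \<in> nonunits e"
  shows "x + y \<in> nonunits e"
proof -
  have xy: "x + y \<in> integ e"
    using nonunits_integ[OF x] nonunits_integ[OF y] by (auto intro: A_add factor_add)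
  moreover have "\<not> unit_in e (x + y)"
  proof
    assume "unit_in e (x + y)"
    then obtain w where w: "w \<in> integ e" "(x + y) * w = e" by (auto simp: unit_in_def)
    have "unit_in e (e - x * w)" by (rule one_minus_nonunit[OF e nonunits_mult[OF x w(1)]])
    moreover have "e - x * w = y * w" using w(2) by (simp add: algebra_simps)
    moreover have "y * w \<in> nonunits e" by (rule nonunits_mult[OF y w(1)])
    ultimately show False by (simp add: nonunits_def)
  qed
  ultimately show ?thesis by (simp add: nonunits_def)
qed

lemma p_integ_nonunit: assumes e: "e \<in> prim_idem" and z: "z \<in> integ e" shows "p * z \<in> nonunits e"
proof (rule unit_in_p_inv[OF e])
  show "p * z \<in> integ e" using z by (auto intro: p_A factor_mult2)
  show "p_inv * (p * z) \<in> A" using z by (simp add: mult.assoc[symmetric] mult.commute[of p_inv] p_p_inv)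
qed

text \<open>Filling up the other factors with all of \<open>A\<close> turns the maximal ideal of one
  factor into a full lattice of \<open>E\<close>, to which \<open>stable_imp_A\<close>
  applies.\<close>

lemma osub_nonunits_preimage:
  assumes e: "e \<in> prim_idem" shows "osub {z \<in> A. e * z \<in> nonunits e}"
proof (rule OF_submodule_def[THEN iffD2], intro conjI ballI)
  have "p * 0 \<in> nonunits e"
    using osub_0[OF osub_A] by (intro p_integ_nonunit[OF e]) (simp add: factor_def)
  then show "0 \<in> {z \<in> A. e * z \<in> nonunits e}" using osub_0[OF osub_A] by simp
  show "x + y \<in> {z \<in> A. e * z \<in> nonunits e}"
    if "x \<in> {z \<in> A. e * z \<in> nonunits e}" "y \<in> {z \<in> A. e * z \<in> nonunits e}" for x y
    using that nonunits_add[OF e] by (auto simp: distrib_left A_add)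
  fix a x assume "a \<in> val_ring av" "x \<in> {z \<in> A. e * z \<in> nonunits e}"
  then have x: "x \<in> A" "e * x \<in> nonunits e" "sc a 1 \<in> A" using osub_sc[OF osub_A _ one_A] by auto
  have "e * sc a x = (e * x) * sc a 1" by (subst sc_eq_mult) (simp add: ac_simps)
  then show "sc a x \<in> {z \<in> A. e * z \<in> nonunits e}"
    using x nonunits_mult_A[OF x(2,3) e] osub_sc[OF osub_A \<open>a \<in> val_ring av\<close>] by auto
qed

text \<open>An element that generates a minimal ideal of the local ring \<open>e A / p A\<close>: its annihilator is chosen
  maximal.\<close>

lemma socle_element:
  assumes e: "e \<in> prim_idem"
  shows "\<exists>b\<in>integ e. p_inv * b \<notin> A \<and> (\<forall>x\<in>nonunits e. p_inv * (b * x) \<in> A)"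
proof -
  define ann where "ann b = {y \<in> A. p_inv * (b * y) \<in> A}" for b
  let ?G = "ann ` {b \<in> integ e. p_inv * b \<notin> A}"
  have latpA: "lat ((*) p ` A)" by (rule lat_scale[OF lat_A p_p_inv])
  have "?G \<subseteq> {N. osub N \<and> (*) p ` A \<subseteq> N \<and> N \<subseteq> A}"
  proof safe
    fix b assume b: "b \<in> A"
    have "osub (A \<inter> {y. (p_inv * b) * y \<in> A})" by (intro osub_Int osub_A osub_vimage_mult)
    moreover have "ann b = A \<inter> {y. (p_inv * b) * y \<in> A}" by (auto simp: ann_def mult.assoc)
    ultimately show "osub (ann b)" by simp
    show "p * z \<in> ann b" if "z \<in> A" for z
    proof -
      have "p_inv * (b * (p * z)) = (p * p_inv) * (b * z)" by (simp only: ac_simps)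
      then show ?thesis using that b by (simp add: ann_def p_A p_p_inv A_mult)
    qed
  qed (auto simp: ann_def)
  then have "finite ?G" by (rule finite_subset) (rule lat_finite_intermediate[OF lat_A latpA])
  moreover have "?G \<noteq> {}" using prim_integ[OF e] p_inv_prim_notin[OF e] by blast
  ultimately obtain N where N: "N \<in> ?G" "\<forall>M\<in>?G. N \<subseteq> M \<longrightarrow> N = M"
    using finite_has_maximal[of ?G] by blast
  then obtain b where b: "b \<in> integ e" "p_inv * b \<notin> A" "N = ann b" by auto
  have "p_inv * (b * x) \<in> A" if x: "x \<in> nonunits e" for x
  proof (rule ccontr)
    assume bx: "p_inv * (b * x) \<notin> A"
    have bA: "b \<in> A" using b by simp
    have xA: "x \<in> A" and xi: "x \<in> integ e" using nonunits_A[OF x] nonunits_integ[OF x] by auto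
    obtain n where n: "p_inv * x ^ Suc n \<in> A" using nonunits_nilpotent[OF e x] by blast
    define j where "j = (LEAST j. p_inv * (b * x ^ Suc j) \<in> A)"
    have "p_inv * (b * x ^ Suc n) \<in> A"
      using A_mult[OF bA n] by (simp only: mult.left_commute[of p_inv b])
    then have j: "p_inv * (b * x ^ Suc j) \<in> A" unfolding j_def by (rule LeastI)
    have "j \<noteq> 0" using j bx by (cases j) auto
    then obtain i where i: "j = Suc i" by (cases j) auto
    have ni: "p_inv * (b * x ^ Suc i) \<notin> A"
      using not_less_Least[of i "\<lambda>j. p_inv * (b * x ^ Suc j) \<in> A"] i j_def by auto
    let ?b = "b * x ^ Suc i"
    have "?b \<in> integ e" using b(1) xA by (auto intro: A_mult A_power factor_mult1)
    then have "ann ?b \<in> ?G" using ni by blast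
    moreover have "ann b \<subseteq> ann ?b"
    proof
      fix y assume y: "y \<in> ann b"
      have "p_inv * (?b * y) = x ^ Suc i * (p_inv * (b * y))" by (simp only: ac_simps)
      also have "\<dots> \<in> A" using y by (intro A_mult[OF A_power[OF xA]]) (simp add: ann_def)
      finally show "y \<in> ann ?b" using y by (simp add: ann_def)
    qed
    ultimately have "ann b = ann ?b" using N b by blast
    moreover have "x \<in> ann ?b" using j xA by (simp add: ann_def i ac_simps)
    moreover have "x \<notin> ann b" using bx by (simp add: ann_def)
    ultimately show False by simp
  qed
  then show ?thesis using b by blast
qed

text \<open>With \<open>b\<close> from \<open>socle_element\<close> and \<open>y = b / p\<close>, the set \<open>y \<mm>\<close> consists of integers. It is not
  contained in the maximal ideal \<open>\<mm>\<close>, since otherwise \<open>y\<close> would be an integer; so \<open>y x\<close> is a unit for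
  some \<open>x \<in> \<mm>\<close>, and then \<open>x\<close> generates \<open>\<mm>\<close>.\<close>

lemma nonunits_principal:
  assumes e: "e \<in> prim_idem" shows "\<exists>x\<in>nonunits e. \<forall>z\<in>nonunits e. \<exists>w\<in>integ e. z = x * w"
proof -
  obtain b where b: "b \<in> integ e" "p_inv * b \<notin> A" "\<And>x. x \<in> nonunits e \<Longrightarrow> p_inv * (b * x) \<in> A"
    using socle_element[OF e] by blast
  define y where "y = p_inv * b"
  have yx: "y * x \<in> integ e" if "x \<in> nonunits e" for x
    using b(3)[OF that] nonunits_integ[OF that] by (auto simp: y_def mult.assoc intro: factor_mult2)
  have "\<exists>x\<in>nonunits e. unit_in e (y * x)"
  proof (rule ccontr)
    assume "\<not> ?thesis"
    then have "\<not> unit_in e (y * x)" if "x \<in> nonunits e" for x using that by blast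
    then have st: "y * x \<in> nonunits e" if "x \<in> nonunits e" for x
      using that yx[OF that] unfolding nonunits_def[of e] by blast
    let ?M = "{z \<in> A. e * z \<in> nonunits e}"
    have "lat ?M"
    proof (rule lat_between[OF osub_nonunits_preimage[OF e] lat_scale[OF lat_A p_p_inv] lat_A])
      show "(*) p ` A \<subseteq> ?M"
      proof safe
        fix z assume z: "z \<in> A"
        then show "p * z \<in> A" by (rule p_A)
        have "e * z \<in> integ e" using z by (auto intro: A_mult prim_A[OF e] factor_mult1 prim_in_factor[OF e])
        then show "e * (p * z) \<in> nonunits e"
          using p_integ_nonunit[OF e, of "e * z"] by (simp add: mult.left_commute)
      qed
    qed auto
    moreover have "y * m \<in> ?M" if m: "m \<in> ?M" for m
    proof -
      have "e * y = y" using b(1) by (simp add: y_def factor_def mult.left_commute[of e])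
      then have "y * m = y * (e * m)" by (metis mult.assoc mult.commute)
      moreover have "e * (y * m) = y * m" using \<open>e * y = y\<close> by (simp add: mult.assoc[symmetric])
      ultimately show ?thesis using st[of "e * m"] m nonunits_A by auto
    qed
    ultimately have "y \<in> A" by (rule stable_imp_A)
    then show False using b(2) by (simp add: y_def)
  qed
  then obtain x where x: "x \<in> nonunits e" "unit_in e (y * x)" by blast
  then obtain v where v: "v \<in> integ e" "(y * x) * v = e" by (auto simp: unit_in_def)
  have "\<exists>w\<in>integ e. z = x * w" if z: "z \<in> nonunits e" for z
  proof -
    have "z = (y * x * v) * z" using nonunits_factor[OF z] v(2) by simp
    also have "\<dots> = x * (v * (y * z))" by (simp only: ac_simps)
    finally have "z = x * (v * (y * z))" .
    moreover have "v * (y * z) \<in> integ e" by (rule integ_mult[OF v(1) yx[OF z]])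
    ultimately show ?thesis by blast
  qed
  then show ?thesis using x by blast
qed

definition ufm :: "'e \<Rightarrow> 'e" where
  "ufm e = (SOME x. x \<in> nonunits e \<and> (\<forall>z\<in>nonunits e. \<exists>w\<in>integ e. z = x * w))"

lemma ufm_nonunit: "e \<in> prim_idem \<Longrightarrow> ufm e \<in> nonunits e"
  and ufm_dvd: "e \<in> prim_idem \<Longrightarrow> z \<in> nonunits e \<Longrightarrow> \<exists>w\<in>integ e. z = ufm e * w"
proof -
  assume e: "e \<in> prim_idem"
  have "\<exists>x. x \<in> nonunits e \<and> (\<forall>z\<in>nonunits e. \<exists>w\<in>integ e. z = x * w)"
    using nonunits_principal[OF e] by blast
  from someI_ex[OF this] show "ufm e \<in> nonunits e" "z \<in> nonunits e \<Longrightarrow> \<exists>w\<in>integ e. z = ufm e * w"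
    unfolding ufm_def by blast+
qed

lemma ufm_A: "e \<in> prim_idem \<Longrightarrow> ufm e \<in> A"
  and ufm_factor: "e \<in> prim_idem \<Longrightarrow> e * ufm e = ufm e"
  by (rule nonunits_A[OF ufm_nonunit], assumption) (rule nonunits_factor[OF ufm_nonunit])

text \<open>Some power of \<open>ufm e\<close> is divisible by \<open>p\<close>, so an element
  divisible by all powers of \<open>ufm e\<close> is divisible by all powers of \<open>p\<close> and
  vanishes. At the last exponent the cofactor lies outside the maximal ideal.\<close>

lemma integ_decomp:
  assumes e: "e \<in> prim_idem" and z: "z \<in> integ e" "z \<noteq> 0"
  shows "\<exists>k u. unit_in e u \<and> z = ufm e ^ k * u"
proof -
  obtain n where n: "p_inv * ufm e ^ Suc n \<in> A" using nonunits_nilpotent[OF e ufm_nonunit[OF e]] by blast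
  let ?S = "{k. \<exists>w\<in>integ e. z = ufm e ^ k * w}"
  have ex: "\<exists>k. k \<notin> ?S"
  proof (rule ccontr)
    assume "\<not> ?thesis"
    then have all: "\<exists>w\<in>integ e. z = ufm e ^ k * w" for k by blast
    have "p_inv ^ m * z \<in> A" for m
    proof -
      obtain w where w: "w \<in> integ e" "z = ufm e ^ (Suc n * m) * w" using all by blast
      have "p_inv ^ m * z = (p_inv * ufm e ^ Suc n) ^ m * w"
        unfolding w(2) by (simp only: power_mult power_mult_distrib mult.assoc)
      then show ?thesis using w n by (auto intro: A_mult A_power)
    qed
    then show False using A_no_line z by blast
  qed
  define k where "k = (LEAST k. k \<notin> ?S)"
  have k: "k \<notin> ?S" unfolding k_def using ex by (rule LeastI_ex)
  have "0 \<in> ?S" using z by auto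
  then have "k \<noteq> 0" using k by metis
  then obtain j where j: "k = Suc j" by (cases k) auto
  then have "j \<in> ?S" using not_less_Least[of j "\<lambda>k. k \<notin> ?S"] k_def by auto
  then obtain w where w: "w \<in> integ e" "z = ufm e ^ j * w" by blast
  have "unit_in e w"
  proof (rule ccontr)
    assume "\<not> unit_in e w"
    then have "w \<in> nonunits e" using w by (simp add: nonunits_def)
    then obtain v where "v \<in> integ e" "w = ufm e * v" using ufm_dvd[OF e] by blast
    then have "z = ufm e ^ k * v" using w j by (simp add: ac_simps)
    then show False using k \<open>v \<in> integ e\<close> by blast
  qed
  then show ?thesis using w by blast
qed

text \<open>After clearing denominators by the common \<open>p ^ (i + j)\<close>, the exponents of
  \<open>ufm e\<close> decide which element divides the other.\<close>

lemma factor_dichotomy: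
  assumes e: "e \<in> prim_idem" and y: "y \<in> factor e" "y \<noteq> 0" and z: "z \<in> factor e" "z \<noteq> 0"
  shows "(\<exists>w\<in>integ e. y = z * w) \<or> (\<exists>w\<in>integ e. z = y * w)"
proof -
  obtain i where i: "p ^ i * y \<in> A" using lat_clears[OF lat_A] by blast
  obtain j where j: "p ^ j * z \<in> A" using lat_clears[OF lat_A] by blast
  let ?P = "p ^ (i + j)"
  have inv: "x = x'" if "?P * x = ?P * x'" for x x'
    using that by (metis injD inj_mult_unit p_power_inv)
  have yA: "?P * y \<in> integ e" "?P * z \<in> integ e"
    using osub_p_power[OF osub_A i, of j] osub_p_power[OF osub_A j, of i] y z
    by (auto simp: power_add ac_simps intro: factor_mult1 factor_mult2)
  have "?P * y \<noteq> ?P * 0" "?P * z \<noteq> ?P * 0" using inv[of y 0] inv[of z 0] y z by auto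
  then have "?P * y \<noteq> 0" "?P * z \<noteq> 0" by auto
  then obtain k u l v where ku: "unit_in e u" "?P * y = ufm e ^ k * u"
    and lv: "unit_in e v" "?P * z = ufm e ^ l * v"
    using integ_decomp[OF e] yA by metis
  have main: "\<exists>w\<in>integ e. y = z * w"
    if "l \<le> k" and ku: "unit_in e u" "?P * y = ufm e ^ k * u" and lv: "unit_in e v" "?P * z = ufm e ^ l * v"
    for k u l v y z
  proof -
    obtain v' where v': "v' \<in> integ e" "v * v' = e" using lv by (auto simp: unit_in_def)
    have eu: "e * u = u" "u \<in> integ e" using ku by (auto simp: unit_in_def factor_def)
    define w where "w = ufm e ^ (k - l) * u * v'"
    have w: "w \<in> integ e"
      unfolding w_def using eu v' ufm_A[OF e] by (auto intro!: A_mult A_power factor_mult2)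
    have "?P * (z * w) = (ufm e ^ l * ufm e ^ (k - l)) * (u * (v * v'))"
      using lv(2) unfolding w_def by (simp only: mult.assoc[symmetric]) (simp only: ac_simps)
    also have "\<dots> = ufm e ^ k * u"
      using \<open>l \<le> k\<close> eu by (simp add: power_add[symmetric] v'(2) mult.commute[of u e])
    finally have "y = z * w" using ku(2) inv by metis
    then show ?thesis using w by blast
  qed
  show ?thesis
    using main[of l k u y v z] main[of k l v z u y] ku lv by (cases "l \<le> k") auto
qed

text \<open>An element with the least exponent of \<open>ufm e\<close> generates the component of
  \<open>N\<close> at \<open>e\<close>. Exponents are taken after multiplication by
  \<open>p ^ j\<close>, which makes them natural numbers.\<close>

lemma module_generator:
  assumes N: "lat N" and AN: "\<And>a x. a \<in> A \<Longrightarrow> x \<in> N \<Longrightarrow> a * x \<in> N" and e: "e \<in> prim_idem"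
  shows "\<exists>a\<in>N. e * a = a \<and> a \<noteq> 0 \<and> (\<forall>z\<in>N. \<exists>w\<in>A. e * z = a * w)"
proof -
  obtain j where j: "\<forall>x\<in>N. p ^ j * x \<in> A" using lat_commensurable[OF N lat_A] by blast
  obtain i where i: "p ^ i * e \<in> N" using lat_clears[OF N] by blast
  have inv: "x = x'" if "p ^ k * x = p ^ k * x'" for x x' k
    using that by (metis injD inj_mult_unit p_power_inv)
  let ?Q = "\<lambda>k. \<exists>a u. a \<in> N \<and> e * a = a \<and> unit_in e u \<and> p ^ j * a = ufm e ^ k * u"
  have dec: "\<exists>k u. unit_in e u \<and> p ^ j * a = ufm e ^ k * u" if "a \<in> N" "e * a = a" "a \<noteq> 0" for a
  proof (rule integ_decomp[OF e])
    show "p ^ j * a \<in> integ e" using that j by (auto simp: factor_def mult.left_commute[of e])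
    show "p ^ j * a \<noteq> 0" using inv[of j a 0] that by auto
  qed
  have "p ^ i * e \<noteq> 0" using inv[of i e 0] prim_idemD(2)[OF e] by auto
  moreover have "e * (p ^ i * e) = p ^ i * e" using prim_idemD(1)[OF e] by (simp add: mult.left_commute[of e])
  ultimately have "\<exists>k. ?Q k" using dec[OF i] i by blast
  define k where "k = (LEAST k. ?Q k)"
  have "?Q k" unfolding k_def using \<open>\<exists>k. ?Q k\<close> by (rule LeastI_ex)
  then obtain a u where a: "a \<in> N" "e * a = a" "unit_in e u" "p ^ j * a = ufm e ^ k * u" by blast
  obtain u' where u': "u' \<in> integ e" "u * u' = e" using a by (auto simp: unit_in_def)
  have "u \<noteq> 0" using u' prim_idemD(2)[OF e] by auto
  \<comment> \<open>The least exponent alone does not exclude \<open>a = 0\<close>. In that case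
    \<open>ufm e ^ k * e\<close> would vanish, and with it every element of \<open>N\<close> in the
    factor, as exponents of nonzero elements are at least \<open>k\<close>.\<close>
  have "a \<noteq> 0"
  proof
    assume "a = 0"
    then have z: "ufm e ^ k * u = 0" using a by simp
    obtain b where "b \<in> N" "e * b = b" "b \<noteq> 0"
      using i \<open>p ^ i * e \<noteq> 0\<close> \<open>e * (p ^ i * e) = p ^ i * e\<close> by blast
    then obtain l v where lv: "unit_in e v" "p ^ j * b = ufm e ^ l * v" using dec by blast
    then have "?Q l" using \<open>b \<in> N\<close> \<open>e * b = b\<close> by blast
    then have "k \<le> l" unfolding k_def by (rule Least_le)
    have "ufm e ^ k * e = (ufm e ^ k * u) * u'" by (simp only: mult.assoc u'(2))
    then have "ufm e ^ k * e = 0" using z by simp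
    moreover have "e * v = v" using lv by (auto simp: unit_in_def factor_def)
    moreover have "ufm e ^ l = ufm e ^ (l - k) * ufm e ^ k" using \<open>k \<le> l\<close> by (simp add: power_add[symmetric])
    ultimately have "ufm e ^ l * v = 0" by (metis mult.assoc mult_zero_left mult_zero_right)
    then show False using lv inv[of j b 0] \<open>b \<noteq> 0\<close> by simp
  qed
  moreover have "\<exists>w\<in>A. e * z = a * w" if z: "z \<in> N" for z
  proof (cases "e * z = 0")
    case True then show ?thesis using osub_0[OF osub_A] by force
  next
    case False
    have ez: "e * z \<in> N" "e * (e * z) = e * z"
      using AN[OF prim_A[OF e] z] prim_idemD(1)[OF e] by (auto simp: mult.assoc[symmetric])
    then obtain l v where lv: "unit_in e v" "p ^ j * (e * z) = ufm e ^ l * v" using dec False by blast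
    then have "?Q l" using ez by blast
    then have "k \<le> l" unfolding k_def by (rule Least_le)
    have ev: "e * v = v" "v \<in> A" using lv by (auto simp: unit_in_def factor_def)
    define w where "w = ufm e ^ (l - k) * v * u'"
    have "p ^ j * (a * w) = (ufm e ^ k * ufm e ^ (l - k)) * (v * (u * u'))"
      unfolding w_def using a(4) by (simp only: mult.assoc[symmetric]) (simp only: ac_simps)
    also have "\<dots> = ufm e ^ l * v"
      using \<open>k \<le> l\<close> ev by (simp add: power_add[symmetric] u'(2) mult.commute[of v e])
    finally have "e * z = a * w" using lv(2) inv by metis
    moreover have "w \<in> A" unfolding w_def using u'(1) by (intro A_mult A_power ufm_A[OF e] ev(2)) blast
    ultimately show ?thesis by blast
  qed
  ultimately show ?thesis using a by blast
qed

text \<open>Generators of the components are added up; since the factors are fields, the sum is a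
  unit of \<open>E\<close>.\<close>

lemma lattice_principal:
  assumes N: "lat N" and AN: "\<And>a x. a \<in> A \<Longrightarrow> x \<in> N \<Longrightarrow> a * x \<in> N"
  shows "\<exists>x y. x * y = 1 \<and> N = (*) x ` A"
proof -
  have "\<forall>e\<in>prim_idem. \<exists>a. a \<in> N \<and> e * a = a \<and> a \<noteq> 0 \<and> (\<forall>z\<in>N. \<exists>w\<in>A. e * z = a * w)"
    using module_generator[OF N AN] by blast
  then obtain g where g: "\<And>e. e \<in> prim_idem \<Longrightarrow> g e \<in> N \<and> e * g e = g e \<and> g e \<noteq> 0 \<and> (\<forall>z\<in>N. \<exists>w\<in>A. e * z = g e * w)"
    by metis
  have "\<forall>e\<in>prim_idem. \<exists>h. e * h = h \<and> g e * h = e"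
    using g factor_field by (auto simp: factor_def)
  then obtain h where h: "\<And>e. e \<in> prim_idem \<Longrightarrow> e * h e = h e \<and> g e * h e = e" by metis
  define x where "x = (\<Sum>e\<in>prim_idem. g e)"
  define y where "y = (\<Sum>e\<in>prim_idem. h e)"
  have comp_sum: "e * (\<Sum>f\<in>prim_idem. k f) = k e"
    if e: "e \<in> prim_idem" and k: "\<And>f. f \<in> prim_idem \<Longrightarrow> f * k f = k f" for e :: 'e and k
  proof -
    have "e * (\<Sum>f\<in>prim_idem. k f) = (\<Sum>f\<in>prim_idem. if f = e then k e else 0)"
      unfolding sum_distrib_left
    proof (rule sum.cong)
      fix f :: 'e assume f: "f \<in> prim_idem"
      have "e * k f = (e * f) * k f" using k[OF f] by (simp add: mult.assoc)
      then show "e * k f = (if f = e then k e else 0)"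
        using prim_idem_orth[OF e f] k[OF e] by (cases "f = e") auto
    qed simp
    then show ?thesis using e finite_prim_idem by simp
  qed
  have ex: "e * x = g e" and ey: "e * y = h e" if "e \<in> prim_idem" for e
    using comp_sum[OF that] g h by (auto simp: x_def y_def)
  have "x * y = 1"
  proof (rule components_eqI)
    fix e :: 'e assume e: "e \<in> prim_idem"
    have "e * (x * y) = (e * e) * (x * y)" using prim_idemD(1)[OF e] by simp
    also have "\<dots> = (e * x) * (e * y)" by (simp only: ac_simps)
    finally show "e * (x * y) = e * 1" using ex[OF e] ey[OF e] h[OF e] by simp
  qed
  moreover have "N = (*) x ` A"
  proof (intro equalityI subsetI)
    fix z assume z: "z \<in> N"
    then have "\<forall>e\<in>prim_idem. \<exists>w. w \<in> A \<and> e * z = g e * w" using g by blast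
    then obtain w where w: "\<And>e. e \<in> prim_idem \<Longrightarrow> w e \<in> A \<and> e * z = g e * w e" by metis
    have "z = (\<Sum>e\<in>prim_idem. e * z)" by (simp add: sum_components)
    also have "\<dots> = (\<Sum>e\<in>prim_idem. x * (e * w e))"
      using w ex by (intro sum.cong) (auto simp: mult.assoc[symmetric] mult.commute[of x])
    also have "\<dots> = x * (\<Sum>e\<in>prim_idem. e * w e)" by (simp add: sum_distrib_left)
    finally have "z = x * (\<Sum>e\<in>prim_idem. e * w e)" .
    moreover have "(\<Sum>e\<in>prim_idem. e * w e) \<in> A"
      using w by (intro osub_sum[OF osub_A] A_mult) (auto intro: prim_A)
    ultimately show "z \<in> (*) x ` A" by blast
  next
    fix z assume "z \<in> (*) x ` A"
    then obtain a where a: "a \<in> A" "z = a * x" by (auto simp: mult.commute)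
    have "x \<in> N" unfolding x_def using g by (intro osub_sum lat_osub[OF N]) auto
    then show "z \<in> N" using AN a by simp
  qed
  ultimately show ?thesis by blast
qed

end

section \<open>Units and their cosets\<close>

lemma sum_Pow_insert:
  assumes "finite B" "e \<notin> B"
  shows "(\<Sum>I\<in>Pow (insert e B). F I) = (\<Sum>I\<in>Pow B. F I) + (\<Sum>I\<in>Pow B. F (insert e I))"
proof -
  have "(\<Sum>I\<in>Pow (insert e B). F I) = (\<Sum>I\<in>Pow B. F I) + (\<Sum>I\<in>insert e ` Pow B. F I)"
    unfolding Pow_insert using assms by (intro sum.union_disjoint) auto
  also have "(\<Sum>I\<in>insert e ` Pow B. F I) = (\<Sum>I\<in>Pow B. F (insert e I))"
    using assms by (intro sum.reindex_cong[where l = "insert e"]) (auto intro!: inj_onI)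
  finally show ?thesis .
qed

text \<open>Expansion of the product of \<open>1 - [Q e]\<close> over \<open>B\<close>; inclusion
  and exclusion is used in this form below.\<close>

lemma sum_Pow_alternating:
  assumes "finite B"
  shows "(\<Sum>J\<in>Pow B. (- 1) ^ card J * (if \<forall>e\<in>J. Q e then 1 else 0)) =
         (if \<forall>e\<in>B. \<not> Q e then 1 else 0 :: 'a::comm_ring_1)"
  using assms
proof (induction B rule: finite_induct)
  case (insert e B)
  have "(\<Sum>J\<in>Pow B. (- 1) ^ card (insert e J) * (if \<forall>f\<in>insert e J. Q f then 1 else 0)) =
        (\<Sum>J\<in>Pow B. (if Q e then - 1 else 0) * ((- 1) ^ card J * (if \<forall>e\<in>J. Q e then 1 else 0 :: 'a)))"
  proof (rule sum.cong)
    fix J assume "J \<in> Pow B"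
    then have "finite J" "e \<notin> J" using insert.hyps finite_subset by auto
    then show "(- 1) ^ card (insert e J) * (if \<forall>f\<in>insert e J. Q f then 1 else 0) =
        (if Q e then - 1 else 0) * ((- 1) ^ card J * (if \<forall>e\<in>J. Q e then 1 else 0 :: 'a))"
      by auto
  qed simp
  then show ?case
    using insert by (simp add: sum_Pow_insert sum_distrib_left[symmetric])
qed simp

context local_duality
begin

definition uinv :: "'e \<Rightarrow> 'e" where
  "uinv x = (SOME y. x * y = 1)"

lemma uinv: "x * y = 1 \<Longrightarrow> x * uinv x = 1"
  unfolding uinv_def by (rule someI)

text \<open>The uniformizer of the factor of \<open>e\<close>, made a unit of \<open>E\<close> by the entry 1 in all other factors.\<close>

definition ufm_unit :: "'e \<Rightarrow> 'e" where
  "ufm_unit e = ufm e + (1 - e)"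

definition ufm_prod :: "'e set \<Rightarrow> 'e" where
  "ufm_prod I = (\<Prod>e\<in>I. ufm_unit e)"

definition ufm_prod_inv :: "'e set \<Rightarrow> 'e" where
  "ufm_prod_inv I = (\<Prod>e\<in>I. uinv (ufm_unit e))"

lemma ufm_nz: assumes e: "e \<in> prim_idem" shows "ufm e \<noteq> 0"
proof
  assume "ufm e = 0"
  then have "p * e = 0"
    using ufm_dvd[OF e p_integ_nonunit[OF e prim_integ[OF e]]] by auto
  then have "p_inv * (p * e) = 0" by simp
  then have "e = 0" by (simp add: mult.assoc[symmetric] mult.commute[of p_inv] p_p_inv)
  then show False using prim_idemD(2)[OF e] by simp
qed

lemma ufm_unit_inverse: assumes e: "e \<in> prim_idem" shows "ufm_unit e * uinv (ufm_unit e) = 1"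
proof -
  obtain h where h: "h \<in> factor e" "ufm e * h = e"
    using factor_field[OF e _ ufm_nz[OF e]] ufm_factor[OF e] by (auto simp: factor_def)
  have eh: "e * h = h" using h by (simp add: factor_def)
  have ee: "e * e = e" by (rule prim_idemD(1)[OF e])
  have ue: "ufm e * e = ufm e" using ufm_factor[OF e] by (simp add: mult.commute)
  have "ufm_unit e * (h + (1 - e)) = ufm e * h + (ufm e - ufm e * e) + (h - e * h) + (1 - e - e + e * e)"
    unfolding ufm_unit_def by (simp add: algebra_simps)
  also have "\<dots> = 1" by (simp add: h ue eh ee)
  finally show ?thesis by (rule uinv)
qed

lemma ufm_prod_ufm_prod_inv: "I \<subseteq> prim_idem \<Longrightarrow> ufm_prod I * ufm_prod_inv I = 1"
proof -
  assume I: "I \<subseteq> prim_idem"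
  have "ufm_prod I * ufm_prod_inv I = (\<Prod>e\<in>I. ufm_unit e * uinv (ufm_unit e))" by (simp add: ufm_prod_def ufm_prod_inv_def prod.distrib)
  also have "\<dots> = (\<Prod>e\<in>I. 1)" using I ufm_unit_inverse by (intro prod.cong) auto
  finally show ?thesis by simp
qed

lemma ufm_prod_inv_ufm_prod: "I \<subseteq> prim_idem \<Longrightarrow> ufm_prod_inv I * ufm_prod I = 1"
  using ufm_prod_ufm_prod_inv by (simp add: mult.commute)

lemma finite_idem: "I \<subseteq> (prim_idem :: 'e set) \<Longrightarrow> finite I"
  by (rule finite_subset[OF _ finite_prim_idem])

lemma comp_ufm_unit:
  assumes "e \<in> prim_idem" "f \<in> prim_idem" shows "f * ufm_unit e = (if f = e then ufm e else f)"
proof (cases "f = e")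
  case True
  then show ?thesis using prim_idemD(1)[OF assms(1)] ufm_factor[OF assms(1)]
    by (simp add: ufm_unit_def algebra_simps)
next
  case False
  have fe: "f * e = 0" by (rule prim_idem_orth[OF assms(2,1) False])
  have "f * (e * ufm e) = (f * e) * ufm e" by (simp only: mult.assoc)
  then have "f * ufm e = 0" by (simp add: ufm_factor[OF assms(1)] fe)
  then show ?thesis using False fe by (simp add: ufm_unit_def distrib_left right_diff_distrib)
qed

lemma comp_ufm_unit_inv:
  assumes "e \<in> prim_idem" "f \<in> prim_idem" "f \<noteq> e" shows "f * uinv (ufm_unit e) = f"
proof -
  have "f * uinv (ufm_unit e) = f * (ufm_unit e * uinv (ufm_unit e))"
    using comp_ufm_unit[OF assms(1,2)] assms(3) by (simp add: mult.assoc[symmetric])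
  then show ?thesis by (simp add: ufm_unit_inverse[OF assms(1)])
qed

lemma comp_ufm_prod_inv:
  assumes "I \<subseteq> prim_idem" "f \<in> prim_idem"
  shows "f * ufm_prod_inv I = (if f \<in> I then f * uinv (ufm_unit f) else f)"
proof -
  have fin: "finite I" by (rule finite_idem[OF assms(1)])
  show ?thesis
    using fin assms(1)
  proof (induction I rule: finite_induct)
    case empty
    then show ?case by (simp add: ufm_prod_inv_def)
  next
    case (insert e I)
    have eq: "ufm_prod_inv (insert e I) = uinv (ufm_unit e) * ufm_prod_inv I" using insert by (simp add: ufm_prod_inv_def)
    show ?case
    proof (cases "f = e")
      case True
      have "f * ufm_prod_inv (insert e I) = uinv (ufm_unit e) * (f * ufm_prod_inv I)" unfolding eq by (simp only: ac_simps)
      also have "f * ufm_prod_inv I = f" using insert True by simp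
      finally show ?thesis using True by (simp add: mult.commute)
    next
      case False
      have "f * ufm_prod_inv (insert e I) = (f * uinv (ufm_unit e)) * ufm_prod_inv I" unfolding eq by (simp only: ac_simps)
      also have "f * uinv (ufm_unit e) = f" using insert.prems False assms(2) by (intro comp_ufm_unit_inv) auto
      finally show ?thesis using insert False by auto
    qed
  qed
qed

lemma ufm_unit_A: "e \<in> prim_idem \<Longrightarrow> ufm_unit e \<in> A"
  unfolding ufm_unit_def by (intro A_add A_diff ufm_A one_A prim_A)

lemma ufm_prod_A: "I \<subseteq> prim_idem \<Longrightarrow> ufm_prod I \<in> A"
  unfolding ufm_prod_def by (induction I rule: infinite_finite_induct) (auto intro: one_A A_mult ufm_unit_A)

lemma A_components: "(\<And>e. e \<in> prim_idem \<Longrightarrow> e * x \<in> A) \<Longrightarrow> x \<in> A"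
  using osub_sum[OF osub_A, of prim_idem "\<lambda>e. e * x"] by (simp add: sum_components)

lemma A_comp: "e \<in> prim_idem \<Longrightarrow> x \<in> A \<Longrightarrow> e * x \<in> integ e"
  by (auto intro: A_mult prim_A factor_mult1 prim_in_factor)

lemma ufm_inverse: assumes e: "e \<in> prim_idem" shows "e * uinv (ufm_unit e) * ufm e = e"
proof -
  have "e * uinv (ufm_unit e) * ufm e = uinv (ufm_unit e) * (e * ufm e)" by (simp only: ac_simps)
  also have "\<dots> = uinv (ufm_unit e) * (e * ufm_unit e)" using comp_ufm_unit[OF e e] ufm_factor[OF e] by simp
  also have "\<dots> = e * (ufm_unit e * uinv (ufm_unit e))" by (simp only: ac_simps)
  finally show ?thesis by (simp add: ufm_unit_inverse[OF e])
qed

lemma ufm_unit_inv_notin: assumes e: "e \<in> prim_idem" shows "e * uinv (ufm_unit e) \<notin> A"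
proof
  assume *: "e * uinv (ufm_unit e) \<in> A"
  have "e * uinv (ufm_unit e) \<in> integ e" using * factor_mult1[OF prim_in_factor[OF e]] by blast
  moreover have "ufm e * (e * uinv (ufm_unit e)) = e" using ufm_inverse[OF e] by (simp add: mult.commute)
  ultimately have "unit_in e (ufm e)" using nonunits_integ[OF ufm_nonunit[OF e]] by (auto simp: unit_in_def)
  then show False using ufm_nonunit[OF e] by (simp add: nonunits_def)
qed

text \<open>Membership in the maximal ideal at \<open>e\<close> becomes divisibility by a unit of
  \<open>E\<close>, so that the lemmas on scaling and indices apply.\<close>

lemma ufm_unit_inv_mult_A_iff:
  assumes e: "e \<in> prim_idem" and x: "x \<in> A"
  shows "uinv (ufm_unit e) * x \<in> A \<longleftrightarrow> e * x \<in> nonunits e"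
proof
  assume *: "uinv (ufm_unit e) * x \<in> A"
  have "e * x = e * (ufm_unit e * uinv (ufm_unit e)) * x" by (simp add: ufm_unit_inverse[OF e])
  also have "\<dots> = (e * ufm_unit e) * (uinv (ufm_unit e) * x)" by (simp only: ac_simps)
  also have "\<dots> = ufm e * (uinv (ufm_unit e) * x)" using comp_ufm_unit[OF e e] by simp
  finally show "e * x \<in> nonunits e" using nonunits_mult_A[OF ufm_nonunit[OF e] * e] by simp
next
  assume "e * x \<in> nonunits e"
  then obtain w where w: "w \<in> integ e" "e * x = ufm e * w" using ufm_dvd[OF e] by blast
  show "uinv (ufm_unit e) * x \<in> A"
  proof (rule A_components)
    fix f :: 'e assume f: "f \<in> prim_idem"
    show "f * (uinv (ufm_unit e) * x) \<in> A"
    proof (cases "f = e")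
      case True
      have "e * (uinv (ufm_unit e) * x) = (e * e) * (uinv (ufm_unit e) * x)" by (simp add: prim_idemD(1)[OF e])
      also have "\<dots> = (e * uinv (ufm_unit e)) * (e * x)" by (simp only: ac_simps)
      also have "\<dots> = (e * uinv (ufm_unit e) * ufm e) * w" unfolding w(2) by (simp only: ac_simps)
      also have "\<dots> = e * w" by (simp only: ufm_inverse[OF e])
      finally show ?thesis using True w A_mult[OF prim_A[OF e]] by auto
    next
      case False
      have "f * (uinv (ufm_unit e) * x) = f * x"
        using comp_ufm_unit_inv[OF e f False] by (simp add: mult.assoc[symmetric])
      then show ?thesis using A_mult[OF prim_A[OF f] x] by simp
    qed
  qed
qed

lemma p_ufm_unit_inv: assumes e: "e \<in> prim_idem" shows "p * uinv (ufm_unit e) \<in> A"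
proof -
  have pA: "p \<in> A" using p_A[OF one_A] by simp
  have "e * p \<in> nonunits e" using p_integ_nonunit[OF e prim_integ[OF e]] by (simp add: mult.commute)
  then show ?thesis using ufm_unit_inv_mult_A_iff[OF e pA] by (simp add: mult.commute)
qed

text \<open>Membership in an \<open>A\<close>-module can be checked factor by factor, and the factor
  \<open>e\<close> sees only its own uniformizer. This independence is what inclusion and exclusion
  over \<open>J\<close> relies on.\<close>

lemma ufm_prod_inv_mem_iff:
  assumes J: "J \<subseteq> prim_idem" and N: "osub N" and AN: "\<And>a x. a \<in> A \<Longrightarrow> x \<in> N \<Longrightarrow> a * x \<in> N"
  shows "ufm_prod_inv J * z \<in> N \<longleftrightarrow> z \<in> N \<and> (\<forall>e\<in>J. uinv (ufm_unit e) * z \<in> N)"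
proof
  assume Q: "ufm_prod_inv J * z \<in> N"
  have "ufm_prod J * (ufm_prod_inv J * z) \<in> N" by (rule AN[OF ufm_prod_A[OF J] Q])
  then have 1: "z \<in> N" using ufm_prod_ufm_prod_inv[OF J] by (simp add: mult.assoc[symmetric])
  have "uinv (ufm_unit e) * z \<in> N" if e: "e \<in> J" for e
  proof -
    have J': "J - {e} \<subseteq> prim_idem" using J by blast
    have "ufm_prod_inv J = uinv (ufm_unit e) * ufm_prod_inv (J - {e})"
      using finite_idem[OF J] e by (simp add: ufm_prod_inv_def prod.remove)
    then have "ufm_prod (J - {e}) * (ufm_prod_inv J * z) = (ufm_prod_inv (J - {e}) * ufm_prod (J - {e})) * (uinv (ufm_unit e) * z)"
      by (simp add: ac_simps)
    then have "uinv (ufm_unit e) * z = ufm_prod (J - {e}) * (ufm_prod_inv J * z)" by (simp add: ufm_prod_inv_ufm_prod[OF J'])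
    then show ?thesis using AN[OF ufm_prod_A[OF J'] Q] by simp
  qed
  then show "z \<in> N \<and> (\<forall>e\<in>J. uinv (ufm_unit e) * z \<in> N)" using 1 by blast
next
  assume *: "z \<in> N \<and> (\<forall>e\<in>J. uinv (ufm_unit e) * z \<in> N)"
  have "f * (ufm_prod_inv J * z) \<in> N" if f: "f \<in> prim_idem" for f
  proof -
    have "f * (ufm_prod_inv J * z) = (if f \<in> J then f * (uinv (ufm_unit f) * z) else f * z)"
      using comp_ufm_prod_inv[OF J f] by (simp add: mult.assoc[symmetric])
    then show ?thesis using * AN[OF prim_A[OF f]] by simp
  qed
  then have "(\<Sum>f\<in>prim_idem. f * (ufm_prod_inv J * z)) \<in> N" by (rule osub_sum[OF N])
  then show "ufm_prod_inv J * z \<in> N" by (simp only: sum_components)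
qed

section \<open>The units of the ring of integers\<close>

definition UA :: "'e set" where
  "UA = {x \<in> A. \<exists>y\<in>A. x * y = 1}"

lemma integer_units_eq: "integer_units av sc = UA"
  by (simp add: integer_units_def UA_def alg_integers_eq)

text \<open>An element outside every maximal ideal is invertible in each factor, and the inverses
  are added up.\<close>

lemma UA_iff: "x \<in> UA \<longleftrightarrow> x \<in> A \<and> (\<forall>e\<in>prim_idem. uinv (ufm_unit e) * x \<notin> A)"
proof
  assume x: "x \<in> UA"
  then obtain y where y: "x \<in> A" "y \<in> A" "x * y = 1" by (auto simp: UA_def)
  have "uinv (ufm_unit e) * x \<notin> A" if e: "e \<in> prim_idem" for e
  proof
    assume "uinv (ufm_unit e) * x \<in> A"
    then have "e * (uinv (ufm_unit e) * x * y) \<in> A" using A_mult[OF prim_A[OF e] A_mult[OF _ y(2)]] by blast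
    moreover have "e * (uinv (ufm_unit e) * x * y) = e * uinv (ufm_unit e)" by (simp add: mult.assoc y(3))
    ultimately show False using ufm_unit_inv_notin[OF e] by simp
  qed
  then show "x \<in> A \<and> (\<forall>e\<in>prim_idem. uinv (ufm_unit e) * x \<notin> A)" using y by blast
next
  assume x: "x \<in> A \<and> (\<forall>e\<in>prim_idem. uinv (ufm_unit e) * x \<notin> A)"
  have "\<forall>e\<in>prim_idem. \<exists>y\<in>integ e. (e * x) * y = e"
    using x ufm_unit_inv_mult_A_iff A_comp unfolding nonunits_def unit_in_def by blast
  then obtain y where y: "\<And>e. e \<in> prim_idem \<Longrightarrow> y e \<in> integ e \<and> (e * x) * y e = e" by metis
  have "x * (\<Sum>e\<in>prim_idem. y e) = (\<Sum>e\<in>prim_idem. e)"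
    unfolding sum_distrib_left
  proof (rule sum.cong)
    fix e :: 'e assume e: "e \<in> prim_idem"
    have "x * y e = x * (e * y e)" using y[OF e] by (simp add: factor_def)
    then show "x * y e = e" using y[OF e] by (simp add: mult.left_commute mult.commute)
  qed simp
  moreover have "(\<Sum>e\<in>prim_idem. y e) \<in> A" using y by (intro osub_sum[OF osub_A]) auto
  ultimately show "x \<in> UA" using x by (auto simp: UA_def sum_prim_idem)
qed

lemma UA_mult: "x \<in> UA \<Longrightarrow> y \<in> UA \<Longrightarrow> x * y \<in> UA"
proof -
  assume "x \<in> UA" "y \<in> UA"
  then obtain x' y' where *: "x \<in> A" "y \<in> A" "x' \<in> A" "y' \<in> A" "x * x' = 1" "y * y' = 1" by (auto simp: UA_def)
  have "(x * y) * (x' * y') = (x * x') * (y * y')" by (simp only: ac_simps)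
  then show ?thesis using * by (auto simp: UA_def intro!: A_mult bexI[of _ "x' * y'"])
qed

lemma UA_unit: "x \<in> UA \<Longrightarrow> \<exists>y. x * y = 1"
  by (auto simp: UA_def)

lemma UA_scale_A: assumes "u \<in> UA" shows "(*) u ` A = A"
proof -
  obtain v where v: "u \<in> A" "v \<in> A" "u * v = 1" using assms by (auto simp: UA_def)
  have "x \<in> (*) u ` A" if "x \<in> A" for x
    using mem_mult_unit_iff[OF v(3), of x A] A_mult[OF v(2) that] by simp
  then show ?thesis using A_mult[OF v(1)] by blast
qed

lemma scale_A_eq_imp_UA:
  assumes uv: "u * v = 1" and eq: "(*) u ` A = A" shows "u \<in> UA"
proof -
  have "u * 1 \<in> (*) u ` A" using one_A by (rule imageI)
  then have "u \<in> A" using eq by simp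
  moreover have "v * 1 \<in> A" using mem_mult_unit_iff[OF uv, of 1 A] eq one_A by simp
  ultimately show ?thesis using uv by (auto simp: UA_def)
qed

section \<open>The dual of a fractional ideal\<close>

abbreviation "X \<equiv> frac_ideals sc R"
abbreviation "D \<equiv> dual_lat"

lemma X_iff: "M \<in> X \<longleftrightarrow> lat M \<and> (\<forall>r\<in>R. \<forall>x\<in>M. r * x \<in> M)"
  unfolding frac_ideals_iff ring_submodule_def
  using osub_0 osub_add lat_osub by blast

lemma X_lat: "M \<in> X \<Longrightarrow> lat M" and X_R: "M \<in> X \<Longrightarrow> r \<in> R \<Longrightarrow> x \<in> M \<Longrightarrow> r * x \<in> M"
  by (auto simp: X_iff)

lemma c_inv_unit: "c_inv * c = 1" using c_c_inv by (simp add: mult.commute)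

lemma lat_D: "lat M \<Longrightarrow> lat (D M)" and D_D: "lat M \<Longrightarrow> D (D M) = M"
  and D_antimono: "M \<subseteq> N \<Longrightarrow> D N \<subseteq> D M"
  and ri_D: "lat M \<Longrightarrow> lat N \<Longrightarrow> ri (D N) (D M) = ri M N"
  unfolding dual_eq_dl using lat_dl[OF c_inv_unit] dl_dl[OF c_inv_unit] dl_antimono ri_dl[OF c_inv_unit] by auto

lemma mem_D: "x \<in> D M \<longleftrightarrow> (\<forall>y\<in>M. tr (c_inv * x * y) \<in> val_ring av)"
  by (simp add: dual_eq_dl dl_def)

lemma D_X: assumes M: "M \<in> X" shows "D M \<in> X"
  unfolding X_iff
proof (intro conjI ballI)
  show "lat (D M)" by (rule lat_D[OF X_lat[OF M]])
  fix r x assume r: "r \<in> R" and x: "x \<in> D M"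
  show "r * x \<in> D M"
    unfolding mem_D
  proof
    fix y assume "y \<in> M"
    then have "r * y \<in> M" by (rule X_R[OF M r])
    then have "tr (c_inv * x * (r * y)) \<in> val_ring av" using x by (simp add: mem_D)
    then show "tr (c_inv * (r * x) * y) \<in> val_ring av" by (simp add: ac_simps)
  qed
qed

lemma R_X: "R \<in> X" using lat_R mult_R by (simp add: X_iff)

text \<open>The pairing of \<open>x\<close> with \<open>r\<close> is that of 1 with
  \<open>r * x\<close>, and \<open>M\<close> is stable under \<open>R\<close>. Inclusions in the
  dual of \<open>R\<close> thus become memberships of single vectors in \<open>D M\<close>, which
  can be counted.\<close>

lemma subset_D_R_iff: assumes M: "M \<in> X" shows "M \<subseteq> D R \<longleftrightarrow> 1 \<in> D M"
proof
  assume MD: "M \<subseteq> D R"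
  have "tr (c_inv * 1 * y) \<in> val_ring av" if "y \<in> M" for y
  proof -
    have "y \<in> D R" using MD that by blast
    then have "tr (c_inv * y * 1) \<in> val_ring av" using one_R unfolding mem_D by blast
    then show ?thesis by simp
  qed
  then show "1 \<in> D M" unfolding mem_D by blast
next
  assume 1: "1 \<in> D M"
  show "M \<subseteq> D R"
  proof
    fix x assume x: "x \<in> M"
    show "x \<in> D R"
      unfolding mem_D
    proof
      fix r assume "r \<in> R"
      then have "r * x \<in> M" using X_R[OF M _ x] by blast
      then have "tr (c_inv * 1 * (r * x)) \<in> val_ring av" using 1 unfolding mem_D by blast
      then show "tr (c_inv * x * r) \<in> val_ring av" by (simp add: ac_simps)
    qed
  qed
qed

lemma D_scale: assumes uv: "u * v = 1" shows "x \<in> D ((*) u ` M) \<longleftrightarrow> u * x \<in> D M"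
  by (auto simp: mem_D ac_simps)

lemma X_scale: assumes uv: "u * v = 1" and M: "M \<in> X" shows "(*) u ` M \<in> X"
  unfolding X_iff
proof (intro conjI ballI)
  show "lat ((*) u ` M)" by (rule lat_scale[OF X_lat[OF M] uv])
  fix r x assume "r \<in> R" "x \<in> (*) u ` M"
  then show "r * x \<in> (*) u ` M"
    using X_R[OF M] by (auto simp: mult.left_commute[of r])
qed

lemma scale_subset_D_R:
  assumes uv: "u * v = 1" and M: "M \<in> X" shows "(*) u ` M \<subseteq> D R \<longleftrightarrow> u \<in> D M"
  using subset_D_R_iff[OF X_scale[OF uv M]] D_scale[OF uv, of 1 M] by simp

text \<open>The codifferent is an \<open>A\<close>-stable lattice, hence of the form
  \<open>d A\<close>, and the different is its inverse. Comparison with \<open>c A\<close> shows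
  that the twist by \<open>c_inv\<close> makes \<open>A\<close> its own dual.\<close>

lemma D_A: "D A = A"
proof -
  let ?N = "dl 1 A"
  have N: "lat ?N" using lat_dl[OF _ lat_A, of 1 1] by simp
  have AN: "a * x \<in> ?N" if a: "a \<in> A" and x: "x \<in> ?N" for a x
    unfolding dl_def
  proof safe
    fix y assume "y \<in> A"
    then have "tr (1 * x * (a * y)) \<in> val_ring av" using x A_mult[OF a] unfolding dl_def by blast
    then show "tr (1 * (a * x) * y) \<in> val_ring av" by (simp add: ac_simps)
  qed
  obtain d d' where d: "d * d' = 1" "?N = (*) d ` A" using lattice_principal[OF N AN] by blast
  have codiff: "codifferent av sc = ?N" by (simp add: codifferent_def dl_def alg_integers_eq)
  have "different av sc = (*) d' ` A"
  proof (intro equalityI subsetI)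
    fix x assume "x \<in> different av sc"
    then have "x * (d * 1) \<in> A" using one_A unfolding different_def codiff d(2) alg_integers_eq by blast
    then show "x \<in> (*) d' ` A"
      using mem_mult_unit_iff[of d' d x A] d(1) by (simp add: mult.commute)
  next
    fix x assume "x \<in> (*) d' ` A"
    then obtain a where a: "a \<in> A" "x = d' * a" by blast
    show "x \<in> different av sc"
      unfolding different_def codiff d(2) alg_integers_eq
    proof safe
      fix y assume "y \<in> A"
      have "x * (d * y) = (d * d') * (a * y)" by (simp only: a ac_simps)
      then show "x * (d * y) \<in> A" using d(1) A_mult[OF a(1) \<open>y \<in> A\<close>] by simp
    qed
  qed
  then have eq: "(*) d' ` A = (*) c ` A" using different_eq by simp
  have "D A = {x. c_inv * x \<in> ?N}" unfolding dual_eq_dl dl_def by (simp add: mult.assoc)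
  also have "\<dots> = {x. d' * (c_inv * x) \<in> A}" unfolding d(2) by (simp add: mem_mult_unit_iff[OF d(1)])
  also have "\<dots> = A"
  proof -
    have d'd: "d' * d = 1" using d(1) by (simp add: mult.commute)
    have 1: "d * (c * a) \<in> A" if "a \<in> A" for a
      using that eq mem_mult_unit_iff[OF d'd, of "c * a" A] by blast
    have 2: "c_inv * (d' * a) \<in> A" if "a \<in> A" for a
      using that eq mem_mult_unit_iff[OF c_c_inv, of "d' * a" A] by blast
    have 3: "d * (c * (d' * (c_inv * x))) = x" for x
    proof -
      have "d * (c * (d' * (c_inv * x))) = (d * d') * (c * c_inv) * x" by (simp only: ac_simps)
      then show ?thesis using d(1) c_c_inv by simp
    qed
    have "x \<in> A" if "d' * (c_inv * x) \<in> A" for x using 1[OF that] 3 by simp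
    moreover have "d' * (c_inv * x) \<in> A" if "x \<in> A" for x
      using 2[OF that] by (simp add: mult.left_commute[of d'])
    ultimately show ?thesis by blast
  qed
  finally show ?thesis .
qed

end

lemma coset_reps_restrict:
  assumes "coset_reps D M W" "S \<subseteq> M" "\<And>x y. x \<in> S \<Longrightarrow> y \<in> M \<Longrightarrow> x - y \<in> W \<Longrightarrow> y \<in> S"
  shows "coset_reps (D \<inter> S) S W"
  unfolding coset_reps_def
proof (intro conjI ballI)
  fix x assume x: "x \<in> S"
  then obtain d where d: "d \<in> D" "x - d \<in> W" using assms(1,2) unfolding coset_reps_def by blast
  have "d \<in> M" using assms(1) d by (auto simp: coset_reps_def)
  then have "d \<in> S" using assms(3) x d by blast
  show "\<exists>!d. d \<in> D \<inter> S \<and> x - d \<in> W"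
  proof (rule ex1I[of _ d])
    show "d \<in> D \<inter> S \<and> x - d \<in> W" using d \<open>d \<in> S\<close> by blast
    fix e assume "e \<in> D \<inter> S \<and> x - e \<in> W"
    then show "e = d" using coset_reps_unique[OF assms(1)] x assms(2) d by blast
  qed
qed simp

section \<open>Counting units in a fractional ideal\<close>

context local_duality
begin

abbreviation "idems \<equiv> prim_idem :: 'e set"

text \<open>A power of \<open>p\<close> in the conductor; it is nontrivial, so that \<open>1 + p\<^bsup>cond_exp\<^esup> A\<close> consists of units.\<close>

definition cond_exp :: nat where
  "cond_exp = (SOME k. k \<ge> 1 \<and> (\<forall>x\<in>A. p ^ k * x \<in> R))"

lemma cond_exp_ge_1: "cond_exp \<ge> 1" and cond_exp_clears: "x \<in> A \<Longrightarrow> p ^ cond_exp * x \<in> R"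
proof -
  obtain k where k: "\<forall>x\<in>A. p ^ k * x \<in> R" using lat_commensurable[OF lat_A lat_R] by blast
  then have "\<forall>x\<in>A. p ^ Suc k * x \<in> R" using osub_p[OF osub_R] by (simp add: mult.assoc)
  then have "\<exists>k. k \<ge> 1 \<and> (\<forall>x\<in>A. p ^ k * x \<in> R)" by (intro exI[of _ "Suc k"]) simp
  from someI_ex[OF this] show "cond_exp \<ge> 1" "x \<in> A \<Longrightarrow> p ^ cond_exp * x \<in> R" by (simp_all add: cond_exp_def)
qed

lemma lat_pK: "lat ((*) (p ^ cond_exp) ` A)"
  by (rule lat_p_power[OF lat_A])

definition unit_reps :: "'e set" where
  "unit_reps = (SOME unit_reps. coset_reps unit_reps UA ((*) (p ^ cond_exp) ` A))"

lemma coset_reps_unit_reps: "coset_reps unit_reps UA ((*) (p ^ cond_exp) ` A)"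
  unfolding unit_reps_def by (rule someI_ex) (rule coset_reps_exist[OF lat_add_subgroup[OF lat_pK]])

lemma unit_reps_UA: "u \<in> unit_reps \<Longrightarrow> u \<in> UA"
  using coset_reps_unit_reps by (auto simp: coset_reps_def)

lemma finite_unit_reps: "finite unit_reps"
proof -
  have "fin_idx UA ((*) (p ^ cond_exp) ` A)"
    using lat_fin_idx[OF lat_A lat_pK]
    by (rule fin_idx_mono[rotated 2]) (auto intro: lat_add_subgroup lat_pK simp: UA_def)
  then show ?thesis using fin_idx_iff_finite[OF lat_add_subgroup[OF lat_pK] coset_reps_unit_reps] by simp
qed

lemma one_UA: "1 \<in> UA" by (auto simp: UA_def one_A)

lemma card_unit_reps_pos: "card unit_reps > 0"
proof -
  have "unit_reps \<noteq> {}" using coset_reps_unit_reps one_UA unfolding coset_reps_def by blast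
  then show ?thesis using finite_unit_reps by (simp add: card_gt_0_iff)
qed

lemma idx_ratio:
  assumes "lat W" "lat M" "lat N" "W \<subseteq> M" "W \<subseteq> N"
  shows "real (idx M W) = real q powi (ri M N) * real (idx N W)"
proof -
  have "real q \<noteq> 0" using q_ge_2 by simp
  then have "real q powi (ri M N) * real q ^ len N W = real q powi (ri M N + int (len N W))"
    by (simp add: power_int_add)
  also have "ri M N + int (len N W) = int (len M W)" using ri_eq_len assms by simp
  finally show ?thesis using assms by (simp add: lat_idx_len)
qed

lemma one_plus_pK_unit: "a \<in> A \<Longrightarrow> 1 + p ^ cond_exp * a \<in> UA"
proof -
  assume a: "a \<in> A"
  obtain k where k: "cond_exp = Suc k" using cond_exp_ge_1 by (cases cond_exp) auto
  have b: "p ^ k * a \<in> A" by (rule osub_p_power[OF osub_A a])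
  have eq: "1 + p ^ cond_exp * a = 1 + p * (p ^ k * a)" by (simp add: k mult.assoc)
  show ?thesis unfolding eq using one_plus_p_unit[OF b] one_A A_add[OF one_A p_A[OF b]]
    by (auto simp: UA_def)
qed

text \<open>Both sides are the number of cosets, modulo a small lattice and divided by the index of that lattice in
  \<open>l p\<^bsup>cond_exp\<^esup> A\<close>, in the set of those elements of \<open>N\<close> that generate \<open>l A\<close>; the right-hand side comes from
  inclusion and exclusion over the prime ideals.\<close>

lemma unit_count:
  assumes N: "N \<in> X" and l: "l * l' = 1"
  shows "real (card {u \<in> unit_reps. u * l \<in> N}) =
    (\<Sum>J\<in>Pow idems. (- 1) ^ card J *
       real q powi (ri (N \<inter> (*) (l * ufm_prod J) ` A) ((*) (l * p ^ cond_exp) ` A)))"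
proof -
  define B where "B J = (*) (l * ufm_prod J) ` A" for J
  define C where "C = (*) (l * p ^ cond_exp) ` A"
  \<comment> \<open>Small enough to lie in \<open>C\<close> and in every
    \<open>N \<inter> B J\<close>, so that all these lattices can be compared through their indices
    over \<open>W\<close>.\<close>
  define W where "W = N \<inter> B idems \<inter> C"
  define Z where "Z = {x \<in> N. l' * x \<in> UA}"
  have uB: "(l * ufm_prod J) * (l' * ufm_prod_inv J) = 1" if "J \<subseteq> idems" for J
  proof -
    have "(l * ufm_prod J) * (l' * ufm_prod_inv J) = (l * l') * (ufm_prod J * ufm_prod_inv J)" by (simp only: ac_simps)
    then show ?thesis using l ufm_prod_ufm_prod_inv[OF that] by simp
  qed
  have uC: "(l * p ^ cond_exp) * (l' * p_inv ^ cond_exp) = 1"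
  proof -
    have "(l * p ^ cond_exp) * (l' * p_inv ^ cond_exp) = (l * l') * (p ^ cond_exp * p_inv ^ cond_exp)" by (simp only: ac_simps)
    then show ?thesis using l p_power_inv by simp
  qed
  have latN: "lat N" by (rule X_lat[OF N])
  have latB: "lat (B J)" if "J \<subseteq> idems" for J unfolding B_def by (rule lat_scale[OF lat_A uB[OF that]])
  have latC: "lat C" unfolding C_def by (rule lat_scale[OF lat_A uC])
  have latNB: "lat (N \<inter> B J)" if "J \<subseteq> idems" for J by (rule lat_Int[OF latN latB[OF that]])
  have latW: "lat W" unfolding W_def by (intro lat_Int latN latB latC) simp
  have Bchar: "x \<in> B J \<longleftrightarrow> l' * x \<in> A \<and> (\<forall>e\<in>J. uinv (ufm_unit e) * (l' * x) \<in> A)" if J: "J \<subseteq> idems" for x J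
  proof -
    have 1: "x \<in> B J \<longleftrightarrow> ufm_prod_inv J * (l' * x) \<in> A"
      unfolding B_def mem_mult_unit_iff[OF uB[OF J]] by (simp add: ac_simps)
    show ?thesis unfolding 1 by (rule ufm_prod_inv_mem_iff[OF J osub_A A_mult])
  qed
  have Cchar: "x \<in> C \<longleftrightarrow> (\<exists>a\<in>A. l' * x = p ^ cond_exp * a)" for x
  proof
    assume "x \<in> C"
    then obtain a where a: "a \<in> A" "x = l * p ^ cond_exp * a" by (auto simp: C_def)
    have "l' * x = (l * l') * (p ^ cond_exp * a)" unfolding a by (simp only: ac_simps)
    then show "\<exists>a\<in>A. l' * x = p ^ cond_exp * a" using a l by auto
  next
    assume "\<exists>a\<in>A. l' * x = p ^ cond_exp * a"
    then obtain a where a: "a \<in> A" "l' * x = p ^ cond_exp * a" by blast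
    have "x = (l * l') * x" using l by simp
    also have "\<dots> = l * (l' * x)" by (simp only: mult.assoc)
    also have "\<dots> = l * p ^ cond_exp * a" by (simp only: a mult.assoc)
    finally show "x \<in> C" using a by (auto simp: C_def)
  qed
  have Zchar: "x \<in> Z \<longleftrightarrow> x \<in> N \<and> l' * x \<in> A \<and> (\<forall>e\<in>idems. uinv (ufm_unit e) * (l' * x) \<notin> A)" for x
    unfolding Z_def using UA_iff by blast
  have agN: "add_subgroup N" and agW: "add_subgroup W" and agC: "add_subgroup C"
    using latN latW latC lat_add_subgroup by auto
  obtain D where D: "coset_reps D (N \<inter> B {}) W" using coset_reps_exist[OF agW] by blast
  have finD: "finite D"
    using fin_idx_iff_finite[OF agW D] lat_fin_idx[OF latNB[of "{}"] latW] by simp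
  have DN: "d \<in> N" "l' * d \<in> A" if "d \<in> D" for d
    using D that Bchar[of "{}"] by (auto simp: coset_reps_def)
  have idxB: "idx (N \<inter> B J) W = (\<Sum>d\<in>D. if d \<in> N \<inter> B J then 1 else 0)" if J: "J \<subseteq> idems" for J
  proof -
    have "coset_reps (D \<inter> (N \<inter> B J)) (N \<inter> B J) W"
    proof (rule coset_reps_restrict[OF D])
      show "N \<inter> B J \<subseteq> N \<inter> B {}" using Bchar[OF J] Bchar[of "{}"] by auto
      fix x y assume x: "x \<in> N \<inter> B J" and xy: "x - y \<in> W"
      have "W \<subseteq> N \<inter> B J" using Bchar[OF J] Bchar[of idems] J by (auto simp: W_def)
      then have "x - (x - y) \<in> N \<inter> B J"
        using add_subgroup_diff[OF lat_add_subgroup[OF latNB[OF J]] x] xy by blast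
      then show "y \<in> N \<inter> B J" by simp
    qed
    then have "idx (N \<inter> B J) W = card (D \<inter> (N \<inter> B J))" by (rule idx_eq_card[OF agW])
    also have "\<dots> = (\<Sum>d\<in>D. if d \<in> N \<inter> B J then 1 else 0)"
      unfolding card_eq_sum by (rule sum.inter_restrict[OF finD])
    finally show ?thesis .
  qed
  have repsZ: "coset_reps (D \<inter> Z) Z W"
  proof (rule coset_reps_restrict[OF D])
    show "Z \<subseteq> N \<inter> B {}" using Zchar Bchar[of "{}"] by auto
    fix x y assume x: "x \<in> Z" and y: "y \<in> N \<inter> B {}" and xy: "x - y \<in> W"
    have yA: "l' * y \<in> A" "y \<in> N" using y Bchar[of "{}"] by auto
    have "uinv (ufm_unit e) * (l' * y) \<notin> A" if e: "e \<in> idems" for e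
    proof
      assume *: "uinv (ufm_unit e) * (l' * y) \<in> A"
      have "uinv (ufm_unit e) * (l' * (x - y)) \<in> A" using xy Bchar[of idems] e by (auto simp: W_def)
      then have "uinv (ufm_unit e) * (l' * (x - y)) + uinv (ufm_unit e) * (l' * y) \<in> A" by (rule A_add[OF _ *])
      moreover have "uinv (ufm_unit e) * (l' * (x - y)) + uinv (ufm_unit e) * (l' * y) = uinv (ufm_unit e) * (l' * x)"
        by (simp add: algebra_simps)
      ultimately show False using x e Zchar by auto
    qed
    then show "y \<in> Z" using yA Zchar by blast
  qed
  have idxZ: "real (idx Z W) = (\<Sum>J\<in>Pow idems. (- 1) ^ card J * real (idx (N \<inter> B J) W))"
  proof -
    have "(\<Sum>J\<in>Pow idems. (- 1) ^ card J * real (idx (N \<inter> B J) W)) =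
        (\<Sum>J\<in>Pow idems. \<Sum>d\<in>D. (- 1) ^ card J * (if \<forall>e\<in>J. uinv (ufm_unit e) * (l' * d) \<in> A then 1 else 0))"
    proof (rule sum.cong)
      fix J assume "J \<in> Pow idems"
      then have J: "J \<subseteq> idems" by simp
      have "real (idx (N \<inter> B J) W) = (\<Sum>d\<in>D. if d \<in> N \<inter> B J then 1 else 0)"
        unfolding idxB[OF J] of_nat_sum by (intro sum.cong) auto
      also have "\<dots> = (\<Sum>d\<in>D. if \<forall>e\<in>J. uinv (ufm_unit e) * (l' * d) \<in> A then 1 else 0)"
        using DN Bchar[OF J] by (intro sum.cong) auto
      finally show "(- 1) ^ card J * real (idx (N \<inter> B J) W) =
        (\<Sum>d\<in>D. (- 1) ^ card J * (if \<forall>e\<in>J. uinv (ufm_unit e) * (l' * d) \<in> A then 1 else 0))"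
        by (simp add: sum_distrib_left)
    qed simp
    also have "\<dots> = (\<Sum>d\<in>D. \<Sum>J\<in>Pow idems. (- 1) ^ card J * (if \<forall>e\<in>J. uinv (ufm_unit e) * (l' * d) \<in> A then 1 else 0))"
      by (rule sum.swap)
    also have "\<dots> = (\<Sum>d\<in>D. if d \<in> Z then 1 else 0)"
      unfolding sum_Pow_alternating[OF finite_prim_idem] using DN Zchar by (intro sum.cong) auto
    also have "\<dots> = real (card (D \<inter> Z))"
      using sum.inter_restrict[OF finD, of "\<lambda>_. 1 :: real" Z] by simp
    also have "\<dots> = real (idx Z W)" using idx_eq_card[OF agW repsZ] by simp
    finally show ?thesis by simp
  qed
  \<comment> \<open>An element of \<open>C\<close> is \<open>x\<close> times an element of
    \<open>p ^ cond_exp A\<close>. The latter lies in \<open>R\<close> and so keeps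
    \<open>N\<close>, and adding it multiplies \<open>l' * x\<close> by a unit.\<close>
  have closed: "x + y \<in> Z" if x: "x \<in> Z" and y: "y \<in> C" for x y
  proof -
    obtain a where a: "a \<in> A" "l' * y = p ^ cond_exp * a" using y Cchar by blast
    have xN: "x \<in> N" and xU: "l' * x \<in> UA" using x by (auto simp: Z_def)
    obtain t where t: "t \<in> A" "l' * x * t = 1" using xU by (auto simp: UA_def)
    have eq: "y = (p ^ cond_exp * (a * t)) * x"
    proof -
      have "l' * ((p ^ cond_exp * (a * t)) * x) = (p ^ cond_exp * a) * (l' * x * t)" by (simp only: ac_simps)
      also have "\<dots> = l' * y" by (simp only: t a mult_1_right)
      finally have "l * (l' * ((p ^ cond_exp * (a * t)) * x)) = l * (l' * y)" by simp
      then show ?thesis using l by (simp add: mult.assoc[symmetric])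
    qed
    have "p ^ cond_exp * (a * t) \<in> R" using a t by (intro cond_exp_clears A_mult)
    then have yN: "y \<in> N" using X_R[OF N _ xN] eq by simp
    have "l' * (x + y) = (l' * x) * (1 + p ^ cond_exp * (a * t))"
      using eq by (simp add: distrib_left ac_simps)
    also have "\<dots> \<in> UA" using a t by (intro UA_mult xU one_plus_pK_unit A_mult)
    finally show ?thesis using add_subgroup_add[OF agN xN yN] by (simp add: Z_def)
  qed
  have WC: "W \<subseteq> C" by (auto simp: W_def)
  \<comment> \<open>Representatives of the units modulo \<open>p ^ cond_exp A\<close>, multiplied by
    \<open>l\<close>, represent the generators of \<open>l A\<close> modulo \<open>C\<close>. That
    \<open>u * l\<close> lies in \<open>N\<close> follows because \<open>Z\<close> absorbs
    \<open>C\<close>.\<close>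
  have "coset_reps ((\<lambda>u. u * l) ` {u \<in> unit_reps. u * l \<in> N}) Z C"
    unfolding coset_reps_def
  proof (intro conjI ballI)
    show "(\<lambda>u. u * l) ` {u \<in> unit_reps. u * l \<in> N} \<subseteq> Z"
    proof safe
      fix u assume u: "u \<in> unit_reps" "u * l \<in> N"
      have "l' * (u * l) = (l * l') * u" by (simp only: ac_simps)
      then show "u * l \<in> Z" using u l unit_reps_UA by (simp add: Z_def)
    qed
    fix x assume x: "x \<in> Z"
    have mem: "x - u * l \<in> C \<longleftrightarrow> l' * x - u \<in> (*) (p ^ cond_exp) ` A" for u
    proof -
      have "l' * (x - u * l) = l' * x - (l * l') * u" by (simp add: algebra_simps)
      then show ?thesis using l unfolding Cchar by auto
    qed
    obtain u where u: "u \<in> unit_reps" "l' * x - u \<in> (*) (p ^ cond_exp) ` A"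
      using coset_reps_unit_reps x unfolding coset_reps_def Z_def by blast
    have "x - u * l \<in> C" using u mem by blast
    then have "x + - (x - u * l) \<in> Z" by (intro closed[OF x] add_subgroup_minus[OF agC])
    then have uN: "u * l \<in> N" by (simp add: Z_def)
    show "\<exists>!d. d \<in> (\<lambda>u. u * l) ` {u \<in> unit_reps. u * l \<in> N} \<and> x - d \<in> C"
    proof (rule ex1I[of _ "u * l"])
      show "u * l \<in> (\<lambda>u. u * l) ` {u \<in> unit_reps. u * l \<in> N} \<and> x - u * l \<in> C" using u uN mem by blast
      fix d assume "d \<in> (\<lambda>u. u * l) ` {u \<in> unit_reps. u * l \<in> N} \<and> x - d \<in> C"
      then obtain t where "t \<in> unit_reps" "d = t * l" "l' * x - t \<in> (*) (p ^ cond_exp) ` A" using mem by blast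
      moreover have "l' * x \<in> UA" using x by (simp add: Z_def)
      ultimately show "d = u * l" using coset_reps_unique[OF coset_reps_unit_reps, of "l' * x" t u] u by blast
    qed
  qed
  then have "idx Z C = card ((\<lambda>u. u * l) ` {u \<in> unit_reps. u * l \<in> N})" by (rule idx_eq_card[OF agC])
  also have "\<dots> = card {u \<in> unit_reps. u * l \<in> N}"
  proof (rule card_image, rule inj_onI)
    fix u t assume "u * l = t * l"
    then have "u * (l * l') = t * (l * l')" by (simp add: mult.assoc[symmetric])
    then show "u = t" using l by simp
  qed
  finally have idxZC: "idx Z C = card {u \<in> unit_reps. u * l \<in> N}" .
  have "real (card {u \<in> unit_reps. u * l \<in> N}) * real (idx C W) = real (idx Z W)"
    using idx_trans_closed(1)[OF agW agC closed WC] idxZC by simp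
  also have "\<dots> = (\<Sum>J\<in>Pow idems. (- 1) ^ card J * (real q powi (ri (N \<inter> B J) C) * real (idx C W)))"
    unfolding idxZ
  proof (rule sum.cong)
    fix J assume "J \<in> Pow idems"
    then have J: "J \<subseteq> idems" by simp
    have "W \<subseteq> N \<inter> B J" using Bchar[OF J] Bchar[of idems] J by (auto simp: W_def)
    then show "(- 1) ^ card J * real (idx (N \<inter> B J) W) =
        (- 1) ^ card J * (real q powi (ri (N \<inter> B J) C) * real (idx C W))"
      using idx_ratio[OF latW latNB[OF J] latC _ WC] by simp
  qed simp
  also have "\<dots> = (\<Sum>J\<in>Pow idems. (- 1) ^ card J * real q powi (ri (N \<inter> B J) C)) * real (idx C W)"
    by (simp add: sum_distrib_right mult.assoc)
  finally show ?thesis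
    using lat_idx_pos[OF latW latC] by (simp add: B_def C_def)
qed

section \<open>The weights of the fractional ideals\<close>

text \<open>For a unit of \<open>E\<close> this is the sum over the factors of valuation times
  residue degree, expressed as an index.\<close>

definition vA :: "'e \<Rightarrow> int" where
  "vA x = ri A ((*) x ` A)"

lemma scale_scale_image: "(*) (x * y) ` M = (*) x ` (*) y ` (M :: 'e set)"
  by (simp add: image_image mult.assoc)

lemma vA_mult: assumes x: "x * x' = 1" and y: "y * y' = 1" shows "vA (x * y) = vA x + vA y"
proof -
  have lx: "lat ((*) x ` A)" and ly: "lat ((*) y ` A)" using lat_scale[OF lat_A] x y by auto
  have lxy: "lat ((*) x ` (*) y ` A)" by (rule lat_scale[OF ly x])
  have "vA (x * y) = ri A ((*) x ` A) + ri ((*) x ` A) ((*) x ` (*) y ` A)"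
    unfolding vA_def scale_scale_image by (rule ri_trans[OF lat_A lx lxy])
  also have "ri ((*) x ` A) ((*) x ` (*) y ` A) = ri A ((*) y ` A)" by (rule ri_scale[OF x lat_A ly])
  finally show ?thesis by (simp add: vA_def)
qed

lemma vA_1: "vA 1 = 0"
  by (simp add: vA_def ri_self[OF lat_A])

lemma vA_inverse: assumes x: "x * x' = 1" shows "vA x' = - vA x"
proof -
  have "x' * x = 1" using x by (simp add: mult.commute)
  then show ?thesis using vA_mult[OF x \<open>x' * x = 1\<close>] x vA_1 by simp
qed

lemma vA_UA: "u \<in> UA \<Longrightarrow> vA u = 0"
  by (simp add: vA_def UA_scale_A ri_self[OF lat_A])

lemma ri_scale_self:
  assumes x: "x * x' = 1" and M: "lat M" shows "ri M ((*) x ` M) = vA x"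
  unfolding vA_def by (rule ri_unit_indep[OF x M lat_A])

lemma ri_scale_A:
  assumes x: "x * x' = 1" and y: "y * y' = 1" shows "ri ((*) x ` A) ((*) y ` A) = vA y - vA x"
proof -
  have lx: "lat ((*) x ` A)" and ly: "lat ((*) y ` A)" using lat_scale[OF lat_A] x y by auto
  show ?thesis using ri_trans[OF lat_A lx ly] by (simp add: vA_def)
qed

lemma D_sumset: assumes "lat M" "lat N" shows "D (sumset M N) = D M \<inter> D N"
proof (intro equalityI subsetI)
  fix x assume "x \<in> D (sumset M N)"
  then show "x \<in> D M \<inter> D N"
    using D_antimono[OF sumset_upper1[OF lat_add_subgroup[OF assms(2)], of M]]
      D_antimono[OF sumset_upper2[OF lat_add_subgroup[OF assms(1)], of N]] by auto
next
  fix x assume x: "x \<in> D M \<inter> D N"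
  show "x \<in> D (sumset M N)"
    unfolding mem_D
  proof
    fix y assume "y \<in> sumset M N"
    then obtain m n where "m \<in> M" "n \<in> N" "y = m + n" by (auto simp: sumset_def)
    then show "tr (c_inv * x * y) \<in> val_ring av"
      using x by (auto simp: mem_D distrib_left tr_add intro!: val_ring_add)
  qed
qed

lemma D_scale_A: assumes x: "x * x' = 1" shows "D ((*) x' ` A) = (*) x ` A"
proof -
  have x': "x' * x = 1" using x by (simp add: mult.commute)
  have "y \<in> D ((*) x' ` A) \<longleftrightarrow> y \<in> (*) x ` A" for y
    using D_scale[OF x', of y A] by (simp add: D_A mem_mult_unit_iff[OF x])
  then show ?thesis by blast
qed

text \<open>As \<open>A\<close> is self-dual, \<open>D N \<inter> x A\<close> is the dual of
  \<open>N + x' A\<close>, so its index is that of the sum; the second isomorphism theorem turns the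
  sum back into an intersection.\<close>

lemma ri_D_Int:
  assumes N: "lat N" and x: "x * x' = 1"
  shows "ri (D N \<inter> (*) x ` A) A = ri A N + ri (N \<inter> (*) x' ` A) ((*) x' ` A)"
proof -
  have x': "x' * x = 1" using x by (simp add: mult.commute)
  have lx: "lat ((*) x' ` A)" by (rule lat_scale[OF lat_A x'])
  let ?S = "sumset N ((*) x' ` A)"
  have S: "lat ?S" by (rule lat_sumset[OF N lx])
  have I: "lat (N \<inter> (*) x' ` A)" by (rule lat_Int[OF N lx])
  have "ri (D N \<inter> (*) x ` A) A = ri (D ?S) (D A)"
    unfolding D_sumset[OF N lx] D_scale_A[OF x] D_A ..
  also have "\<dots> = ri A ?S" by (rule ri_D[OF lat_A S])
  also have "\<dots> = ri A N + ri N ?S" by (rule ri_trans[OF lat_A N S])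
  also have "ri N ?S = - ri ?S N" by (rule ri_sym[OF S N])
  also have "ri ?S N = ri ((*) x' ` A) (N \<inter> (*) x' ` A)" by (rule ri_sumset[OF N lx])
  also have "\<dots> = - ri (N \<inter> (*) x' ` A) ((*) x' ` A)" by (rule ri_sym[OF I lx])
  finally show ?thesis by simp
qed

text \<open>The inner sum over \<open>J\<close> is the right-hand side of \<open>unit_count\<close>
  for \<open>l = ufm_prod_inv I\<close>. Written in indices, it can be compared at a lattice and at
  its dual.\<close>

definition dual_wt_sum :: "'e set \<Rightarrow> real" where
  "dual_wt_sum N = (\<Sum>I\<in>Pow idems. \<Sum>J\<in>Pow idems. (- 1) ^ (card I + card J) *
     real q powi (ri (N \<inter> (*) (ufm_prod_inv I * ufm_prod J) ` A) ((*) (ufm_prod_inv I * p ^ cond_exp) ` A)))"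

text \<open>The term \<open>(I, J)\<close> at the dual matches the term \<open>(J, I)\<close> at
  \<open>N\<close> up to the common factor \<open>q powi ri A N\<close>; the signs are symmetric in
  \<open>I\<close> and \<open>J\<close>.\<close>

lemma dual_wt_sum_dual: assumes N: "lat N" shows "dual_wt_sum (D N) = real q powi (ri A N) * dual_wt_sum N"
proof -
  have q0: "real q \<noteq> 0" using q_ge_2 by simp
  have swap: "ri (D N \<inter> (*) (ufm_prod_inv I * ufm_prod J) ` A) ((*) (ufm_prod_inv I * p ^ cond_exp) ` A) =
      ri A N + ri (N \<inter> (*) (ufm_prod_inv J * ufm_prod I) ` A) ((*) (ufm_prod_inv J * p ^ cond_exp) ` A)"
    if I: "I \<subseteq> idems" and J: "J \<subseteq> idems" for I J
  proof -
    have uI: "ufm_prod I * ufm_prod_inv I = 1" "ufm_prod_inv I * ufm_prod I = 1" and uJ: "ufm_prod J * ufm_prod_inv J = 1" "ufm_prod_inv J * ufm_prod J = 1"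
      using ufm_prod_ufm_prod_inv ufm_prod_inv_ufm_prod I J by auto
    have x: "(ufm_prod_inv I * ufm_prod J) * (ufm_prod_inv J * ufm_prod I) = 1"
    proof -
      have "(ufm_prod_inv I * ufm_prod J) * (ufm_prod_inv J * ufm_prod I) = (ufm_prod I * ufm_prod_inv I) * (ufm_prod J * ufm_prod_inv J)" by (simp only: ac_simps)
      then show ?thesis using uI uJ by simp
    qed
    have x': "(ufm_prod_inv J * ufm_prod I) * (ufm_prod_inv I * ufm_prod J) = 1" using x by (simp add: mult.commute)
    have unit: "(a * p ^ cond_exp) * (b * p_inv ^ cond_exp) = 1" if "a * b = 1" for a b
    proof -
      have "(a * p ^ cond_exp) * (b * p_inv ^ cond_exp) = (a * b) * (p ^ cond_exp * p_inv ^ cond_exp)" by (simp only: ac_simps)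
      then show ?thesis using that p_power_inv by simp
    qed
    note uIp = unit[OF uI(2)] and uJp = unit[OF uJ(2)]
    have l1: "lat ((*) (ufm_prod_inv I * p ^ cond_exp) ` A)" by (rule lat_scale[OF lat_A uIp])
    have l2: "lat ((*) (ufm_prod_inv J * p ^ cond_exp) ` A)" by (rule lat_scale[OF lat_A uJp])
    have l3: "lat ((*) (ufm_prod_inv J * ufm_prod I) ` A)" by (rule lat_scale[OF lat_A x'])
    have l4: "lat ((*) (ufm_prod_inv I * ufm_prod J) ` A)" by (rule lat_scale[OF lat_A x])
    have v1: "vA (ufm_prod_inv I * p ^ cond_exp) = vA (p ^ cond_exp) - vA (ufm_prod I)"
      using vA_mult[OF uI(2) p_power_inv] vA_inverse[OF uI(1)] by simp
    have v2: "vA (ufm_prod_inv J * p ^ cond_exp) = vA (p ^ cond_exp) - vA (ufm_prod J)"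
      using vA_mult[OF uJ(2) p_power_inv] vA_inverse[OF uJ(1)] by simp
    have v3: "vA (ufm_prod_inv J * ufm_prod I) = vA (ufm_prod I) - vA (ufm_prod J)"
      using vA_mult[OF uJ(2) uI(1)] vA_inverse[OF uJ(1)] by simp
    have "ri (D N \<inter> (*) (ufm_prod_inv I * ufm_prod J) ` A) ((*) (ufm_prod_inv I * p ^ cond_exp) ` A) =
        ri (D N \<inter> (*) (ufm_prod_inv I * ufm_prod J) ` A) A + vA (ufm_prod_inv I * p ^ cond_exp)"
      unfolding vA_def by (rule ri_trans[OF lat_Int[OF lat_D[OF N] l4] lat_A l1])
    also have "\<dots> = ri A N + ri (N \<inter> (*) (ufm_prod_inv J * ufm_prod I) ` A) ((*) (ufm_prod_inv J * ufm_prod I) ` A) + vA (ufm_prod_inv I * p ^ cond_exp)"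
      using ri_D_Int[OF N x] by simp
    \<comment> \<open>Both sides equal \<open>vA (p ^ cond_exp) - vA (ufm_prod I)\<close>; the
      contribution of \<open>J\<close> cancels on the right.\<close>
    also have "vA (ufm_prod_inv I * p ^ cond_exp) = ri ((*) (ufm_prod_inv J * ufm_prod I) ` A) ((*) (ufm_prod_inv J * p ^ cond_exp) ` A)"
      unfolding ri_scale_A[OF x' uJp] using v1 v2 v3 by simp
    also have "ri A N + ri (N \<inter> (*) (ufm_prod_inv J * ufm_prod I) ` A) ((*) (ufm_prod_inv J * ufm_prod I) ` A) +
        ri ((*) (ufm_prod_inv J * ufm_prod I) ` A) ((*) (ufm_prod_inv J * p ^ cond_exp) ` A) =
        ri A N + ri (N \<inter> (*) (ufm_prod_inv J * ufm_prod I) ` A) ((*) (ufm_prod_inv J * p ^ cond_exp) ` A)"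
      using ri_trans[OF lat_Int[OF N l3] l3 l2] by simp
    finally show ?thesis .
  qed
  have "dual_wt_sum (D N) = (\<Sum>I\<in>Pow idems. \<Sum>J\<in>Pow idems. (- 1) ^ (card I + card J) *
     (real q powi (ri A N) * real q powi (ri (N \<inter> (*) (ufm_prod_inv J * ufm_prod I) ` A) ((*) (ufm_prod_inv J * p ^ cond_exp) ` A))))"
    unfolding dual_wt_sum_def using q0 by (intro sum.cong) (auto simp: swap power_int_add)
  also have "\<dots> = (\<Sum>J\<in>Pow idems. \<Sum>I\<in>Pow idems. (- 1) ^ (card I + card J) *
     (real q powi (ri A N) * real q powi (ri (N \<inter> (*) (ufm_prod_inv J * ufm_prod I) ` A) ((*) (ufm_prod_inv J * p ^ cond_exp) ` A))))"
    by (rule sum.swap)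
  also have "\<dots> = real q powi (ri A N) * dual_wt_sum N"
    unfolding dual_wt_sum_def sum_distrib_left by (intro sum.cong) (auto simp: ac_simps)
  finally show ?thesis .
qed

text \<open>Writing \<open>(M \<subseteq> D R)\<close> for 1 or 0 according to whether the inclusion holds, and \<open>P\<^sub>I\<close> for \<open>ufm_prod I\<close>,
  multiplication of \<open>\<Sum>\<^sub>M (M \<subseteq> D R) t\<^bsup>[D R : M]\<^esup>\<close> by \<open>\<Prod>\<^sub>e (1 - t\<^bsup>n\<^sub>e\<^esup>)\<close> replaces the coefficient of \<open>M\<close> by the alternating
  sum of the \<open>(P\<^sub>I\<inverse> M \<subseteq> D R)\<close>, and \<open>P\<^sub>I\<inverse> M \<subseteq> D R\<close> says that \<open>P\<^sub>I\<inverse> \<in> D M\<close>. Averaging over the units makes these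
  weights accessible to \<open>unit_count\<close>.\<close>

definition wt :: "'e set \<Rightarrow> int" where
  "wt M = (\<Sum>I\<in>Pow idems. (- 1) ^ card I * (if ufm_prod_inv I \<in> D M then 1 else 0))"

definition wt_sum :: "'e set \<Rightarrow> int" where
  "wt_sum M = (\<Sum>u\<in>unit_reps. wt ((*) u ` M))"

text \<open>After exchanging the sums, the coefficient of \<open>I\<close> is the number of
  \<open>u\<close> with \<open>u * ufm_prod_inv I\<close> in \<open>D M\<close>, which
  \<open>unit_count\<close> evaluates.\<close>

lemma wt_sum_eq: assumes M: "M \<in> X" shows "real_of_int (wt_sum M) = dual_wt_sum (D M)"
proof -
  have "real_of_int (wt_sum M) = (\<Sum>u\<in>unit_reps. \<Sum>I\<in>Pow idems. (- 1) ^ card I * (if u * ufm_prod_inv I \<in> D M then 1 else 0))"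
    unfolding wt_sum_def wt_def of_int_sum
  proof (intro sum.cong refl)
    fix u I assume "u \<in> unit_reps"
    then obtain v where "u * v = 1" using UA_unit unit_reps_UA by blast
    then have "ufm_prod_inv I \<in> D ((*) u ` M) \<longleftrightarrow> u * ufm_prod_inv I \<in> D M" by (rule D_scale)
    then show "real_of_int ((- 1) ^ card I * (if ufm_prod_inv I \<in> D ((*) u ` M) then 1 else 0)) =
        (- 1) ^ card I * (if u * ufm_prod_inv I \<in> D M then 1 else 0)" by simp
  qed
  also have "\<dots> = (\<Sum>I\<in>Pow idems. (- 1) ^ card I * real (card {u \<in> unit_reps. u * ufm_prod_inv I \<in> D M}))"
  proof (subst sum.swap, rule sum.cong)
    fix I :: "'e set"
    have "{u \<in> unit_reps. u * ufm_prod_inv I \<in> D M} = unit_reps \<inter> {u. u * ufm_prod_inv I \<in> D M}" by auto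
    then have "real (card {u \<in> unit_reps. u * ufm_prod_inv I \<in> D M}) = (\<Sum>u\<in>unit_reps. if u * ufm_prod_inv I \<in> D M then 1 else 0)"
      using sum.inter_restrict[OF finite_unit_reps, of "\<lambda>_. 1 :: real" "{u. u * ufm_prod_inv I \<in> D M}"] by simp
    then show "(\<Sum>u\<in>unit_reps. (- 1) ^ card I * (if u * ufm_prod_inv I \<in> D M then 1 else 0)) =
        (- 1) ^ card I * real (card {u \<in> unit_reps. u * ufm_prod_inv I \<in> D M})"
      by (simp add: sum_distrib_left)
  qed simp
  also have "\<dots> = dual_wt_sum (D M)"
    unfolding dual_wt_sum_def
  proof (rule sum.cong)
    fix I assume "I \<in> Pow idems"
    then have "ufm_prod_inv I * ufm_prod I = 1" using ufm_prod_inv_ufm_prod by blast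
    from unit_count[OF D_X[OF M] this]
    show "(- 1) ^ card I * real (card {u \<in> unit_reps. u * ufm_prod_inv I \<in> D M}) =
      (\<Sum>J\<in>Pow idems. (- 1) ^ (card I + card J) *
        real q powi (ri (D M \<inter> (*) (ufm_prod_inv I * ufm_prod J) ` A) ((*) (ufm_prod_inv I * p ^ cond_exp) ` A)))"
      by (simp add: sum_distrib_left power_add mult.assoc)
  qed simp
  finally show ?thesis .
qed

lemma wt_sum_dual:
  assumes M: "M \<in> X" shows "real_of_int (wt_sum M) = real q powi (ri A M) * real_of_int (wt_sum (D M))"
  unfolding wt_sum_eq[OF M] wt_sum_eq[OF D_X[OF M]] D_D[OF X_lat[OF M]] by (rule dual_wt_sum_dual[OF X_lat[OF M]])

lemma ufm_unit_inv_comp_complement: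
  assumes e: "e \<in> idems" shows "(1 - e) * uinv (ufm_unit e) = 1 - e"
proof -
  have ee: "e * e = e" by (rule prim_idemD(1)[OF e])
  have "(1 - e) * ufm_unit e = 1 - e"
    using ee ufm_factor[OF e] by (simp add: ufm_unit_def algebra_simps)
  then have "(1 - e) * (ufm_unit e * uinv (ufm_unit e)) = (1 - e) * uinv (ufm_unit e)" by (simp add: mult.assoc[symmetric])
  then show ?thesis by (simp add: ufm_unit_inverse[OF e])
qed

text \<open>If \<open>D M\<close> is large in the direction of \<open>e\<close>, the terms of \<open>I\<close> and of \<open>insert e I\<close> cancel.\<close>

lemma wt_eq_0:
  assumes M: "M \<in> X" and e: "e \<in> idems" and sub: "\<And>a. a \<in> A \<Longrightarrow> e * uinv (ufm_unit e) * a \<in> D M"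
  shows "wt M = 0"
proof -
  define B where "B = idems - {e}"
  have B: "idems = insert e B" "finite B" "e \<notin> B" using e finite_prim_idem by (auto simp: B_def)
  let ?F = "\<lambda>I. (- 1) ^ card I * (if ufm_prod_inv I \<in> D M then 1 else 0 :: int)"
  have lD: "lat (D M)" by (rule lat_D[OF X_lat[OF M]])
  have "?F (insert e I) = - ?F I" if "I \<subseteq> B" for I
  proof -
    have I: "I \<subseteq> idems" "e \<notin> I" "finite I" using that B finite_subset by auto
    have eq: "ufm_prod_inv (insert e I) = uinv (ufm_unit e) * ufm_prod_inv I" using I by (simp add: ufm_prod_inv_def)
    let ?i = "uinv (ufm_unit e)"
    have "1 - ufm_unit e \<in> A" by (intro A_diff one_A ufm_unit_A e)
    then have mem: "e * ?i * (1 - ufm_unit e) \<in> D M" by (rule sub)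
    have eQ: "e * ufm_prod_inv I = e" using comp_ufm_prod_inv[OF I(1) e] I(2) by simp
    have "?i = e * ?i + (1 - e) * ?i" by (simp add: algebra_simps)
    then have i: "?i = e * ?i + (1 - e)" by (simp only: ufm_unit_inv_comp_complement[OF e])
    \<comment> \<open>The two vectors differ only in the component at \<open>e\<close>, where
      \<open>ufm_prod_inv I\<close> is 1. The difference is \<open>e * ?i\<close> times an element
      of \<open>A\<close>, so it lies in \<open>D M\<close> and both memberships agree.\<close>
    have "ufm_prod_inv (insert e I) - ufm_prod_inv I = (?i - 1) * ufm_prod_inv I" by (simp add: eq left_diff_distrib)
    also have "?i - 1 = e * ?i - e" by (subst i) simp
    also have "e * ?i - e = e * ?i * (1 - ufm_unit e)"
    proof -
      have "e * ?i * ufm_unit e = e * (ufm_unit e * ?i)" by (simp only: ac_simps)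
      then show ?thesis using ufm_unit_inverse[OF e] by (simp add: right_diff_distrib)
    qed
    also have "e * ?i * (1 - ufm_unit e) * ufm_prod_inv I = (e * ufm_prod_inv I) * ?i * (1 - ufm_unit e)" by (simp only: ac_simps)
    also have "\<dots> = e * ?i * (1 - ufm_unit e)" by (simp only: eQ)
    finally have diff: "ufm_prod_inv (insert e I) - ufm_prod_inv I \<in> D M" using mem by simp
    have "ufm_prod_inv (insert e I) \<in> D M \<longleftrightarrow> ufm_prod_inv I \<in> D M"
    proof
      assume "ufm_prod_inv (insert e I) \<in> D M"
      then have "ufm_prod_inv (insert e I) - (ufm_prod_inv (insert e I) - ufm_prod_inv I) \<in> D M" using diff by (rule osub_diff[OF lat_osub[OF lD]])
      then show "ufm_prod_inv I \<in> D M" by simp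
    next
      assume "ufm_prod_inv I \<in> D M"
      then have "ufm_prod_inv I + (ufm_prod_inv (insert e I) - ufm_prod_inv I) \<in> D M" using diff by (rule osub_add[OF lat_osub[OF lD]])
      then show "ufm_prod_inv (insert e I) \<in> D M" by simp
    qed
    then show ?thesis using I by simp
  qed
  then have "(\<Sum>I\<in>Pow B. ?F (insert e I)) = (\<Sum>I\<in>Pow B. - ?F I)" by (intro sum.cong) auto
  then show ?thesis unfolding wt_def B(1) sum_Pow_insert[OF B(2,3)] by (simp add: sum_negf)
qed

text \<open>A nonzero weight needs some \<open>ufm_prod_inv I\<close> in \<open>D M\<close>, which
  bounds \<open>D M\<close> from below through the conductor. By \<open>wt_eq_0\<close>,
  \<open>D M\<close> contains \<open>e * uinv (ufm_unit e) * A\<close> for no \<open>e\<close>,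
  which bounds each component from above; the extra factor \<open>p\<close> clears the inverse
  uniformizer.\<close>

lemma wt_nz_bounds:
  assumes M: "M \<in> X" and w: "wt M \<noteq> 0"
  shows "\<And>x. x \<in> A \<Longrightarrow> p ^ cond_exp * x \<in> D M" and "\<And>x. x \<in> D M \<Longrightarrow> p ^ Suc cond_exp * x \<in> A"
proof -
  have DX: "D M \<in> X" by (rule D_X[OF M])
  have "\<exists>I\<in>Pow idems. ufm_prod_inv I \<in> D M"
  proof (rule ccontr)
    assume "\<not> ?thesis"
    then have "wt M = 0" unfolding wt_def by (intro sum.neutral) auto
    then show False using w by simp
  qed
  then obtain I where I: "I \<subseteq> idems" "ufm_prod_inv I \<in> D M" by blast
  show "p ^ cond_exp * x \<in> D M" if x: "x \<in> A" for x
  proof -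
    have "p ^ cond_exp * (x * ufm_prod I) \<in> R" by (intro cond_exp_clears A_mult x ufm_prod_A I)
    then have "p ^ cond_exp * (x * ufm_prod I) * ufm_prod_inv I \<in> D M" using X_R[OF DX _ I(2)] by blast
    moreover have "p ^ cond_exp * (x * ufm_prod I) * ufm_prod_inv I = p ^ cond_exp * x * (ufm_prod I * ufm_prod_inv I)" by (simp only: ac_simps)
    ultimately show ?thesis using ufm_prod_ufm_prod_inv[OF I(1)] by simp
  qed
  show "p ^ Suc cond_exp * x \<in> A" if x: "x \<in> D M" for x
  proof (rule A_components)
    fix e :: 'e assume e: "e \<in> idems"
    let ?i = "uinv (ufm_unit e)"
    let ?y = "e * (p ^ cond_exp * x)" and ?z = "e * ?i"
    have eA: "e \<in> A" by (rule prim_A[OF e])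
    obtain a where a: "a \<in> A" "?z * a \<notin> D M" using wt_eq_0[OF M e] w by blast
    show "e * (p ^ Suc cond_exp * x) \<in> A"
    proof (cases "?y = 0")
      case True
      have "e * (p ^ Suc cond_exp * x) = p * ?y" by (simp add: ac_simps)
      then show ?thesis using True osub_0[OF osub_A] by simp
    next
      case False
      have z0: "?z \<noteq> 0" using ufm_unit_inv_notin[OF e] osub_0[OF osub_A] by metis
      have fac: "?y \<in> factor e" "?z \<in> factor e" by (intro factor_mult1 prim_in_factor e)+
      consider w where "w \<in> integ e" "?y = ?z * w" | w where "w \<in> integ e" "?z = ?y * w"
        using factor_dichotomy[OF e fac(1) False fac(2) z0] by blast
      then show ?thesis
      proof cases
        case 1
        have "e * (p ^ Suc cond_exp * x) = p * ?y" by (simp add: ac_simps)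
        also have "\<dots> = e * (p * ?i) * w" unfolding 1(2) by (simp only: ac_simps)
        also have "\<dots> \<in> A" using 1(1) by (intro A_mult eA p_ufm_unit_inv e) auto
        finally show ?thesis .
      next
        case 2
        \<comment> \<open>In this case \<open>?z * a\<close> would be an \<open>R\<close>-multiple
          of \<open>x\<close>, contrary to the choice of \<open>a\<close>.\<close>
        have "p ^ cond_exp * (e * w * a) \<in> R" using 2(1) a(1) by (intro cond_exp_clears A_mult eA) auto
        then have "p ^ cond_exp * (e * w * a) * x \<in> D M" using X_R[OF DX _ x] by blast
        moreover have "?z * a = p ^ cond_exp * (e * w * a) * x" unfolding 2(2) by (simp only: ac_simps)
        ultimately show ?thesis using a(2) by simp
      qed
    qed
  qed
qed

definition wt_supp :: "'e set set" where
  "wt_supp = {M \<in> X. wt M \<noteq> 0}"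

lemma finite_wt_supp: "finite wt_supp"
proof -
  let ?S = "{N. osub N \<and> (*) (p ^ cond_exp) ` A \<subseteq> N \<and> N \<subseteq> (*) (p_inv ^ Suc cond_exp) ` A}"
  have fin: "finite ?S" by (rule lat_finite_intermediate[OF lat_p_inv_power[OF lat_A] lat_pK])
  have "wt_supp \<subseteq> D ` ?S"
  proof
    fix M assume "M \<in> wt_supp"
    then have M: "M \<in> X" "wt M \<noteq> 0" by (auto simp: wt_supp_def)
    have "(*) (p ^ cond_exp) ` A \<subseteq> D M" using wt_nz_bounds(1)[OF M] by auto
    moreover have "D M \<subseteq> (*) (p_inv ^ Suc cond_exp) ` A"
    proof
      fix x assume "x \<in> D M"
      then have "p ^ Suc cond_exp * x \<in> A" by (rule wt_nz_bounds(2)[OF M])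
      then show "x \<in> (*) (p_inv ^ Suc cond_exp) ` A" unfolding mem_mult_unit_iff[OF p_inv_power] .
    qed
    moreover have "osub (D M)" by (intro lat_osub lat_D X_lat M)
    ultimately have "D M \<in> ?S" by blast
    moreover have "M = D (D M)" using D_D[OF X_lat[OF M(1)]] by simp
    ultimately show "M \<in> D ` ?S" by blast
  qed
  then show ?thesis by (rule finite_subset) (rule finite_imageI[OF fin])
qed

section \<open>Residue degrees\<close>

lemma zero_nonunit: assumes e: "e \<in> idems" shows "0 \<in> nonunits e"
  using p_integ_nonunit[OF e, of 0] osub_0[OF osub_A] by (simp add: factor_def)

lemma sc_nonunit: assumes e: "e \<in> idems" and "a \<in> val_ring av" "x \<in> nonunits e" shows "sc a x \<in> nonunits e"
proof -
  have "sc a 1 \<in> A" using assms osub_sc[OF osub_A _ one_A] by blast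
  then have "x * sc a 1 \<in> nonunits e" using nonunits_mult_A[OF assms(3) _ e] by blast
  then show ?thesis by (simp add: sc_mult_right)
qed

lemma nonunits_sum: "e \<in> idems \<Longrightarrow> (\<And>i. i \<in> I \<Longrightarrow> f i \<in> nonunits e) \<Longrightarrow> sum f I \<in> nonunits e"
  by (induction I rule: infinite_finite_induct) (auto intro: zero_nonunit nonunits_add)

definition residue_span :: "'e \<Rightarrow> 'e set \<Rightarrow> bool" where
  "residue_span e S \<longleftrightarrow> finite S \<and> S \<subseteq> integ e \<and>
     (\<forall>x\<in>integ e. \<exists>u\<in>S \<rightarrow> val_ring av. x - (\<Sum>b\<in>S. sc (u b) b) \<in> nonunits e)"

lemma residue_span_exists: assumes e: "e \<in> idems" shows "\<exists>S. residue_span e S"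
proof -
  obtain S0 where S0: "finite S0" "A = osub hull S0" using lat_fg[OF lat_A] by blast
  let ?S = "(*) e ` S0"
  have S0A: "S0 \<subseteq> A" unfolding S0(2) by (rule hull_subset)
  have "\<exists>u\<in>?S \<rightarrow> val_ring av. x - (\<Sum>b\<in>?S. sc (u b) b) \<in> nonunits e" if x: "x \<in> integ e" for x
  proof -
    have "S0 \<subseteq> {y. e * y \<in> osub hull ?S}" using hull_subset[of ?S osub] by auto
    then have "A \<subseteq> {y. e * y \<in> osub hull ?S}"
      unfolding S0(2) by (rule hull_minimal) (intro osub_vimage_mult OF_submodule_hull)
    then have "e * x \<in> osub hull ?S" using x by auto
    then have "x \<in> osub hull ?S" using x by (simp add: factor_def)
    then obtain u where "u \<in> ?S \<rightarrow> val_ring av" "x = (\<Sum>b\<in>?S. sc (u b) b)"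
      using OF_hull_finite[OF finite_imageI[OF S0(1), of "(*) e"]] by blast
    then show ?thesis using zero_nonunit[OF e] by (intro bexI[of _ u]) auto
  qed
  moreover have "?S \<subseteq> integ e" using S0A A_comp[OF e] by auto
  ultimately show ?thesis using S0(1) unfolding residue_span_def by blast
qed

lemma residue_basis_iff:
  "residue_basis av sc e S \<longleftrightarrow> residue_span e S \<and>
     (\<forall>u\<in>S \<rightarrow> val_ring av. (\<Sum>b\<in>S. sc (u b) b) \<in> nonunits e \<longrightarrow> (\<forall>b\<in>S. u b \<in> val_ideal av))"
  unfolding residue_basis_def residue_span_def factor_max_ideal_eq factor_integers_eq by blast

text \<open>A spanning set of least size works: a relation with a coefficient outside the maximal
  ideal would allow one element to be discarded.\<close>

lemma residue_basis_exists: assumes e: "e \<in> idems" shows "\<exists>S. residue_basis av sc e S"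
proof -
  obtain S where S: "residue_span e S" and min: "\<And>S'. residue_span e S' \<Longrightarrow> card S \<le> card S'"
    using ex_has_least_nat[of "residue_span e" _ card] residue_span_exists[OF e] by metis
  have finS: "finite S" using S by (simp add: residue_span_def)
  have "b0 \<in> S \<Longrightarrow> u b0 \<in> val_ideal av"
    if u: "u \<in> S \<rightarrow> val_ring av" "(\<Sum>b\<in>S. sc (u b) b) \<in> nonunits e" for u b0
  proof (rule ccontr)
    assume b0: "b0 \<in> S" "u b0 \<notin> val_ideal av"
    then have "av (u b0) = 1" using u val_ring_cases by blast
    then have inv: "inverse (u b0) \<in> val_ring av" "u b0 \<noteq> 0" using unit_inverse av_eq_0_iff[of "u b0"] by auto
    have "residue_span e (S - {b0})"
      unfolding residue_span_def
    proof (intro conjI ballI)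
      fix x assume "x \<in> integ e"
      then obtain a where a: "a \<in> S \<rightarrow> val_ring av" "x - (\<Sum>b\<in>S. sc (a b) b) \<in> nonunits e"
        using S unfolding residue_span_def by blast
      define k where "k = a b0 * inverse (u b0)"
      have k: "k \<in> val_ring av" unfolding k_def using a b0 inv by (auto intro: val_ring_mult)
      have "x - (\<Sum>b\<in>S. sc (a b) b) + sc k (\<Sum>b\<in>S. sc (u b) b) \<in> nonunits e"
        by (intro nonunits_add[OF e] a(2) sc_nonunit[OF e k u(2)])
      also have "x - (\<Sum>b\<in>S. sc (a b) b) + sc k (\<Sum>b\<in>S. sc (u b) b) = x - (\<Sum>b\<in>S. sc (a b - k * u b) b)"
        by (simp add: scale_sum_right scale_left_diff_distrib sum_subtractf)
      also have "(\<Sum>b\<in>S. sc (a b - k * u b) b) = (\<Sum>b\<in>S - {b0}. sc (a b - k * u b) b)"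
        using inv by (subst sum.remove[OF finS b0(1)]) (simp add: k_def)
      finally have "x - (\<Sum>b\<in>S - {b0}. sc (a b - k * u b) b) \<in> nonunits e" .
      moreover have "(\<lambda>b. a b - k * u b) \<in> S - {b0} \<rightarrow> val_ring av"
        using a(1) u(1) k by (auto intro!: val_ring_diff val_ring_mult)
      ultimately show "\<exists>u\<in>S - {b0} \<rightarrow> val_ring av. x - (\<Sum>b\<in>S - {b0}. sc (u b) b) \<in> nonunits e"
        by (intro bexI[of _ "\<lambda>b. a b - k * u b"])
    qed (use S in \<open>auto simp: residue_span_def\<close>)
    then have "card S \<le> card (S - {b0})" by (rule min)
    then show False using b0 finS by (metis card_Diff1_less not_less)
  qed
  then show ?thesis using S unfolding residue_basis_iff by blast
qed

lemma ufm_unit_image_iff: assumes e: "e \<in> idems" shows "x \<in> (*) (ufm_unit e) ` A \<longleftrightarrow> x \<in> A \<and> e * x \<in> nonunits e"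
proof -
  have "x \<in> A" if "uinv (ufm_unit e) * x \<in> A"
  proof -
    have "ufm_unit e * (uinv (ufm_unit e) * x) \<in> A" by (rule A_mult[OF ufm_unit_A[OF e] that])
    then show ?thesis by (simp add: mult.assoc[symmetric] ufm_unit_inverse[OF e])
  qed
  then show ?thesis
    using ufm_unit_inv_mult_A_iff[OF e] unfolding mem_mult_unit_iff[OF ufm_unit_inverse[OF e]] by blast
qed

text \<open>Combinations with coefficients among \<open>q\<close> digits represent \<open>A\<close>
  modulo \<open>ufm_unit e A\<close>, that is, the residue field of the factor. So
  \<open>residue_degree\<close> does not depend on the chosen basis.\<close>

lemma residue_basis_card:
  assumes e: "e \<in> idems" and S: "residue_basis av sc e S"
  shows "idx A ((*) (ufm_unit e) ` A) = q ^ card S"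
proof -
  have finS: "finite S" and SA: "S \<subseteq> integ e"
    and span: "\<And>x. x \<in> integ e \<Longrightarrow> \<exists>u\<in>S \<rightarrow> val_ring av. x - (\<Sum>b\<in>S. sc (u b) b) \<in> nonunits e"
    and ind: "\<And>u. u \<in> S \<rightarrow> val_ring av \<Longrightarrow> (\<Sum>b\<in>S. sc (u b) b) \<in> nonunits e \<Longrightarrow> \<forall>b\<in>S. u b \<in> val_ideal av"
    using S unfolding residue_basis_iff residue_span_def by blast+
  obtain Q where Q: "coset_reps Q (val_ring av) (val_ideal av)"
    using coset_reps_exist[OF add_subgroup_val_ideal] by blast
  have QO: "Q \<subseteq> val_ring av" using Q by (simp add: coset_reps_def)
  have cQ: "card Q = q" using idx_eq_card[OF add_subgroup_val_ideal Q] q_eq_idx by simp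
  let ?g = "\<lambda>f. \<Sum>b\<in>S. sc (f b) b"
  let ?F = "S \<rightarrow>\<^sub>E Q"
  let ?W = "(*) (ufm_unit e) ` A"
  have latW: "lat ?W" by (rule lat_scale[OF lat_A ufm_unit_inverse[OF e]])
  have gA: "?g f \<in> integ e" if "f \<in> S \<rightarrow> val_ring av" for f
  proof
    show "?g f \<in> A" using that SA by (intro osub_sum[OF osub_A] osub_sc[OF osub_A]) auto
    have "e * ?g f = ?g f"
      unfolding sum_distrib_left using SA by (intro sum.cong) (auto simp: sc_mult_right factor_def)
    then show "?g f \<in> factor e" by (simp add: factor_def)
  qed
  have FO: "f \<in> S \<rightarrow> val_ring av" if "f \<in> ?F" for f using that QO by auto
  have eq: "f = f'" if f: "f \<in> ?F" "f' \<in> ?F" and d: "e * (?g f - ?g f') \<in> nonunits e" for f f'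
  proof (rule PiE_ext[OF f])
    fix b assume b: "b \<in> S"
    have "?g f - ?g f' \<in> factor e" using gA[OF FO[OF f(1)]] gA[OF FO[OF f(2)]] by (auto intro: factor_diff)
    then have "?g f - ?g f' \<in> nonunits e" using d by (simp add: factor_def)
    then have "(\<Sum>b\<in>S. sc (f b - f' b) b) \<in> nonunits e"
      by (simp add: scale_left_diff_distrib sum_subtractf)
    moreover have "(\<lambda>b. f b - f' b) \<in> S \<rightarrow> val_ring av" using FO[OF f(1)] FO[OF f(2)] by (auto intro: val_ring_diff)
    ultimately have "f b - f' b \<in> val_ideal av" using ind[of "\<lambda>b. f b - f' b"] b by blast
    moreover have "f b - f b \<in> val_ideal av" using add_subgroup_zero[OF add_subgroup_val_ideal] by simp
    moreover have "f b \<in> Q" "f' b \<in> Q" using f b by auto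
    ultimately show "f b = f' b" using coset_reps_unique[OF Q, of "f b" "f b" "f' b"] QO by auto
  qed
  have inj: "inj_on ?g ?F"
    using eq zero_nonunit[OF e] by (intro inj_onI) auto
  have "coset_reps (?g ` ?F) A ?W"
    unfolding coset_reps_def
  proof (intro conjI ballI)
    show "?g ` ?F \<subseteq> A" using gA FO by blast
    fix x assume x: "x \<in> A"
    obtain u where u: "u \<in> S \<rightarrow> val_ring av" "e * x - ?g u \<in> nonunits e"
      using span[OF A_comp[OF e x]] by blast
    have "\<forall>b\<in>S. \<exists>d. d \<in> Q \<and> u b - d \<in> val_ideal av"
      using Q u(1) unfolding coset_reps_def by blast
    then obtain d where d: "\<And>b. b \<in> S \<Longrightarrow> d b \<in> Q \<and> u b - d b \<in> val_ideal av" by metis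
    define f where "f = restrict d S"
    have f: "f \<in> ?F" using d by (auto simp: f_def)
    have "?g u - ?g f = (\<Sum>b\<in>S. sc (u b - d b) b)"
      by (simp add: f_def scale_left_diff_distrib sum_subtractf)
    also have "\<dots> \<in> nonunits e"
    proof (rule nonunits_sum[OF e])
      fix b assume b: "b \<in> S"
      then obtain a where a: "u b - d b = unif * a" "a \<in> val_ring av" using d by (auto simp: val_ideal_eq)
      have "sc (u b - d b) b = p * sc a b" using sc_unif_power[of 1 "sc a b"] by (simp add: a)
      moreover have "sc a b \<in> integ e"
        using a SA b osub_sc[OF osub_A a(2), of b] by (auto simp: factor_def sc_mult_right)
      ultimately show "sc (u b - d b) b \<in> nonunits e" using p_integ_nonunit[OF e] by simp
    qed
    finally have "(e * x - ?g u) + (?g u - ?g f) \<in> nonunits e" by (rule nonunits_add[OF e u(2)])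
    moreover have egf: "e * ?g f = ?g f" if "f \<in> ?F" for f using gA[OF FO[OF that]] by (simp add: factor_def)
    ultimately have xf: "e * (x - ?g f) \<in> nonunits e" using egf[OF f] by (simp add: right_diff_distrib)
    have mem: "x - ?g f' \<in> ?W \<longleftrightarrow> e * (x - ?g f') \<in> nonunits e" if "f' \<in> ?F" for f'
      unfolding ufm_unit_image_iff[OF e] using A_diff[OF x] gA[OF FO[OF that]] by blast
    show "\<exists>!s. s \<in> ?g ` ?F \<and> x - s \<in> ?W"
    proof (rule ex1I[of _ "?g f"])
      show "?g f \<in> ?g ` ?F \<and> x - ?g f \<in> ?W" using f xf mem by blast
      fix s assume "s \<in> ?g ` ?F \<and> x - s \<in> ?W"
      then obtain f' where f': "f' \<in> ?F" "s = ?g f'" "x - ?g f' \<in> ?W" by blast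
      have "x - ?g f \<in> ?W" using mem f xf by blast
      then have "(x - ?g f) - (x - ?g f') \<in> ?W" by (rule add_subgroup_diff[OF lat_add_subgroup[OF latW] _ f'(3)])
      then have "e * (?g f' - ?g f) \<in> nonunits e" unfolding ufm_unit_image_iff[OF e] by simp
      then show "s = ?g f" using eq[OF f'(1) f] f'(2) by blast
    qed
  qed
  then have "idx A ?W = card (?g ` ?F)" by (rule idx_eq_card[OF lat_add_subgroup[OF latW]])
  also have "\<dots> = card ?F" by (rule card_image[OF inj])
  also have "\<dots> = q ^ card S" using finS cQ by (simp add: card_PiE)
  finally show ?thesis .
qed

abbreviation "rdeg \<equiv> residue_degree av sc"

lemma vA_ufm_unit: assumes e: "e \<in> idems" shows "vA (ufm_unit e) = int (rdeg e)"
proof -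
  have "residue_basis av sc e (SOME S. residue_basis av sc e S)"
    using residue_basis_exists[OF e] by (rule someI_ex)
  then have idx: "idx A ((*) (ufm_unit e) ` A) = q ^ rdeg e"
    unfolding residue_degree_def by (rule residue_basis_card[OF e])
  have l: "lat ((*) (ufm_unit e) ` A)" by (rule lat_scale[OF lat_A ufm_unit_inverse[OF e]])
  have sub: "(*) (ufm_unit e) ` A \<subseteq> A" using A_mult[OF ufm_unit_A[OF e]] by auto
  have "q ^ len A ((*) (ufm_unit e) ` A) = q ^ rdeg e" using idx lat_idx_len[OF l lat_A sub] by simp
  then show ?thesis using q_power_inject ri_sub[OF l lat_A sub] by (simp add: vA_def)
qed

lemma rdeg_pos: assumes e: "e \<in> idems" shows "rdeg e \<ge> 1"
proof (rule ccontr)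
  assume "\<not> rdeg e \<ge> 1"
  then have "vA (ufm_unit e) = 0" using vA_ufm_unit[OF e] by simp
  have l: "lat ((*) (ufm_unit e) ` A)" by (rule lat_scale[OF lat_A ufm_unit_inverse[OF e]])
  have sub: "(*) (ufm_unit e) ` A \<subseteq> A" using A_mult[OF ufm_unit_A[OF e]] by auto
  have "len A ((*) (ufm_unit e) ` A) = 0" using \<open>vA (ufm_unit e) = 0\<close> ri_sub[OF l lat_A sub] by (simp add: vA_def)
  then have "(*) (ufm_unit e) ` A = A" by (rule len_0_imp[OF l lat_A sub])
  then have "e \<in> (*) (ufm_unit e) ` A" using prim_A[OF e] by simp
  then have "e * e \<in> nonunits e" using ufm_unit_image_iff[OF e] by blast
  then have "e \<in> nonunits e" using prim_idemD(1)[OF e] by simp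
  then show False using prim_integ[OF e] prim_idemD(1)[OF e] by (auto simp: nonunits_def unit_in_def)
qed

definition rdeg_sum :: "'e set \<Rightarrow> nat" where
  "rdeg_sum I = (\<Sum>e\<in>I. rdeg e)"

lemma vA_ufm_prod: assumes I: "I \<subseteq> idems" shows "vA (ufm_prod I) = int (rdeg_sum I)"
proof -
  have "finite I" by (rule finite_idem[OF I])
  then show ?thesis
    using I
  proof (induction I rule: finite_induct)
    case empty
    then show ?case by (simp add: ufm_prod_def rdeg_sum_def vA_1)
  next
    case (insert e I)
    have "ufm_prod (insert e I) = ufm_unit e * ufm_prod I" using insert.hyps by (simp add: ufm_prod_def)
    moreover have "vA (ufm_unit e * ufm_prod I) = vA (ufm_unit e) + vA (ufm_prod I)"
      using insert.prems by (intro vA_mult[OF ufm_unit_inverse ufm_prod_ufm_prod_inv]) auto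
    ultimately show ?case using insert by (simp add: vA_ufm_unit rdeg_sum_def)
  qed
qed

section \<open>The power series and the polynomial\<close>

text \<open>A composition series has \<open>len M N\<close> steps, each killed by \<open>p\<close>.
  All submodules of a given colength therefore contain one fixed sublattice.\<close>

lemma len_clears:
  assumes "lat N" "lat M" "N \<subseteq> M" "x \<in> M" shows "p ^ len M N * x \<in> N"
  using assms
proof (induction "len M N" arbitrary: N)
  case 0
  then have "N = M" using len_0_imp by metis
  then show ?case using 0 by simp
next
  case (Suc k)
  have "N \<noteq> M" using Suc.hyps(2) len_self Suc.prems by force
  then obtain N' where N': "osub N'" "N \<subset> N'" "N' \<subseteq> M" "idx N' N = q" "\<forall>x\<in>N'. p * x \<in> N"
    using osub_step[OF lat_osub[OF Suc.prems(1)] lat_osub[OF Suc.prems(2)] _ lat_fin_idx[OF Suc.prems(2,1)]]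
      Suc.prems(3) by blast
  have l: "lat N'" using lat_between[OF N'(1) Suc.prems(1,2)] N' by blast
  have "q ^ len N' N = q ^ 1" using lat_idx_len[OF Suc.prems(1) l] N' by simp
  then have "len N' N = 1" using q_power_inject by blast
  then have "len M N = len M N' + 1" using len_trans[OF Suc.prems(1) l Suc.prems(2)] N' by simp
  then have k: "k = len M N'" using Suc.hyps(2) by simp
  have "p ^ k * x \<in> N'" using Suc.hyps(1)[OF k l Suc.prems(2) N'(3) Suc.prems(4)] k by simp
  then have "p * (p ^ k * x) \<in> N" using N' by blast
  then show ?case using Suc.hyps(2) by (metis mult.assoc power_Suc)
qed

definition colen :: "'e set \<Rightarrow> int" where
  "colen M = ri (D R) M"

lemma lat_DR: "lat (D R)" by (rule lat_D[OF lat_R])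

lemma colen_scale: assumes "x * x' = 1" "M \<in> X" shows "colen ((*) x ` M) = colen M + vA x"
  unfolding colen_def
  using ri_trans[OF lat_DR X_lat[OF assms(2)] lat_scale[OF X_lat[OF assms(2)] assms(1)]]
    ri_scale_self[OF assms(1) X_lat[OF assms(2)]] by simp

lemma colen_nonneg: assumes "M \<in> X" "M \<subseteq> D R" shows "colen M \<ge> 0"
  unfolding colen_def using ri_sub[OF X_lat[OF assms(1)] lat_DR assms(2)] by simp

lemma ufm_prod_inv_mem_D_iff:
  assumes I: "I \<subseteq> idems" and M: "M \<in> X" shows "ufm_prod_inv I \<in> D M \<longleftrightarrow> (*) (ufm_prod_inv I) ` M \<subseteq> D R"
  using scale_subset_D_R[OF ufm_prod_inv_ufm_prod[OF I] M] by simp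

lemma vA_ufm_prod_inv: assumes I: "I \<subseteq> idems" shows "vA (ufm_prod_inv I) = - int (rdeg_sum I)"
  using vA_inverse[OF ufm_prod_ufm_prod_inv[OF I]] vA_ufm_prod[OF I] by simp

text \<open>\<open>ufm_prod_inv I M\<close> still lies in the dual of \<open>R\<close>, so its
  colength, smaller by \<open>rdeg_sum I\<close>, is nonnegative.\<close>

lemma colen_ge: assumes I: "I \<subseteq> idems" and M: "M \<in> X" and Q: "ufm_prod_inv I \<in> D M" shows "colen M \<ge> int (rdeg_sum I)"
proof -
  have "colen ((*) (ufm_prod_inv I) ` M) \<ge> 0"
    using Q ufm_prod_inv_mem_D_iff[OF I M] by (intro colen_nonneg X_scale[OF ufm_prod_inv_ufm_prod[OF I] M]) auto
  then show ?thesis using colen_scale[OF ufm_prod_inv_ufm_prod[OF I] M] vA_ufm_prod_inv[OF I] by simp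
qed

lemma wt_nz_ufm_prod_inv: assumes "wt M \<noteq> 0" shows "\<exists>I\<subseteq>idems. ufm_prod_inv I \<in> D M"
proof (rule ccontr)
  assume "\<not> ?thesis"
  then have "wt M = 0" unfolding wt_def by (intro sum.neutral) auto
  then show False using assms by simp
qed

lemma colen_wt_supp_nonneg: assumes "M \<in> wt_supp" shows "colen M \<ge> 0"
proof -
  obtain I where "I \<subseteq> idems" "ufm_prod_inv I \<in> D M" using wt_nz_ufm_prod_inv assms by (auto simp: wt_supp_def)
  then have "colen M \<ge> int (rdeg_sum I)" using assms colen_ge by (auto simp: wt_supp_def)
  then show ?thesis by simp
qed

abbreviation "Quot \<equiv> Quot_dual av sc c R"

lemma Quot_iff: "M \<in> Quot j \<longleftrightarrow> M \<in> X \<and> M \<subseteq> D R \<and> colen M = int j"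
  by (auto simp: Quot_dual_def colen_def)

lemma finite_Quot: "finite (Quot j)"
proof (rule finite_subset)
  show "finite {N. osub N \<and> (*) (p ^ j) ` D R \<subseteq> N \<and> N \<subseteq> D R}"
    by (rule lat_finite_intermediate[OF lat_DR lat_p_power[OF lat_DR]])
  show "Quot j \<subseteq> {N. osub N \<and> (*) (p ^ j) ` D R \<subseteq> N \<and> N \<subseteq> D R}"
  proof
    fix M assume "M \<in> Quot j"
    then have M: "M \<in> X" "M \<subseteq> D R" "colen M = int j" by (auto simp: Quot_iff)
    have lM: "lat M" by (rule X_lat[OF M(1)])
    have "len (D R) M = j" using M(3) ri_sub[OF lM lat_DR M(2)] by (simp add: colen_def)
    then have "(*) (p ^ j) ` D R \<subseteq> M" using len_clears[OF lM lat_DR M(2)] by auto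
    then show "M \<in> {N. osub N \<and> (*) (p ^ j) ` D R \<subseteq> N \<and> N \<subseteq> D R}"
      using M lat_osub[OF lM] by blast
  qed
qed

text \<open>The truncation by \<open>nat\<close> loses nothing, as colengths on the support are
  nonnegative (\<open>colen_wt_supp_nonneg\<close>).\<close>

definition zeta_poly :: "int poly" where
  "zeta_poly = (\<Sum>M\<in>wt_supp. monom (wt M) (nat (colen M)))"

lemma bij_scale:
  assumes x: "x * x' = 1"
    and "\<And>M. M \<in> P \<Longrightarrow> (*) x ` M \<in> Q" "\<And>M. M \<in> Q \<Longrightarrow> (*) x' ` M \<in> P"
  shows "bij_betw (\<lambda>M. (*) x ` M) P (Q :: 'e set set)"
proof (rule bij_betw_byWitness[where f' = "\<lambda>M. (*) x' ` M"])
  have x': "x' * x = 1" using x by (simp add: mult.commute)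
  show "\<forall>M\<in>P. (*) x' ` (*) x ` M = M" "\<forall>M\<in>Q. (*) x ` (*) x' ` M = M"
    using x x' by (simp_all add: scale_scale_image[symmetric])
qed (use assms in auto)

text \<open>The left-hand side is a coefficient of the Euler factors times the counting series.
  Scaling by \<open>ufm_prod I\<close> shifts colengths by \<open>rdeg_sum I\<close>, so the term of
  \<open>I\<close> counts the \<open>M\<close> of colength \<open>m\<close> with
  \<open>ufm_prod_inv I\<close> in \<open>D M\<close>.\<close>

lemma coeff_relation:
  "(\<Sum>I\<in>Pow idems. (- 1) ^ card I * (if rdeg_sum I \<le> m then int (card (Quot (m - rdeg_sum I))) else 0)) = coeff zeta_poly m"
proof -
  define S where "S I = {M \<in> X. ufm_prod_inv I \<in> D M \<and> colen M = int m}" for I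
  have S: "finite (S I) \<and> (if rdeg_sum I \<le> m then int (card (Quot (m - rdeg_sum I))) else 0) = int (card (S I))"
    if I: "I \<subseteq> idems" for I
  proof (cases "rdeg_sum I \<le> m")
    case True
    have "bij_betw (\<lambda>M. (*) (ufm_prod I) ` M) (Quot (m - rdeg_sum I)) (S I)"
    proof (rule bij_scale[OF ufm_prod_ufm_prod_inv[OF I]])
      fix M assume "M \<in> Quot (m - rdeg_sum I)"
      then have M: "M \<in> X" "M \<subseteq> D R" "colen M = int (m - rdeg_sum I)" by (auto simp: Quot_iff)
      have PM: "(*) (ufm_prod I) ` M \<in> X" by (rule X_scale[OF ufm_prod_ufm_prod_inv[OF I] M(1)])
      have "(*) (ufm_prod_inv I) ` (*) (ufm_prod I) ` M = M" by (simp add: scale_scale_image[symmetric] ufm_prod_inv_ufm_prod[OF I])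
      then have "ufm_prod_inv I \<in> D ((*) (ufm_prod I) ` M)" using ufm_prod_inv_mem_D_iff[OF I PM] M(2) by simp
      moreover have "colen ((*) (ufm_prod I) ` M) = int m"
        using colen_scale[OF ufm_prod_ufm_prod_inv[OF I] M(1)] vA_ufm_prod[OF I] M(3) True by simp
      ultimately show "(*) (ufm_prod I) ` M \<in> S I" using PM by (simp add: S_def)
    next
      fix M assume "M \<in> S I"
      then have M: "M \<in> X" "ufm_prod_inv I \<in> D M" "colen M = int m" by (auto simp: S_def)
      have "colen ((*) (ufm_prod_inv I) ` M) = int (m - rdeg_sum I)"
        using colen_scale[OF ufm_prod_inv_ufm_prod[OF I] M(1)] vA_ufm_prod_inv[OF I] M(3) True by simp
      then show "(*) (ufm_prod_inv I) ` M \<in> Quot (m - rdeg_sum I)"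
        using X_scale[OF ufm_prod_inv_ufm_prod[OF I] M(1)] ufm_prod_inv_mem_D_iff[OF I M(1)] M(2) by (simp add: Quot_iff)
    qed
    then show ?thesis using True bij_betw_same_card bij_betw_finite finite_Quot by metis
  next
    case False
    have "S I = {}" using colen_ge[OF I] False by (fastforce simp: S_def)
    then show ?thesis using False by simp
  qed
  let ?U = "\<Union>I\<in>Pow idems. S I"
  have finU: "finite ?U" using S finite_prim_idem by (intro finite_UN_I) auto
  have "(\<Sum>I\<in>Pow idems. (- 1) ^ card I * (if rdeg_sum I \<le> m then int (card (Quot (m - rdeg_sum I))) else 0)) =
     (\<Sum>I\<in>Pow idems. \<Sum>M\<in>?U. (- 1) ^ card I * (if ufm_prod_inv I \<in> D M then 1 else 0))"
  proof (rule sum.cong)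
    fix I assume I: "I \<in> Pow idems"
    have "int (card (S I)) = int (card (?U \<inter> {M. ufm_prod_inv I \<in> D M}))"
      using I by (intro arg_cong[where f = "\<lambda>S. int (card S)"]) (auto simp: S_def)
    also have "\<dots> = (\<Sum>M\<in>?U. if ufm_prod_inv I \<in> D M then 1 else 0)"
      using sum.inter_restrict[OF finU, of "\<lambda>_. 1 :: int" "{M. ufm_prod_inv I \<in> D M}"] by simp
    finally show "(- 1) ^ card I * (if rdeg_sum I \<le> m then int (card (Quot (m - rdeg_sum I))) else 0) =
        (\<Sum>M\<in>?U. (- 1) ^ card I * (if ufm_prod_inv I \<in> D M then 1 else 0))"
      using S[of I] I by (simp add: sum_distrib_left)
  qed simp
  also have "\<dots> = (\<Sum>M\<in>?U. wt M)"
    unfolding wt_def by (rule sum.swap)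
  also have "\<dots> = (\<Sum>M\<in>{M \<in> wt_supp. colen M = int m}. wt M)"
  proof (rule sum.mono_neutral_right[OF finU])
    show "{M \<in> wt_supp. colen M = int m} \<subseteq> ?U" using wt_nz_ufm_prod_inv by (auto simp: wt_supp_def S_def)
    show "\<forall>M\<in>?U - {M \<in> wt_supp. colen M = int m}. wt M = 0" by (auto simp: wt_supp_def S_def)
  qed
  also have "\<dots> = (\<Sum>M\<in>wt_supp. if nat (colen M) = m then wt M else 0)"
  proof -
    have "{M \<in> wt_supp. colen M = int m} = wt_supp \<inter> {M. nat (colen M) = m}" using colen_wt_supp_nonneg by auto
    then show ?thesis using sum.inter_restrict[OF finite_wt_supp, of wt "{M. nat (colen M) = m}"] by simp
  qed
  also have "\<dots> = coeff zeta_poly m" by (simp add: zeta_poly_def coeff_sum)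
  finally show ?thesis .
qed

lemma Quot_0: "Quot 0 = {D R}"
proof (intro equalityI subsetI)
  fix M assume "M \<in> Quot 0"
  then have M: "M \<in> X" "M \<subseteq> D R" "colen M = 0" by (auto simp: Quot_iff)
  have "len (D R) M = 0" using M ri_sub[OF X_lat[OF M(1)] lat_DR M(2)] by (simp add: colen_def)
  then show "M \<in> {D R}" using len_0_imp[OF X_lat[OF M(1)] lat_DR M(2)] by simp
next
  fix M assume "M \<in> {D R}"
  then show "M \<in> Quot 0" using D_X[OF R_X] ri_self[OF lat_DR] by (simp add: Quot_iff colen_def)
qed

text \<open>Residue degrees are positive, so only the empty \<open>I\<close> contributes, and the
  only quotient of length 0 comes from the dual of \<open>R\<close> itself.\<close>

lemma coeff_zeta_poly_0: "coeff zeta_poly 0 = 1"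
proof -
  have nz: "rdeg_sum I \<noteq> 0" if I: "I \<subseteq> idems" "I \<noteq> {}" for I
  proof -
    obtain e where "e \<in> I" using I by blast
    then have "rdeg e \<le> rdeg_sum I" unfolding rdeg_sum_def using finite_idem[OF I(1)] by (intro member_le_sum) auto
    moreover have "rdeg e \<ge> 1" using rdeg_pos \<open>e \<in> I\<close> I by blast
    ultimately show ?thesis by simp
  qed
  have "coeff zeta_poly 0 = (\<Sum>I\<in>{{}}. (- 1) ^ card I * (if rdeg_sum I \<le> 0 then int (card (Quot (0 - rdeg_sum I))) else 0))"
    unfolding coeff_relation[symmetric]
  proof (rule sum.mono_neutral_right)
    show "\<forall>I\<in>Pow idems - {{}}. (- 1) ^ card I * (if rdeg_sum I \<le> 0 then int (card (Quot (0 - rdeg_sum I))) else 0) = 0"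
    proof
      fix I assume "I \<in> Pow idems - {{}}"
      then have "rdeg_sum I \<noteq> 0" by (intro nz) auto
      then show "(- 1) ^ card I * (if rdeg_sum I \<le> 0 then int (card (Quot (0 - rdeg_sum I))) else 0) = 0" by simp
    qed
  qed (use finite_prim_idem in auto)
  then show ?thesis by (simp add: rdeg_sum_def Quot_0)
qed

section \<open>The functional equation of the polynomial\<close>

definition delta_len :: nat where
  "delta_len = len A R"

lemma delta_eq: "delta av sc R = int delta_len"
  unfolding delta_def alg_integers_eq delta_len_def by (rule ri_sub[OF lat_R lat_A R_subset_A])

lemma ri_A_R: "ri A R = int delta_len"
  using ri_sub[OF lat_R lat_A R_subset_A] by (simp add: delta_len_def)

lemma colen_eq: assumes "M \<in> X" shows "colen M = int delta_len + ri A M"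
proof -
  have "ri (D R) (D A) = ri A R" by (rule ri_D[OF lat_A lat_R])
  then have "ri (D R) A = int delta_len" by (simp add: D_A ri_A_R)
  then show ?thesis unfolding colen_def using ri_trans[OF lat_DR lat_A X_lat[OF assms]] by simp
qed

lemma colen_D: assumes M: "M \<in> X" shows "colen (D M) = int delta_len - ri A M"
proof -
  have "colen (D M) = ri M R" unfolding colen_def by (rule ri_D[OF X_lat[OF M] lat_R])
  also have "\<dots> = ri M A + ri A R" by (rule ri_trans[OF X_lat[OF M] lat_A lat_R])
  also have "ri M A = - ri A M" by (rule ri_sym[OF lat_A X_lat[OF M]])
  finally show ?thesis by (simp add: ri_A_R)
qed

lemma poly_zeta_poly:
  assumes "t \<noteq> (0 :: complex)"
  shows "poly (map_poly of_int zeta_poly) t = (\<Sum>M\<in>wt_supp. of_int (wt M) * t powi colen M)"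
proof -
  have "map_poly of_int zeta_poly = (\<Sum>M\<in>wt_supp. monom (of_int (wt M)) (nat (colen M)) :: complex poly)"
    unfolding zeta_poly_def by (simp add: poly_eq_iff coeff_map_poly coeff_sum) (auto intro!: sum.cong)
  then show ?thesis
    by (simp add: poly_sum poly_monom power_int_def colen_wt_supp_nonneg)
qed

text \<open>\<open>wt_sum M\<close> involves the translates \<open>u M\<close> only, so among
  fractional ideals it vanishes outside this finite set. In \<open>\<Omega>\<close> the duals are
  added so that \<open>D\<close> permutes the index set.\<close>

definition \<Omega>0 :: "'e set set" where
  "\<Omega>0 = (\<Union>u\<in>unit_reps. (\<lambda>M. (*) (uinv u) ` M) ` wt_supp)"

definition \<Omega> :: "'e set set" where
  "\<Omega> = \<Omega>0 \<union> D ` \<Omega>0"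

lemma unit_reps_inv: assumes "u \<in> unit_reps" shows "u * uinv u = 1" "uinv u * u = 1"
proof -
  obtain y where "u * y = 1" using UA_unit[OF unit_reps_UA[OF assms]] by blast
  then show "u * uinv u = 1" by (rule uinv)
  then show "uinv u * u = 1" by (simp add: mult.commute)
qed

lemma \<Omega>0_X: "\<Omega>0 \<subseteq> X"
  unfolding \<Omega>0_def using X_scale[OF unit_reps_inv(2)] by (auto simp: wt_supp_def)

lemma \<Omega>_X: "\<Omega> \<subseteq> X"
  unfolding \<Omega>_def using \<Omega>0_X D_X by auto

lemma finite_\<Omega>: "finite \<Omega>"
  unfolding \<Omega>_def \<Omega>0_def using finite_unit_reps finite_wt_supp by blast

lemma bij_D_\<Omega>: "bij_betw D \<Omega> \<Omega>"
proof (rule bij_betw_byWitness[where f' = D])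
  have DD: "D (D M) = M" if "M \<in> X" for M using D_D[OF X_lat[OF that]] .
  show "\<forall>M\<in>\<Omega>. D (D M) = M" "\<forall>M\<in>\<Omega>. D (D M) = M" using \<Omega>_X DD by auto
  have "D M \<in> \<Omega>" if "M \<in> \<Omega>" for M
    using that \<Omega>0_X DD unfolding \<Omega>_def by auto
  then show "D ` \<Omega> \<subseteq> \<Omega>" "D ` \<Omega> \<subseteq> \<Omega>" by auto
qed

text \<open>Units of \<open>A\<close> preserve colengths, so every \<open>u\<close> contributes the
  same sum.\<close>

lemma average:
  "of_nat (card unit_reps) * (\<Sum>M\<in>wt_supp. of_int (wt M) * t powi colen M) = (\<Sum>M\<in>\<Omega>. of_int (wt_sum M) * (t::complex) powi colen M)"
proof -
  have one: "(\<Sum>M\<in>\<Omega>. of_int (wt ((*) u ` M)) * t powi colen M) = (\<Sum>M\<in>wt_supp. of_int (wt M) * t powi colen M)"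
    if u: "u \<in> unit_reps" for u
  proof -
    note inv = unit_reps_inv[OF u]
    have "(\<Sum>M\<in>\<Omega>. of_int (wt ((*) u ` M)) * t powi colen M) =
        (\<Sum>M\<in>{M \<in> \<Omega>. (*) u ` M \<in> wt_supp}. of_int (wt ((*) u ` M)) * t powi colen M)"
      using finite_\<Omega> X_scale[OF inv(1)] \<Omega>_X by (intro sum.mono_neutral_right) (auto simp: wt_supp_def)
    also have "\<dots> = (\<Sum>M\<in>wt_supp. of_int (wt M) * t powi colen M)"
    proof (rule sum.reindex_bij_betw[THEN trans[rotated]])
      show "bij_betw (\<lambda>M. (*) u ` M) {M \<in> \<Omega>. (*) u ` M \<in> wt_supp} wt_supp"
      proof (rule bij_scale[OF inv(1)])
        fix M assume M: "M \<in> wt_supp"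
        have "(*) u ` (*) (uinv u) ` M = M" using inv by (simp add: scale_scale_image[symmetric])
        moreover have "(*) (uinv u) ` M \<in> \<Omega>" using u M by (auto simp: \<Omega>_def \<Omega>0_def)
        ultimately show "(*) (uinv u) ` M \<in> {M \<in> \<Omega>. (*) u ` M \<in> wt_supp}" using M by simp
      qed simp
      show "(\<Sum>M\<in>{M \<in> \<Omega>. (*) u ` M \<in> wt_supp}. of_int (wt ((*) u ` M)) * t powi colen M) =
        (\<Sum>M\<in>{M \<in> \<Omega>. (*) u ` M \<in> wt_supp}. of_int (wt ((*) u ` M)) * t powi colen ((*) u ` M))"
        using \<Omega>_X colen_scale[OF inv(1)] vA_UA[OF unit_reps_UA[OF u]] by (intro sum.cong) auto
    qed
    finally show ?thesis .
  qed
  have "(\<Sum>M\<in>\<Omega>. of_int (wt_sum M) * t powi colen M) = (\<Sum>M\<in>\<Omega>. \<Sum>u\<in>unit_reps. of_int (wt ((*) u ` M)) * t powi colen M)"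
    by (simp add: wt_sum_def sum_distrib_right)
  also have "\<dots> = (\<Sum>u\<in>unit_reps. \<Sum>M\<in>\<Omega>. of_int (wt ((*) u ` M)) * t powi colen M)" by (rule sum.swap)
  also have "\<dots> = (\<Sum>u\<in>unit_reps. \<Sum>M\<in>wt_supp. of_int (wt M) * t powi colen M)" by (intro sum.cong[OF refl] one)
  finally show ?thesis by simp
qed

text \<open>The averaged sum is reindexed by \<open>D\<close>. With \<open>r = ri A M\<close>, the
  exponents are \<open>delta_len + r\<close> at \<open>M\<close> and \<open>delta_len - r\<close> at
  \<open>D M\<close>, and the factor \<open>q powi r\<close> from \<open>wt_sum_dual\<close>
  accounts for the power of \<open>q\<close>.\<close>

lemma zeta_poly_functional_equation:
  fixes t :: complex
  assumes t: "t \<noteq> 0"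
  shows "poly (map_poly of_int zeta_poly) t =
    (of_nat q * t ^ 2) ^ delta_len * poly (map_poly of_int zeta_poly) (1 / (of_nat q * t))"
proof -
  let ?q = "of_nat q :: complex"
  have q0: "?q \<noteq> 0" using q_ge_2 by simp
  let ?s = "1 / (?q * t)"
  have s0: "?s \<noteq> 0" using q0 t by simp
  have W: "of_int (wt_sum M) = ?q powi (ri A M) * of_int (wt_sum (D M))" if "M \<in> X" for M
  proof -
    have "complex_of_real (real_of_int (wt_sum M)) = complex_of_real (real q powi (ri A M) * real_of_int (wt_sum (D M)))"
      by (simp only: wt_sum_dual[OF that])
    then show ?thesis by (simp add: of_real_power_int)
  qed
  have "of_nat (card unit_reps) * ((?q * t ^ 2) ^ delta_len * poly (map_poly of_int zeta_poly) ?s) =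
      (?q * t ^ 2) ^ delta_len * (\<Sum>M\<in>\<Omega>. of_int (wt_sum M) * ?s powi colen M)"
    unfolding poly_zeta_poly[OF s0] average[symmetric] by simp
  also have "(\<Sum>M\<in>\<Omega>. of_int (wt_sum M) * ?s powi colen M) = (\<Sum>M\<in>\<Omega>. of_int (wt_sum (D M)) * ?s powi colen (D M))"
    by (rule sum.reindex_bij_betw[OF bij_D_\<Omega>, symmetric])
  also have "(?q * t ^ 2) ^ delta_len * \<dots> = (\<Sum>M\<in>\<Omega>. of_int (wt_sum M) * t powi colen M)"
    unfolding sum_distrib_left
  proof (rule sum.cong)
    fix M assume "M \<in> \<Omega>"
    then have M: "M \<in> X" using \<Omega>_X by blast
    let ?r = "ri A M"
    have "?s powi colen (D M) = (?q * t) powi (?r - int delta_len)"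
    proof -
      have "(1 / x) powi n = x powi (- n)" for x :: complex and n
        by (simp add: divide_inverse power_int_inverse power_int_minus)
      then show ?thesis unfolding colen_D[OF M] by simp
    qed
    also have "\<dots> = ?q powi (?r - int delta_len) * t powi (?r - int delta_len)"
      by (rule power_int_mult_distrib)
    finally have s: "?s powi colen (D M) = ?q powi (?r - int delta_len) * t powi (?r - int delta_len)" .
    have "(?q * t ^ 2) ^ delta_len = ?q powi int delta_len * t powi (2 * int delta_len)"
    proof -
      have "t powi (2 * int delta_len) = t ^ (2 * delta_len)" using power_int_of_nat[of t "2 * delta_len"] by simp
      then show ?thesis by (simp add: power_mult_distrib power_mult)
    qed
    then have "(?q * t ^ 2) ^ delta_len * (of_int (wt_sum (D M)) * ?s powi colen (D M)) =
      (?q powi int delta_len * ?q powi (?r - int delta_len)) * of_int (wt_sum (D M)) * (t powi (2 * int delta_len) * t powi (?r - int delta_len))"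
      unfolding s by (simp only: ac_simps)
    also have "?q powi int delta_len * ?q powi (?r - int delta_len) = ?q powi ?r"
      using q0 power_int_add[of ?q "int delta_len" "?r - int delta_len"] by simp
    also have "t powi (2 * int delta_len) * t powi (?r - int delta_len) = t powi colen M"
      using t by (simp add: power_int_add[symmetric] colen_eq[OF M])
    also have "?q powi ?r * of_int (wt_sum (D M)) = of_int (wt_sum M)" using W[OF M] by simp
    finally show "(?q * t ^ 2) ^ delta_len * (of_int (wt_sum (D M)) * ?s powi colen (D M)) = of_int (wt_sum M) * t powi colen M" .
  qed simp
  also have "\<dots> = of_nat (card unit_reps) * poly (map_poly of_int zeta_poly) t"
    unfolding poly_zeta_poly[OF t] average ..
  finally show ?thesis using card_unit_reps_pos by simp
qed

text \<open>The functional equation relates the polynomial to its reversal. The constant term 1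
  ensures that the reversal has the same degree \<open>N\<close>, and comparing degrees gives
  \<open>N + N = 2 * delta_len + N\<close>.\<close>

lemma degree_zeta_poly: "degree zeta_poly = 2 * delta_len"
proof -
  let ?P = "map_poly of_int zeta_poly :: complex poly"
  let ?q = "of_nat q :: complex"
  have q0: "?q \<noteq> 0" using q_ge_2 by simp
  have c0: "coeff ?P 0 = 1" by (simp add: coeff_map_poly coeff_zeta_poly_0)
  have deg: "degree ?P = degree zeta_poly" by (rule degree_map_poly) simp
  define N where "N = degree ?P"
  \<comment> \<open>The two sides of the functional equation times \<open>t * (q * t) ^ N\<close>:
    the power \<open>N\<close> clears the denominator, and the extra \<open>t\<close> makes the
    identity hold at 0.\<close>
  define L where "L = monom (?q ^ N) (Suc N) * ?P"
  define M where "M = monom (?q ^ delta_len) (Suc (2 * delta_len)) * pcompose (reflect_poly ?P) [:0, ?q:]"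
  have "poly L t = poly M t" for t
  proof (cases "t = 0")
    case True
    then show ?thesis by (simp add: L_def M_def poly_monom)
  next
    case False
    have "poly (reflect_poly ?P) (?q * t) = (?q * t) ^ N * poly ?P (1 / (?q * t))"
      using poly_reflect_poly_nz[of "?q * t" ?P] q0 False by (simp add: N_def inverse_eq_divide)
    then have "poly M t = ?q ^ delta_len * t ^ Suc (2 * delta_len) * ((?q * t) ^ N * poly ?P (1 / (?q * t)))"
      by (simp add: M_def poly_monom poly_pcompose mult.commute[of t])
    also have "\<dots> = t * (?q * t) ^ N * ((?q * t ^ 2) ^ delta_len * poly ?P (1 / (?q * t)))"
      by (simp add: power_mult_distrib power_mult[symmetric] ac_simps)
    also have "\<dots> = t * (?q * t) ^ N * poly ?P t" by (simp only: zeta_poly_functional_equation[OF False])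
    also have "\<dots> = poly L t" by (simp add: L_def poly_monom power_mult_distrib ac_simps)
    finally show ?thesis by simp
  qed
  then have "L = M" using poly_eq_poly_eq_iff by blast
  have P0: "?P \<noteq> 0" using c0 by auto
  have "degree L = Suc N + N" unfolding L_def using P0 q0
    by (subst degree_mult_eq) (auto simp: degree_monom_eq monom_eq_0_iff N_def)
  moreover have "degree M = Suc (2 * delta_len) + N"
  proof -
    have R0: "reflect_poly ?P \<noteq> 0" using P0 by simp
    have "degree (pcompose (reflect_poly ?P) [:0, ?q:]) = N"
      using c0 q0 by (simp add: degree_reflect_poly_eq degree_pcompose N_def)
    moreover have "pcompose (reflect_poly ?P) [:0, ?q:] \<noteq> 0"
    proof
      assume "pcompose (reflect_poly ?P) [:0, ?q:] = 0"
      then have "reflect_poly ?P = 0" by (rule pcompose_eq_0) (use q0 in simp)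
      then show False using R0 by simp
    qed
    ultimately show ?thesis unfolding M_def using q0
      by (subst degree_mult_eq) (auto simp: degree_monom_eq monom_eq_0_iff)
  qed
  ultimately show ?thesis using \<open>L = M\<close> deg by (simp add: N_def)
qed

section \<open>The value at one and the orbits\<close>

definition ext :: "'e set \<Rightarrow> 'e set" where
  "ext M = ring_submodule A hull M"

lemma ring_submodule_ext: "ring_submodule A (ext M)"
  unfolding ext_def by (rule hull_in) (auto simp: ring_submodule_def)

lemma ext_upper: "M \<subseteq> ext M"
  unfolding ext_def by (rule hull_subset)

lemma ext_least: "ring_submodule A N \<Longrightarrow> M \<subseteq> N \<Longrightarrow> ext M \<subseteq> N"
  unfolding ext_def by (rule hull_minimal)

lemma ext_mult: "a \<in> A \<Longrightarrow> x \<in> ext M \<Longrightarrow> a * x \<in> ext M"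
  using ring_submodule_ext by (auto simp: ring_submodule_def)

lemma osub_ext: "osub (ext M)"
proof (rule OF_submodule_def[THEN iffD2], intro conjI ballI)
  show "0 \<in> ext M" using ring_submodule_ext by (auto simp: ring_submodule_def)
  show "x + y \<in> ext M" if "x \<in> ext M" "y \<in> ext M" for x y
    using that ring_submodule_ext unfolding ring_submodule_def by blast
  fix a x assume "a \<in> val_ring av" "x \<in> ext M"
  then have "sc a 1 * x \<in> ext M" using osub_sc[OF osub_A _ one_A] by (intro ext_mult)
  then show "sc a x \<in> ext M" using sc_eq_mult by metis
qed

lemma ring_submodule_scale: "ring_submodule A N \<Longrightarrow> ring_submodule A ((*) u ` N)"
  unfolding ring_submodule_def
proof (intro conjI ballI)
  assume N: "0 \<in> N \<and> (\<forall>x\<in>N. \<forall>y\<in>N. x + y \<in> N) \<and> (\<forall>r\<in>A. \<forall>x\<in>N. r * x \<in> N)"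
  show "0 \<in> (*) u ` N" using N by force
  show "x + y \<in> (*) u ` N" if "x \<in> (*) u ` N" "y \<in> (*) u ` N" for x y
    using that N by (auto simp: distrib_left[symmetric])
  show "r * x \<in> (*) u ` N" if "r \<in> A" "x \<in> (*) u ` N" for r x
    using that N by (auto simp: mult.left_commute[of r])
qed

lemma ext_scale_subset: "ext ((*) u ` M) \<subseteq> (*) u ` ext M"
  by (intro ext_least ring_submodule_scale ring_submodule_ext image_mono ext_upper)

lemma ext_scale: assumes uv: "u * v = 1" shows "ext ((*) u ` M) = (*) u ` ext M"
proof (intro equalityI ext_scale_subset)
  have vu: "v * u = 1" using uv by (simp add: mult.commute)
  have "ext M = ext ((*) v ` (*) u ` M)" by (simp add: scale_scale_image[symmetric] vu)
  also have "\<dots> \<subseteq> (*) v ` ext ((*) u ` M)" by (rule ext_scale_subset)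
  finally have "(*) u ` ext M \<subseteq> (*) u ` (*) v ` ext ((*) u ` M)" by (rule image_mono)
  then show "(*) u ` ext M \<subseteq> ext ((*) u ` M)" by (simp add: scale_scale_image[symmetric] uv)
qed

text \<open>The elements carried into \<open>M\<close> by \<open>p ^ cond_exp A\<close> form an
  \<open>A\<close>-module, and it contains \<open>M\<close> because \<open>p ^ cond_exp A\<close>
  lies in \<open>R\<close>.\<close>

lemma pK_ext: assumes M: "M \<in> X" and x: "x \<in> ext M" shows "p ^ cond_exp * x \<in> M"
proof -
  let ?N = "{x. \<forall>a\<in>A. p ^ cond_exp * (a * x) \<in> M}"
  have oM: "osub M" by (rule lat_osub[OF X_lat[OF M]])
  have "r * x \<in> ?N" if "r \<in> A" "x \<in> ?N" for r x
  proof safe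
    fix a assume "a \<in> A"
    then have "a * r \<in> A" using that by (intro A_mult)
    then have "p ^ cond_exp * ((a * r) * x) \<in> M" using that by blast
    then show "p ^ cond_exp * (a * (r * x)) \<in> M" by (simp add: mult.assoc)
  qed
  then have "ring_submodule A ?N"
    using osub_0[OF oM] osub_add[OF oM] by (auto simp: ring_submodule_def distrib_left)
  moreover have "M \<subseteq> ?N"
  proof safe
    fix m a assume "m \<in> M" "a \<in> A"
    then have "(p ^ cond_exp * a) * m \<in> M" using cond_exp_clears X_R[OF M] by blast
    then show "p ^ cond_exp * (a * m) \<in> M" by (simp add: mult.assoc)
  qed
  ultimately have "ext M \<subseteq> ?N" by (rule ext_least)
  then have "p ^ cond_exp * (1 * x) \<in> M" using x one_A by blast
  then show ?thesis by simp
qed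

lemma lat_ext: assumes M: "M \<in> X" shows "lat (ext M)"
  by (rule lat_sandwich[OF osub_ext X_lat[OF M] X_lat[OF M], of 0 M cond_exp])
    (use ext_upper pK_ext[OF M] in auto)

lemma ext_principal: assumes M: "M \<in> X" shows "\<exists>x y. x * y = 1 \<and> ext M = (*) x ` A"
  using lattice_principal[OF lat_ext[OF M] ext_mult] by blast

definition ext_fibre :: "'e set set" where
  "ext_fibre = {M \<in> X. ext M = A}"

lemma finite_ext_fibre: "finite ext_fibre"
proof (rule finite_subset)
  show "finite {N. osub N \<and> (*) (p ^ cond_exp) ` A \<subseteq> N \<and> N \<subseteq> A}"
    by (rule lat_finite_intermediate[OF lat_A lat_pK])
  show "ext_fibre \<subseteq> {N. osub N \<and> (*) (p ^ cond_exp) ` A \<subseteq> N \<and> N \<subseteq> A}"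
  proof
    fix M assume "M \<in> ext_fibre"
    then have M: "M \<in> X" "ext M = A" by (auto simp: ext_fibre_def)
    have "(*) (p ^ cond_exp) ` A \<subseteq> M" using pK_ext[OF M(1)] M(2) by auto
    moreover have "M \<subseteq> A" using ext_upper[of M] M(2) by simp
    ultimately show "M \<in> {N. osub N \<and> (*) (p ^ cond_exp) ` A \<subseteq> N \<and> N \<subseteq> A}"
      using lat_osub[OF X_lat[OF M(1)]] by simp
  qed
qed

lemma subset_D_R_of_ext: assumes "ext M \<subseteq> A" shows "M \<subseteq> D R"
proof -
  have "A \<subseteq> D R" using D_antimono[OF R_subset_A] by (simp add: D_A)
  then show ?thesis using assms ext_upper[of M] by blast
qed

text \<open>\<open>ext M\<close> is principal, say \<open>x A\<close>. With
  \<open>z = x * a\<close>, the conditions say that \<open>a\<close> is integral and outside every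
  maximal ideal, hence a unit of \<open>A\<close>.\<close>

lemma ext_eq_iff:
  assumes M: "M \<in> X" and z: "z * z' = 1"
  shows "ext M = (*) z ` A \<longleftrightarrow> z \<in> ext M \<and> (\<forall>e\<in>idems. uinv (ufm_unit e) * z \<notin> ext M)"
proof
  assume eq: "ext M = (*) z ` A"
  have "uinv (ufm_unit e) * z \<notin> ext M" if e: "e \<in> idems" for e
  proof
    assume "uinv (ufm_unit e) * z \<in> ext M"
    then have "z' * (uinv (ufm_unit e) * z) \<in> A" unfolding eq mem_mult_unit_iff[OF z] .
    moreover have "z' * (uinv (ufm_unit e) * z) = (z * z') * uinv (ufm_unit e)" by (simp only: ac_simps)
    ultimately have "uinv (ufm_unit e) \<in> A" using z by simp
    then show False using A_mult[OF prim_A[OF e]] ufm_unit_inv_notin[OF e] by blast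
  qed
  moreover have "z \<in> ext M" using eq one_A by force
  ultimately show "z \<in> ext M \<and> (\<forall>e\<in>idems. uinv (ufm_unit e) * z \<notin> ext M)" by blast
next
  assume *: "z \<in> ext M \<and> (\<forall>e\<in>idems. uinv (ufm_unit e) * z \<notin> ext M)"
  obtain x y where x: "x * y = 1" "ext M = (*) x ` A" using ext_principal[OF M] by blast
  obtain a where a: "a \<in> A" "z = x * a" using * x by blast
  have "uinv (ufm_unit e) * a \<notin> A" if e: "e \<in> idems" for e
  proof
    assume "uinv (ufm_unit e) * a \<in> A"
    then have "x * (uinv (ufm_unit e) * a) \<in> ext M" using x by blast
    moreover have "x * (uinv (ufm_unit e) * a) = uinv (ufm_unit e) * z" by (simp add: a mult.left_commute)
    ultimately show False using * e by simp
  qed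
  then have "a \<in> UA" using a UA_iff by blast
  then have "(*) z ` A = ext M" by (simp add: a scale_scale_image UA_scale_A x)
  then show "ext M = (*) z ` A" by simp
qed

text \<open>Restricting to the \<open>M\<close> with \<open>z \<in> M A\<close> makes the sums finite. After replacing \<open>M\<close> by \<open>P\<^sub>I M\<close> in the term
  of \<open>I\<close>, inclusion and exclusion leave exactly the \<open>M\<close> with \<open>M A = z A\<close>.\<close>

lemma sum_wt: "(\<Sum>M\<in>wt_supp. wt M) = int (card ext_fibre)"
proof -
  \<comment> \<open>The upper bound on \<open>D M\<close> in \<open>wt_nz_bounds\<close>, dualised:
    every \<open>M\<close> of nonzero weight contains \<open>p ^ k A\<close>, so the condition
    \<open>z \<in> ext M\<close> loses none of them.\<close>
  define k where "k = Suc cond_exp"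
  define z where "z = p ^ k"
  define V where "V I = {M \<in> X. ufm_prod_inv I \<in> D M \<and> z \<in> ext M}" for I
  define V0 where "V0 = {M \<in> X. M \<subseteq> D R \<and> z \<in> ext M}"
  have zz: "z * p_inv ^ k = 1" "p_inv ^ k * z = 1" by (simp_all add: z_def p_power_inv p_inv_power)
  have V0: "V {} = V0"
    using subset_D_R_iff by (auto simp: V_def V0_def ufm_prod_inv_def)
  have extDR: "lat (ext (D R))" by (rule lat_ext[OF D_X[OF R_X]])
  have finV: "finite (V I)" if I: "I \<subseteq> idems" for I
  proof (rule finite_subset)
    have lz: "lat ((*) (p ^ cond_exp * z) ` A)"
    proof (rule lat_scale[OF lat_A])
      show "(p ^ cond_exp * z) * (p_inv ^ cond_exp * p_inv ^ k) = 1"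
        using zz p_power_inv[of cond_exp] by (metis mult.assoc mult.left_commute mult_1_right)
    qed
    show "finite {N. osub N \<and> (*) (p ^ cond_exp * z) ` A \<subseteq> N \<and> N \<subseteq> ext (D R)}"
      by (rule lat_finite_intermediate[OF extDR lz])
    show "V I \<subseteq> {N. osub N \<and> (*) (p ^ cond_exp * z) ` A \<subseteq> N \<and> N \<subseteq> ext (D R)}"
    proof
      fix M assume "M \<in> V I"
      then have M: "M \<in> X" "ufm_prod_inv I \<in> D M" "z \<in> ext M" by (auto simp: V_def)
      have "(*) (p ^ cond_exp * z) ` A \<subseteq> M"
      proof safe
        fix a assume "a \<in> A"
        then have "p ^ cond_exp * (a * z) \<in> M" using ext_mult M pK_ext by blast
        then show "p ^ cond_exp * z * a \<in> M" by (simp add: ac_simps)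
      qed
      moreover have "M \<subseteq> ext (D R)"
      proof
        fix x assume "x \<in> M"
        then have "ufm_prod_inv I * x \<in> D R" using ufm_prod_inv_mem_D_iff[OF I M(1)] M(2) by blast
        then have "ufm_prod_inv I * x \<in> ext (D R)" by (rule subsetD[OF ext_upper])
        then have "ufm_prod I * (ufm_prod_inv I * x) \<in> ext (D R)" by (rule ext_mult[OF ufm_prod_A[OF I]])
        then show "x \<in> ext (D R)" using ufm_prod_ufm_prod_inv[OF I] by (simp add: mult.assoc[symmetric])
      qed
      ultimately show "M \<in> {N. osub N \<and> (*) (p ^ cond_exp * z) ` A \<subseteq> N \<and> N \<subseteq> ext (D R)}"
        using lat_osub[OF X_lat[OF M(1)]] by blast
    qed
  qed
  have finV0: "finite V0" using finV[of "{}"] V0 by simp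
  let ?U = "\<Union>I\<in>Pow idems. V I"
  have finU: "finite ?U" using finV finite_prim_idem by (intro finite_UN_I) auto
  have YU: "wt_supp \<subseteq> ?U"
  proof
    fix M assume "M \<in> wt_supp"
    then have M: "M \<in> X" "wt M \<noteq> 0" by (auto simp: wt_supp_def)
    obtain I where I: "I \<subseteq> idems" "ufm_prod_inv I \<in> D M" using wt_nz_ufm_prod_inv[OF M(2)] by blast
    have "D M \<subseteq> (*) (p_inv ^ k) ` A"
    proof
      fix x assume "x \<in> D M"
      then have "p ^ k * x \<in> A" unfolding k_def by (rule wt_nz_bounds(2)[OF M])
      then show "x \<in> (*) (p_inv ^ k) ` A" unfolding mem_mult_unit_iff[OF p_inv_power] .
    qed
    then have "D ((*) (p_inv ^ k) ` A) \<subseteq> D (D M)" by (rule D_antimono)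
    then have "(*) z ` A \<subseteq> M" using D_scale_A[OF zz(1)] D_D[OF X_lat[OF M(1)]] by simp
    moreover have "z \<in> (*) z ` A" using one_A by force
    ultimately have "z \<in> ext M" using ext_upper by blast
    then show "M \<in> ?U" using M I by (auto simp: V_def)
  qed
  \<comment> \<open>Replacing \<open>M\<close> by \<open>ufm_prod_inv I M\<close> moves the
    dependence on \<open>I\<close> from the inclusion in \<open>D R\<close> to the position of
    \<open>z\<close>.\<close>
  have cardV: "card (V I) = card {M \<in> V0. \<forall>e\<in>I. uinv (ufm_unit e) * z \<in> ext M}" if I: "I \<subseteq> idems" for I
  proof -
    have "bij_betw (\<lambda>M. (*) (ufm_prod_inv I) ` M) (V I) {M \<in> V0. \<forall>e\<in>I. uinv (ufm_unit e) * z \<in> ext M}"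
    proof (rule bij_scale[OF ufm_prod_inv_ufm_prod[OF I]])
      fix M assume "M \<in> V I"
      then have M: "M \<in> X" "ufm_prod_inv I \<in> D M" "z \<in> ext M" by (auto simp: V_def)
      have QX: "(*) (ufm_prod_inv I) ` M \<in> X" by (rule X_scale[OF ufm_prod_inv_ufm_prod[OF I] M(1)])
      have "ufm_prod_inv I * z \<in> ext ((*) (ufm_prod_inv I) ` M)" using M(3) ext_scale[OF ufm_prod_inv_ufm_prod[OF I]] by blast
      then show "(*) (ufm_prod_inv I) ` M \<in> {M \<in> V0. \<forall>e\<in>I. uinv (ufm_unit e) * z \<in> ext M}"
        using ufm_prod_inv_mem_D_iff[OF I M(1)] M(2) QX ufm_prod_inv_mem_iff[OF I osub_ext ext_mult] unfolding V0_def by blast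
    next
      fix M assume "M \<in> {M \<in> V0. \<forall>e\<in>I. uinv (ufm_unit e) * z \<in> ext M}"
      then have M: "M \<in> X" "M \<subseteq> D R" "z \<in> ext M" "\<forall>e\<in>I. uinv (ufm_unit e) * z \<in> ext M" by (auto simp: V0_def)
      have PX: "(*) (ufm_prod I) ` M \<in> X" by (rule X_scale[OF ufm_prod_ufm_prod_inv[OF I] M(1)])
      have "ufm_prod_inv I * z \<in> ext M" using ufm_prod_inv_mem_iff[OF I osub_ext ext_mult] M by blast
      then have "z \<in> ext ((*) (ufm_prod I) ` M)"
        unfolding ext_scale[OF ufm_prod_ufm_prod_inv[OF I]] mem_mult_unit_iff[OF ufm_prod_ufm_prod_inv[OF I]] .
      moreover have "(*) (ufm_prod_inv I) ` (*) (ufm_prod I) ` M = M" by (simp add: scale_scale_image[symmetric] ufm_prod_inv_ufm_prod[OF I])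
      then have "ufm_prod_inv I \<in> D ((*) (ufm_prod I) ` M)" using ufm_prod_inv_mem_D_iff[OF I PX] M(2) by simp
      ultimately show "(*) (ufm_prod I) ` M \<in> V I" using PX by (simp add: V_def)
    qed
    then show ?thesis by (rule bij_betw_same_card)
  qed
  have "(\<Sum>M\<in>wt_supp. wt M) = (\<Sum>M\<in>?U. wt M)"
    using finU YU by (intro sum.mono_neutral_left) (auto simp: wt_supp_def V_def)
  also have "\<dots> = (\<Sum>I\<in>Pow idems. \<Sum>M\<in>?U. (- 1) ^ card I * (if ufm_prod_inv I \<in> D M then 1 else 0))"
    unfolding wt_def by (rule sum.swap)
  also have "\<dots> = (\<Sum>I\<in>Pow idems. \<Sum>M\<in>V0. (- 1) ^ card I * (if \<forall>e\<in>I. uinv (ufm_unit e) * z \<in> ext M then 1 else 0))"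
  proof (rule sum.cong)
    fix I assume "I \<in> Pow idems"
    then have I: "I \<subseteq> idems" by simp
    have "(\<Sum>M\<in>?U. if ufm_prod_inv I \<in> D M then 1 else 0 :: int) = int (card (?U \<inter> {M. ufm_prod_inv I \<in> D M}))"
      using sum.inter_restrict[OF finU, of "\<lambda>_. 1 :: int" "{M. ufm_prod_inv I \<in> D M}"] by simp
    also have "?U \<inter> {M. ufm_prod_inv I \<in> D M} = V I" using I by (auto simp: V_def)
    also have "card (V I) = card (V0 \<inter> {M. \<forall>e\<in>I. uinv (ufm_unit e) * z \<in> ext M})"
      unfolding cardV[OF I] by (simp add: Collect_conj_eq)
    also have "int \<dots> = (\<Sum>M\<in>V0. if \<forall>e\<in>I. uinv (ufm_unit e) * z \<in> ext M then 1 else 0)"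
      using sum.inter_restrict[OF finV0, of "\<lambda>_. 1 :: int" "{M. \<forall>e\<in>I. uinv (ufm_unit e) * z \<in> ext M}"] by simp
    finally show "(\<Sum>M\<in>?U. (- 1) ^ card I * (if ufm_prod_inv I \<in> D M then 1 else 0 :: int)) =
        (\<Sum>M\<in>V0. (- 1) ^ card I * (if \<forall>e\<in>I. uinv (ufm_unit e) * z \<in> ext M then 1 else 0))"
      by (simp add: sum_distrib_left[symmetric])
  qed simp
  also have "\<dots> = (\<Sum>M\<in>V0. \<Sum>I\<in>Pow idems. (- 1) ^ card I * (if \<forall>e\<in>I. uinv (ufm_unit e) * z \<in> ext M then 1 else 0))"
    by (rule sum.swap)
  also have "\<dots> = (\<Sum>M\<in>V0. if \<forall>e\<in>idems. uinv (ufm_unit e) * z \<notin> ext M then 1 else 0)"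
    unfolding sum_Pow_alternating[OF finite_prim_idem] ..
  also have "\<dots> = int (card (V0 \<inter> {M. \<forall>e\<in>idems. uinv (ufm_unit e) * z \<notin> ext M}))"
    using sum.inter_restrict[OF finV0, of "\<lambda>_. 1 :: int" "{M. \<forall>e\<in>idems. uinv (ufm_unit e) * z \<notin> ext M}"] by simp
  also have "V0 \<inter> {M. \<forall>e\<in>idems. uinv (ufm_unit e) * z \<notin> ext M} = {M \<in> X. ext M = (*) z ` A}"
  proof -
    \<comment> \<open>The inclusion in \<open>D R\<close> is automatic here, as \<open>z A\<close>
      lies in \<open>A\<close> and \<open>A\<close> in \<open>D R\<close>.\<close>
    have "M \<subseteq> D R" if "ext M = (*) z ` A" for M
    proof (rule subset_D_R_of_ext)
      show "ext M \<subseteq> A" unfolding that z_def using osub_p_power[OF osub_A] by auto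
    qed
    then show ?thesis using ext_eq_iff[OF _ zz(1)] unfolding V0_def by blast
  qed
  also have "card {M \<in> X. ext M = (*) z ` A} = card ext_fibre"
  proof -
    have "bij_betw (\<lambda>M. (*) z ` M) ext_fibre {M \<in> X. ext M = (*) z ` A}"
    proof (rule bij_scale[OF zz(1)])
      show "(*) z ` M \<in> {M \<in> X. ext M = (*) z ` A}" if "M \<in> ext_fibre" for M
        using that X_scale[OF zz(1)] ext_scale[OF zz(1)] by (simp add: ext_fibre_def)
      show "(*) (p_inv ^ k) ` M \<in> ext_fibre" if "M \<in> {M \<in> X. ext M = (*) z ` A}" for M
        using that X_scale[OF zz(2)] ext_scale[OF zz(2)]
        by (simp add: ext_fibre_def scale_scale_image[symmetric] zz(2))
    qed
    then show ?thesis by (rule bij_betw_same_card[symmetric])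
  qed
  finally show ?thesis .
qed

lemma poly_zeta_poly_1: "poly zeta_poly 1 = int (card ext_fibre)"
  unfolding sum_wt[symmetric] by (simp add: zeta_poly_def poly_sum poly_monom)

text \<open>Every orbit contains exactly one \<open>M\<close> with \<open>M A = A\<close>, because \<open>L\<close> acts simply transitively on the
  principal fractional ideals of \<open>A\<close>.\<close>

lemma bij_ext_fibre_orbits:
  assumes L: "is_unit_lattice av sc L"
  shows "bij_betw (\<lambda>M. (\<lambda>l. (*) l ` M) ` L) ext_fibre (orbits sc R L)"
proof -
  have sub: "subgroup L unit_group"
    and bij: "bij_betw (\<lambda>(l, u). l * u) (L \<times> UA) (carrier unit_group)"
    using L by (auto simp: is_unit_lattice_def integer_units_eq)
  have L1: "1 \<in> L" using subgroup.one_closed[OF sub] by simp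
  have Lm: "l * m \<in> L" if "l \<in> L" "m \<in> L" for l m using subgroup.m_closed[OF sub that] by simp
  have Li: "\<exists>m\<in>L. l * m = 1" if "l \<in> L" for l
    using subgroup.m_inv_closed[OF sub that] unit_group_inv subgroup.mem_carrier[OF sub that] by blast
  \<comment> \<open>Such an \<open>l\<close> factors both as \<open>l * 1\<close> and as
    \<open>1 * l\<close>, and the factorisation is unique.\<close>
  have LU: "l = 1" if "l \<in> L" "l \<in> UA" for l
  proof -
    have "(case (l, 1) of (l, u) \<Rightarrow> l * u) = (case (1, l) of (l, u) \<Rightarrow> l * u)" by simp
    then have "(l, 1) = (1, l)"
      using bij that L1 one_UA unfolding bij_betw_def inj_on_def by blast
    then show ?thesis by simp
  qed
  have orb: "(\<lambda>l. (*) l ` (*) m ` M) ` L = (\<lambda>l. (*) l ` M) ` L" if m: "m \<in> L" for m and M :: "'e set"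
  proof -
    obtain m' where m': "m' \<in> L" "m * m' = 1" using Li[OF m] by blast
    have "(\<lambda>l. l * m) ` L = L"
    proof (intro equalityI subsetI)
      fix l assume "l \<in> L"
      moreover have "l = (l * m') * m" using m' by (simp add: mult.assoc mult.commute[of m'])
      ultimately show "l \<in> (\<lambda>l. l * m) ` L" using Lm m' by blast
    qed (use Lm m in blast)
    then have "(\<lambda>l. (*) l ` M) ` L = (\<lambda>l. (*) l ` M) ` (\<lambda>l. l * m) ` L" by simp
    then show ?thesis by (simp add: image_image mult.assoc)
  qed
  show ?thesis
    unfolding bij_betw_def
  proof
    show "inj_on (\<lambda>M. (\<lambda>l. (*) l ` M) ` L) ext_fibre"
    proof (rule inj_onI)
      fix M N assume M: "M \<in> ext_fibre" and N: "N \<in> ext_fibre" and eq: "(\<lambda>l. (*) l ` M) ` L = (\<lambda>l. (*) l ` N) ` L"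
      have "(*) 1 ` M \<in> (\<lambda>l. (*) l ` N) ` L" using eq L1 by blast
      then obtain l where l: "l \<in> L" "M = (*) l ` N" by auto
      obtain m where m: "l * m = 1" using Li[OF l(1)] by blast
      have "(*) l ` A = A" using ext_scale[OF m, of N] M N l by (simp add: ext_fibre_def)
      then have "l = 1" using LU[OF l(1)] scale_A_eq_imp_UA[OF m] by blast
      then show "M = N" using l by simp
    qed
    show "(\<lambda>M. (\<lambda>l. (*) l ` M) ` L) ` ext_fibre = orbits sc R L"
    proof (intro equalityI subsetI)
      fix o' assume "o' \<in> (\<lambda>M. (\<lambda>l. (*) l ` M) ` L) ` ext_fibre"
      then show "o' \<in> orbits sc R L" by (auto simp: orbits_def ext_fibre_def)
    next
      fix o' assume "o' \<in> orbits sc R L"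
      then obtain M where M: "M \<in> X" "o' = (\<lambda>l. (*) l ` M) ` L" by (auto simp: orbits_def)
      obtain x y where x: "x * y = 1" "ext M = (*) x ` A" using ext_principal[OF M(1)] by blast
      have "x \<in> carrier unit_group" using x(1) by (auto simp: carrier_unit_group)
      then have "x \<in> (\<lambda>(l, u). l * u) ` (L \<times> UA)" using bij by (simp add: bij_betw_def)
      then obtain l u where lu: "l \<in> L" "u \<in> UA" "x = l * u" by auto
      obtain m where m: "m \<in> L" "l * m = 1" using Li[OF lu(1)] by blast
      have ml: "m * l = 1" using m by (simp add: mult.commute)
      have "ext ((*) m ` M) = (*) m ` (*) (l * u) ` A" using ext_scale[OF ml] x(2) lu(3) by simp
      also have "\<dots> = A" by (simp add: scale_scale_image[symmetric] mult.assoc[symmetric] ml UA_scale_A[OF lu(2)])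
      finally have "(*) m ` M \<in> ext_fibre" using X_scale[OF ml M(1)] by (simp add: ext_fibre_def)
      moreover have "o' = (\<lambda>l. (*) l ` (*) m ` M) ` L" using orb[OF m(1), of M] M(2) by simp
      ultimately show "o' \<in> (\<lambda>M. (\<lambda>l. (*) l ` M) ` L) ` ext_fibre" by (rule rev_image_eqI)
    qed
  qed
qed

end

section \<open>The zeta function\<close>

lemma prod_one_minus:
  assumes "finite B"
  shows "(\<Prod>e\<in>B. 1 - f e) = (\<Sum>I\<in>Pow B. (- 1) ^ card I * (\<Prod>e\<in>I. f e :: 'a::comm_ring_1))"
  using assms
proof (induction B rule: finite_induct)
  case (insert e B)
  have "(\<Sum>I\<in>Pow B. (- 1) ^ card (insert e I) * (\<Prod>e\<in>insert e I. f e)) =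
      (\<Sum>I\<in>Pow B. - f e * ((- 1) ^ card I * (\<Prod>e\<in>I. f e)))"
  proof (rule sum.cong)
    fix I assume "I \<in> Pow B"
    then have "finite I" "e \<notin> I" using insert.hyps finite_subset by auto
    then show "(- 1) ^ card (insert e I) * (\<Prod>e\<in>insert e I. f e) =
        - f e * ((- 1) ^ card I * (\<Prod>e\<in>I. f e))" by simp
  qed simp
  then show ?case
    using insert by (simp add: sum_Pow_insert sum_distrib_left[symmetric] algebra_simps sum_negf)
qed simp

text \<open>Identity theorem for \<open>g - h\<close>: with its removable singularities filled in,
  it is nicely meromorphic on the connected plane and vanishes near a point of the half-plane, hence
  everywhere.\<close>

lemma remove_sings_eq_entire:
  fixes g h :: "complex \<Rightarrow> complex"
  assumes g: "g meromorphic_on UNIV" and h: "h analytic_on UNIV"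
    and eq: "\<And>s. Re s > \<sigma> \<Longrightarrow> g s = h s"
  shows "remove_sings g z = h z"
proof (rule remove_sings_eqI)
  define d where "d s = g s - h s" for s
  have d: "d meromorphic_on UNIV"
    unfolding d_def by (intro meromorphic_on_diff g analytic_on_imp_meromorphic_on h)
  have sing: "isolated_singularity_at d w" for w
    by (rule meromorphic_on_isolated_singularity[OF meromorphic_on_subset[OF d]]) simp
  define s0 where "s0 = complex_of_real (\<sigma> + 1)"
  have "eventually (\<lambda>s. Re s > \<sigma>) (nhds s0)"
    by (rule eventually_nhds_in_open[of "{s. Re s > \<sigma>}", simplified])
      (auto simp: s0_def open_halfspace_Re_gt)
  then have "eventually (\<lambda>s. d s = 0) (nhds s0)"
    by eventually_elim (simp add: d_def eq)
  then have "eventually (\<lambda>s. d s = 0) (at s0)" by (simp add: eventually_nhds_conv_at)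
  moreover have "eventually (\<lambda>s. remove_sings d s = d s) (at s0)"
    by (rule eventually_remove_sings_eq_at[OF sing])
  ultimately have "eventually (\<lambda>s. remove_sings d s = 0) (at s0)" by eventually_elim simp
  then have "frequently (\<lambda>s. remove_sings d s = 0) (at s0)"
    by (rule eventually_frequently[rotated]) simp
  then have zero: "remove_sings d w = 0" for w
    by (rule frequently_eq_meromorphic_imp_constant[OF _ remove_sings_nicely_meromorphic[OF d]
          open_UNIV connected_UNIV UNIV_I UNIV_I])
  have "eventually (\<lambda>s. remove_sings d s = d s) (at z)"
    by (rule eventually_remove_sings_eq_at[OF sing])
  then have "eventually (\<lambda>s. h s = g s) (at z)"
    by eventually_elim (simp add: zero d_def)
  moreover have "h \<midarrow>z\<rightarrow> h z"
    using h by (intro isContD analytic_at_imp_isCont) (auto intro: analytic_on_subset)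
  ultimately show "g \<midarrow>z\<rightarrow> h z" by (rule Lim_transform_eventually[rotated])
qed

context local_duality
begin

section \<open>The counting series as a rational function of q^(-s)\<close>

abbreviation "qt s \<equiv> (of_nat q :: complex) powr (- s)"

abbreviation "PC \<equiv> map_poly of_int zeta_poly :: complex poly"

definition euler_poly :: "complex poly" where
  "euler_poly = (\<Prod>e\<in>idems. 1 - monom 1 (rdeg e))"

definition quot_fps :: "complex fps" where
  "quot_fps = Abs_fps (\<lambda>j. of_nat (card (Quot j)))"

lemma q_nz: "(of_nat q :: complex) \<noteq> 0"
  using q_ge_2 by simp

lemma poly_euler_poly: "poly euler_poly t = (\<Prod>e\<in>idems. 1 - t ^ rdeg e)"
  by (simp add: euler_poly_def poly_prod poly_monom)

lemma euler_poly_mult_quot_fps: "fps_of_poly euler_poly * quot_fps = fps_of_poly PC"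
proof (rule fps_ext)
  fix m
  have mon: "(\<Prod>e\<in>I. monom (1::complex) (rdeg e)) = monom 1 (rdeg_sum I)" if "I \<subseteq> idems" for I
  proof -
    have "finite I" by (rule finite_idem[OF that])
    then show ?thesis by (induction I rule: finite_induct) (simp_all add: rdeg_sum_def mult_monom)
  qed
  have "euler_poly = (\<Sum>I\<in>Pow idems. (- 1) ^ card I * (\<Prod>e\<in>I. monom 1 (rdeg e)))"
    unfolding euler_poly_def by (rule prod_one_minus[OF finite_prim_idem])
  also have "\<dots> = (\<Sum>I\<in>Pow idems. (- 1) ^ card I * monom 1 (rdeg_sum I))"
    using mon by (intro sum.cong) auto
  also have "\<dots> = (\<Sum>I\<in>Pow idems. smult ((- 1) ^ card I) (monom 1 (rdeg_sum I)))"
  proof (rule sum.cong)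
    fix I :: "'e set"
    have "(- 1) ^ k * x = smult ((- 1) ^ k) x" for x :: "complex poly" and k
      by (induction k) auto
    then show "(- 1) ^ card I * monom 1 (rdeg_sum I) = smult ((- 1) ^ card I) (monom (1::complex) (rdeg_sum I))" .
  qed simp
  finally have "fps_of_poly euler_poly = (\<Sum>I\<in>Pow idems. fps_const ((- 1) ^ card I) * fps_X ^ rdeg_sum I)"
    by (simp add: fps_of_poly_sum fps_of_poly_smult fps_of_poly_monom)
  then have "fps_nth (fps_of_poly euler_poly * quot_fps) m =
      (\<Sum>I\<in>Pow idems. (- 1) ^ card I * (if rdeg_sum I \<le> m then of_nat (card (Quot (m - rdeg_sum I))) else 0))"
    by (simp add: sum_distrib_right fps_sum_nth mult.assoc fps_X_power_mult_nth quot_fps_def not_less if_distrib cong: if_cong)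
      (intro sum.cong, auto)
  also have "\<dots> = of_int (\<Sum>I\<in>Pow idems. (- 1) ^ card I * (if rdeg_sum I \<le> m then int (card (Quot (m - rdeg_sum I))) else 0))"
    unfolding of_int_sum by (intro sum.cong) auto
  also have "\<dots> = fps_nth (fps_of_poly PC) m"
    unfolding coeff_relation by (simp add: coeff_map_poly)
  finally show "fps_nth (fps_of_poly euler_poly * quot_fps) m = fps_nth (fps_of_poly PC) m" .
qed

text \<open>The counting series is a quotient of polynomials whose denominator has constant term 1;
  convergence comes from this rather than from a growth estimate.\<close>

lemma quot_fps_radius: "fps_conv_radius quot_fps > 0"
proof -
  have V0: "fps_nth (fps_of_poly euler_poly) 0 = 1"
  proof -
    have "poly euler_poly 0 = 1" unfolding poly_euler_poly using rdeg_pos by (intro prod.neutral) fastforce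
    then show ?thesis by (simp add: poly_0_coeff_0)
  qed
  have "quot_fps = (inverse (fps_of_poly euler_poly) * fps_of_poly euler_poly) * quot_fps"
    using V0 by (subst inverse_mult_eq_1) auto
  then have "quot_fps = inverse (fps_of_poly euler_poly) * fps_of_poly PC" by (simp add: mult.assoc euler_poly_mult_quot_fps)
  moreover have "fps_conv_radius (inverse (fps_of_poly euler_poly)) > 0"
    using V0 by (intro fps_conv_radius_inverse_pos) auto
  then have "fps_conv_radius (inverse (fps_of_poly euler_poly) * fps_of_poly PC) > 0"
    using fps_conv_radius_mult[of "inverse (fps_of_poly euler_poly)" "fps_of_poly PC"] by (auto intro: less_le_trans)
  ultimately show ?thesis by simp
qed

lemma euler_poly_mult_eval: "ereal (norm t) < fps_conv_radius quot_fps \<Longrightarrow> poly euler_poly t * eval_fps quot_fps t = poly PC t"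
  using eval_fps_mult[of t "fps_of_poly euler_poly" quot_fps] by (simp add: euler_poly_mult_quot_fps)

lemma norm_qt: "norm (qt s) = real q powr (- Re s)"
  by (simp add: norm_powr_real_powr)

text \<open>Besides convergence of the series, \<open>norm (qt s) < 1\<close> keeps the Euler
  factors \<open>1 - qt s ^ rdeg e\<close> different from zero.\<close>

lemma qt_small: "\<exists>\<sigma>\<ge>0. \<forall>s. Re s > \<sigma> \<longrightarrow> ereal (norm (qt s)) < fps_conv_radius quot_fps \<and> norm (qt s) < 1"
proof -
  obtain r :: real where r: "r > 0" "ereal r < fps_conv_radius quot_fps"
    using quot_fps_radius ereal_dense2[of 0 "fps_conv_radius quot_fps"] by auto
  have q1: "real q > 1" using q_ge_2 by simp
  define \<sigma> where "\<sigma> = max 0 (- log (real q) r)"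
  have "ereal (norm (qt s)) < fps_conv_radius quot_fps \<and> norm (qt s) < 1" if s: "Re s > \<sigma>" for s
  proof
    have "- Re s < log (real q) r" using s by (simp add: \<sigma>_def)
    then have "real q powr (- Re s) < real q powr (log (real q) r)" using q1 by (simp only: powr_less_cancel_iff)
    also have "\<dots> = r" using q1 r by simp
    finally have "ereal (norm (qt s)) < ereal r" by (simp add: norm_qt)
    then show "ereal (norm (qt s)) < fps_conv_radius quot_fps" using r(2) by (rule less_trans)
    have "- Re s < 0" using s by (simp add: \<sigma>_def)
    then have "real q powr (- Re s) < real q powr 0" using q1 by (simp only: powr_less_cancel_iff)
    then show "norm (qt s) < 1" using q1 by (simp add: norm_qt)
  qed
  then show ?thesis by (intro exI[of _ \<sigma>]) (simp add: \<sigma>_def)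
qed

lemma qt_power: "qt (of_nat j * s) = qt s ^ j"
  using q_nz by (simp add: powr_def exp_of_nat_mult[symmetric] mult.assoc)

lemma qt_analytic: "(\<lambda>s. qt s) analytic_on UNIV"
  unfolding powr_def using q_nz by (auto intro!: analytic_intros)

lemma poly_qt_analytic: "(\<lambda>s. poly Q (qt s)) analytic_on UNIV"
  unfolding poly_altdef by (intro analytic_intros qt_analytic)

text \<open>\<open>zeta_J\<close> is picked by \<open>SOME\<close>, so a continuation has to be
  exhibited: a rational function of \<open>qt s\<close>, with \<open>remove_sings\<close>
  normalising its values as \<open>nicely_meromorphic_on\<close> demands.\<close>

lemma continues_zeta_exists: "\<exists>J. continues_zeta av sc c R J"
proof -
  let ?f = "\<lambda>s. poly PC (qt s) / poly euler_poly (qt s)"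
  obtain \<sigma> where \<sigma>: "\<forall>s. Re s > \<sigma> \<longrightarrow> ereal (norm (qt s)) < fps_conv_radius quot_fps \<and> norm (qt s) < 1"
    using qt_small by blast
  have mero: "?f meromorphic_on UNIV"
    by (intro meromorphic_on_divide analytic_on_imp_meromorphic_on poly_qt_analytic)
  have "(\<lambda>j. of_nat (card (Quot j)) * of_nat q powr (- of_nat j * s)) sums remove_sings ?f s"
    if s: "Re s > \<sigma>" for s
  proof -
    have small: "ereal (norm (qt s)) < fps_conv_radius quot_fps" "norm (qt s) < 1" using \<sigma> s by auto
    have Vnz: "poly euler_poly (qt s) \<noteq> 0"
      unfolding poly_euler_poly prod_zero_iff[OF finite_prim_idem]
    proof
      assume "\<exists>e\<in>idems. 1 - qt s ^ rdeg e = 0"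
      then obtain e where e: "e \<in> idems" "qt s ^ rdeg e = 1" by auto
      then have "norm (qt s) ^ rdeg e = 1" by (metis norm_one norm_power)
      moreover have "norm (qt s) ^ rdeg e < 1"
        using rdeg_pos[OF e(1)] small(2) by (intro power_less_one_iff[THEN iffD2]) auto
      ultimately show False by simp
    qed
    have "?f analytic_on {s}"
      using Vnz by (intro analytic_on_divide) (auto intro: analytic_on_subset[OF poly_qt_analytic])
    then have "remove_sings ?f s = ?f s" by simp
    also have "\<dots> = eval_fps quot_fps (qt s)"
      using euler_poly_mult_eval[OF small(1)] Vnz by (simp add: field_simps)
    finally have "remove_sings ?f s = eval_fps quot_fps (qt s)" .
    then show ?thesis
      using sums_eval_fps[OF small(1)] by (simp add: quot_fps_def qt_power)
  qed
  then show ?thesis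
    unfolding continues_zeta_def using remove_sings_nicely_meromorphic[OF mero] by blast
qed

lemma continues_zeta_J: "continues_zeta av sc c R (zeta_J av sc c R)"
  unfolding zeta_J_def using continues_zeta_exists by (rule someI_ex)

lemma factor_V_eq: "factor_V av sc R s = of_nat q powr (of_nat delta_len * s) * poly euler_poly (qt s)"
  by (simp add: factor_V_def delta_eq poly_euler_poly qt_power)

text \<open>The chosen continuation is given explicitly only where the series converges. There the
  product equals an entire function of \<open>s\<close>, and the identity theorem extends this;
  \<open>remove_sings\<close> repairs the values at poles cancelled by
  \<open>factor_V\<close>.\<close>

lemma zeta_J_tilde_eq: "zeta_J_tilde av sc c R s = of_nat q powr (of_nat delta_len * s) * poly PC (qt s)"
proof -
  let ?J = "zeta_J av sc c R"
  let ?g = "\<lambda>s. factor_V av sc R s * ?J s"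
  let ?h = "\<lambda>s. of_nat q powr (of_nat delta_len * s) * poly PC (qt s)"
  obtain \<sigma> where \<sigma>: "\<forall>s. Re s > \<sigma> \<longrightarrow> ereal (norm (qt s)) < fps_conv_radius quot_fps \<and> norm (qt s) < 1"
    using qt_small by blast
  obtain \<tau> where \<tau>: "\<And>s. Re s > \<tau> \<Longrightarrow>
      (\<lambda>j. of_nat (card (Quot j)) * of_nat q powr (- of_nat j * s)) sums ?J s"
    using continues_zeta_J by (auto simp: continues_zeta_def)
  have pw: "(\<lambda>s. of_nat q powr (of_nat delta_len * s) :: complex) analytic_on UNIV"
    unfolding powr_def using q_nz by (auto intro!: analytic_intros)
  have "?J meromorphic_on UNIV"
    using continues_zeta_J by (simp add: continues_zeta_def nicely_meromorphic_on_def)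
  then have "?g meromorphic_on UNIV"
    unfolding factor_V_eq
    by (intro meromorphic_on_mult[OF _ \<open>?J meromorphic_on UNIV\<close>] analytic_on_imp_meromorphic_on
        analytic_on_mult pw poly_qt_analytic)
  moreover have "?h analytic_on UNIV" by (intro analytic_on_mult pw poly_qt_analytic)
  moreover have "?g s = ?h s" if s: "Re s > max \<sigma> \<tau>" for s
  proof -
    have small: "ereal (norm (qt s)) < fps_conv_radius quot_fps" using \<sigma> s by simp
    have "?J s = eval_fps quot_fps (qt s)"
      using \<tau>[of s] s sums_eval_fps[OF small] by (simp add: quot_fps_def qt_power sums_unique2)
    then show ?thesis using euler_poly_mult_eval[OF small] by (simp add: factor_V_eq)
  qed
  ultimately show ?thesis unfolding zeta_J_tilde_def by (rule remove_sings_eq_entire)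
qed

text \<open>Replacing \<open>s\<close> by \<open>1 - s\<close> replaces \<open>t = qt s\<close> by
  \<open>1 / (q * t)\<close>.\<close>

lemma zeta_J_tilde_functional_equation:
  "zeta_J_tilde av sc c R s = zeta_J_tilde av sc c R (1 - s)"
proof -
  let ?q = "of_nat q :: complex"
  have inv: "1 / (?q * qt s) = qt (1 - s)"
  proof -
    have "qt (1 - s) * (?q * qt s) = qt (1 - s) * (?q powr 1 * qt s)" using q_nz by simp
    also have "\<dots> = ?q powr (- (1 - s) + (1 + - s))" by (simp only: powr_add)
    also have "\<dots> = 1" using q_nz by simp
    finally show ?thesis using q_nz by (simp add: field_simps)
  qed
  have nz: "qt s \<noteq> 0" using q_nz by simp
  have "?q powr (1 + (- s + - s)) = ?q powr 1 * (qt s * qt s)" by (simp only: powr_add)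
  then have "?q * qt s ^ 2 = ?q powr (1 + (- s + - s))"
    by (simp add: power2_eq_square)
  then have "(?q * qt s ^ 2) ^ delta_len = ?q powr (of_nat delta_len * (1 + (- s + - s)))"
    using q_nz by (simp add: powr_def exp_of_nat_mult mult.assoc)
  then have "?q powr (of_nat delta_len * s) * (?q * qt s ^ 2) ^ delta_len = ?q powr (of_nat delta_len * (1 - s))"
    using q_nz by (simp add: powr_add[symmetric] algebra_simps)
  then show ?thesis
    unfolding zeta_J_tilde_eq zeta_poly_functional_equation[OF nz] inv by (simp only: mult.assoc[symmetric])
qed

end

theorem theorem2p5:
  fixes av :: "'f::field \<Rightarrow> real" and sc :: "'f \<Rightarrow> 'e::comm_ring_1 \<Rightarrow> 'e"
    and R L :: "'e set" and c :: 'e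
  assumes "reduced_local_algebra av sc"
    and "is_order av sc R"
    and "is_unit_lattice av sc L"
    and "generates_different av sc c"
  shows "(\<forall>j. finite (Quot_dual av sc c R j)) \<and> continues_zeta av sc c R (zeta_J av sc c R) \<and>
    finite (orbits sc R L) \<and>
    (\<exists>P :: int poly.
       (coeff P 0 = 1 \<and> int (degree P) = 2 * delta av sc R \<and>
        (\<forall>s. zeta_J_tilde av sc c R s =
               of_nat (residue_card av) powr (of_int (delta av sc R) * s) *
               poly (map_poly of_int P) (of_nat (residue_card av) powr (- s)))) \<and>
       (zeta_J_tilde av sc c R 0 = of_nat (card (orbits sc R L)) \<and>
        zeta_J_tilde av sc c R 1 = of_nat (card (orbits sc R L)) \<and>
        poly P 1 = int (card (orbits sc R L)) \<and>
        (of_nat (residue_card av) :: complex) powi delta av sc R *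
          poly (map_poly of_int P) (1 / of_nat (residue_card av)) = of_nat (card (orbits sc R L))) \<and>
       ((\<forall>s. zeta_J_tilde av sc c R s = zeta_J_tilde av sc c R (1 - s)) \<and>
        (\<forall>t::complex. t \<noteq> 0 \<longrightarrow>
           poly (map_poly of_int P) t =
             (of_nat (residue_card av) * t ^ 2) powi delta av sc R *
             poly (map_poly of_int P) (1 / (of_nat (residue_card av) * t)))))"
proof -
  interpret local_duality av sc R c
    using assms by (intro local_duality.intro local_order.intro)
      (auto simp: local_order_axioms_def local_duality_axioms_def)
  have card: "card (orbits sc R L) = card ext_fibre"
    using bij_betw_same_card[OF bij_ext_fibre_orbits[OF assms(3)]] by simp
  have fin: "finite (orbits sc R L)"
    using bij_betw_finite[OF bij_ext_fibre_orbits[OF assms(3)]] finite_ext_fibre by simp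
  \<comment> \<open>At \<open>t = 1\<close> the colengths disappear from
    \<open>poly_zeta_poly\<close>, and the sum of the weights remains.\<close>
  have PC1: "poly PC 1 = of_nat (card (orbits sc R L))"
    using arg_cong[OF sum_wt, of "of_int :: int \<Rightarrow> complex"] by (simp add: poly_zeta_poly card)
  have z0: "zeta_J_tilde av sc c R 0 = of_nat (card (orbits sc R L))"
    using PC1 q_nz by (simp add: zeta_J_tilde_eq)
  have z1: "zeta_J_tilde av sc c R 1 = of_nat (card (orbits sc R L))"
    using zeta_J_tilde_functional_equation[of 1] z0 by simp
  have FE: "poly PC t = (of_nat q * t ^ 2) powi delta av sc R * poly PC (1 / (of_nat q * t))"
    if "t \<noteq> 0" for t
    using zeta_poly_functional_equation[OF that] by (simp add: delta_eq)
  have "of_nat q powi delta av sc R * poly PC (1 / of_nat q) = of_nat (card (orbits sc R L))"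
    using FE[of 1] PC1 by simp
  then show ?thesis
    using finite_Quot continues_zeta_J fin coeff_zeta_poly_0 degree_zeta_poly zeta_J_tilde_eq z0 z1 FE
      zeta_J_tilde_functional_equation poly_zeta_poly_1
    by (intro conjI exI[of _ zeta_poly] allI impI) (simp_all add: delta_eq card)
qed

end
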